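(* Let $k_1,k_2\in\mathrm{Supp}_{BV}(Q)$, let $F,G\in\mathcal S(L_2(Q))$ with corresponding measures $f,g\in\mathcal M(L_2(Q))$, and let $\mathcal H=\{h_1,\dots,h_n\}$ be a finite family of functions in $\mathrm{Supp}_{BV}(Q)$. Let $\mathbf s(\mathcal H)\in\mathrm{Supp}_{BV}(Q)$ satisfy $\mathbf s(\mathcal H)^2=h_1^2+\cdots+h_n^2$ $m_L^2$-a.e. on $Q$, and assume that $\mathbf s(\mathcal H)^2=k_1k_2$ $m_L^2$-a.e. on $Q$. For $j\in\{1,2\}$ let $\mathbf s(\mathcal K_j)\in\mathrm{Supp}_{BV}(Q)$ satisfy $\mathbf s(\mathcal K_j)^2=h_1^2+\cdots+h_n^2+k_j^2$ $m_L^2$-a.e. on $Q$. Then, for all nonzero real $q$, $$\begin{aligned}&T_{q,h_n}^{(1)}\big(T_{q,h_{n-1}}^{(1)}\big(\cdots\big(T_{q,h_2}^{(1)}\big(T_{q,h_1}^{(1)}\big((F*G)_q^{(k_1,k_2)}\big)\big)\big)\cdots\big)\big)(y)\\&=T_{q,\mathbf s(\mathcal H)}^{(1)}\big((F*G)_q^{(k_1,k_2)}\big)(y)\\&=T_{q,\mathbf s(\mathcal K_1)/\sqrt2}^{(1)}(F)\Big(\frac{y}{\sqrt2}\Big)\,T_{q,\mathbf s(\mathcal K_2)/\sqrt2}^{(1)}(G)\Big(\frac{y}{\sqrt2}\Big)\end{aligned}$$ for s-a.e. $y\in C_0(Q)$.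
   Context: Fix $S,T>0$, let $Q=[0,S]\times[0,T]$, $m_L^2$ = Lebesgue measure on $Q$, and $L_2(Q)$ the real Hilbert space with inner product $(\cdot,\cdot)_2$ and norm $\|\cdot\|_2$. $C_0(Q)$ is the space of real continuous $x$ on $Q$ with $x(s,0)=x(0,t)=0$, with (completed) Yeh--Wiener measure $m_{\mathrm y}$, i.e. the centered Gaussian measure with $\int x(s,t)x(s',t')\,dm_{\mathrm y}(x)=\min(s,s')\min(t,t')$. A set $E$ is scale-invariant measurable if $\rho E$ is measurable for every $\rho>0$, a scale-invariant measurable set $N$ is scale-invariant null if $m_{\mathrm y}(\rho N)=0$ for every $\rho>0$; "s-a.e." means off a scale-invariant null set. A functional $F$ is scale-invariant measurable if it is defined on a scale-invariant measurable set and $F(\rho\,\cdot)$ is measurable for every $\rho>0$. PWZ integral: fix a complete orthonormal set $\{\phi_n\}$ of $L_2(Q)$ consisting of functions of bounded variation (Hardy--Krause sense); for $v\in L_2(Q)$, $\langle v,x\rangle=\lim_{n}\int_Q\sum_{j=1}^n(v,\phi_j)_2\phi_j\,dx$ where the limit exists (it exists for s-a.e. $x$ and is essentially independent of $\{\phi_n\}$). $\mathrm{Supp}_{BV}(Q)$ is the set of real functions $h$ on $Q$ of bounded variation (Hardy--Krause sense) with $h\neq0$ $m_L^2$-a.e. For such $h$, $\mathcal Y_h(x;s,t)=\langle\chi_{[0,s]\times[0,t]}h,x\rangle$; its sample paths $\mathcal Y_h(x;\cdot,\cdot)$ lie in $C_0(Q)$. $\mathcal M(L_2(Q))$ is the space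 of complex countably additive Borel measures on $L_2(Q)$. $\mathcal S(L_2(Q))$ is the set of functionals $F$ on $C_0(Q)$ of the form $F(x)=\int_{L_2(Q)}\exp\{i\langle u,x\rangle\}df(u)$ for s-a.e. $x$, for some $f\in\mathcal M(L_2(Q))$. Evaluation along Gaussian paths uses this formula together with $\langle u,\mathcal Y_h(x;\cdot,\cdot)\rangle=\langle uh,x\rangle$, i.e. for real $b,c$, $F(by+c\mathcal Y_h(x;\cdot,\cdot))=\int\exp\{ib\langle u,y\rangle+ic\langle uh,x\rangle\}df(u)$. Transform: let $\mathbb C_+=\{\mathrm{Re}\,\lambda>0\}$ and $h\in\mathrm{Supp}_{BV}(Q)$. $T_{\lambda,h}(F)(y)$, $\lambda\in\mathbb C_+$, is the analytic continuation to $\mathbb C_+$ (if it exists) of $\lambda\mapsto\int_{C_0(Q)}F(y+\lambda^{-1/2}\mathcal Y_h(x;\cdot,\cdot))dm_{\mathrm y}(x)$, $\lambda>0$. For real $q\ne0$, $T_{q,h}^{(1)}(F)(y)=\lim_{\lambda\to-iq,\,\lambda\in\mathbb C_+}T_{\lambda,h}(F)(y)$ for s-a.e. $y$, whenever this limit exists. For $F\in\mathcal S(L_2(Q))$ it exists and belongs to $\mathcal S(L_2(Q))$. Convolution product: for $k_1,k_2\in\mathrm{Supp}_{BV}(Q)$ and real $q\neq0$, $(F*G)_q^{(k_1,k_2)}(y)$ is the limit as $\lambda\to-iq$, $\lambda\in\mathbb C_+$, of the analytic continuation to $\mathbb C_+$ of $$\lambda\mapsto\int_{C_0(Q)}F\Big(\tfrac{y+\lambda^{-1/2}\mathcal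 Y_{k_1}(x;\cdot,\cdot)}{\sqrt2}\Big)G\Big(\tfrac{y-\lambda^{-1/2}\mathcal Y_{k_2}(x;\cdot,\cdot)}{\sqrt2}\Big)dm_{\mathrm y}(x),\quad\lambda>0,$$ if it exists. For $F,G\in\mathcal S(L_2(Q))$ this product exists for s-a.e. $y$ and belongs to $\mathcal S(L_2(Q))$. *)

theory Defs
  imports "HOL-Probability.Probability" "HOL-Complex_Analysis.Complex_Analysis"
begin

section \<open>The rectangle, the space of square-integrable functions, bounded variation\<close>

definition Q :: "real \<Rightarrow> real \<Rightarrow> (real \<times> real) set" where
  "Q S T = {0..S} \<times> {0..T}"

text \<open>Elements of \<open>L\<^sub>2(Q)\<close> are represented by functions on the plane; only the values on \<open>Q\<close>, up to
  null sets, matter.  Hence \<open>l2_norm\<close> is a seminorm on \<open>L2\<close>, and the sets that are open for it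
  are saturated under a.e. equality: \<open>L2_borel\<close> is the pull-back of the Borel sigma-algebra of
  the Hilbert space of equivalence classes, and has the same measures.\<close>

definition L2 :: "real \<Rightarrow> real \<Rightarrow> (real \<times> real \<Rightarrow> real) set" where
  "L2 S T = {u. u \<in> borel_measurable (lebesgue_on (Q S T)) \<and>
                integrable (lebesgue_on (Q S T)) (\<lambda>p. (u p)\<^sup>2)}"

definition l2_inner ::
    "real \<Rightarrow> real \<Rightarrow> (real \<times> real \<Rightarrow> real) \<Rightarrow> (real \<times> real \<Rightarrow> real) \<Rightarrow> real" where
  "l2_inner S T u v = (LINT p|lebesgue_on (Q S T). u p * v p)"

definition l2_norm :: "real \<Rightarrow> real \<Rightarrow> (real \<times> real \<Rightarrow> real) \<Rightarrow> real" where
  "l2_norm S T u = sqrt (l2_inner S T u u)"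

definition L2_open :: "real \<Rightarrow> real \<Rightarrow> (real \<times> real \<Rightarrow> real) set \<Rightarrow> bool" where
  "L2_open S T U \<longleftrightarrow> U \<subseteq> L2 S T \<and>
     (\<forall>u\<in>U. \<exists>\<epsilon>>0. \<forall>v\<in>L2 S T. l2_norm S T (\<lambda>p. v p - u p) < \<epsilon> \<longrightarrow> v \<in> U)"

definition L2_borel :: "real \<Rightarrow> real \<Rightarrow> (real \<times> real \<Rightarrow> real) measure" where
  "L2_borel S T = sigma (L2 S T) {U. L2_open S T U}"

definition subdivision :: "real \<Rightarrow> real \<Rightarrow> nat \<Rightarrow> (nat \<Rightarrow> real) \<Rightarrow> bool" where
  "subdivision a b m s \<longleftrightarrow> s 0 = a \<and> s m = b \<and> (\<forall>i<m. s i < s (Suc i))"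

definition rect_increment ::
    "(real \<times> real \<Rightarrow> real) \<Rightarrow> real \<Rightarrow> real \<Rightarrow> real \<Rightarrow> real \<Rightarrow> real" where
  "rect_increment g a b c d = g (b, d) - g (a, d) - g (b, c) + g (a, c)"

definition bounded_var :: "real \<Rightarrow> real \<Rightarrow> (real \<Rightarrow> real) \<Rightarrow> bool" where
  "bounded_var a b g \<longleftrightarrow>
     (\<exists>B. \<forall>m s. subdivision a b m s \<longrightarrow> (\<Sum>i<m. \<bar>g (s (Suc i)) - g (s i)\<bar>) \<le> B)"

text \<open>Hardy--Krause: bounded variation in the sense of Vitali on \<open>Q\<close>, together with bounded
  variation of all one-dimensional sections.\<close>

definition BV_HK :: "real \<Rightarrow> real \<Rightarrow> (real \<times> real \<Rightarrow> real) \<Rightarrow> bool" where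
  "BV_HK S T g \<longleftrightarrow>
     (\<exists>B. \<forall>m s n t. subdivision 0 S m s \<and> subdivision 0 T n t \<longrightarrow>
        (\<Sum>i<m. \<Sum>j<n. \<bar>rect_increment g (s i) (s (Suc i)) (t j) (t (Suc j))\<bar>) \<le> B) \<and>
     (\<forall>a\<in>{0..S}. bounded_var 0 T (\<lambda>t. g (a, t))) \<and>
     (\<forall>b\<in>{0..T}. bounded_var 0 S (\<lambda>s. g (s, b)))"

definition Supp_BV :: "real \<Rightarrow> real \<Rightarrow> (real \<times> real \<Rightarrow> real) set" where
  "Supp_BV S T = {h. BV_HK S T h \<and> (AE p in lebesgue_on (Q S T). h p \<noteq> 0)}"


section \<open>Yeh--Wiener space\<close>

text \<open>Functions on \<open>Q\<close> are extended by zero to the plane, so that every path is represented by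
  exactly one function.\<close>

definition C0 :: "real \<Rightarrow> real \<Rightarrow> (real \<times> real \<Rightarrow> real) set" where
  "C0 S T = {x. continuous_on (Q S T) x \<and>
                (\<forall>s\<in>{0..S}. x (s, 0) = 0) \<and> (\<forall>t\<in>{0..T}. x (0, t) = 0) \<and>
                (\<forall>p. p \<notin> Q S T \<longrightarrow> x p = 0)}"

definition rescale :: "real \<Rightarrow> (real \<times> real \<Rightarrow> real) \<Rightarrow> (real \<times> real \<Rightarrow> real)" where
  "rescale \<rho> x = (\<lambda>p. \<rho> * x p)"

text \<open>The normal laws of mean zero, including the degenerate one.\<close>

definition centered_normal :: "real measure \<Rightarrow> bool" where
  "centered_normal \<nu> \<longleftrightarrow>
     \<nu> = return borel 0 \<or> (\<exists>\<sigma>>0. \<nu> = density lborel (\<lambda>r. ennreal (normal_density 0 \<sigma> r)))"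

text \<open>The sigma-algebra generated by the evaluations is the Borel sigma-algebra of the uniform
  topology on \<open>C0\<close>.  A measure with the properties below is unique.\<close>

definition yeh_wiener_measure ::
    "real \<Rightarrow> real \<Rightarrow> (real \<times> real \<Rightarrow> real) measure \<Rightarrow> bool" where
  "yeh_wiener_measure S T m \<longleftrightarrow>
     (\<exists>m0. m = completion m0 \<and> prob_space m0 \<and> space m0 = C0 S T \<and>
        sets m0 = sets (sigma (C0 S T)
          {(\<lambda>x. x p) -` B \<inter> C0 S T | p B. p \<in> Q S T \<and> B \<in> sets (borel :: real measure)}) \<and>
        (\<forall>P a. finite P \<and> P \<subseteq> Q S T \<longrightarrow>
           centered_normal (distr m0 borel (\<lambda>x. \<Sum>p\<in>P. a p * x p))) \<and>
        (\<forall>s\<in>{0..S}. \<forall>t\<in>{0..T}. \<forall>s'\<in>{0..S}. \<forall>t'\<in>{0..T}.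
           (LINT x|m0. x (s, t) * x (s', t')) = min s s' * min t t'))"

definition scale_invariant_null ::
    "(real \<times> real \<Rightarrow> real) measure \<Rightarrow> (real \<times> real \<Rightarrow> real) set \<Rightarrow> bool" where
  "scale_invariant_null m N \<longleftrightarrow>
     (\<forall>\<rho>>0. rescale \<rho> ` N \<in> sets m \<and> emeasure m (rescale \<rho> ` N) = 0)"

definition s_ae ::
    "(real \<times> real \<Rightarrow> real) measure \<Rightarrow> ((real \<times> real \<Rightarrow> real) \<Rightarrow> bool) \<Rightarrow> bool" where
  "s_ae m P \<longleftrightarrow> (\<exists>N. scale_invariant_null m N \<and> (\<forall>x\<in>space m - N. P x))"


section \<open>The Paley--Wiener--Zygmund integral\<close>

text \<open>Riemann--Stieltjes integral over \<open>Q\<close>.  The evaluation points form a grid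
  \<open>(\<xi> i, \<eta> j)\<close>: for integrators in \<open>C0\<close> and integrands of bounded variation in the
  sense of Hardy and Krause the limit then exists (sum by parts in both variables).  If the point
  could be chosen independently in each cell, the limit would fail to exist already for
  the indicator of a half-plane and a typical path.\<close>

definition has_RS_integral ::
    "real \<Rightarrow> real \<Rightarrow> (real \<times> real \<Rightarrow> real) \<Rightarrow> (real \<times> real \<Rightarrow> real) \<Rightarrow> real \<Rightarrow> bool" where
  "has_RS_integral S T g x I \<longleftrightarrow>
     (\<forall>\<epsilon>>0. \<exists>\<delta>>0. \<forall>m s \<xi> n t \<eta>.
        subdivision 0 S m s \<and> (\<forall>i<m. s (Suc i) - s i < \<delta> \<and> s i \<le> \<xi> i \<and> \<xi> i \<le> s (Suc i)) \<and>
        subdivision 0 T n t \<and> (\<forall>j<n. t (Suc j) - t j < \<delta> \<and> t j \<le> \<eta> j \<and> \<eta> j \<le> t (Suc j)) \<longrightarrow>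
        \<bar>(\<Sum>i<m. \<Sum>j<n. g (\<xi> i, \<eta> j) *
            rect_increment x (s i) (s (Suc i)) (t j) (t (Suc j))) - I\<bar> < \<epsilon>)"

definition RS_integral ::
    "real \<Rightarrow> real \<Rightarrow> (real \<times> real \<Rightarrow> real) \<Rightarrow> (real \<times> real \<Rightarrow> real) \<Rightarrow> real" where
  "RS_integral S T g x = (THE I. has_RS_integral S T g x I)"

definition complete_orthonormal_BV ::
    "real \<Rightarrow> real \<Rightarrow> (nat \<Rightarrow> real \<times> real \<Rightarrow> real) \<Rightarrow> bool" where
  "complete_orthonormal_BV S T \<phi> \<longleftrightarrow>
     (\<forall>n. \<phi> n \<in> L2 S T \<and> BV_HK S T (\<phi> n)) \<and>
     (\<forall>i j. l2_inner S T (\<phi> i) (\<phi> j) = (if i = j then 1 else 0)) \<and>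
     (\<forall>u\<in>L2 S T. (\<forall>n. l2_inner S T u (\<phi> n) = 0) \<longrightarrow> l2_norm S T u = 0)"

definition pwz_partial ::
    "real \<Rightarrow> real \<Rightarrow> (nat \<Rightarrow> real \<times> real \<Rightarrow> real) \<Rightarrow>
     (real \<times> real \<Rightarrow> real) \<Rightarrow> (real \<times> real \<Rightarrow> real) \<Rightarrow> nat \<Rightarrow> real" where
  "pwz_partial S T \<phi> v x n =
     RS_integral S T (\<lambda>p. \<Sum>j<n. l2_inner S T v (\<phi> j) * \<phi> j p) x"

text \<open>For fixed \<open>v\<close> the default value 0 is taken only on a scale-invariant null set of
  paths \<open>x\<close>.\<close>

definition pwz ::
    "real \<Rightarrow> real \<Rightarrow> (nat \<Rightarrow> real \<times> real \<Rightarrow> real) \<Rightarrow>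
     (real \<times> real \<Rightarrow> real) \<Rightarrow> (real \<times> real \<Rightarrow> real) \<Rightarrow> real" where
  "pwz S T \<phi> v x =
     (if convergent (pwz_partial S T \<phi> v x) then lim (pwz_partial S T \<phi> v x) else 0)"


section \<open>Complex measures\<close>

definition complex_measures :: "'a measure \<Rightarrow> ('a set \<Rightarrow> complex) set" where
  "complex_measures M =
     {f. \<forall>A :: nat \<Rightarrow> 'a set. range A \<subseteq> sets M \<and> disjoint_family A \<longrightarrow>
           (\<lambda>n. f (A n)) sums f (\<Union>n. A n)}"

text \<open>Upper variation of a signed measure \<open>\<nu>\<close> on \<open>M\<close>; the lower variation is that of \<open>-\<nu>\<close>, and
  integrals against a complex measure are defined by the Jordan decompositions of its real and
  imaginary parts.  (The function \<open>ennreal\<close> sends negative numbers to 0, which does not affect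
  the supremum, as the empty set is among the competitors.)\<close>

definition upper_variation :: "'a measure \<Rightarrow> ('a set \<Rightarrow> real) \<Rightarrow> 'a measure" where
  "upper_variation M \<nu> =
     measure_of (space M) (sets M) (\<lambda>A. SUP B\<in>{B \<in> sets M. B \<subseteq> A}. ennreal (\<nu> B))"

definition signed_integral :: "'a measure \<Rightarrow> ('a set \<Rightarrow> real) \<Rightarrow> ('a \<Rightarrow> complex) \<Rightarrow> complex" where
  "signed_integral M \<nu> \<Phi> =
     (LINT u|upper_variation M \<nu>. \<Phi> u) - (LINT u|upper_variation M (\<lambda>A. - \<nu> A). \<Phi> u)"

definition cm_integral :: "'a measure \<Rightarrow> ('a set \<Rightarrow> complex) \<Rightarrow> ('a \<Rightarrow> complex) \<Rightarrow> complex" where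
  "cm_integral M f \<Phi> =
     signed_integral M (\<lambda>A. Re (f A)) \<Phi> + \<i> * signed_integral M (\<lambda>A. Im (f A)) \<Phi>"


section \<open>The class S of functionals\<close>

text \<open>Functionals are partial functions on the paths.\<close>

type_synonym functional = "(real \<times> real \<Rightarrow> real) \<rightharpoonup> complex"

definition corresponds ::
    "real \<Rightarrow> real \<Rightarrow> (real \<times> real \<Rightarrow> real) measure \<Rightarrow> (nat \<Rightarrow> real \<times> real \<Rightarrow> real) \<Rightarrow>
     ((real \<times> real \<Rightarrow> real) set \<Rightarrow> complex) \<Rightarrow> functional \<Rightarrow> bool" where
  "corresponds S T m \<phi> f F \<longleftrightarrow> f \<in> complex_measures (L2_borel S T) \<and>
     s_ae m (\<lambda>x. F x =
       Some (cm_integral (L2_borel S T) f (\<lambda>u. exp (\<i> * complex_of_real (pwz S T \<phi> u x)))))"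

definition S_class ::
    "real \<Rightarrow> real \<Rightarrow> (real \<times> real \<Rightarrow> real) measure \<Rightarrow> (nat \<Rightarrow> real \<times> real \<Rightarrow> real) \<Rightarrow>
     functional set" where
  "S_class S T m \<phi> = {F. \<exists>f. corresponds S T m \<phi> f F}"

text \<open>A functional of the class determines its measure on the Borel sets, so this choice has no
  influence on integrals.\<close>

definition measure_of_functional ::
    "real \<Rightarrow> real \<Rightarrow> (real \<times> real \<Rightarrow> real) measure \<Rightarrow> (nat \<Rightarrow> real \<times> real \<Rightarrow> real) \<Rightarrow>
     functional \<Rightarrow> ((real \<times> real \<Rightarrow> real) set \<Rightarrow> complex)" where
  "measure_of_functional S T m \<phi> F = (SOME f. corresponds S T m \<phi> f F)"

text \<open>The value \<open>F(b y + c Y\<^sub>h(x))\<close> along the Gaussian process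
  \<open>Y\<^sub>h(x; s, t) = \<langle>\<chi> h, x\<rangle>\<close>, \<open>\<chi>\<close> the indicator of \<open>[0, s] \<times> [0, t]\<close>.
  A functional of the class is given only up to scale-invariant null sets, while the law of
  \<open>Y\<^sub>h\<close> may be singular to all scaled Yeh--Wiener measures, so substituting the path into \<open>F\<close>
  pointwise has no meaning.  By convention the value is given by the integral formula
  for \<open>F\<close> together with \<open>\<langle>u, Y\<^sub>h(x)\<rangle> = \<langle>u h, x\<rangle>\<close>.\<close>

definition eval_along ::
    "real \<Rightarrow> real \<Rightarrow> (real \<times> real \<Rightarrow> real) measure \<Rightarrow> (nat \<Rightarrow> real \<times> real \<Rightarrow> real) \<Rightarrow>
     functional \<Rightarrow> real \<Rightarrow> (real \<times> real \<Rightarrow> real) \<Rightarrow> real \<Rightarrow> (real \<times> real \<Rightarrow> real) \<Rightarrow>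
     (real \<times> real \<Rightarrow> real) \<Rightarrow> complex" where
  "eval_along S T m \<phi> F b y c h x =
     cm_integral (L2_borel S T) (measure_of_functional S T m \<phi> F)
       (\<lambda>u. exp (\<i> * complex_of_real b * complex_of_real (pwz S T \<phi> u y)
              + \<i> * complex_of_real c * complex_of_real (pwz S T \<phi> (\<lambda>p. u p * h p) x)))"


section \<open>Analytic transform and convolution product\<close>

text \<open>\<open>z\<close> is the limit, as \<open>\<kappa> \<rightarrow> -\<i>q\<close> in the right half-plane, of the analytic continuation of
  \<open>\<kappa> \<mapsto> \<integral> \<Phi> \<kappa> x dm(x)\<close>, \<open>\<kappa> > 0\<close>.\<close>

definition has_analytic_limit ::
    "(real \<times> real \<Rightarrow> real) measure \<Rightarrow> real \<Rightarrow> (real \<Rightarrow> (real \<times> real \<Rightarrow> real) \<Rightarrow> complex) \<Rightarrow>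
     complex \<Rightarrow> bool" where
  "has_analytic_limit m q \<Phi> z \<longleftrightarrow>
     (\<exists>J. J holomorphic_on {\<kappa>. Re \<kappa> > 0} \<and>
        (\<forall>\<kappa>>0. has_bochner_integral m (\<Phi> \<kappa>) (J (complex_of_real \<kappa>))) \<and>
        (J \<longlongrightarrow> z) (at (- \<i> * complex_of_real q) within {\<kappa>. Re \<kappa> > 0}))"

definition analytic_limit ::
    "(real \<times> real \<Rightarrow> real) measure \<Rightarrow> real \<Rightarrow> (real \<Rightarrow> (real \<times> real \<Rightarrow> real) \<Rightarrow> complex) \<Rightarrow>
     complex option" where
  "analytic_limit m q \<Phi> =
     (if \<exists>z. has_analytic_limit m q \<Phi> z then Some (THE z. has_analytic_limit m q \<Phi> z) else None)"

definition transform ::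
    "real \<Rightarrow> real \<Rightarrow> (real \<times> real \<Rightarrow> real) measure \<Rightarrow> (nat \<Rightarrow> real \<times> real \<Rightarrow> real) \<Rightarrow>
     real \<Rightarrow> (real \<times> real \<Rightarrow> real) \<Rightarrow> functional \<Rightarrow> functional" where
  "transform S T m \<phi> q h F = (\<lambda>y.
     if F \<in> S_class S T m \<phi>
     then analytic_limit m q (\<lambda>\<kappa> x. eval_along S T m \<phi> F 1 y (\<kappa> powr (-1/2)) h x)
     else None)"

definition convolution_product ::
    "real \<Rightarrow> real \<Rightarrow> (real \<times> real \<Rightarrow> real) measure \<Rightarrow> (nat \<Rightarrow> real \<times> real \<Rightarrow> real) \<Rightarrow>
     real \<Rightarrow> (real \<times> real \<Rightarrow> real) \<Rightarrow> (real \<times> real \<Rightarrow> real) \<Rightarrow>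
     functional \<Rightarrow> functional \<Rightarrow> functional" where
  "convolution_product S T m \<phi> q k1 k2 F G = (\<lambda>y.
     if F \<in> S_class S T m \<phi> \<and> G \<in> S_class S T m \<phi>
     then analytic_limit m q (\<lambda>\<kappa> x.
            eval_along S T m \<phi> F (1 / sqrt 2) y (\<kappa> powr (-1/2) / sqrt 2) k1 x *
            eval_along S T m \<phi> G (1 / sqrt 2) y (- (\<kappa> powr (-1/2) / sqrt 2)) k2 x)
     else None)"

primrec iterated_transform ::
    "real \<Rightarrow> real \<Rightarrow> (real \<times> real \<Rightarrow> real) measure \<Rightarrow> (nat \<Rightarrow> real \<times> real \<Rightarrow> real) \<Rightarrow>
     real \<Rightarrow> (nat \<Rightarrow> real \<times> real \<Rightarrow> real) \<Rightarrow> nat \<Rightarrow> functional \<Rightarrow> functional" where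
  "iterated_transform S T m \<phi> q h 0 F = F"
| "iterated_transform S T m \<phi> q h (Suc n) F =
     transform S T m \<phi> q (h (Suc n)) (iterated_transform S T m \<phi> q h n F)"

end

theory Submission imports Defs begin

text \<open>For a functional \<open>F\<close> with measure \<open>f\<close>, Fubini and the characteristic function of the Gaussian
  variable \<open>\<langle>uh, x\<rangle>\<close> turn the transform into the integral of
  \<open>exp (i \<langle>u, y\<rangle> - i \<parallel>uh\<parallel>\<^sup>2 / (2 q))\<close> against \<open>f\<close>, and the convolution product into the integral of
  \<open>exp (i \<langle>(u + v) / \<surd>2, y\<rangle> - i \<parallel>(u k\<^sub>1 - v k\<^sub>2) / \<surd>2\<parallel>\<^sup>2 / (2 q))\<close> against \<open>f \<times> g\<close>.  Further
  transforms only add phases, so everything reduces to the pointwise identity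
  \<open>(u + v)\<^sup>2 s\<^sup>2 + (u k\<^sub>1 - v k\<^sub>2)\<^sup>2 = u\<^sup>2 (s\<^sup>2 + k\<^sub>1\<^sup>2) + v\<^sup>2 (s\<^sup>2 + k\<^sub>2\<^sup>2)\<close>, in which the cross terms cancel
  because \<open>s\<^sup>2 = k\<^sub>1 k\<^sub>2\<close>.

  Two points need real work.  The limit defining \<open>\<langle>v, x\<rangle>\<close> must exist for almost every \<open>x\<close> along the full
  sequence of partial sums; this follows from a maximal inequality for fourth moments.  And the
  transform evaluates \<open>F\<close> through a measure chosen to represent it, so this measure must be unique:
  averaging \<open>F\<close> against \<open>exp (- i c \<langle>v, x\<rangle>)\<close> recovers the integrals against \<open>f\<close> of all Gaussians
  \<open>exp (- a \<parallel>u - v\<parallel>\<^sup>2)\<close>, and these determine \<open>f\<close>.\<close>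


section \<open>Functions of bounded variation\<close>


text \<open>Three obstacles shape the development. Variation in the sense of Hardy--Krause is
  awkward under products, so it is kept for the orthonormal functions, where integration by parts
  requires it; the multipliers \<open>h\<close>, \<open>k1\<close>, \<open>k2\<close> and the
  functions \<open>sH\<close>, \<open>sK1\<close>, \<open>sK2\<close> enter through the weaker
  \<open>osc_bounded\<close>, a modulus made of monotone functions of one variable each. Measures on
  \<open>L2\<close> are inconvenient to push forward and multiply, so a functional is carried by a
  parameter space, a map into \<open>L2\<close> and a complex density: transforms then change the
  density only, and the convolution product and all its transforms live on one product space with
  one map. Finally, the limit defining \<open>pwz\<close> exists outside a null set of paths that
  depends on the vector. Linearity in the vector is therefore applied only after Fubini has turned
  this into: for almost every path, the limit exists for almost every parameter. Scale-invariant
  almost everywhere statements are read as ordinary ones at every scale, and uniqueness of the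
  representing measure draws on all scales at once.\<close>

fun chain_sum :: "('a \<Rightarrow> 'a \<Rightarrow> real) \<Rightarrow> 'a list \<Rightarrow> real" where
  "chain_sum \<Psi> (a # b # xs) = \<Psi> a b + chain_sum \<Psi> (b # xs)"
| "chain_sum \<Psi> _ = 0"

lemma chain_sum_nth: "chain_sum \<Psi> xs = (\<Sum>i<length xs - 1. \<Psi> (xs ! i) (xs ! Suc i))"
proof (induction \<Psi> xs rule: chain_sum.induct)
  case (1 \<Psi> a b xs)
  then show ?case by (simp add: sum.lessThan_Suc_shift del: sum.lessThan_Suc)
qed auto

lemma chain_sum_nonneg:
  assumes "\<And>a b. \<Psi> a b \<ge> 0"
  shows "chain_sum \<Psi> xs \<ge> 0"
  unfolding chain_sum_nth by (intro sum_nonneg assms)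

lemma chain_sum_mono:
  assumes "\<And>a b. a \<in> set xs \<Longrightarrow> b \<in> set xs \<Longrightarrow> \<Psi> a b \<le> \<Psi>' a b"
  shows "chain_sum \<Psi> xs \<le> chain_sum \<Psi>' xs"
  unfolding chain_sum_nth by (intro sum_mono assms nth_mem) auto

lemma chain_sum_Cons_ge:
  assumes "\<And>a b. \<Psi> a b \<ge> 0"
  shows "chain_sum \<Psi> xs \<le> chain_sum \<Psi> (a # xs)"
  using assms by (cases xs) auto

lemma chain_sum_append_ge:
  assumes "\<And>a b. \<Psi> a b \<ge> 0"
  shows "chain_sum \<Psi> xs + chain_sum \<Psi> ys \<le> chain_sum \<Psi> (xs @ ys)"
proof (induction xs)
  case (Cons a xs)
  show ?case
  proof (cases xs)
    case Nil
    then show ?thesis using chain_sum_Cons_ge[OF assms] by simp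
  next
    case (Cons b zs)
    then show ?thesis using \<open>chain_sum \<Psi> xs + chain_sum \<Psi> ys \<le> chain_sum \<Psi> (xs @ ys)\<close> by simp
  qed
qed simp

text \<open>Inside the chain the new point replaces one term by two, which are no smaller by the
  triangle inequality; at either end it adds a nonnegative term. Grids may thus be refined
  freely.\<close>

lemma chain_sum_insort_ge:
  assumes nn: "\<And>a b. \<Psi> a b \<ge> 0" and tri: "\<And>a b c. \<Psi> a c \<le> \<Psi> a b + \<Psi> b c"
  shows "chain_sum \<Psi> xs \<le> chain_sum \<Psi> (insort x xs)"
proof (induction xs)
  case (Cons a xs)
  show ?case
  proof (cases xs)
    case Nil
    then show ?thesis using nn by simp
  next
    case (Cons b zs)
    with \<open>chain_sum \<Psi> xs \<le> chain_sum \<Psi> (insort x xs)\<close> show ?thesis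
      using nn[of x a] tri[of a b x] by (auto split: if_splits)
  qed
qed simp

text \<open>The triangle inequality along the stretch of the list from \<open>a\<close> to
  \<open>b\<close>; the remaining terms are nonnegative, and the vanishing diagonal settles
  \<open>a = b\<close>.\<close>

lemma chain_sum_between_ge:
  assumes nn: "\<And>a b. \<Psi> a b \<ge> 0" and tri: "\<And>a b c. \<Psi> a c \<le> \<Psi> a b + \<Psi> b c"
    and zero: "\<And>a. \<Psi> a a = 0"
    and "sorted xs" "a \<in> set xs" "b \<in> set xs" "a \<le> (b :: 'a :: linorder)"
  shows "\<Psi> a b \<le> chain_sum \<Psi> xs"
  using assms(4-)
proof (induction xs arbitrary: a b)
  case (Cons x ys)
  have ge: "chain_sum \<Psi> ys \<le> chain_sum \<Psi> (x # ys)" by (rule chain_sum_Cons_ge[OF nn])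
  have nn': "0 \<le> chain_sum \<Psi> (x # ys)" by (rule chain_sum_nonneg[OF nn])
  consider "a \<in> set ys" "b \<in> set ys" | "a = b" | "a = x" "b \<in> set ys"
    using Cons.prems by (auto intro: antisym)
  then show ?case
  proof cases
    case 1
    then show ?thesis using Cons.IH[of a b] Cons.prems ge by auto
  next
    case 2
    then show ?thesis using zero nn' by simp
  next
    case 3
    then obtain c zs where ys: "ys = c # zs" by (cases ys) auto
    have "\<Psi> c b \<le> chain_sum \<Psi> ys"
      using Cons.IH[of c b] Cons.prems 3 unfolding ys by auto
    then show ?thesis using tri[of x b c] 3 unfolding ys by simp
  qed
qed simp

lemma chain_sum_remdups_adj:
  assumes "\<And>a. \<Psi> a a = 0"
  shows "chain_sum \<Psi> (remdups_adj xs) = chain_sum \<Psi> xs"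
proof (induction xs rule: remdups_adj.induct)
  case (3 x y xs)
  then show ?case
    using assms by (cases "x = y") (simp_all, metis chain_sum.simps(1) remdups_adj_Cons_alt)
qed auto

lemma sorted_remdups_adj_strict:
  "sorted (xs :: 'a :: linorder list) \<Longrightarrow> sorted_wrt (<) (remdups_adj xs)"
  by (induction xs rule: remdups_adj.induct) (auto simp: order.strict_iff_order)

text \<open>A sorted list may repeat points and miss the endpoints, whereas
  \<open>subdivision\<close> is strict and runs from 0 to \<open>S\<close>. One subdivision must
  serve every \<open>\<Psi>\<close>, because in a Vitali sum the inner \<open>\<Psi>\<close> changes
  with the outer cell.\<close>

lemma chain_le_subdivision:
  assumes "S > 0" "sorted xs" "set xs \<subseteq> {0..S}"
  obtains m s where "subdivision 0 S m s"
    and "\<And>\<Psi>. \<lbrakk>\<And>a. \<Psi> a a = 0; \<And>a b. \<Psi> a b \<ge> 0\<rbrakk> \<Longrightarrow>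
           chain_sum \<Psi> xs \<le> (\<Sum>i<m. \<Psi> (s i) (s (Suc i)))"
proof -
  define ys where "ys = 0 # xs @ [S]"
  define zs where "zs = remdups_adj ys"
  have sys: "sorted ys" using assms by (auto simp: ys_def sorted_append)
  have strict: "sorted_wrt (<) zs" unfolding zs_def by (rule sorted_remdups_adj_strict[OF sys])
  have hd: "hd zs = 0" and last: "last zs = S" unfolding zs_def ys_def by simp_all
  have ne: "zs \<noteq> []" unfolding zs_def ys_def by simp
  have "subdivision 0 S (length zs - 1) (\<lambda>i. zs ! i)"
    unfolding subdivision_def using hd last ne strict
    by (auto simp: hd_conv_nth last_conv_nth sorted_wrt_iff_nth_less)
  moreover have "chain_sum \<Psi> xs \<le> (\<Sum>i<length zs - 1. \<Psi> (zs ! i) (zs ! Suc i))"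
    if z: "\<And>a. \<Psi> a a = 0" and nn: "\<And>a b. \<Psi> a b \<ge> 0" for \<Psi>
  proof -
    have "chain_sum \<Psi> xs \<le> chain_sum \<Psi> (xs @ [S])"
      using chain_sum_append_ge[of \<Psi> xs "[S]", OF nn] by simp
    also have "\<dots> \<le> chain_sum \<Psi> ys" unfolding ys_def by (rule chain_sum_Cons_ge[OF nn])
    also have "\<dots> = chain_sum \<Psi> zs" unfolding zs_def by (rule chain_sum_remdups_adj[OF z, symmetric])
    finally show ?thesis unfolding chain_sum_nth[of \<Psi> zs] .
  qed
  ultimately show ?thesis by (rule that)
qed

section \<open>Vitali sums over grids and moduli of Hardy--Krause functions\<close>

definition vitali_sum :: "(real \<times> real \<Rightarrow> real) \<Rightarrow> real list \<Rightarrow> real list \<Rightarrow> real" where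
  "vitali_sum g xs ys = chain_sum (\<lambda>a b. chain_sum (\<lambda>c d. \<bar>rect_increment g a b c d\<bar>) ys) xs"

lemma BV_HK_vitali_bound:
  assumes "S > 0" "T > 0" "BV_HK S T g"
  obtains B where "\<And>xs ys. \<lbrakk>sorted xs; set xs \<subseteq> {0..S}; sorted ys; set ys \<subseteq> {0..T}\<rbrakk> \<Longrightarrow>
    vitali_sum g xs ys \<le> B"
proof -
  from assms(3) obtain B where B: "\<And>m s n t. subdivision 0 S m s \<Longrightarrow> subdivision 0 T n t \<Longrightarrow>
        (\<Sum>i<m. \<Sum>j<n. \<bar>rect_increment g (s i) (s (Suc i)) (t j) (t (Suc j))\<bar>) \<le> B"
    unfolding BV_HK_def by blast
  have "vitali_sum g xs ys \<le> B"
    if xs: "sorted xs" "set xs \<subseteq> {0..S}" and ys: "sorted ys" "set ys \<subseteq> {0..T}" for xs ys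
  proof -
    obtain m s where s: "subdivision 0 S m s"
      and s_le: "\<And>\<Psi>. \<lbrakk>\<And>a. \<Psi> a a = 0; \<And>a b. \<Psi> a b \<ge> 0\<rbrakk> \<Longrightarrow>
           chain_sum \<Psi> xs \<le> (\<Sum>i<m. \<Psi> (s i) (s (Suc i)))"
      using chain_le_subdivision[OF assms(1) xs] by blast
    obtain n t where t: "subdivision 0 T n t"
      and t_le: "\<And>\<Psi>. \<lbrakk>\<And>a. \<Psi> a a = 0; \<And>a b. \<Psi> a b \<ge> 0\<rbrakk> \<Longrightarrow>
           chain_sum \<Psi> ys \<le> (\<Sum>i<n. \<Psi> (t i) (t (Suc i)))"
      using chain_le_subdivision[OF assms(2) ys] by blast
    \<comment> \<open>Refinement in the first variable, with the whole inner chain sum in the role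
      of \<open>\<Psi>\<close>.\<close>
    have "vitali_sum g xs ys \<le>
        (\<Sum>i<m. chain_sum (\<lambda>c d. \<bar>rect_increment g (s i) (s (Suc i)) c d\<bar>) ys)"
      unfolding vitali_sum_def
      by (rule s_le) (auto simp: rect_increment_def chain_sum_nth intro!: sum_nonneg)
    also have "\<dots> \<le> (\<Sum>i<m. \<Sum>j<n. \<bar>rect_increment g (s i) (s (Suc i)) (t j) (t (Suc j))\<bar>)"
      by (intro sum_mono t_le) (auto simp: rect_increment_def)
    also have "\<dots> \<le> B" by (rule B[OF s t])
    finally show ?thesis .
  qed
  then show ?thesis by (rule that)
qed

lemma bounded_var_chain_bound:
  assumes "S > 0" "bounded_var 0 S f"
  obtains B where "\<And>xs. \<lbrakk>sorted xs; set xs \<subseteq> {0..S}\<rbrakk> \<Longrightarrow> chain_sum (\<lambda>a b. \<bar>f b - f a\<bar>) xs \<le> B"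
proof -
  from assms(2) obtain B where B: "\<And>m s. subdivision 0 S m s \<Longrightarrow> (\<Sum>i<m. \<bar>f (s (Suc i)) - f (s i)\<bar>) \<le> B"
    unfolding bounded_var_def by metis
  have "chain_sum (\<lambda>a b. \<bar>f b - f a\<bar>) xs \<le> B"
    if xs: "sorted xs" "set xs \<subseteq> {0..S}" for xs
  proof -
    obtain m s where s: "subdivision 0 S m s"
      and s_le: "\<And>\<Psi>. \<lbrakk>\<And>a. \<Psi> a a = 0; \<And>a b. \<Psi> a b \<ge> 0\<rbrakk> \<Longrightarrow>
           chain_sum \<Psi> xs \<le> (\<Sum>i<m. \<Psi> (s i) (s (Suc i)))"
      using chain_le_subdivision[OF assms(1) xs] by blast
    have "chain_sum (\<lambda>a b. \<bar>f b - f a\<bar>) xs \<le> (\<Sum>i<m. \<bar>f (s (Suc i)) - f (s i)\<bar>)"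
      by (rule s_le) auto
    with B[OF s] show ?thesis by linarith
  qed
  then show ?thesis by (rule that)
qed

text \<open>The one-dimensional modulus \<open>W s\<close> is the Vitali variation over \<open>[0, s] \<times> [0, T]\<close> plus the
  variation of the bottom edge over \<open>[0, s]\<close>; what matters is that it does not depend on \<open>t\<close>.\<close>

lemma BV_HK_modulus_fst:
  assumes "S > 0" "T > 0" "BV_HK S T g"
  obtains W where "\<And>s s' t. \<lbrakk>0 \<le> s; s \<le> s'; s' \<le> S; t \<in> {0..T}\<rbrakk> \<Longrightarrow>
    \<bar>g (s', t) - g (s, t)\<bar> \<le> W s' - W s"
proof -
  obtain B1 where B1: "\<And>xs ys. \<lbrakk>sorted xs; set xs \<subseteq> {0..S}; sorted ys; set ys \<subseteq> {0..T}\<rbrakk> \<Longrightarrow>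
    vitali_sum g xs ys \<le> B1" using BV_HK_vitali_bound[OF assms] by blast
  have "bounded_var 0 S (\<lambda>s. g (s, 0))" using assms unfolding BV_HK_def by auto
  then obtain B2 where B2: "\<And>xs. \<lbrakk>sorted xs; set xs \<subseteq> {0..S}\<rbrakk> \<Longrightarrow>
      chain_sum (\<lambda>a b. \<bar>g (b, 0) - g (a, 0)\<bar>) xs \<le> B2"
    using bounded_var_chain_bound[OF assms(1)] by blast
  define V where "V xs ys = vitali_sum g xs ys + chain_sum (\<lambda>a b. \<bar>g (b, 0) - g (a, 0)\<bar>) xs" for xs ys
  define I where "I s = {(xs, ys). sorted xs \<and> set xs \<subseteq> {0..s} \<and> sorted ys \<and> set ys \<subseteq> {0..T}}" for s :: real
  define W where "W s = (SUP z\<in>I s. V (fst z) (snd z))" for s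
  have bdd: "bdd_above ((\<lambda>z. V (fst z) (snd z)) ` I s)" if "s \<le> S" for s
  proof (rule bdd_aboveI2)
    fix z assume z: "z \<in> I s"
    have "set (fst z) \<subseteq> {0..S}" using z that unfolding I_def by fastforce
    then show "V (fst z) (snd z) \<le> B1 + B2"
      using z that unfolding V_def I_def by (intro add_mono B1 B2) auto
  qed
  have "\<bar>g (s', t) - g (s, t)\<bar> \<le> W s' - W s"
    if st: "0 \<le> s" "s \<le> s'" "s' \<le> S" "t \<in> {0..T}" for s s' t
  proof -
    have ne: "I s \<noteq> {}" unfolding I_def by (auto intro!: exI[of _ "[]"])
    have "V (fst z) (snd z) + \<bar>g (s', t) - g (s, t)\<bar> \<le> W s'" if z: "z \<in> I s" for z
    proof -
      obtain xs ys where [simp]: "z = (xs, ys)" by (cases z)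
      have xs: "sorted xs" "set xs \<subseteq> {0..s}" and ys: "sorted ys" "set ys \<subseteq> {0..T}"
        using z by (auto simp: I_def)
      \<comment> \<open>With 0 and \<open>t\<close> among the grid points, the rectangle over
        \<open>[s, s']\<close> and \<open>[0, t]\<close> is a union of cells, so its increment is
        seen by the Vitali sum. As \<open>xs\<close> stays in \<open>[0, s]\<close>, the points
        \<open>s, s'\<close> can be appended.\<close>
      define ys' where "ys' = insort 0 (insort t ys)"
      have ys': "sorted ys'" "set ys' = insert 0 (insert t (set ys))"
        using ys by (auto simp: ys'_def sorted_insort set_insort_key)
      define \<Phi> where "\<Phi> a b ys = chain_sum (\<lambda>c d. \<bar>rect_increment g a b c d\<bar>) ys" for a b ys
      have \<Phi>nn: "\<Phi> a b zs \<ge> 0" for a b zs unfolding \<Phi>_def by (rule chain_sum_nonneg) auto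
      have tri: "\<bar>rect_increment g a b c e\<bar> \<le> \<bar>rect_increment g a b c d\<bar> + \<bar>rect_increment g a b d e\<bar>"
        for a b c d e unfolding rect_increment_def by linarith
      have \<Phi>ys: "\<Phi> a b ys \<le> \<Phi> a b ys'" for a b
        unfolding \<Phi>_def ys'_def
        by (rule order_trans[OF chain_sum_insort_ge chain_sum_insort_ge]) (auto intro: tri)
      have \<Phi>t: "\<bar>rect_increment g s s' 0 t\<bar> \<le> \<Phi> s s' ys'"
        unfolding \<Phi>_def
        by (rule chain_sum_between_ge[where \<Psi> = "\<lambda>c d. \<bar>rect_increment g s s' c d\<bar>"])
          (use ys' st in \<open>auto intro: tri simp: rect_increment_def\<close>)
      have "vitali_sum g xs ys + \<bar>rect_increment g s s' 0 t\<bar> \<le> chain_sum (\<lambda>a b. \<Phi> a b ys') xs + \<Phi> s s' ys'"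
        unfolding vitali_sum_def \<Phi>_def[symmetric] by (intro add_mono chain_sum_mono \<Phi>ys \<Phi>t)
      also have "\<dots> \<le> vitali_sum g (xs @ [s, s']) ys'"
        unfolding vitali_sum_def \<Phi>_def[symmetric]
        using chain_sum_append_ge[of "\<lambda>a b. \<Phi> a b ys'" xs "[s, s']", OF \<Phi>nn] by simp
      finally have 1: "vitali_sum g xs ys + \<bar>rect_increment g s s' 0 t\<bar> \<le> vitali_sum g (xs @ [s, s']) ys'" .
      have 2: "chain_sum (\<lambda>a b. \<bar>g (b, 0) - g (a, 0)\<bar>) xs + \<bar>g (s', 0) - g (s, 0)\<bar>
          \<le> chain_sum (\<lambda>a b. \<bar>g (b, 0) - g (a, 0)\<bar>) (xs @ [s, s'])"
        using chain_sum_append_ge[of "\<lambda>a b. \<bar>g (b, 0) - g (a, 0)\<bar>" xs "[s, s']"] by simp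
      \<comment> \<open>The increment at height \<open>t\<close> is that of the rectangle below it
        plus that along the bottom edge.\<close>
      have 3: "\<bar>g (s', t) - g (s, t)\<bar> \<le> \<bar>rect_increment g s s' 0 t\<bar> + \<bar>g (s', 0) - g (s, 0)\<bar>"
        unfolding rect_increment_def by linarith
      have mem: "(xs @ [s, s'], ys') \<in> I s'"
        using xs ys' ys st unfolding I_def by (auto simp: sorted_append)
      have "V xs ys + \<bar>g (s', t) - g (s, t)\<bar> \<le> V (xs @ [s, s']) ys'"
        using 1 2 3 unfolding V_def by linarith
      also have "\<dots> \<le> W s'" unfolding W_def using cSUP_upper[OF mem bdd[of s']] st by simp
      finally show ?thesis by simp
    qed
    then have "W s \<le> W s' - \<bar>g (s', t) - g (s, t)\<bar>"
      unfolding W_def[of s] by (intro cSUP_least[OF ne]) (simp add: le_diff_eq)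
    then show ?thesis by linarith
  qed
  then show ?thesis by (rule that)
qed

lemma BV_HK_swap:
  assumes "BV_HK S T g"
  shows "BV_HK T S (\<lambda>p. g (snd p, fst p))"
proof -
  from assms obtain B where B: "\<And>m s n t. subdivision 0 S m s \<Longrightarrow> subdivision 0 T n t \<Longrightarrow>
        (\<Sum>i<m. \<Sum>j<n. \<bar>rect_increment g (s i) (s (Suc i)) (t j) (t (Suc j))\<bar>) \<le> B"
    unfolding BV_HK_def by blast
  have eq: "rect_increment (\<lambda>p. g (snd p, fst p)) a b c d = rect_increment g c d a b" for a b c d
    by (simp add: rect_increment_def)
  have "(\<Sum>i<m. \<Sum>j<n. \<bar>rect_increment (\<lambda>p. g (snd p, fst p)) (s i) (s (Suc i)) (t j) (t (Suc j))\<bar>) \<le> B"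
    if "subdivision 0 T m s" "subdivision 0 S n t" for m s n t
    unfolding eq using B[OF that(2,1)] by (subst sum.swap) simp
  then have "\<exists>B. \<forall>m s n t. subdivision 0 T m s \<and> subdivision 0 S n t \<longrightarrow>
      (\<Sum>i<m. \<Sum>j<n. \<bar>rect_increment (\<lambda>p. g (snd p, fst p)) (s i) (s (Suc i)) (t j) (t (Suc j))\<bar>) \<le> B"
    by blast
  then show ?thesis using assms unfolding BV_HK_def by simp
qed

text \<open>A joint modulus that separates the variables. It follows from Hardy--Krause variation,
  passes easily to sums and products, and already gives boundedness, measurability and convergence
  of Riemann sums.\<close>

definition osc_bounded :: "real \<Rightarrow> real \<Rightarrow> (real \<times> real \<Rightarrow> real) \<Rightarrow> bool" where
  "osc_bounded S T g \<longleftrightarrow> (\<exists>W Z. mono_on {0..S} W \<and> mono_on {0..T} Z \<and>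
     (\<forall>s\<in>{0..S}. \<forall>s'\<in>{0..S}. \<forall>t\<in>{0..T}. \<forall>t'\<in>{0..T}.
        \<bar>g (s, t) - g (s', t')\<bar> \<le> \<bar>W s - W s'\<bar> + \<bar>Z t - Z t'\<bar>))"

lemma BV_HK_osc_bounded:
  assumes "S > 0" "T > 0" "BV_HK S T g"
  shows "osc_bounded S T g"
proof -
  obtain W where W: "\<And>s s' t. \<lbrakk>0 \<le> s; s \<le> s'; s' \<le> S; t \<in> {0..T}\<rbrakk> \<Longrightarrow>
    \<bar>g (s', t) - g (s, t)\<bar> \<le> W s' - W s" using BV_HK_modulus_fst[OF assms] by blast
  obtain Z where Z: "\<And>t t' s. \<lbrakk>0 \<le> t; t \<le> t'; t' \<le> T; s \<in> {0..S}\<rbrakk> \<Longrightarrow>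
    \<bar>g (s, t') - g (s, t)\<bar> \<le> Z t' - Z t"
    using BV_HK_modulus_fst[OF assms(2,1) BV_HK_swap[OF assms(3)]] by auto
  have "mono_on {0..S} W" using W[of _ _ 0] assms by (force intro!: mono_onI)
  moreover have "mono_on {0..T} Z" using Z[of _ _ 0] assms by (force intro!: mono_onI)
  moreover have "\<bar>g (s, t) - g (s', t')\<bar> \<le> \<bar>W s - W s'\<bar> + \<bar>Z t - Z t'\<bar>"
    if "s \<in> {0..S}" "s' \<in> {0..S}" "t \<in> {0..T}" "t' \<in> {0..T}" for s s' t t'
  proof -
    have "\<bar>g (s, t) - g (s', t)\<bar> \<le> \<bar>W s - W s'\<bar>"
      using W[of s s' t] W[of s' s t] that by (cases s s' rule: linorder_cases) auto
    moreover have "\<bar>g (s', t) - g (s', t')\<bar> \<le> \<bar>Z t - Z t'\<bar>"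
      using Z[of t t' s'] Z[of t' t s'] that by (cases t t' rule: linorder_cases) auto
    ultimately show ?thesis by linarith
  qed
  ultimately show ?thesis unfolding osc_bounded_def by blast
qed

lemma osc_bounded_bound:
  assumes "S > 0" "T > 0" "osc_bounded S T g"
  obtains C where "C \<ge> 0" "\<And>p. p \<in> Q S T \<Longrightarrow> \<bar>g p\<bar> \<le> C"
proof -
  from assms(3) obtain W Z where WZ: "mono_on {0..S} W" "mono_on {0..T} Z"
    "\<And>s s' t t'. \<lbrakk>s\<in>{0..S}; s'\<in>{0..S}; t\<in>{0..T}; t'\<in>{0..T}\<rbrakk> \<Longrightarrow>
        \<bar>g (s, t) - g (s', t')\<bar> \<le> \<bar>W s - W s'\<bar> + \<bar>Z t - Z t'\<bar>"
    unfolding osc_bounded_def by metis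
  have "\<bar>g p\<bar> \<le> \<bar>g (0,0)\<bar> + (W S - W 0) + (Z T - Z 0)" if p: "p \<in> Q S T" for p
  proof -
    obtain s t where [simp]: "p = (s, t)" and st: "s \<in> {0..S}" "t \<in> {0..T}"
      using p unfolding Q_def by auto
    have "W 0 \<le> W s" "W s \<le> W S" "Z 0 \<le> Z t" "Z t \<le> Z T"
      using st assms by (auto intro!: mono_onD[OF WZ(1)] mono_onD[OF WZ(2)])
    then show ?thesis using WZ(3)[of s 0 t 0] st assms by simp
  qed
  then show ?thesis using that[of "\<bar>\<bar>g (0,0)\<bar> + (W S - W 0) + (Z T - Z 0)\<bar>"] by force
qed

lemma osc_bounded_const: "osc_bounded S T (\<lambda>p. c)"
  unfolding osc_bounded_def by (intro exI[of _ "\<lambda>_. 0"]) (auto intro: mono_onI)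

lemma osc_bounded_add:
  assumes "osc_bounded S T g" "osc_bounded S T h"
  shows "osc_bounded S T (\<lambda>p. g p + h p)"
proof -
  from assms obtain W Z W' Z' where *: "mono_on {0..S} W" "mono_on {0..T} Z"
     "mono_on {0..S} W'" "mono_on {0..T} Z'"
    "\<And>s s' t t'. \<lbrakk>s\<in>{0..S}; s'\<in>{0..S}; t\<in>{0..T}; t'\<in>{0..T}\<rbrakk> \<Longrightarrow>
        \<bar>g (s, t) - g (s', t')\<bar> \<le> \<bar>W s - W s'\<bar> + \<bar>Z t - Z t'\<bar>"
    "\<And>s s' t t'. \<lbrakk>s\<in>{0..S}; s'\<in>{0..S}; t\<in>{0..T}; t'\<in>{0..T}\<rbrakk> \<Longrightarrow>
        \<bar>h (s, t) - h (s', t')\<bar> \<le> \<bar>W' s - W' s'\<bar> + \<bar>Z' t - Z' t'\<bar>"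
    unfolding osc_bounded_def by metis
  \<comment> \<open>Monotone functions have increments of the same sign, so their absolute values
    add without loss.\<close>
  have abs_mono: "\<bar>A s - A s'\<bar> + \<bar>A' s - A' s'\<bar> = \<bar>(A s + A' s) - (A s' + A' s')\<bar>"
    if "mono_on {0..R} A" "mono_on {0..R} A'" "s \<in> {0..R}" "s' \<in> {0..R}" for A A' :: "real \<Rightarrow> real" and R s s'
    using mono_onD[OF that(1), of s s'] mono_onD[OF that(1), of s' s]
      mono_onD[OF that(2), of s s'] mono_onD[OF that(2), of s' s] that(3,4)
    by (cases "s \<le> s'") auto
  show ?thesis unfolding osc_bounded_def
  proof (rule exI[of _ "\<lambda>s. W s + W' s"], rule exI[of _ "\<lambda>t. Z t + Z' t"], intro conjI ballI)
    show "mono_on {0..S} (\<lambda>s. W s + W' s)" "mono_on {0..T} (\<lambda>t. Z t + Z' t)"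
      using *(1-4) by (auto simp: mono_on_def intro!: add_mono)
    fix s s' t t' assume st: "s\<in>{0..S}" "s'\<in>{0..S}" "t\<in>{0..T}" "t'\<in>{0..T}"
    show "\<bar>g (s, t) + h (s, t) - (g (s', t') + h (s', t'))\<bar>
      \<le> \<bar>W s + W' s - (W s' + W' s')\<bar> + \<bar>Z t + Z' t - (Z t' + Z' t')\<bar>"
      using *(5,6)[OF st] abs_mono[OF *(1,3) st(1,2)] abs_mono[OF *(2,4) st(3,4)] by linarith
  qed
qed

lemma osc_bounded_mult:
  assumes "S > 0" "T > 0" "osc_bounded S T g" "osc_bounded S T h"
  shows "osc_bounded S T (\<lambda>p. g p * h p)"
proof -
  obtain C where C: "C \<ge> 0" "\<And>p. p \<in> Q S T \<Longrightarrow> \<bar>g p\<bar> \<le> C" using osc_bounded_bound[OF assms(1-3)] by blast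
  obtain D where D: "D \<ge> 0" "\<And>p. p \<in> Q S T \<Longrightarrow> \<bar>h p\<bar> \<le> D" using osc_bounded_bound[OF assms(1,2,4)] by blast
  from assms obtain W Z W' Z' where *: "mono_on {0..S} W" "mono_on {0..T} Z"
     "mono_on {0..S} W'" "mono_on {0..T} Z'"
    "\<And>s s' t t'. \<lbrakk>s\<in>{0..S}; s'\<in>{0..S}; t\<in>{0..T}; t'\<in>{0..T}\<rbrakk> \<Longrightarrow>
        \<bar>g (s, t) - g (s', t')\<bar> \<le> \<bar>W s - W s'\<bar> + \<bar>Z t - Z t'\<bar>"
    "\<And>s s' t t'. \<lbrakk>s\<in>{0..S}; s'\<in>{0..S}; t\<in>{0..T}; t'\<in>{0..T}\<rbrakk> \<Longrightarrow>
        \<bar>h (s, t) - h (s', t')\<bar> \<le> \<bar>W' s - W' s'\<bar> + \<bar>Z' t - Z' t'\<bar>"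
    unfolding osc_bounded_def by metis
  \<comment> \<open>The weights come from the product rule: an increment of \<open>g\<close> is
    multiplied by a value of \<open>h\<close>, bounded by \<open>D\<close>, and an increment of
    \<open>h\<close> by a value of \<open>g\<close>, bounded by \<open>C\<close>.\<close>
  have abs_mono: "D * \<bar>A s - A s'\<bar> + C * \<bar>A' s - A' s'\<bar> = \<bar>(D * A s + C * A' s) - (D * A s' + C * A' s')\<bar>"
    if A: "mono_on {0..R} A" "mono_on {0..R} A'" "s \<in> {0..R}" "s' \<in> {0..R}" for A A' :: "real \<Rightarrow> real" and R s s'
  proof -
    have *: "D * \<bar>A s - A s'\<bar> = \<bar>D * A s - D * A s'\<bar>" "C * \<bar>A' s - A' s'\<bar> = \<bar>C * A' s - C * A' s'\<bar>"
      using C D by (auto simp: abs_mult right_diff_distrib[symmetric])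
    have **: "s \<le> s' \<Longrightarrow> D * A s \<le> D * A s'" "s' \<le> s \<Longrightarrow> D * A s' \<le> D * A s"
      "s \<le> s' \<Longrightarrow> C * A' s \<le> C * A' s'" "s' \<le> s \<Longrightarrow> C * A' s' \<le> C * A' s"
      using A C D by (auto intro!: mult_left_mono mono_onD[OF A(1)] mono_onD[OF A(2)])
    show ?thesis unfolding * using ** by (cases "s \<le> s'") auto
  qed
  show ?thesis unfolding osc_bounded_def
  proof (rule exI[of _ "\<lambda>s. D * W s + C * W' s"], rule exI[of _ "\<lambda>t. D * Z t + C * Z' t"], intro conjI ballI)
    show "mono_on {0..S} (\<lambda>s. D * W s + C * W' s)" "mono_on {0..T} (\<lambda>t. D * Z t + C * Z' t)"
      using *(1-4) C D by (auto simp: mono_on_def intro!: add_mono mult_left_mono)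
    fix s s' t t' assume st: "s\<in>{0..S}" "s'\<in>{0..S}" "t\<in>{0..T}" "t'\<in>{0..T}"
    have "g (s, t) * h (s, t) - g (s', t') * h (s', t') =
        g (s, t) * (h (s, t) - h (s', t')) + (g (s, t) - g (s', t')) * h (s', t')" by algebra
    also have "\<bar>\<dots>\<bar> \<le> \<bar>g (s, t)\<bar> * \<bar>h (s, t) - h (s', t')\<bar> + \<bar>g (s, t) - g (s', t')\<bar> * \<bar>h (s', t')\<bar>"
      by (simp add: abs_mult order_trans[OF abs_triangle_ineq])
    also have "\<dots> \<le> C * (\<bar>W' s - W' s'\<bar> + \<bar>Z' t - Z' t'\<bar>) + (\<bar>W s - W s'\<bar> + \<bar>Z t - Z t'\<bar>) * D"
      using *(5,6)[OF st] C D st by (intro add_mono mult_mono) (auto simp: Q_def)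
    also have "\<dots> = (D * \<bar>W s - W s'\<bar> + C * \<bar>W' s - W' s'\<bar>) + (D * \<bar>Z t - Z t'\<bar> + C * \<bar>Z' t - Z' t'\<bar>)"
      by (simp add: algebra_simps)
    also have "\<dots> = \<bar>D * W s + C * W' s - (D * W s' + C * W' s')\<bar> + \<bar>D * Z t + C * Z' t - (D * Z t' + C * Z' t')\<bar>"
      unfolding abs_mono[OF *(1,3) st(1,2)] abs_mono[OF *(2,4) st(3,4)] ..
    finally show "\<bar>g (s, t) * h (s, t) - g (s', t') * h (s', t')\<bar> \<le> \<dots>" .
  qed
qed

lemma osc_bounded_sum:
  assumes "\<And>i. i \<in> I \<Longrightarrow> osc_bounded S T (g i)"
  shows "osc_bounded S T (\<lambda>p. \<Sum>i\<in>I. g i p)"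
  using assms by (induction I rule: infinite_finite_induct) (auto intro: osc_bounded_const osc_bounded_add)

section \<open>Lebesgue measure on the rectangle\<close>

abbreviation Leb :: "real \<Rightarrow> real \<Rightarrow> (real \<times> real) measure" where
  "Leb S T \<equiv> lebesgue_on (Q S T)"

lemma Q_cbox: "Q S T = cbox (0, 0) (S, T)"
  unfolding Q_def by (auto simp: cbox_Pair_eq)

lemma finite_measure_Leb: "finite_measure (Leb S T)"
  unfolding Q_cbox by (rule finite_measure_lebesgue_on) simp

lemma null_lines:
  assumes "countable N"
  shows "N \<times> UNIV \<in> null_sets (lborel :: (real \<times> real) measure)"
    "UNIV \<times> N \<in> null_sets (lborel :: (real \<times> real) measure)"
proof -
  have N: "N \<in> null_sets (lborel :: real measure)" by (rule countable_imp_null_set_lborel[OF assms])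
  show "N \<times> UNIV \<in> null_sets (lborel :: (real \<times> real) measure)"
    "UNIV \<times> N \<in> null_sets (lborel :: (real \<times> real) measure)"
    unfolding lborel_prod[symmetric]
    using lborel.times_in_null_sets1[OF N, of UNIV] lborel.times_in_null_sets2[OF _ N, of UNIV lborel] by auto
qed

text \<open>The monotone moduli have countably many discontinuities. Off the corresponding vertical
  and horizontal lines, which form a null set, \<open>g\<close> is continuous, and completeness of
  Lebesgue measure does the rest.\<close>

lemma osc_bounded_measurable:
  assumes "S > 0" "T > 0" "osc_bounded S T g"
  shows "g \<in> borel_measurable (Leb S T)"
proof -
  from assms(3) obtain W Z where WZ: "mono_on {0..S} W" "mono_on {0..T} Z"
    "\<And>s s' t t'. \<lbrakk>s\<in>{0..S}; s'\<in>{0..S}; t\<in>{0..T}; t'\<in>{0..T}\<rbrakk> \<Longrightarrow>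
        \<bar>g (s, t) - g (s', t')\<bar> \<le> \<bar>W s - W s'\<bar> + \<bar>Z t - Z t'\<bar>"
    unfolding osc_bounded_def by metis
  define D where "D = {a\<in>{0..S}. \<not> continuous (at a within {0..S}) W}"
  define E where "E = {a\<in>{0..T}. \<not> continuous (at a within {0..T}) Z}"
  have ctb: "countable D" "countable E"
    unfolding D_def E_def using mono_on_ctble_discont WZ(1,2) by blast+
  define N where "N = D \<times> UNIV \<union> UNIV \<times> E"
  have N0: "N \<in> null_sets lborel" unfolding N_def using null_lines ctb by (auto intro!: null_sets.Un)
  have cont: "continuous_on (Q S T - N) g"
    unfolding continuous_on_eq_continuous_within
  proof
    fix p assume p: "p \<in> Q S T - N"
    obtain s t where [simp]: "p = (s, t)" by (cases p)
    have st: "s \<in> {0..S}" "t \<in> {0..T}" "s \<notin> D" "t \<notin> E"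
      using p unfolding Q_def N_def by auto
    have cW: "(W \<longlongrightarrow> W s) (at s within {0..S})" and cZ: "(Z \<longlongrightarrow> Z t) (at t within {0..T})"
      using st unfolding D_def E_def continuous_within by auto
    show "continuous (at p within (Q S T - N)) g"
      unfolding continuous_within tendsto_iff
    proof (intro allI impI)
      fix e :: real assume "e > 0"
      then have e2: "e / 2 > 0" by simp
      obtain d1 where d1: "d1 > 0" "\<And>s'. s' \<in> {0..S} \<Longrightarrow> dist s' s < d1 \<Longrightarrow> dist (W s') (W s) < e/2"
        using cW e2 unfolding Lim_within by (metis dist_eq_0_iff zero_less_dist_iff)
      obtain d2 where d2: "d2 > 0" "\<And>t'. t' \<in> {0..T} \<Longrightarrow> dist t' t < d2 \<Longrightarrow> dist (Z t') (Z t) < e/2"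
        using cZ e2 unfolding Lim_within by (metis dist_eq_0_iff zero_less_dist_iff)
      show "\<forall>\<^sub>F x in at p within Q S T - N. dist (g x) (g p) < e"
        unfolding eventually_at
      proof (intro exI[of _ "min d1 d2"] conjI ballI impI)
        show "min d1 d2 > 0" using d1 d2 by simp
        fix x assume x: "x \<in> Q S T - N" "x \<noteq> p \<and> dist x p < min d1 d2"
        obtain s' t' where [simp]: "x = (s', t')" by (cases x)
        have st': "s' \<in> {0..S}" "t' \<in> {0..T}" using x unfolding Q_def by auto
        have "dist s' s \<le> dist x p" "dist t' t \<le> dist x p"
          using dist_fst_le[of x p] dist_snd_le[of x p] by auto
        then have "dist (W s') (W s) < e/2" "dist (Z t') (Z t) < e/2" using d1 d2 x st' by auto
        then show "dist (g x) (g p) < e"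
          using WZ(3)[OF st'(1) st(1) st'(2) st(2)] by (auto simp: dist_real_def)
      qed
    qed
  qed
  have Qb: "Q S T \<in> sets borel" unfolding Q_cbox by simp
  have Nb: "N \<in> sets borel" using N0 by auto
  have "(\<lambda>p. if p \<in> Q S T - N then g p else 0) \<in> borel_measurable borel"
    using borel_measurable_continuous_on_if[of "Q S T - N" g "\<lambda>_. 0"] Qb Nb cont by auto
  then have m1: "(\<lambda>p. if p \<in> Q S T - N then g p else 0) \<in> borel_measurable lebesgue"
    by (simp add: measurable_completion)
  have "AE p in lebesgue. (if p \<in> Q S T - N then g p else 0) = (if p \<in> Q S T then g p else 0)"
    using AE_not_in[OF null_sets_completionI[OF N0]] by eventually_elim auto
  from borel_measurable_AE[OF m1 this] have "(\<lambda>p. if p \<in> Q S T then g p else 0) \<in> borel_measurable lebesgue" .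
  then show ?thesis using Qb by (subst (asm) borel_measurable_if) auto
qed


section \<open>Riemann--Stieltjes integrals\<close>


definition RS_sum :: "(real \<times> real \<Rightarrow> real) \<Rightarrow> (real \<times> real \<Rightarrow> real) \<Rightarrow>
    nat \<Rightarrow> (nat \<Rightarrow> real) \<Rightarrow> (nat \<Rightarrow> real) \<Rightarrow> nat \<Rightarrow> (nat \<Rightarrow> real) \<Rightarrow> (nat \<Rightarrow> real) \<Rightarrow> real" where
  "RS_sum g x m s \<xi> n t \<eta> = (\<Sum>i<m. \<Sum>j<n. g (\<xi> i, \<eta> j) *
            rect_increment x (s i) (s (Suc i)) (t j) (t (Suc j)))"

definition fine_tags :: "real \<Rightarrow> real \<Rightarrow> nat \<Rightarrow> (nat \<Rightarrow> real) \<Rightarrow> (nat \<Rightarrow> real) \<Rightarrow> bool" where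
  "fine_tags S \<delta> m s \<xi> \<longleftrightarrow> subdivision 0 S m s \<and>
     (\<forall>i<m. s (Suc i) - s i < \<delta> \<and> s i \<le> \<xi> i \<and> \<xi> i \<le> s (Suc i))"

lemma has_RS_integral_fine_tags:
  "has_RS_integral S T g x I \<longleftrightarrow> (\<forall>\<epsilon>>0. \<exists>\<delta>>0. \<forall>m s \<xi> n t \<eta>. fine_tags S \<delta> m s \<xi> \<and> fine_tags T \<delta> n t \<eta> \<longrightarrow>
     \<bar>RS_sum g x m s \<xi> n t \<eta> - I\<bar> < \<epsilon>)"
  unfolding has_RS_integral_def RS_sum_def fine_tags_def by (simp add: conj_assoc)

lemma has_RS_integralD:
  assumes "has_RS_integral S T g x I" "\<epsilon> > 0"
  obtains \<delta> where "\<delta> > 0" "\<And>m s \<xi> n t \<eta>. fine_tags S \<delta> m s \<xi> \<Longrightarrow> fine_tags T \<delta> n t \<eta> \<Longrightarrow>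
     \<bar>RS_sum g x m s \<xi> n t \<eta> - I\<bar> < \<epsilon>"
proof -
  from assms(1)[unfolded has_RS_integral_fine_tags, rule_format, OF assms(2)]
  obtain \<delta> where \<delta>: "\<delta> > 0" and *: "\<forall>m s \<xi> n t \<eta>. fine_tags S \<delta> m s \<xi> \<and> fine_tags T \<delta> n t \<eta> \<longrightarrow>
     \<bar>RS_sum g x m s \<xi> n t \<eta> - I\<bar> < \<epsilon>" by (elim exE conjE)
  show ?thesis using *[rule_format, OF conjI] by (rule that[OF \<delta>])
qed

lemma fine_tags_mono: "fine_tags S \<delta> m s \<xi> \<Longrightarrow> \<delta> \<le> \<delta>' \<Longrightarrow> fine_tags S \<delta>' m s \<xi>"
  unfolding fine_tags_def by force

lemma subdivision_le:
  assumes "subdivision a b m s" "i \<le> j" "j \<le> m"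
  shows "s i \<le> s j"
  using assms(2,3)
proof (induction j rule: dec_induct)
  case (step j)
  have "s j < s (Suc j)" using assms(1) step.prems unfolding subdivision_def by simp
  moreover have "s i \<le> s j" using step by simp
  ultimately show ?case by simp
qed simp

lemma fine_tags_range:
  assumes "fine_tags S \<delta> m s \<xi>"
  shows "i \<le> m \<Longrightarrow> s i \<in> {0..S}" "i < m \<Longrightarrow> \<xi> i \<in> {0..S}" "i < m \<Longrightarrow> s i \<le> s (Suc i)"
    "i < m \<Longrightarrow> s i \<le> \<xi> i" "i < m \<Longrightarrow> \<xi> i \<le> s (Suc i)" "s 0 = 0" "s m = S"
    "Suc i < m \<Longrightarrow> \<xi> i \<le> \<xi> (Suc i)"
proof -
  have sub: "subdivision 0 S m s" and tg: "\<And>i. i < m \<Longrightarrow> s i \<le> \<xi> i \<and> \<xi> i \<le> s (Suc i)"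
    using assms unfolding fine_tags_def by auto
  show e: "s 0 = 0" "s m = S" using sub unfolding subdivision_def by auto
  show r: "i \<le> m \<Longrightarrow> s i \<in> {0..S}" for i
    using subdivision_le[OF sub, of 0 i] subdivision_le[OF sub, of i m] e by auto
  show "i < m \<Longrightarrow> \<xi> i \<in> {0..S}" using tg[of i] r[of i] r[of "Suc i"] by auto
  show "i < m \<Longrightarrow> s i \<le> s (Suc i)" "i < m \<Longrightarrow> s i \<le> \<xi> i" "i < m \<Longrightarrow> \<xi> i \<le> s (Suc i)"
    using tg[of i] by auto
  show "Suc i < m \<Longrightarrow> \<xi> i \<le> \<xi> (Suc i)" using tg[of i] tg[of "Suc i"] by auto
qed

text \<open>A concrete sequence of partitions, tagged by left endpoints, along which limits over all
  fine partitions become limits of sequences. Uniqueness, measurability and moments of the integral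
  are obtained along it.\<close>

definition unif_grid :: "real \<Rightarrow> nat \<Rightarrow> nat \<Rightarrow> real" where
  "unif_grid S k i = S * real i / real (Suc k)"

lemma fine_tags_unif_grid:
  assumes "S > 0" "S / real (Suc k) < \<delta>"
  shows "fine_tags S \<delta> (Suc k) (unif_grid S k) (unif_grid S k)"
proof -
  have d: "unif_grid S k (Suc i) - unif_grid S k i = S / real (Suc k)" for i
    unfolding unif_grid_def by (simp add: diff_divide_distrib[symmetric] distrib_left)
  have "unif_grid S k i < unif_grid S k (Suc i)" for i
  proof -
    have "S / real (Suc k) > 0" using assms(1) by simp
    then show ?thesis using d[of i] by linarith
  qed
  moreover have "unif_grid S k 0 = 0" "unif_grid S k (Suc k) = S" unfolding unif_grid_def by simp_all
  ultimately show ?thesis using assms(2) d unfolding fine_tags_def subdivision_def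
    by (simp add: less_imp_le)
qed

lemma eventually_unif_grid_fine:
  assumes "\<delta> > 0"
  shows "eventually (\<lambda>k. S / real (Suc k) < \<delta>) sequentially"
proof -
  have "(\<lambda>k. S * inverse (real (Suc k))) \<longlonglongrightarrow> S * 0"
    by (intro tendsto_intros LIMSEQ_inverse_real_of_nat)
  from order_tendstoD(2)[OF this, of \<delta>] show ?thesis using assms by (simp add: divide_inverse)
qed

definition unif_RS_sum :: "real \<Rightarrow> real \<Rightarrow> (real \<times> real \<Rightarrow> real) \<Rightarrow> (real \<times> real \<Rightarrow> real) \<Rightarrow> nat \<Rightarrow> real" where
  "unif_RS_sum S T g x k = RS_sum g x (Suc k) (unif_grid S k) (unif_grid S k) (Suc k) (unif_grid T k) (unif_grid T k)"

lemma unif_RS_sum_LIMSEQ: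
  assumes "S > 0" "T > 0" "has_RS_integral S T g x I"
  shows "unif_RS_sum S T g x \<longlonglongrightarrow> I"
proof (rule LIMSEQ_I)
  fix e :: real assume "e > 0"
  then obtain \<delta> where \<delta>: "\<delta> > 0" "\<And>m s \<xi> n t \<eta>. fine_tags S \<delta> m s \<xi> \<Longrightarrow> fine_tags T \<delta> n t \<eta> \<Longrightarrow>
     \<bar>RS_sum g x m s \<xi> n t \<eta> - I\<bar> < e" using has_RS_integralD[OF assms(3)] by blast
  have "eventually (\<lambda>k. S / real (Suc k) < \<delta> \<and> T / real (Suc k) < \<delta>) sequentially"
    by (intro eventually_conj eventually_unif_grid_fine \<delta>(1))
  then have "eventually (\<lambda>k. norm (unif_RS_sum S T g x k - I) < e) sequentially"
    unfolding unif_RS_sum_def real_norm_def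
    by eventually_elim (rule \<delta>(2); rule fine_tags_unif_grid; use assms in simp)
  then show "\<exists>no. \<forall>n\<ge>no. norm (unif_RS_sum S T g x n - I) < e"
    by (simp add: eventually_sequentially)
qed

lemma RS_integral_eqI:
  assumes "S > 0" "T > 0" "has_RS_integral S T g x I"
  shows "RS_integral S T g x = I"
  unfolding RS_integral_def
proof (rule the_equality)
  show "J = I" if "has_RS_integral S T g x J" for J
    by (rule LIMSEQ_unique[OF unif_RS_sum_LIMSEQ[OF assms(1,2) that] unif_RS_sum_LIMSEQ[OF assms]])
qed (rule assms(3))

lemma RS_sum_add_left: "RS_sum (\<lambda>p. g p + h p) x m s \<xi> n t \<eta> = RS_sum g x m s \<xi> n t \<eta> + RS_sum h x m s \<xi> n t \<eta>"
  unfolding RS_sum_def by (simp add: sum.distrib distrib_right)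

lemma RS_sum_cmult_left: "RS_sum (\<lambda>p. c * g p) x m s \<xi> n t \<eta> = c * RS_sum g x m s \<xi> n t \<eta>"
  unfolding RS_sum_def by (simp add: sum_distrib_left mult.assoc)

lemma RS_sum_add_right: "RS_sum g (\<lambda>p. x p + y p) m s \<xi> n t \<eta> = RS_sum g x m s \<xi> n t \<eta> + RS_sum g y m s \<xi> n t \<eta>"
proof -
  have "rect_increment (\<lambda>p. x p + y p) a b c d = rect_increment x a b c d + rect_increment y a b c d" for a b c d
    by (simp add: rect_increment_def)
  then show ?thesis unfolding RS_sum_def by (simp add: sum.distrib distrib_left)
qed

lemma RS_sum_cmult_right: "RS_sum g (\<lambda>p. c * x p) m s \<xi> n t \<eta> = c * RS_sum g x m s \<xi> n t \<eta>"
proof -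
  have "rect_increment (\<lambda>p. c * x p) a b c' d = c * rect_increment x a b c' d" for a b c' d
    unfolding rect_increment_def by algebra
  then show ?thesis unfolding RS_sum_def by (simp add: sum_distrib_left mult.left_commute)
qed

text \<open>Linearity in the integrand and in the integrator at once: what matters is that the sums
  combine linearly.\<close>

lemma has_RS_integral_combine:
  assumes 1: "has_RS_integral S T g x I" and 2: "has_RS_integral S T g' x' I'"
    and eq: "\<And>m s \<xi> n t \<eta>. RS_sum g'' x'' m s \<xi> n t \<eta> = a * RS_sum g x m s \<xi> n t \<eta> + b * RS_sum g' x' m s \<xi> n t \<eta>"
  shows "has_RS_integral S T g'' x'' (a * I + b * I')"
  unfolding has_RS_integral_fine_tags
proof (intro allI impI)
  fix e :: real assume "e > 0"
  \<comment> \<open>The summand 1 keeps \<open>c\<close> positive and strictly above the sum of the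
    coefficients, also when \<open>a = b = 0\<close>.\<close>
  define c where "c = \<bar>a\<bar> + \<bar>b\<bar> + 1"
  have c: "c > 0" "\<bar>a\<bar> + \<bar>b\<bar> < c" by (auto simp: c_def)
  then have e': "e / c > 0" using \<open>e > 0\<close> by simp
  obtain d1 where d1: "d1 > 0" "\<And>m s \<xi> n t \<eta>. fine_tags S d1 m s \<xi> \<Longrightarrow> fine_tags T d1 n t \<eta> \<Longrightarrow>
     \<bar>RS_sum g x m s \<xi> n t \<eta> - I\<bar> < e / c" using has_RS_integralD[OF 1 e'] by blast
  obtain d2 where d2: "d2 > 0" "\<And>m s \<xi> n t \<eta>. fine_tags S d2 m s \<xi> \<Longrightarrow> fine_tags T d2 n t \<eta> \<Longrightarrow>
     \<bar>RS_sum g' x' m s \<xi> n t \<eta> - I'\<bar> < e / c" using has_RS_integralD[OF 2 e'] by blast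
  have "\<bar>RS_sum g'' x'' m s \<xi> n t \<eta> - (a * I + b * I')\<bar> < e"
    if "fine_tags S (min d1 d2) m s \<xi>" "fine_tags T (min d1 d2) n t \<eta>" for m s \<xi> n t \<eta>
  proof -
    let ?A = "RS_sum g x m s \<xi> n t \<eta> - I" and ?B = "RS_sum g' x' m s \<xi> n t \<eta> - I'"
    have AB: "\<bar>?A\<bar> \<le> e / c" "\<bar>?B\<bar> \<le> e / c"
      using d1(2) d2(2) fine_tags_mono[OF that(1)] fine_tags_mono[OF that(2)] by (auto intro!: less_imp_le)
    have "\<bar>RS_sum g'' x'' m s \<xi> n t \<eta> - (a * I + b * I')\<bar> = \<bar>a * ?A + b * ?B\<bar>"
      unfolding eq by (simp add: algebra_simps)
    also have "\<dots> \<le> \<bar>a\<bar> * \<bar>?A\<bar> + \<bar>b\<bar> * \<bar>?B\<bar>"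
      using abs_triangle_ineq[of "a * ?A" "b * ?B"] by (simp only: abs_mult)
    also have "\<dots> \<le> \<bar>a\<bar> * (e / c) + \<bar>b\<bar> * (e / c)"
      by (intro add_mono mult_left_mono AB) auto
    also have "\<dots> = (\<bar>a\<bar> + \<bar>b\<bar>) * (e / c)" by (simp add: algebra_simps)
    also have "\<dots> < c * (e / c)" using c e' by (intro mult_strict_right_mono)
    also have "\<dots> = e" using c by simp
    finally show ?thesis .
  qed
  then show "\<exists>\<delta>>0. \<forall>m s \<xi> n t \<eta>. fine_tags S \<delta> m s \<xi> \<and> fine_tags T \<delta> n t \<eta> \<longrightarrow>
     \<bar>RS_sum g'' x'' m s \<xi> n t \<eta> - (a * I + b * I')\<bar> < e"
    using d1(1) d2(1) by (intro exI[of _ "min d1 d2"] conjI allI impI) (simp, blast)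
qed

lemma abel_summation:
  fixes a b :: "nat \<Rightarrow> real"
  assumes "b 0 = 0"
  shows "(\<Sum>i<Suc m. a i * (b (Suc i) - b i)) = a m * b (Suc m) + (\<Sum>i<m. (a i - a (Suc i)) * b (Suc i))"
proof (induction m)
  case (Suc m)
  have "(\<Sum>i<Suc (Suc m). a i * (b (Suc i) - b i)) =
      (a m * b (Suc m) + (\<Sum>i<m. (a i - a (Suc i)) * b (Suc i))) + a (Suc m) * (b (Suc (Suc m)) - b (Suc m))"
    by (simp only: sum.lessThan_Suc[of _ "Suc m"] Suc.IH)
  then show ?case by (simp add: ring_distribs)
qed (simp add: assms)

text \<open>Summation by parts in both variables moves all differences from \<open>y\<close> to
  \<open>a\<close>; the lower boundary terms vanish with \<open>y\<close>. What remains is a corner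
  value, the variations along two edges and the double variation of \<open>a\<close>.\<close>

lemma abel_summation_2d_bound:
  fixes a y :: "nat \<Rightarrow> nat \<Rightarrow> real"
  assumes z: "\<And>i. y i 0 = 0" "\<And>j. y 0 j = 0"
    and E: "\<And>i j. i \<le> Suc m \<Longrightarrow> j \<le> Suc n \<Longrightarrow> \<bar>y i j\<bar> \<le> E"
  shows "\<bar>\<Sum>i<Suc m. \<Sum>j<Suc n. a i j * (y (Suc i) (Suc j) - y i (Suc j) - y (Suc i) j + y i j)\<bar> \<le>
    E * (\<bar>a m n\<bar> + (\<Sum>i<m. \<bar>a i n - a (Suc i) n\<bar>) + (\<Sum>j<n. \<bar>a m j - a m (Suc j)\<bar>) +
      (\<Sum>j<n. \<Sum>i<m. \<bar>a i j - a i (Suc j) - (a (Suc i) j - a (Suc i) (Suc j))\<bar>))"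
proof -
  have inner: "(\<Sum>j<Suc n. a i j * (y (Suc i) (Suc j) - y i (Suc j) - y (Suc i) j + y i j)) =
      a i n * (y (Suc i) (Suc n) - y i (Suc n)) +
      (\<Sum>j<n. (a i j - a i (Suc j)) * (y (Suc i) (Suc j) - y i (Suc j)))" for i
  proof -
    have "(\<Sum>j<Suc n. a i j * (y (Suc i) (Suc j) - y i (Suc j) - y (Suc i) j + y i j)) =
        (\<Sum>j<Suc n. a i j * ((y (Suc i) (Suc j) - y i (Suc j)) - (y (Suc i) j - y i j)))"
      by (intro sum.cong refl arg_cong2[where f = times]) linarith
    also have "\<dots> = a i n * (y (Suc i) (Suc n) - y i (Suc n)) +
      (\<Sum>j<n. (a i j - a i (Suc j)) * (y (Suc i) (Suc j) - y i (Suc j)))"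
      by (rule abel_summation[of "\<lambda>j. y (Suc i) j - y i j"]) (simp add: z)
    finally show ?thesis .
  qed
  have "(\<Sum>i<Suc m. \<Sum>j<Suc n. a i j * (y (Suc i) (Suc j) - y i (Suc j) - y (Suc i) j + y i j)) =
     (\<Sum>i<Suc m. a i n * (y (Suc i) (Suc n) - y i (Suc n))) +
     (\<Sum>j<n. \<Sum>i<Suc m. (a i j - a i (Suc j)) * (y (Suc i) (Suc j) - y i (Suc j)))"
    unfolding inner sum.distrib
    by (rule arg_cong2[where f = "(+)", OF refl sum.swap])
  also have "\<dots> = a m n * y (Suc m) (Suc n) + (\<Sum>i<m. (a i n - a (Suc i) n) * y (Suc i) (Suc n)) +
     (\<Sum>j<n. (a m j - a m (Suc j)) * y (Suc m) (Suc j) +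
       (\<Sum>i<m. (a i j - a i (Suc j) - (a (Suc i) j - a (Suc i) (Suc j))) * y (Suc i) (Suc j)))"
    by (intro arg_cong2[where f = "(+)"] sum.cong refl
        abel_summation[of "\<lambda>i. y i (Suc n)" "\<lambda>i. a i n" m]
        abel_summation[of "\<lambda>i. y i (Suc j)" "\<lambda>i. a i j - a i (Suc j)" m for j] z(2))
  finally have eq: "(\<Sum>i<Suc m. \<Sum>j<Suc n. a i j * (y (Suc i) (Suc j) - y i (Suc j) - y (Suc i) j + y i j)) = \<dots>" .
  have "\<bar>\<Sum>i<Suc m. \<Sum>j<Suc n. a i j * (y (Suc i) (Suc j) - y i (Suc j) - y (Suc i) j + y i j)\<bar>
     \<le> \<bar>a m n\<bar> * E + (\<Sum>i<m. \<bar>a i n - a (Suc i) n\<bar> * E) +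
     (\<Sum>j<n. \<bar>a m j - a m (Suc j)\<bar> * E +
       (\<Sum>i<m. \<bar>a i j - a i (Suc j) - (a (Suc i) j - a (Suc i) (Suc j))\<bar> * E))"
  proof -
    have L: "\<bar>c * y i j\<bar> \<le> \<bar>c\<bar> * E" if "i \<le> Suc m" "j \<le> Suc n" for c i j
      unfolding abs_mult by (rule mult_left_mono[OF E[OF that]]) simp
    have add: "\<bar>u + v\<bar> \<le> b + c" if "\<bar>u\<bar> \<le> b" "\<bar>v\<bar> \<le> c" for u v b c :: real
      using that by linarith
    have s: "\<bar>sum f {..<k}\<bar> \<le> sum f' {..<k}" if "\<And>i. i < k \<Longrightarrow> \<bar>f i\<bar> \<le> f' i" for f f' :: "nat \<Rightarrow> real" and k
      by (rule order_trans[OF sum_abs sum_mono]) (use that in auto)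
    have X1: "\<bar>\<Sum>i<m. (a i n - a (Suc i) n) * y (Suc i) (Suc n)\<bar> \<le> (\<Sum>i<m. \<bar>a i n - a (Suc i) n\<bar> * E)"
      by (rule s, rule L) auto
    have X2: "\<bar>\<Sum>j<n. (a m j - a m (Suc j)) * y (Suc m) (Suc j) +
       (\<Sum>i<m. (a i j - a i (Suc j) - (a (Suc i) j - a (Suc i) (Suc j))) * y (Suc i) (Suc j))\<bar> \<le>
      (\<Sum>j<n. \<bar>a m j - a m (Suc j)\<bar> * E +
       (\<Sum>i<m. \<bar>a i j - a i (Suc j) - (a (Suc i) j - a (Suc i) (Suc j))\<bar> * E))"
    proof (rule s)
      fix j assume "j < n"
      then have "\<bar>(a m j - a m (Suc j)) * y (Suc m) (Suc j)\<bar> \<le> \<bar>a m j - a m (Suc j)\<bar> * E"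
        by (intro L) auto
      moreover have "\<bar>\<Sum>i<m. (a i j - a i (Suc j) - (a (Suc i) j - a (Suc i) (Suc j))) * y (Suc i) (Suc j)\<bar> \<le>
         (\<Sum>i<m. \<bar>a i j - a i (Suc j) - (a (Suc i) j - a (Suc i) (Suc j))\<bar> * E)"
        by (rule s, rule L) (use \<open>j < n\<close> in auto)
      ultimately show "\<bar>(a m j - a m (Suc j)) * y (Suc m) (Suc j) +
       (\<Sum>i<m. (a i j - a i (Suc j) - (a (Suc i) j - a (Suc i) (Suc j))) * y (Suc i) (Suc j))\<bar> \<le>
       \<bar>a m j - a m (Suc j)\<bar> * E + (\<Sum>i<m. \<bar>a i j - a i (Suc j) - (a (Suc i) j - a (Suc i) (Suc j))\<bar> * E)"
        by (rule add)
    qed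
    have X3: "\<bar>a m n * y (Suc m) (Suc n)\<bar> \<le> \<bar>a m n\<bar> * E" by (rule L) auto
    show ?thesis unfolding eq by (rule add[OF add[OF X3 X1] X2])
  qed
  also have "\<dots> = E * (\<bar>a m n\<bar> + (\<Sum>i<m. \<bar>a i n - a (Suc i) n\<bar>) + (\<Sum>j<n. \<bar>a m j - a m (Suc j)\<bar>) +
      (\<Sum>j<n. \<Sum>i<m. \<bar>a i j - a i (Suc j) - (a (Suc i) j - a (Suc i) (Suc j))\<bar>))"
    by (subst mult.commute) (simp only: sum.distrib sum_distrib_right[symmetric] distrib_right[symmetric] add.assoc)
  finally show ?thesis .
qed

lemma mono_chain_sum_le:
  fixes W :: "real \<Rightarrow> real"
  assumes "mono_on {0..S} W" "fine_tags S \<delta> (Suc m) s \<xi>"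
  shows "(\<Sum>i<m. \<bar>W (\<xi> i) - W (\<xi> (Suc i))\<bar>) \<le> W S - W 0"
proof -
  note r = fine_tags_range[OF assms(2)]
  have "(\<Sum>i<m. \<bar>W (\<xi> i) - W (\<xi> (Suc i))\<bar>) = (\<Sum>i<m. W (\<xi> (Suc i)) - W (\<xi> i))"
  proof (rule sum.cong)
    fix i assume "i \<in> {..<m}"
    then have "W (\<xi> i) \<le> W (\<xi> (Suc i))" by (intro mono_onD[OF assms(1)] r) auto
    then show "\<bar>W (\<xi> i) - W (\<xi> (Suc i))\<bar> = W (\<xi> (Suc i)) - W (\<xi> i)" by linarith
  qed simp
  also have "\<dots> = W (\<xi> m) - W (\<xi> 0)" by (rule sum_lessThan_telescope)
  also have "\<dots> \<le> W S - W 0"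
    using r(2)[of m] r(2)[of 0] by (intro diff_mono mono_onD[OF assms(1)]) auto
  finally show ?thesis .
qed

text \<open>The constant depends on \<open>g\<close> alone, neither on the partition nor on the
  path. Stieltjes sums are thus continuous in the integrator for the supremum norm, uniformly in the
  partition, which makes approximation of the path by polynomials possible.\<close>

lemma RS_sum_bound:
  assumes "S > 0" "T > 0" "BV_HK S T g"
  obtains K where "K \<ge> 0" "\<And>m s \<xi> n t \<eta> x E \<delta>. \<lbrakk>fine_tags S \<delta> m s \<xi>; fine_tags T \<delta> n t \<eta>; \<And>p. p \<in> Q S T \<Longrightarrow> \<bar>x p\<bar> \<le> E\<rbrakk> \<Longrightarrow>
    \<bar>RS_sum g x m s \<xi> n t \<eta>\<bar> \<le> K * E"
proof -
  note osc = BV_HK_osc_bounded[OF assms]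
  obtain C where C: "C \<ge> 0" "\<And>p. p \<in> Q S T \<Longrightarrow> \<bar>g p\<bar> \<le> C" using osc_bounded_bound[OF assms(1,2) osc] by blast
  obtain W Z where WZ: "mono_on {0..S} W" "mono_on {0..T} Z"
    "\<And>s s' t t'. \<lbrakk>s\<in>{0..S}; s'\<in>{0..S}; t\<in>{0..T}; t'\<in>{0..T}\<rbrakk> \<Longrightarrow>
        \<bar>g (s, t) - g (s', t')\<bar> \<le> \<bar>W s - W s'\<bar> + \<bar>Z t - Z t'\<bar>"
    using osc unfolding osc_bounded_def by metis
  obtain B where B: "\<And>xs ys. \<lbrakk>sorted xs; set xs \<subseteq> {0..S}; sorted ys; set ys \<subseteq> {0..T}\<rbrakk> \<Longrightarrow>
    vitali_sum g xs ys \<le> B" using BV_HK_vitali_bound[OF assms] by blast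
  have B0: "B \<ge> 0" using B[of "[]" "[]"] by (simp add: vitali_sum_def)
  have W0: "W S \<ge> W 0" "Z T \<ge> Z 0" using assms by (auto intro!: mono_onD[OF WZ(1)] mono_onD[OF WZ(2)])
  define K where "K = 4 * (C + (W S - W 0) + (Z T - Z 0) + B)"
  have "\<bar>RS_sum g x m s \<xi> n t \<eta>\<bar> \<le> K * E"
    if f: "fine_tags S \<delta> m s \<xi>" "fine_tags T \<delta> n t \<eta>" and E: "\<And>p. p \<in> Q S T \<Longrightarrow> \<bar>x p\<bar> \<le> E" for m s \<xi> n t \<eta> x E \<delta>
  proof -
    note r = fine_tags_range[OF f(1)] and r' = fine_tags_range[OF f(2)]
    have "m \<noteq> 0" "n \<noteq> 0" using r(6,7) r'(6,7) assms by (auto intro: gr0I)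
    then obtain m' n' where [simp]: "m = Suc m'" "n = Suc n'" using not0_implies_Suc by metis
    have E0: "E \<ge> 0" using E[of "(0,0)"] assms by (auto simp: Q_def intro: order_trans[OF abs_ge_zero])
    \<comment> \<open>Subtracting the values on the axes leaves all rectangle increments unchanged
      and makes \<open>y\<close> vanish for \<open>i = 0\<close> and for \<open>j = 0\<close>. The
      four terms account for the factor 4.\<close>
    define y where "y i j = x (s i, t j) - x (s i, t 0) - x (s 0, t j) + x (s 0, t 0)" for i j
    have eq: "RS_sum g x m s \<xi> n t \<eta> = (\<Sum>i<Suc m'. \<Sum>j<Suc n'. g (\<xi> i, \<eta> j) * (y (Suc i) (Suc j) - y i (Suc j) - y (Suc i) j + y i j))"
      unfolding RS_sum_def rect_increment_def y_def by (intro sum.cong arg_cong2[where f=times]) auto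
    have "\<bar>RS_sum g x m s \<xi> n t \<eta>\<bar> \<le> 4 * E * (\<bar>g (\<xi> m', \<eta> n')\<bar> + (\<Sum>i<m'. \<bar>g (\<xi> i, \<eta> n') - g (\<xi> (Suc i), \<eta> n')\<bar>) +
        (\<Sum>j<n'. \<bar>g (\<xi> m', \<eta> j) - g (\<xi> m', \<eta> (Suc j))\<bar>) +
      (\<Sum>j<n'. \<Sum>i<m'. \<bar>g (\<xi> i, \<eta> j) - g (\<xi> i, \<eta> (Suc j)) - (g (\<xi> (Suc i), \<eta> j) - g (\<xi> (Suc i), \<eta> (Suc j)))\<bar>))"
      unfolding eq
    proof (rule abel_summation_2d_bound[where a = "\<lambda>i j. g (\<xi> i, \<eta> j)" and y = y and E = "4 * E" and m = m' and n = n'])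
      fix i j assume ij: "i \<le> Suc m'" "j \<le> Suc n'"
      have "s i \<in> {0..S}" "s 0 \<in> {0..S}" "t j \<in> {0..T}" "t 0 \<in> {0..T}"
        using ij r(1)[of i] r(1)[of 0] r'(1)[of j] r'(1)[of 0] by auto
      then have "\<bar>x (s i, t j)\<bar> \<le> E" "\<bar>x (s i, t 0)\<bar> \<le> E" "\<bar>x (s 0, t j)\<bar> \<le> E" "\<bar>x (s 0, t 0)\<bar> \<le> E"
        by (auto intro!: E simp: Q_def)
      then show "\<bar>y i j\<bar> \<le> 4 * E" unfolding y_def by linarith
    qed (auto simp: y_def)
    also have "\<dots> \<le> 4 * E * (C + (W S - W 0) + (Z T - Z 0) + B)"
    proof (intro mult_left_mono add_mono)
      show "\<bar>g (\<xi> m', \<eta> n')\<bar> \<le> C" using r(2)[of m'] r'(2)[of n'] by (intro C) (auto simp: Q_def)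
      have "(\<Sum>i<m'. \<bar>g (\<xi> i, \<eta> n') - g (\<xi> (Suc i), \<eta> n')\<bar>) \<le> (\<Sum>i<m'. \<bar>W (\<xi> i) - W (\<xi> (Suc i))\<bar>)"
      proof (rule sum_mono)
        fix i assume "i \<in> {..<m'}"
        then show "\<bar>g (\<xi> i, \<eta> n') - g (\<xi> (Suc i), \<eta> n')\<bar> \<le> \<bar>W (\<xi> i) - W (\<xi> (Suc i))\<bar>"
          using WZ(3)[OF r(2)[of i] r(2)[of "Suc i"] r'(2)[of n'] r'(2)[of n']] by auto
      qed
      also have "\<dots> \<le> W S - W 0" using f by (intro mono_chain_sum_le[OF WZ(1)]) auto
      finally show "(\<Sum>i<m'. \<bar>g (\<xi> i, \<eta> n') - g (\<xi> (Suc i), \<eta> n')\<bar>) \<le> W S - W 0" .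
      have "(\<Sum>j<n'. \<bar>g (\<xi> m', \<eta> j) - g (\<xi> m', \<eta> (Suc j))\<bar>) \<le> (\<Sum>j<n'. \<bar>Z (\<eta> j) - Z (\<eta> (Suc j))\<bar>)"
      proof (rule sum_mono)
        fix j assume "j \<in> {..<n'}"
        then show "\<bar>g (\<xi> m', \<eta> j) - g (\<xi> m', \<eta> (Suc j))\<bar> \<le> \<bar>Z (\<eta> j) - Z (\<eta> (Suc j))\<bar>"
          using WZ(3)[OF r(2)[of m'] r(2)[of m'] r'(2)[of j] r'(2)[of "Suc j"]] by auto
      qed
      also have "\<dots> \<le> Z T - Z 0" using f by (intro mono_chain_sum_le[OF WZ(2)]) auto
      finally show "(\<Sum>j<n'. \<bar>g (\<xi> m', \<eta> j) - g (\<xi> m', \<eta> (Suc j))\<bar>) \<le> Z T - Z 0" .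
      have "(\<Sum>j<n'. \<Sum>i<m'. \<bar>g (\<xi> i, \<eta> j) - g (\<xi> i, \<eta> (Suc j)) - (g (\<xi> (Suc i), \<eta> j) - g (\<xi> (Suc i), \<eta> (Suc j)))\<bar>)
         = (\<Sum>i<m'. \<Sum>j<n'. \<bar>rect_increment g (\<xi> i) (\<xi> (Suc i)) (\<eta> j) (\<eta> (Suc j))\<bar>)"
        by (subst sum.swap, intro sum.cong refl) (simp add: rect_increment_def algebra_simps)
      \<comment> \<open>The grid consists of the tags. Neighbouring tags may coincide, which lists
        allow and strict subdivisions do not.\<close>
      also have "\<dots> = vitali_sum g (map \<xi> [0..<m]) (map \<eta> [0..<n])"
        unfolding vitali_sum_def chain_sum_nth by (auto intro!: sum.cong simp del: upt_Suc)
      also have "\<dots> \<le> B"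
      proof (rule B)
        show "sorted (map \<xi> [0..<m])" "sorted (map \<eta> [0..<n])"
          unfolding sorted_iff_nth_Suc using r(8) r'(8) by (auto simp del: upt_Suc)
        show "set (map \<xi> [0..<m]) \<subseteq> {0..S}" "set (map \<eta> [0..<n]) \<subseteq> {0..T}"
          using r(2) r'(2) by auto
      qed
      finally show "(\<Sum>j<n'. \<Sum>i<m'. \<bar>g (\<xi> i, \<eta> j) - g (\<xi> i, \<eta> (Suc j)) - (g (\<xi> (Suc i), \<eta> j) - g (\<xi> (Suc i), \<eta> (Suc j)))\<bar>) \<le> B" .
    qed (use E0 in auto)
    also have "\<dots> = K * E" by (simp add: K_def)
    finally show ?thesis .
  qed
  moreover have "K \<ge> 0" using C(1) W0 B0 by (simp add: K_def)
  ultimately show ?thesis using that by blast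
qed

section \<open>Increments of monomials and Riemann sums over half-open cells\<close>

definition cell :: "real \<Rightarrow> real \<Rightarrow> real \<Rightarrow> real \<Rightarrow> (real \<times> real) set" where
  "cell a b c d = {a<..b} \<times> {c<..d}"

lemma cell_sets [measurable]: "cell a b c d \<in> sets borel"
  unfolding cell_def by (simp add: borel_Times)

lemma borel_measurable_Leb: "f \<in> borel_measurable borel \<Longrightarrow> f \<in> borel_measurable (Leb S T)"
  by (intro measurable_restrict_space1 measurable_completion) simp

lemma integral_Leb_lborel:
  fixes f :: "real \<times> real \<Rightarrow> real"
  assumes [measurable]: "f \<in> borel_measurable borel"
  shows "(LINT p|Leb S T. f p) = (LINT p|lborel. indicator (Q S T) p * f p)"
proof -
  have [measurable]: "Q S T \<in> sets borel" unfolding Q_cbox by simp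
  have "(LINT p|Leb S T. f p) = (LINT p|lebesgue. indicator (Q S T) p *\<^sub>R f p)"
    by (rule integral_restrict_space) (simp add: sets_completionI_sets)
  also have "\<dots> = (LINT p|lborel. indicator (Q S T) p *\<^sub>R f p)"
    by (rule integral_completion) simp
  finally show ?thesis by simp
qed

lemma integral_cell_product:
  fixes u v :: "real \<Rightarrow> real"
  assumes ord: "0 \<le> a" "a \<le> b" "b \<le> S" "0 \<le> c" "c \<le> d" "d \<le> T"
    and u: "continuous_on UNIV u" and v: "continuous_on UNIV v"
  shows "(LINT p|Leb S T. indicator (cell a b c d) p * (u (fst p) * v (snd p))) =
     (LINT x|lborel. indicator {a<..b} x * u x) * (LINT y|lborel. indicator {c<..d} y * v y)"
proof -
  have [measurable]: "u \<in> borel_measurable borel" "v \<in> borel_measurable borel"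
    using u v by (auto intro: borel_measurable_continuous_onI)
  have int: "integrable lborel (\<lambda>x. indicator {a<..b} x * u x)" if "continuous_on UNIV u" for u :: "real \<Rightarrow> real" and a b
  proof -
    have [measurable]: "u \<in> borel_measurable borel" using that by (auto intro: borel_measurable_continuous_onI)
    have "integrable lborel (\<lambda>x. indicator {a..b} x *\<^sub>R u x)"
      by (intro borel_integrable_compact continuous_on_subset[OF that]) auto
    then show ?thesis by (rule Bochner_Integration.integrable_bound) (auto simp: indicator_def)
  qed
  have i: "integrable (lborel \<Otimes>\<^sub>M lborel) (\<lambda>(x, y). (indicator {a<..b} x * u x) * (indicator {c<..d} y * v y))"
  proof (rule lborel_pair.Fubini_integrable)
    have "integrable lborel (\<lambda>x. \<bar>indicator {a<..b} x * u x\<bar> * (LINT y|lborel. \<bar>indicator {c<..d} y * v y\<bar>))"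
      by (intro integrable_mult_left integrable_abs int u)
    then show "integrable lborel (\<lambda>x. LINT y|lborel. norm (case (x, y) of (x, y) \<Rightarrow> (indicator {a<..b} x * u x) * (indicator {c<..d} y * v y)))"
      by (simp add: abs_mult)
    show "AE x in lborel. integrable lborel (\<lambda>y. case (x, y) of (x, y) \<Rightarrow> (indicator {a<..b} x * u x) * (indicator {c<..d} y * v y))"
      using int[OF v, of c d] by simp
  qed simp
  have "(LINT p|Leb S T. indicator (cell a b c d) p * (u (fst p) * v (snd p))) =
      (LINT p|lborel. indicator (Q S T) p * (indicator (cell a b c d) p * (u (fst p) * v (snd p))))"
    by (rule integral_Leb_lborel) (simp add: borel_prod[symmetric] cell_def)
  also have "\<dots> = (LINT p|(lborel \<Otimes>\<^sub>M lborel). (case p of (x, y) \<Rightarrow> (indicator {a<..b} x * u x) * (indicator {c<..d} y * v y)))"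
    unfolding lborel_prod
  proof (intro Bochner_Integration.integral_cong refl)
    fix p :: "real \<times> real"
    obtain x y where [simp]: "p = (x, y)" by (cases p)
    have "indicator (Q S T) p * indicator (cell a b c d) p = (indicator (cell a b c d) p :: real)"
      using ord by (auto simp: Q_def cell_def indicator_def)
    moreover have "indicator (cell a b c d) p = (indicator {a<..b} x * indicator {c<..d} y :: real)"
      by (simp add: cell_def indicator_times)
    ultimately show "indicator (Q S T) p * (indicator (cell a b c d) p * (u (fst p) * v (snd p))) =
        (case p of (x, y) \<Rightarrow> (indicator {a<..b} x * u x) * (indicator {c<..d} y * v y))"
      by (simp add: mult.assoc[symmetric]) (simp add: ac_simps)
  qed
  also have "\<dots> = (LINT x|lborel. LINT y|lborel. (indicator {a<..b} x * u x) * (indicator {c<..d} y * v y))"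
    using lborel_pair.integral_fst'[OF i] by simp
  finally show ?thesis by simp
qed

text \<open>For \<open>k = 0\<close> the factor \<open>real k\<close> kills the integrand, so the
  truncated exponent \<open>k - 1\<close> does no harm and both sides are 0.\<close>

lemma integral_Ioc_power:
  fixes a b :: real assumes "a \<le> b"
  shows "(LINT x|lborel. indicator {a<..b} x * (real k * x ^ (k - 1))) = b ^ k - a ^ k"
proof -
  have "(LINT x|lborel. indicator {a<..b} x * (real k * x ^ (k - 1))) =
      (LINT x|lborel. indicator {a..b} x *\<^sub>R (real k * x ^ (k - 1)))"
  proof (rule integral_cong_AE)
    show "AE x in lborel. indicator {a<..b} x * (real k * x ^ (k - 1)) = indicator {a..b} x *\<^sub>R (real k * x ^ (k - 1))"
      using AE_lborel_singleton[of a] by eventually_elim (auto simp: indicator_def)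
  qed auto
  also have "\<dots> = b ^ k - a ^ k"
  proof (rule integral_FTC_Icc[OF assms])
    show "((\<lambda>x. x ^ k) has_vector_derivative real k * x ^ (k - 1)) (at x within {a..b})" for x :: real
      unfolding has_real_derivative_iff_has_vector_derivative[symmetric] by (auto intro!: derivative_eq_intros)
  qed (intro continuous_intros)
  finally show ?thesis .
qed

text \<open>The increment is the integral of the mixed derivative over the cell. Stieltjes sums
  against a monomial thereby become Riemann sums with a bounded weight.\<close>

lemma rect_increment_monomial:
  assumes "0 \<le> a" "a \<le> b" "b \<le> S" "0 \<le> c" "c \<le> d" "d \<le> T"
  shows "rect_increment (\<lambda>p. fst p ^ k * snd p ^ l) a b c d =
     (LINT p|Leb S T. indicator (cell a b c d) p * ((real k * fst p ^ (k - 1)) * (real l * snd p ^ (l - 1))))"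
proof -
  have "(LINT p|Leb S T. indicator (cell a b c d) p * ((real k * fst p ^ (k - 1)) * (real l * snd p ^ (l - 1)))) =
      (b ^ k - a ^ k) * (d ^ l - c ^ l)"
    unfolding integral_Ioc_power[OF assms(2), symmetric] integral_Ioc_power[OF assms(5), symmetric]
    by (rule integral_cell_product[OF assms]) (intro continuous_intros)+
  then show ?thesis by (simp add: rect_increment_def algebra_simps)
qed

lemma measure_cell:
  assumes "0 \<le> a" "a \<le> b" "b \<le> S" "0 \<le> c" "c \<le> d" "d \<le> T"
  shows "(LINT p|Leb S T. indicator (cell a b c d) p) = (b - a) * (d - c)"
  using rect_increment_monomial[OF assms, of 1 1] by (simp add: rect_increment_def left_diff_distrib right_diff_distrib)



lemma sum_indicator_Ioc:
  fixes s :: "nat \<Rightarrow> real"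
  assumes "\<And>i. i < m \<Longrightarrow> s i \<le> s (Suc i)"
  shows "s 0 \<le> s m \<and> (\<Sum>i<m. indicator {s i<..s (Suc i)} x) = (indicator {s 0<..s m} x :: real)"
  using assms
proof (induction m)
  case (Suc m)
  have IH: "s 0 \<le> s m" "(\<Sum>i<m. indicator {s i<..s (Suc i)} x) = (indicator {s 0<..s m} x :: real)"
    using Suc.IH Suc.prems by auto
  have "s m \<le> s (Suc m)" using Suc.prems by simp
  then show ?case using IH by (auto simp: indicator_def)
qed simp

text \<open>The half-open cells of a grid are disjoint but miss the two axes; this is the null set
  lost.\<close>

lemma AE_Leb_pos: "AE p in Leb S T. fst p > 0 \<and> snd p > 0"
proof -
  have 1: "AE p in lebesgue. p \<notin> {0 :: real} \<times> (UNIV :: real set)" "AE p in lebesgue. p \<notin> (UNIV :: real set) \<times> {0 :: real}"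
    using AE_completion[OF AE_not_in[OF null_lines(1)[of "{0}"]]] AE_completion[OF AE_not_in[OF null_lines(2)[of "{0}"]]]
    by simp_all
  have "Q S T \<in> sets lebesgue" unfolding Q_cbox by simp
  moreover have "AE p in lebesgue. p \<in> Q S T \<longrightarrow> fst p > 0 \<and> snd p > 0"
    using 1 by eventually_elim (auto simp: Q_def less_le)
  ultimately show ?thesis by (subst AE_restrict_space_iff) auto
qed

lemma integrable_Leb_bounded:
  fixes f :: "real \<times> real \<Rightarrow> real"
  assumes "f \<in> borel_measurable (Leb S T)" "\<And>p. p \<in> Q S T \<Longrightarrow> \<bar>f p\<bar> \<le> C"
  shows "integrable (Leb S T) f"
  by (rule finite_measure.integrable_const_bound[OF finite_measure_Leb, where B = C]) (use assms in auto)

text \<open>An error linear in the mesh, for every choice of grid tags. Summed over the cells, the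
  increments of \<open>W\<close> telescope to \<open>W S - W 0\<close> and the side lengths in the
  other direction to \<open>T\<close>, while the remaining side length supplies
  \<open>\<delta>\<close>; likewise for \<open>Z\<close>.\<close>

lemma osc_bounded_riemann:
  assumes "S > 0" "T > 0" "osc_bounded S T g"
    and w [measurable]: "w \<in> borel_measurable (Leb S T)" and M: "\<And>p. p \<in> Q S T \<Longrightarrow> \<bar>w p\<bar> \<le> M"
  obtains K where "K \<ge> 0" "\<And>m s \<xi> n t \<eta> \<delta>. \<lbrakk>fine_tags S \<delta> m s \<xi>; fine_tags T \<delta> n t \<eta>\<rbrakk> \<Longrightarrow>
    \<bar>(\<Sum>i<m. \<Sum>j<n. g (\<xi> i, \<eta> j) * (LINT p|Leb S T. indicator (cell (s i) (s (Suc i)) (t j) (t (Suc j))) p * w p))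
      - (LINT p|Leb S T. g p * w p)\<bar> \<le> K * \<delta>"
proof -
  have g [measurable]: "g \<in> borel_measurable (Leb S T)" by (rule osc_bounded_measurable[OF assms(1-3)])
  obtain C where C: "C \<ge> 0" "\<And>p. p \<in> Q S T \<Longrightarrow> \<bar>g p\<bar> \<le> C" using osc_bounded_bound[OF assms(1-3)] by blast
  obtain W Z where WZ: "mono_on {0..S} W" "mono_on {0..T} Z"
    "\<And>s s' t t'. \<lbrakk>s\<in>{0..S}; s'\<in>{0..S}; t\<in>{0..T}; t'\<in>{0..T}\<rbrakk> \<Longrightarrow>
        \<bar>g (s, t) - g (s', t')\<bar> \<le> \<bar>W s - W s'\<bar> + \<bar>Z t - Z t'\<bar>"
    using assms(3) unfolding osc_bounded_def by metis
  have M0: "M \<ge> 0"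
  proof -
    have "\<bar>w (0, 0)\<bar> \<le> M" using assms(1,2) by (intro M) (auto simp: Q_def)
    then show ?thesis by linarith
  qed
  have W0: "W S \<ge> W 0" "Z T \<ge> Z 0" using assms by (auto intro!: mono_onD[OF WZ(1)] mono_onD[OF WZ(2)])
  define K where "K = M * (T * (W S - W 0) + S * (Z T - Z 0))"
  have "K \<ge> 0" unfolding K_def using M0 W0 assms by auto
  moreover have "\<bar>(\<Sum>i<m. \<Sum>j<n. g (\<xi> i, \<eta> j) * (LINT p|Leb S T. indicator (cell (s i) (s (Suc i)) (t j) (t (Suc j))) p * w p))
      - (LINT p|Leb S T. g p * w p)\<bar> \<le> K * \<delta>"
    if f: "fine_tags S \<delta> m s \<xi>" "fine_tags T \<delta> n t \<eta>" for m s \<xi> n t \<eta> \<delta>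
  proof -
    note r = fine_tags_range[OF f(1)] and r' = fine_tags_range[OF f(2)]
    have fine: "\<And>i. i < m \<Longrightarrow> s (Suc i) - s i < \<delta>" "\<And>j. j < n \<Longrightarrow> t (Suc j) - t j < \<delta>"
      using f unfolding fine_tags_def by auto
    define c where "c i j = cell (s i) (s (Suc i)) (t j) (t (Suc j))" for i j
    have c [measurable]: "indicator (c i j) \<in> borel_measurable (Leb S T)" for i j
      unfolding c_def by (rule borel_measurable_Leb) (rule borel_measurable_indicator, rule cell_sets)
    have int_gw: "integrable (Leb S T) (\<lambda>p. indicator (c i j) p * (g p * w p))" for i j
      by (rule integrable_Leb_bounded[where C = "C * M"], intro borel_measurable_times c g w)
        (auto simp: abs_mult indicator_def M0 C(1) intro!: mult_mono C M)
    have int_w: "integrable (Leb S T) (\<lambda>p. indicator (c i j) p * w p)" for i j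
      by (rule integrable_Leb_bounded[where C = M], intro borel_measurable_times c w) (auto simp: abs_mult indicator_def M0 intro!: M)
    have int_c: "integrable (Leb S T) (\<lambda>p. indicator (c i j) p * (x::real))" for i j x
      by (rule integrable_Leb_bounded[where C = "\<bar>x\<bar>"], intro borel_measurable_times c borel_measurable_const) (auto simp: abs_mult indicator_def)
    have cover: "(\<Sum>i<m. \<Sum>j<n. indicator (c i j) p) = (1 :: real)"
      if "p \<in> Q S T" "fst p > 0 \<and> snd p > 0" for p
    proof -
      have "(\<Sum>i<m. \<Sum>j<n. indicator (c i j) p) =
          (\<Sum>i<m. \<Sum>j<n. indicator {s i<..s (Suc i)} (fst p) * (indicator {t j<..t (Suc j)} (snd p) :: real))"
        unfolding c_def cell_def by (cases p) (simp add: indicator_times)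
      also have "\<dots> = (\<Sum>i<m. indicator {s i<..s (Suc i)} (fst p)) * (\<Sum>j<n. indicator {t j<..t (Suc j)} (snd p))"
        by (simp add: sum_product)
      also have "\<dots> = 1"
        using sum_indicator_Ioc[of m s "fst p"] sum_indicator_Ioc[of n t "snd p"] r(3,6,7) r'(3,6,7) that
        by (auto simp: Q_def)
      finally show ?thesis .
    qed
    have "(LINT p|Leb S T. g p * w p) = (LINT p|Leb S T. (\<Sum>i<m. \<Sum>j<n. indicator (c i j) p * (g p * w p)))"
    proof (rule integral_cong_AE)
      show "AE p in Leb S T. g p * w p = (\<Sum>i<m. \<Sum>j<n. indicator (c i j) p * (g p * w p))"
        using AE_Leb_pos AE_space
      proof eventually_elim
        case (elim p)
        then have "(\<Sum>i<m. \<Sum>j<n. indicator (c i j) p * (g p * w p)) = 1 * (g p * w p)"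
          unfolding sum_distrib_right[symmetric] by (subst cover) auto
        then show ?case by simp
      qed
    qed measurable
    also have "\<dots> = (\<Sum>i<m. \<Sum>j<n. LINT p|Leb S T. indicator (c i j) p * (g p * w p))"
      by (simp only: Bochner_Integration.integral_sum Bochner_Integration.integrable_sum int_gw)
    finally have 1: "(LINT p|Leb S T. g p * w p) = (\<Sum>i<m. \<Sum>j<n. LINT p|Leb S T. indicator (c i j) p * (g p * w p))" .
    \<comment> \<open>On a cell, \<open>g\<close> differs from its value at the tag by at most the
      increments of \<open>W\<close> and \<open>Z\<close>. In each of the two terms one side length
      is replaced by \<open>\<delta>\<close>, the other is kept for the summation.\<close>
    have cell_bound: "\<bar>g (\<xi> i, \<eta> j) * (LINT p|Leb S T. indicator (c i j) p * w p) -
         (LINT p|Leb S T. indicator (c i j) p * (g p * w p))\<bar>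
       \<le> M * ((W (s (Suc i)) - W (s i)) * (t (Suc j) - t j) + (Z (t (Suc j)) - Z (t j)) * (s (Suc i) - s i)) * \<delta>"
      if ij: "i < m" "j < n" for i j
    proof -
      let ?D = "(W (s (Suc i)) - W (s i)) + (Z (t (Suc j)) - Z (t j))"
      have si: "s i \<in> {0..S}" "s (Suc i) \<in> {0..S}" "t j \<in> {0..T}" "t (Suc j) \<in> {0..T}"
        "s i \<le> s (Suc i)" "t j \<le> t (Suc j)"
        using ij r(1)[of i] r(1)[of "Suc i"] r'(1)[of j] r'(1)[of "Suc j"] r(3)[of i] r'(3)[of j] by auto
      have D: "W (s (Suc i)) \<ge> W (s i)" "Z (t (Suc j)) \<ge> Z (t j)"
        using si by (auto intro: mono_onD[OF WZ(1)] mono_onD[OF WZ(2)])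
      have "g (\<xi> i, \<eta> j) * (LINT p|Leb S T. indicator (c i j) p * w p) -
         (LINT p|Leb S T. indicator (c i j) p * (g p * w p)) =
         (LINT p|Leb S T. indicator (c i j) p * ((g (\<xi> i, \<eta> j) - g p) * w p))"
        unfolding integral_mult_right_zero[symmetric]
        by (subst Bochner_Integration.integral_diff[symmetric, OF integrable_mult_right[OF int_w] int_gw])
          (intro Bochner_Integration.integral_cong refl, algebra)
      then have "\<bar>g (\<xi> i, \<eta> j) * (LINT p|Leb S T. indicator (c i j) p * w p) -
         (LINT p|Leb S T. indicator (c i j) p * (g p * w p))\<bar> \<le>
         (LINT p|Leb S T. \<bar>indicator (c i j) p * ((g (\<xi> i, \<eta> j) - g p) * w p)\<bar>)"
        by (simp only: integral_abs_bound)
      also have "\<dots> \<le> (LINT p|Leb S T. indicator (c i j) p * (?D * M))"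
      proof (rule integral_mono)
        have "integrable (Leb S T) (\<lambda>p. g (\<xi> i, \<eta> j) * (indicator (c i j) p * w p) - indicator (c i j) p * (g p * w p))"
          by (intro Bochner_Integration.integrable_diff integrable_mult_right int_w int_gw)
        then show "integrable (Leb S T) (\<lambda>p. \<bar>indicator (c i j) p * ((g (\<xi> i, \<eta> j) - g p) * w p)\<bar>)"
          by (intro integrable_abs) (simp add: algebra_simps)
        show "integrable (Leb S T) (\<lambda>p. indicator (c i j) p * (?D * M))" by (rule int_c)
        {
          fix p assume p: "p \<in> space (Leb S T)"
          show "\<bar>indicator (c i j) p * ((g (\<xi> i, \<eta> j) - g p) * w p)\<bar> \<le> indicator (c i j) p * (?D * M)"
          proof (cases "p \<in> c i j")
            case True
            obtain x y where [simp]: "p = (x, y)" by (cases p)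
            have xy: "x \<in> {0..S}" "y \<in> {0..T}" "s i \<le> x" "x \<le> s (Suc i)" "t j \<le> y" "y \<le> t (Suc j)"
              using True p by (auto simp: c_def cell_def Q_def)
            have \<xi>: "\<xi> i \<in> {0..S}" "\<eta> j \<in> {0..T}" "s i \<le> \<xi> i" "\<xi> i \<le> s (Suc i)" "t j \<le> \<eta> j" "\<eta> j \<le> t (Suc j)"
              using r(2,4,5)[OF ij(1)] r'(2,4,5)[OF ij(2)] by auto
            have "W (s i) \<le> W x" "W x \<le> W (s (Suc i))" "W (s i) \<le> W (\<xi> i)" "W (\<xi> i) \<le> W (s (Suc i))"
              "Z (t j) \<le> Z y" "Z y \<le> Z (t (Suc j))" "Z (t j) \<le> Z (\<eta> j)" "Z (\<eta> j) \<le> Z (t (Suc j))"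
              using si xy \<xi> by (auto intro: mono_onD[OF WZ(1)] mono_onD[OF WZ(2)])
            then have "\<bar>g (\<xi> i, \<eta> j) - g p\<bar> \<le> ?D"
              using WZ(3)[OF \<xi>(1) xy(1) \<xi>(2) xy(2)] by simp
            then show ?thesis using True p M0 D by (auto simp: abs_mult intro!: mult_mono M)
          qed simp
        }
      qed
      also have "\<dots> = (LINT p|Leb S T. indicator (c i j) p) * (?D * M)" by simp
      also have "\<dots> = (s (Suc i) - s i) * (t (Suc j) - t j) * (?D * M)"
        unfolding c_def using si by (subst measure_cell) auto
      also have "\<dots> = M * ((W (s (Suc i)) - W (s i)) * (t (Suc j) - t j) * (s (Suc i) - s i) +
          (Z (t (Suc j)) - Z (t j)) * (s (Suc i) - s i) * (t (Suc j) - t j))" by algebra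
      also have "\<dots> \<le> M * ((W (s (Suc i)) - W (s i)) * (t (Suc j) - t j) * \<delta> +
          (Z (t (Suc j)) - Z (t j)) * (s (Suc i) - s i) * \<delta>)"
        using D si fine(1)[OF ij(1)] fine(2)[OF ij(2)] M0 by (intro mult_left_mono add_mono) auto
      finally show ?thesis by (simp add: algebra_simps)
    qed
    have tele: "(\<Sum>i<m. s (Suc i) - s i) = S" "(\<Sum>i<m. W (s (Suc i)) - W (s i)) = W S - W 0"
      "(\<Sum>j<n. t (Suc j) - t j) = T" "(\<Sum>j<n. Z (t (Suc j)) - Z (t j)) = Z T - Z 0"
      using sum_lessThan_telescope[of s m] sum_lessThan_telescope[of "\<lambda>i. W (s i)" m]
        sum_lessThan_telescope[of t n] sum_lessThan_telescope[of "\<lambda>i. Z (t i)" n] r(6,7) r'(6,7) by simp_all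
    have "\<bar>(\<Sum>i<m. \<Sum>j<n. g (\<xi> i, \<eta> j) * (LINT p|Leb S T. indicator (c i j) p * w p)) - (LINT p|Leb S T. g p * w p)\<bar>
       = \<bar>\<Sum>i<m. \<Sum>j<n. g (\<xi> i, \<eta> j) * (LINT p|Leb S T. indicator (c i j) p * w p) -
         (LINT p|Leb S T. indicator (c i j) p * (g p * w p))\<bar>"
      unfolding 1 by (simp add: sum_subtractf)
    also have "\<dots> \<le> (\<Sum>i<m. \<Sum>j<n. M * ((W (s (Suc i)) - W (s i)) * (t (Suc j) - t j) + (Z (t (Suc j)) - Z (t j)) * (s (Suc i) - s i)) * \<delta>)"
      by (rule order_trans[OF sum_abs sum_mono], rule order_trans[OF sum_abs sum_mono], rule cell_bound) auto
    also have "\<dots> = M * \<delta> * (\<Sum>i<m. \<Sum>j<n. (W (s (Suc i)) - W (s i)) * (t (Suc j) - t j) + (s (Suc i) - s i) * (Z (t (Suc j)) - Z (t j)))"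
      unfolding sum_distrib_left by (intro sum.cong refl) (simp add: algebra_simps)
    also have "\<dots> = M * \<delta> * ((W S - W 0) * T + S * (Z T - Z 0))"
      by (simp only: sum.distrib sum_product[symmetric] tele)
    finally show ?thesis unfolding K_def c_def by (simp add: mult_ac)
  qed
  ultimately show ?thesis using that by blast
qed

section \<open>Existence of the Riemann--Stieltjes integral for continuous paths\<close>

inductive bipolynomial :: "(real \<times> real \<Rightarrow> real) \<Rightarrow> bool" where
  monomial: "bipolynomial (\<lambda>p. fst p ^ k * snd p ^ l)"
| cmult: "bipolynomial f \<Longrightarrow> bipolynomial (\<lambda>p. c * f p)"
| add: "bipolynomial f \<Longrightarrow> bipolynomial g \<Longrightarrow> bipolynomial (\<lambda>p. f p + g p)"

lemma bipolynomial_monomial_mult: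
  "bipolynomial g \<Longrightarrow> bipolynomial (\<lambda>p. (fst p ^ k * snd p ^ l) * g p)"
proof (induction rule: bipolynomial.induct)
  case (monomial k' l')
  have "(\<lambda>p :: real \<times> real. (fst p ^ k * snd p ^ l) * (fst p ^ k' * snd p ^ l')) = (\<lambda>p. fst p ^ (k + k') * snd p ^ (l + l'))"
    by (simp add: power_add mult_ac)
  then show ?case by (simp only: bipolynomial.monomial)
next
  case (cmult f c)
  then show ?case using bipolynomial.cmult[OF cmult.IH, of c] by (simp add: mult.left_commute)
next
  case (add f g)
  then show ?case using bipolynomial.add[OF add.IH] by (simp add: distrib_left)
qed

lemma bipolynomial_mult:
  assumes "bipolynomial f" "bipolynomial g"
  shows "bipolynomial (\<lambda>p. f p * g p)"
  using assms(1)
proof (induction rule: bipolynomial.induct)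
  case (monomial k l)
  then show ?case by (rule bipolynomial_monomial_mult[OF assms(2)])
next
  case (cmult f c)
  then show ?case using bipolynomial.cmult[OF cmult.IH, of c] by (simp add: mult.assoc)
next
  case (add f h)
  then show ?case using bipolynomial.add[OF add.IH] by (simp add: distrib_right)
qed

text \<open>Stone--Weierstrass supplies \<open>real_polynomial_function\<close>, which is closed
  under products; linearity of the integral reaches only sums of monomials. This bridges the
  two.\<close>

lemma real_polynomial_function_bipolynomial:
  "real_polynomial_function f \<Longrightarrow> bipolynomial f"
proof (induction rule: real_polynomial_function.induct)
  case (linear f)
  then interpret bounded_linear f .
  have "f p = f (1, 0) * (fst p ^ 1 * snd p ^ 0) + f (0, 1) * (fst p ^ 0 * snd p ^ 1)" for p
  proof -
    have "f p = f (fst p *\<^sub>R (1, 0) + snd p *\<^sub>R (0, 1))" by (simp add: scaleR_Pair)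
    also have "\<dots> = fst p *\<^sub>R f (1, 0) + snd p *\<^sub>R f (0, 1)" by (simp only: add scaleR)
    finally show ?thesis by (simp add: mult.commute)
  qed
  then have eq: "f = (\<lambda>p. f (1, 0) * (fst p ^ 1 * snd p ^ 0) + f (0, 1) * (fst p ^ 0 * snd p ^ 1))" by (rule ext)
  show ?case by (subst eq) (intro bipolynomial.add bipolynomial.cmult bipolynomial.monomial)
next
  case (const c)
  have eq: "(\<lambda>p :: real \<times> real. c) = (\<lambda>p. c * (fst p ^ 0 * snd p ^ 0))" by simp
  show ?case by (subst eq) (intro bipolynomial.cmult bipolynomial.monomial)
qed (auto intro: bipolynomial.add bipolynomial_mult)

lemma has_RS_integral_monomial:
  assumes "S > 0" "T > 0" "osc_bounded S T g"
  shows "\<exists>I. has_RS_integral S T g (\<lambda>p. fst p ^ k * snd p ^ l) I"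
proof -
  define w where "w p = (real k * fst p ^ (k - 1)) * (real l * snd p ^ (l - 1))" for p :: "real \<times> real"
  have w: "w \<in> borel_measurable (Leb S T)"
    unfolding w_def by (intro borel_measurable_Leb borel_measurable_continuous_onI continuous_intros)
  have M: "\<bar>w p\<bar> \<le> (real k * S ^ (k - 1)) * (real l * T ^ (l - 1))" if "p \<in> Q S T" for p
    using that assms unfolding w_def abs_mult by (intro mult_mono) (auto simp: Q_def intro!: power_mono)
  obtain K where K: "K \<ge> 0" "\<And>m s \<xi> n t \<eta> \<delta>. \<lbrakk>fine_tags S \<delta> m s \<xi>; fine_tags T \<delta> n t \<eta>\<rbrakk> \<Longrightarrow>
    \<bar>(\<Sum>i<m. \<Sum>j<n. g (\<xi> i, \<eta> j) * (LINT p|Leb S T. indicator (cell (s i) (s (Suc i)) (t j) (t (Suc j))) p * w p))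
      - (LINT p|Leb S T. g p * w p)\<bar> \<le> K * \<delta>"
    using osc_bounded_riemann[OF assms w M] by blast
  have "has_RS_integral S T g (\<lambda>p. fst p ^ k * snd p ^ l) (LINT p|Leb S T. g p * w p)"
    unfolding has_RS_integral_fine_tags
  proof (intro allI impI)
    fix e :: real assume e: "e > 0"
    define \<delta> where "\<delta> = e / (K + 1)"
    have \<delta>: "\<delta> > 0" "K * \<delta> < e" using K(1) e by (auto simp: \<delta>_def field_simps)
    have "\<bar>RS_sum g (\<lambda>p. fst p ^ k * snd p ^ l) m s \<xi> n t \<eta> - (LINT p|Leb S T. g p * w p)\<bar> < e"
      if f: "fine_tags S \<delta> m s \<xi>" "fine_tags T \<delta> n t \<eta>" for m s \<xi> n t \<eta>
    proof -
      note r = fine_tags_range[OF f(1)] and r' = fine_tags_range[OF f(2)]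
      have "RS_sum g (\<lambda>p. fst p ^ k * snd p ^ l) m s \<xi> n t \<eta> =
         (\<Sum>i<m. \<Sum>j<n. g (\<xi> i, \<eta> j) * (LINT p|Leb S T. indicator (cell (s i) (s (Suc i)) (t j) (t (Suc j))) p * w p))"
        unfolding RS_sum_def
      proof (intro sum.cong refl arg_cong2[where f = times])
        fix i j assume "i \<in> {..<m}" "j \<in> {..<n}"
        then show "rect_increment (\<lambda>p. fst p ^ k * snd p ^ l) (s i) (s (Suc i)) (t j) (t (Suc j)) =
            (LINT p|Leb S T. indicator (cell (s i) (s (Suc i)) (t j) (t (Suc j))) p * w p)"
          unfolding w_def using r(1)[of i] r(1)[of "Suc i"] r'(1)[of j] r'(1)[of "Suc j"] r(3)[of i] r'(3)[of j]
          by (intro rect_increment_monomial) auto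
      qed
      then show ?thesis using K(2)[OF f] \<delta> by simp
    qed
    then show "\<exists>\<delta>>0. \<forall>m s \<xi> n t \<eta>. fine_tags S \<delta> m s \<xi> \<and> fine_tags T \<delta> n t \<eta> \<longrightarrow>
      \<bar>RS_sum g (\<lambda>p. fst p ^ k * snd p ^ l) m s \<xi> n t \<eta> - (LINT p|Leb S T. g p * w p)\<bar> < e"
      using \<delta>(1) by blast
  qed
  then show ?thesis by blast
qed

lemma has_RS_integral_bipolynomial:
  assumes "S > 0" "T > 0" "osc_bounded S T g" "bipolynomial f"
  shows "\<exists>I. has_RS_integral S T g f I"
  using assms(4)
proof (induction rule: bipolynomial.induct)
  case (monomial k l)
  then show ?case by (rule has_RS_integral_monomial[OF assms(1-3)])
next
  case (cmult f c)
  then obtain I where "has_RS_integral S T g f I" by blast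
  from has_RS_integral_combine[OF this this, of g "\<lambda>p. c * f p" c 0] show ?case by (auto simp: RS_sum_cmult_right)
next
  case (add f h)
  then obtain I J where "has_RS_integral S T g f I" "has_RS_integral S T g h J" by blast
  from has_RS_integral_combine[OF this, of g "\<lambda>p. f p + h p" 1 1] show ?case by (auto simp: RS_sum_add_right)
qed

text \<open>The path is a uniform limit of polynomials, and replacing it by one of them changes
  every Stieltjes sum by at most a constant times the supremum distance. Uniform grids give a
  candidate \<open>J\<close> by the Cauchy criterion, and the same estimate carries it to all fine
  partitions.\<close>

lemma BV_HK_has_RS_integral:
  assumes "S > 0" "T > 0" "BV_HK S T g" "continuous_on (Q S T) x"
  shows "\<exists>I. has_RS_integral S T g x I"
proof -
  obtain K where K: "K \<ge> 0" "\<And>m s \<xi> n t \<eta> x E \<delta>. \<lbrakk>fine_tags S \<delta> m s \<xi>; fine_tags T \<delta> n t \<eta>; \<And>p. p \<in> Q S T \<Longrightarrow> \<bar>x p\<bar> \<le> E\<rbrakk> \<Longrightarrow>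
    \<bar>RS_sum g x m s \<xi> n t \<eta>\<bar> \<le> K * E" using RS_sum_bound[OF assms(1-3)] by blast
  have cpt: "compact (Q S T)" unfolding Q_cbox by simp
  have "\<exists>f I. (\<forall>p\<in>Q S T. \<bar>x p - f p\<bar> \<le> 1 / real (Suc k)) \<and> has_RS_integral S T g f I" for k
  proof -
    obtain f where f: "real_polynomial_function f" "\<And>p. p \<in> Q S T \<Longrightarrow> \<bar>x p - f p\<bar> < 1 / real (Suc k)"
      using Stone_Weierstrass_real_polynomial_function[OF cpt assms(4), of "1 / real (Suc k)"] by auto
    from has_RS_integral_bipolynomial[OF assms(1,2) BV_HK_osc_bounded[OF assms(1-3)] real_polynomial_function_bipolynomial[OF f(1)]]
    show ?thesis using f(2) by (meson less_imp_le)
  qed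
  then obtain f I where f: "\<And>k p. p \<in> Q S T \<Longrightarrow> \<bar>x p - f k p\<bar> \<le> 1 / real (Suc k)"
    and I: "\<And>k. has_RS_integral S T g (f k) (I k)" by metis
  have close: "\<bar>RS_sum g x m s \<xi> n t \<eta> - RS_sum g (f k) m s \<xi> n t \<eta>\<bar> \<le> K * (1 / real (Suc k))"
    if "fine_tags S \<delta> m s \<xi>" "fine_tags T \<delta> n t \<eta>" for m s \<xi> n t \<eta> \<delta> k
  proof -
    have "RS_sum g x m s \<xi> n t \<eta> - RS_sum g (f k) m s \<xi> n t \<eta> = RS_sum g (\<lambda>p. x p + (-1) * f k p) m s \<xi> n t \<eta>"
      unfolding RS_sum_add_right RS_sum_cmult_right by simp
    then show ?thesis using K(2)[OF that, of "\<lambda>p. x p + (-1) * f k p" "1 / real (Suc k)"] f by simp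
  qed
  have lim0: "(\<lambda>k. K * (1 / real (Suc k))) \<longlonglongrightarrow> 0"
    using tendsto_mult_right_zero[OF LIMSEQ_inverse_real_of_nat, of K] by (simp add: divide_inverse)
  have grid: "\<bar>unif_RS_sum S T g x n - unif_RS_sum S T g (f k) n\<bar> \<le> K * (1 / real (Suc k))" for k n
  proof -
    \<comment> \<open>The estimate \<open>close\<close> holds for any mesh, so a bound exceeding
      every cell length of both grids will do.\<close>
    define \<delta> where "\<delta> = max S T + 1"
    have "S / real (Suc n) \<le> S / 1" "T / real (Suc n) \<le> T / 1"
      using assms(1,2) by (intro divide_left_mono; simp)+
    then have "S / real (Suc n) < \<delta>" "T / real (Suc n) < \<delta>"
      unfolding \<delta>_def by linarith+
    then show ?thesis unfolding unif_RS_sum_def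
      by (intro close[where \<delta> = \<delta>] fine_tags_unif_grid assms(1,2))
  qed
  have "Cauchy (unif_RS_sum S T g x)"
  proof (rule metric_CauchyI)
    fix e :: real assume "e > 0"
    then have "eventually (\<lambda>k. K * (1 / real (Suc k)) < e / 4) sequentially"
      using order_tendstoD(2)[OF lim0, of "e / 4"] by simp
    then obtain k where k: "K * (1 / real (Suc k)) < e / 4" by (meson eventually_sequentially order_refl)
    have "Cauchy (unif_RS_sum S T g (f k))"
      using unif_RS_sum_LIMSEQ[OF assms(1,2) I] by (rule LIMSEQ_imp_Cauchy)
    then obtain N where N: "\<And>m n. m \<ge> N \<Longrightarrow> n \<ge> N \<Longrightarrow> dist (unif_RS_sum S T g (f k) m) (unif_RS_sum S T g (f k) n) < e / 4"
      using \<open>e > 0\<close> by (meson metric_CauchyD zero_less_divide_iff zero_less_numeral)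
    have "dist (unif_RS_sum S T g x m) (unif_RS_sum S T g x n) < e" if "m \<ge> N" "n \<ge> N" for m n
      using grid[of m k] grid[of n k] N[OF that] k unfolding dist_real_def by linarith
    then show "\<exists>N. \<forall>m\<ge>N. \<forall>n\<ge>N. dist (unif_RS_sum S T g x m) (unif_RS_sum S T g x n) < e" by blast
  qed
  then obtain J where J: "unif_RS_sum S T g x \<longlonglongrightarrow> J" by (auto simp: Cauchy_convergent_iff convergent_def)
  have IJ: "\<bar>I k - J\<bar> \<le> K * (1 / real (Suc k))" for k
  proof -
    have "(\<lambda>n. \<bar>unif_RS_sum S T g x n - unif_RS_sum S T g (f k) n\<bar>) \<longlonglongrightarrow> \<bar>J - I k\<bar>"
      by (intro tendsto_intros J unif_RS_sum_LIMSEQ assms(1,2) I)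
    from tendsto_upperbound[OF this, of "K * (1 / real (Suc k))"] grid show ?thesis
      by (simp add: abs_minus_commute)
  qed
  have "has_RS_integral S T g x J"
    unfolding has_RS_integral_fine_tags
  proof (intro allI impI)
    fix e :: real assume "e > 0"
    then have "eventually (\<lambda>k. K * (1 / real (Suc k)) < e / 3) sequentially"
      using order_tendstoD(2)[OF lim0, of "e / 3"] by simp
    then obtain k where k: "K * (1 / real (Suc k)) < e / 3" by (meson eventually_sequentially order_refl)
    have e3: "e / 3 > 0" using \<open>e > 0\<close> by simp
    obtain \<delta> where \<delta>: "\<delta> > 0" "\<And>m s \<xi> n t \<eta>. fine_tags S \<delta> m s \<xi> \<Longrightarrow> fine_tags T \<delta> n t \<eta> \<Longrightarrow>
      \<bar>RS_sum g (f k) m s \<xi> n t \<eta> - I k\<bar> < e / 3" using has_RS_integralD[OF I e3] by metis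
    have "\<bar>RS_sum g x m s \<xi> n t \<eta> - J\<bar> < e" if "fine_tags S \<delta> m s \<xi>" "fine_tags T \<delta> n t \<eta>" for m s \<xi> n t \<eta>
      using close[OF that, of k] \<delta>(2)[OF that] IJ[of k] k by linarith
    then show "\<exists>\<delta>>0. \<forall>m s \<xi> n t \<eta>. fine_tags S \<delta> m s \<xi> \<and> fine_tags T \<delta> n t \<eta> \<longrightarrow> \<bar>RS_sum g x m s \<xi> n t \<eta> - J\<bar> < e"
      using \<delta>(1) by blast
  qed
  then show ?thesis by blast
qed


section \<open>Complex measures and densities\<close>


definition signed_sigma_additive :: "'a measure \<Rightarrow> ('a set \<Rightarrow> real) \<Rightarrow> bool" where
  "signed_sigma_additive M \<nu> \<longleftrightarrow> (\<forall>A :: nat \<Rightarrow> 'a set. range A \<subseteq> sets M \<and> disjoint_family A \<longrightarrow>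
     (\<lambda>n. \<nu> (A n)) sums \<nu> (\<Union>n. A n))"

lemma signed_sigma_additiveD:
  assumes "signed_sigma_additive M \<nu>" "range A \<subseteq> sets M" "disjoint_family (A :: nat \<Rightarrow> 'a set)"
  shows "(\<lambda>n. \<nu> (A n)) sums \<nu> (\<Union>n. A n)"
  using assms unfolding signed_sigma_additive_def by blast

lemma signed_sigma_additive_minus:
  "signed_sigma_additive M \<nu> \<Longrightarrow> signed_sigma_additive M (\<lambda>A. - \<nu> A)"
  unfolding signed_sigma_additive_def by (auto intro: sums_minus)

lemma signed_empty:
  assumes "signed_sigma_additive M \<nu>"
  shows "\<nu> {} = 0"
proof -
  have "(\<lambda>n :: nat. \<nu> {}) sums \<nu> (\<Union>n :: nat. {})"
    by (rule signed_sigma_additiveD[OF assms]) (auto simp: disjoint_family_on_def)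
  then have "summable (\<lambda>n :: nat. \<nu> {})" by (rule sums_summable)
  then show ?thesis by (simp add: summable_const_iff)
qed

lemma signed_Un:
  assumes \<nu>: "signed_sigma_additive M \<nu>" and "A \<in> sets M" "B \<in> sets M" "A \<inter> B = {}"
  shows "\<nu> (A \<union> B) = \<nu> A + \<nu> B"
proof -
  have "(\<lambda>n. \<nu> (binaryset A B n)) sums \<nu> (\<Union>n. binaryset A B n)"
  proof (rule signed_sigma_additiveD[OF \<nu>])
    show "range (binaryset A B) \<subseteq> sets M" using assms by (simp add: range_binaryset_eq)
    show "disjoint_family (binaryset A B)"
      using assms(4) by (auto simp: disjoint_family_on_def binaryset_def)
  qed
  moreover have "(\<lambda>n. \<nu> (binaryset A B n)) sums (\<nu> A + \<nu> B)"
    by (rule binaryset_sums[of \<nu>, OF signed_empty[OF \<nu>]])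
  ultimately show ?thesis using sums_unique2 by (fastforce simp: UN_binaryset_eq)
qed

lemma signed_Diff:
  assumes "signed_sigma_additive M \<nu>" "A \<in> sets M" "B \<in> sets M" "B \<subseteq> A"
  shows "\<nu> (A - B) = \<nu> A - \<nu> B"
proof -
  have "A - B \<union> B = A" using assms(4) by blast
  moreover have "\<nu> (A - B \<union> B) = \<nu> (A - B) + \<nu> B"
    by (rule signed_Un[OF assms(1)]) (use assms in auto)
  ultimately show ?thesis by simp
qed

definition upper_var :: "'a measure \<Rightarrow> ('a set \<Rightarrow> real) \<Rightarrow> 'a set \<Rightarrow> ennreal" where
  "upper_var M \<nu> A = (SUP B\<in>{B \<in> sets M. B \<subseteq> A}. ennreal (\<nu> B))"

lemma upper_var_upper: "B \<in> sets M \<Longrightarrow> B \<subseteq> A \<Longrightarrow> ennreal (\<nu> B) \<le> upper_var M \<nu> A"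
  unfolding upper_var_def by (rule SUP_upper) simp

lemma upper_var_mono: "A \<subseteq> A' \<Longrightarrow> upper_var M \<nu> A \<le> upper_var M \<nu> A'"
  unfolding upper_var_def by (rule SUP_subset_mono) auto

text \<open>Competitors for \<open>A\<close> and for \<open>B\<close> can be united. If one has a
  negative value, \<open>ennreal\<close> truncates it to 0 and the other competes alone.\<close>

lemma upper_var_Un_ge:
  assumes \<nu>: "signed_sigma_additive M \<nu>" and disj: "A \<inter> B = {}"
  shows "upper_var M \<nu> A + upper_var M \<nu> B \<le> upper_var M \<nu> (A \<union> B)"
proof -
  let ?I = "\<lambda>A. {B \<in> sets M. B \<subseteq> A}"
  have ne: "?I A \<noteq> {}" "?I B \<noteq> {}" by auto
  have CD: "ennreal (\<nu> C) + ennreal (\<nu> D) \<le> upper_var M \<nu> (A \<union> B)" if C: "C \<in> ?I A" and D: "D \<in> ?I B" for C D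
  proof -
    have "\<nu> (C \<union> D) = \<nu> C + \<nu> D" using C D disj by (intro signed_Un[OF \<nu>]) auto
    moreover have "ennreal (\<nu> (C \<union> D)) \<le> upper_var M \<nu> (A \<union> B)" "ennreal (\<nu> C) \<le> upper_var M \<nu> (A \<union> B)"
      "ennreal (\<nu> D) \<le> upper_var M \<nu> (A \<union> B)" using C D by (auto intro!: upper_var_upper)
    ultimately show ?thesis
      by (cases "0 \<le> \<nu> C"; cases "0 \<le> \<nu> D") (simp_all add: ennreal_neg)
  qed
  have CB: "ennreal (\<nu> C) + upper_var M \<nu> B \<le> upper_var M \<nu> (A \<union> B)" if C: "C \<in> ?I A" for C
  proof -
    have "ennreal (\<nu> C) + upper_var M \<nu> B = (SUP D\<in>?I B. ennreal (\<nu> C) + ennreal (\<nu> D))"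
      unfolding upper_var_def by (rule ennreal_SUP_add_right[OF ne(2)])
    also have "\<dots> \<le> upper_var M \<nu> (A \<union> B)" by (rule SUP_least) (rule CD[OF C])
    finally show ?thesis .
  qed
  have "upper_var M \<nu> A + upper_var M \<nu> B = (SUP C\<in>?I A. ennreal (\<nu> C) + upper_var M \<nu> B)"
    unfolding upper_var_def[of M \<nu> A] by (rule ennreal_SUP_add_left[OF ne(1), symmetric])
  also have "\<dots> \<le> upper_var M \<nu> (A \<union> B)" by (rule SUP_least) (rule CB)
  finally show ?thesis .
qed

lemma ennreal_sum_le: "ennreal (sum f I) \<le> (\<Sum>i\<in>I. ennreal (f i))"
proof (induction I rule: infinite_finite_induct)
  case (insert x F)
  have "ennreal (f x + sum f F) \<le> ennreal (f x) + ennreal (sum f F)"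
    by (auto simp: ennreal_plus_if intro!: ennreal_leI)
  also have "\<dots> \<le> ennreal (f x) + (\<Sum>i\<in>F. ennreal (f i))" by (intro add_left_mono insert.IH)
  finally show ?case using insert.hyps by simp
qed auto

lemma ennreal_sums_le_suminf:
  assumes "f sums s"
  shows "ennreal s \<le> (\<Sum>i. ennreal (f i))"
proof (rule LIMSEQ_le_const2)
  show "(\<lambda>n. ennreal (\<Sum>i<n. f i)) \<longlonglongrightarrow> ennreal s"
    using assms unfolding sums_def by (rule tendsto_ennrealI)
  show "\<exists>N. \<forall>n\<ge>N. ennreal (\<Sum>i<n. f i) \<le> (\<Sum>i. ennreal (f i))"
    by (intro exI[of _ 0] allI impI order_trans[OF ennreal_sum_le sum_le_suminf]) auto
qed

text \<open>Superadditivity on finite unions bounds the series from above; conversely a competitor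
  for the union is cut into its parts \<open>B \<inter> A i\<close>.\<close>

lemma upper_var_countably_additive:
  assumes \<nu>: "signed_sigma_additive M \<nu>"
  shows "countably_additive (sets M) (upper_var M \<nu>)"
  unfolding countably_additive_def
proof (intro allI impI)
  fix A :: "nat \<Rightarrow> 'a set" assume A: "range A \<subseteq> sets M" "disjoint_family A" "\<Union> (range A) \<in> sets M"
  show "(\<Sum>i. upper_var M \<nu> (A i)) = upper_var M \<nu> (\<Union> (range A))"
  proof (rule antisym)
    have "(\<Sum>i<n. upper_var M \<nu> (A i)) \<le> upper_var M \<nu> (\<Union>i<n. A i)" for n
    proof (induction n)
      case (Suc n)
      have "(\<Sum>i<Suc n. upper_var M \<nu> (A i)) \<le> upper_var M \<nu> (\<Union>i<n. A i) + upper_var M \<nu> (A n)"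
        using Suc.IH by (simp add: add_right_mono)
      also have "\<dots> \<le> upper_var M \<nu> ((\<Union>i<n. A i) \<union> A n)"
      proof (rule upper_var_Un_ge[OF \<nu>])
        have "A i \<inter> A n = {}" if "i < n" for i using A(2) that unfolding disjoint_family_on_def by auto
        then show "(\<Union>i<n. A i) \<inter> A n = {}" by blast
      qed
      finally show ?case by (simp add: lessThan_Suc Un_commute)
    qed simp
    then have "(\<Sum>i<n. upper_var M \<nu> (A i)) \<le> upper_var M \<nu> (\<Union> (range A))" for n
      by (rule order_trans) (intro upper_var_mono, auto)
    then show "(\<Sum>i. upper_var M \<nu> (A i)) \<le> upper_var M \<nu> (\<Union> (range A))"
      by (intro suminf_le_const) auto
    show "upper_var M \<nu> (\<Union> (range A)) \<le> (\<Sum>i. upper_var M \<nu> (A i))"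
      unfolding upper_var_def[of M \<nu> "\<Union> (range A)"]
    proof (rule SUP_least)
      fix B assume B: "B \<in> {B \<in> sets M. B \<subseteq> \<Union> (range A)}"
      have "(\<lambda>i. \<nu> (B \<inter> A i)) sums \<nu> (\<Union>i. B \<inter> A i)"
        using A B by (intro signed_sigma_additiveD[OF \<nu>]) (auto simp: disjoint_family_on_def)
      moreover have "(\<Union>i. B \<inter> A i) = B" using B by blast
      ultimately have "ennreal (\<nu> B) \<le> (\<Sum>i. ennreal (\<nu> (B \<inter> A i)))"
        using ennreal_sums_le_suminf by metis
      also have "\<dots> \<le> (\<Sum>i. upper_var M \<nu> (A i))"
        using A B by (intro suminf_le upper_var_upper) auto
      finally show "ennreal (\<nu> B) \<le> (\<Sum>i. upper_var M \<nu> (A i))" .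
    qed
  qed
qed

lemma upper_var_empty:
  assumes "signed_sigma_additive M \<nu>"
  shows "upper_var M \<nu> {} = 0"
proof -
  have "{B \<in> sets M. B \<subseteq> {}} = {{}}" by auto
  then show ?thesis unfolding upper_var_def using signed_empty[OF assms] by simp
qed

lemma upper_variation_simps:
  assumes \<nu>: "signed_sigma_additive M \<nu>"
  shows "sets (upper_variation M \<nu>) = sets M" "space (upper_variation M \<nu>) = space M"
    "A \<in> sets M \<Longrightarrow> emeasure (upper_variation M \<nu>) A = upper_var M \<nu> A"
proof -
  have eq: "upper_variation M \<nu> = measure_of (space M) (sets M) (upper_var M \<nu>)"
    unfolding upper_variation_def upper_var_def ..
  show "sets (upper_variation M \<nu>) = sets M" "space (upper_variation M \<nu>) = space M"
    unfolding eq by simp_all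
  show "A \<in> sets M \<Longrightarrow> emeasure (upper_variation M \<nu>) A = upper_var M \<nu> A"
    unfolding eq
    by (rule emeasure_measure_of_sigma)
      (auto simp: positive_def upper_var_empty[OF \<nu>] upper_var_countably_additive[OF \<nu>] sets.sigma_algebra_axioms)
qed

text \<open>A competitor \<open>B\<close> with \<open>\<nu> B > \<bar>\<nu> E\<bar> + 1\<close>
  makes both \<open>B\<close> and \<open>E - B\<close> of modulus at least 1, and by subadditivity
  one of the two still has infinite variation.\<close>

lemma upper_var_infinite_split:
  assumes \<nu>: "signed_sigma_additive M \<nu>" and E: "E \<in> sets M" "upper_var M \<nu> E = \<top>"
  shows "\<exists>E'\<in>sets M. E' \<subseteq> E \<and> upper_var M \<nu> E' = \<top> \<and> \<bar>\<nu> (E - E')\<bar> \<ge> 1"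
proof -
  have "ennreal (\<bar>\<nu> E\<bar> + 1) < upper_var M \<nu> E" using E by simp
  then obtain B where B: "B \<in> sets M" "B \<subseteq> E" "ennreal (\<bar>\<nu> E\<bar> + 1) < ennreal (\<nu> B)"
    unfolding upper_var_def less_SUP_iff by auto
  then have b: "\<nu> B > \<bar>\<nu> E\<bar> + 1" by (simp add: ennreal_less_iff del: ennreal_plus)
  have d: "\<nu> (E - B) = \<nu> E - \<nu> B" by (rule signed_Diff[OF \<nu> E(1) B(1,2)])
  have EB: "E - B \<in> sets M" using E B by auto
  have "upper_var M \<nu> E \<le> upper_var M \<nu> B + upper_var M \<nu> (E - B)"
    using emeasure_subadditive[of B "upper_variation M \<nu>" "E - B"] B E EB
    by (simp add: upper_variation_simps[OF \<nu>] Un_absorb1 sets.Un)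
  then consider "upper_var M \<nu> B = \<top>" | "upper_var M \<nu> (E - B) = \<top>"
    using E(2) by (auto simp: top_unique ennreal_add_eq_top)
  then show ?thesis
  proof cases
    case 1
    then show ?thesis using B b d by (intro bexI[of _ B]) auto
  next
    case 2
    moreover have "E - (E - B) = B" using B by auto
    ultimately show ?thesis using EB b by (intro bexI[of _ "E - B"]) auto
  qed
qed

text \<open>Finiteness has to be derived from countable additivity. Repeated splitting would give a
  decreasing sequence whose disjoint differences all have modulus at least 1, while their values
  must form a convergent series.\<close>

lemma upper_var_finite:
  assumes \<nu>: "signed_sigma_additive M \<nu>"
  shows "upper_var M \<nu> (space M) \<noteq> \<top>"
proof
  assume top: "upper_var M \<nu> (space M) = \<top>"
  define P where "P E \<longleftrightarrow> E \<in> sets M \<and> upper_var M \<nu> E = \<top>" for E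
  define R where "R E E' \<longleftrightarrow> E' \<subseteq> E \<and> \<bar>\<nu> (E - E')\<bar> \<ge> 1" for E E'
  have "\<exists>f. \<forall>n :: nat. P (f n) \<and> R (f n) (f (Suc n))"
    using dependent_nat_choice[of "\<lambda>_. P" "\<lambda>_. R"] top upper_var_infinite_split[OF \<nu>]
    unfolding P_def R_def by (metis (no_types, lifting) sets.top)
  then obtain f where f: "\<And>n. P (f n)" "\<And>n. R (f n) (f (Suc n))" by blast
  have dec: "decseq f" using f(2) unfolding R_def by (intro decseq_SucI) auto
  define F where "F n = f n - f (Suc n)" for n
  have "disjoint_family F"
    unfolding disjoint_family_on_def
  proof (intro ballI impI)
    have *: "F m \<inter> F n = {}" if "m < n" for m n
      using decseqD[OF dec, of "Suc m" n] that unfolding F_def by auto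
    show "F m \<inter> F n = {}" if "m \<noteq> n" for m n
      using *[of m n] *[of n m] that by (cases m n rule: linorder_cases) auto
  qed
  moreover have "range F \<subseteq> sets M" using f(1) unfolding F_def P_def by auto
  ultimately have "(\<lambda>n. \<nu> (F n)) sums \<nu> (\<Union>n. F n)" by (intro signed_sigma_additiveD[OF \<nu>])
  then have "(\<lambda>n. \<nu> (F n)) \<longlonglongrightarrow> 0" using summable_LIMSEQ_zero sums_summable by blast
  then have "eventually (\<lambda>n. norm (\<nu> (F n)) < 1) sequentially"
    by (auto simp: tendsto_iff dist_norm)
  then obtain n where "\<bar>\<nu> (F n)\<bar> < 1" by (auto simp: eventually_sequentially)
  then show False using f(2)[of n] unfolding R_def F_def by auto
qed

lemma finite_upper_variation:
  assumes "signed_sigma_additive M \<nu>"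
  shows "finite_measure (upper_variation M \<nu>)"
  by (rule finite_measureI)
    (use upper_variation_simps[OF assms] upper_var_finite[OF assms] in simp)

text \<open>Since \<open>\<nu> B = \<nu> A - \<nu> (A - B)\<close>, the supremum over
  \<open>B\<close> is at most \<open>\<nu> A\<close> plus the lower variation; the opposite
  inequality is the same statement for \<open>- \<nu>\<close>.\<close>

lemma jordan_decomposition:
  assumes \<nu>: "signed_sigma_additive M \<nu>" and A: "A \<in> sets M"
  shows "\<nu> A = measure (upper_variation M \<nu>) A - measure (upper_variation M (\<lambda>A. - \<nu> A)) A"
proof -
  have half: "measure (upper_variation M \<nu>) A \<le> \<nu> A + measure (upper_variation M (\<lambda>A. - \<nu> A)) A"
    if \<nu>: "signed_sigma_additive M \<nu>" for \<nu>
  proof -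
    define p where "p = measure (upper_variation M (\<lambda>A. - \<nu> A)) A"
    note \<nu>' = signed_sigma_additive_minus[OF \<nu>]
    interpret N: finite_measure "upper_variation M (\<lambda>A. - \<nu> A)" by (rule finite_upper_variation[OF \<nu>'])
    interpret N': finite_measure "upper_variation M \<nu>" by (rule finite_upper_variation[OF \<nu>])
    have p: "- \<nu> B \<le> p" if "B \<in> sets M" "B \<subseteq> A" for B
    proof -
      have "ennreal (- \<nu> B) \<le> ennreal p"
        unfolding p_def N.emeasure_eq_measure[symmetric] upper_variation_simps(3)[OF \<nu>' A]
        by (rule upper_var_upper[OF that])
      moreover have "p \<ge> 0" unfolding p_def by (rule measure_nonneg)
      ultimately show ?thesis by (auto simp: ennreal_le_iff2)
    qed
    have "upper_var M \<nu> A \<le> ennreal (\<nu> A + p)"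
      unfolding upper_var_def
    proof (rule SUP_least)
      fix B assume B: "B \<in> {B \<in> sets M. B \<subseteq> A}"
      have "\<nu> (A - B) = \<nu> A - \<nu> B" using B by (intro signed_Diff[OF \<nu> A]) auto
      then show "ennreal (\<nu> B) \<le> ennreal (\<nu> A + p)"
        using p[of "A - B"] A B by (intro ennreal_leI) auto
    qed
    then have "ennreal (measure (upper_variation M \<nu>) A) \<le> ennreal (\<nu> A + p)"
      unfolding N'.emeasure_eq_measure[symmetric] upper_variation_simps(3)[OF \<nu> A] .
    moreover have "\<nu> A + p \<ge> 0" using p[OF A] by simp
    ultimately show ?thesis unfolding p_def by (simp add: ennreal_le_iff)
  qed
  show ?thesis using half[OF \<nu>] half[OF signed_sigma_additive_minus[OF \<nu>]] by simp
qed

lemma complex_measures_Re_Im: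
  assumes "f \<in> complex_measures M"
  shows "signed_sigma_additive M (\<lambda>A. Re (f A))" "signed_sigma_additive M (\<lambda>A. Im (f A))"
  using assms unfolding complex_measures_def signed_sigma_additive_def by (auto intro: sums_Re sums_Im)

lemma add_measure_exists:
  assumes "finite_measure N1" "finite_measure N2" "sets N1 = sets M" "sets N2 = sets M"
  obtains P where "finite_measure P" "sets P = sets M"
    "\<And>A. A \<in> sets M \<Longrightarrow> emeasure P A = emeasure N1 A + emeasure N2 A"
proof -
  define P where "P = measure_of (space M) (sets M) (\<lambda>A. emeasure N1 A + emeasure N2 A)"
  have s: "sets P = sets M" "space P = space M" unfolding P_def by simp_all
  have e: "emeasure P A = emeasure N1 A + emeasure N2 A" if "A \<in> sets M" for A
    unfolding P_def
  proof (rule emeasure_measure_of_sigma[OF _ _ _ that])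
    show "countably_additive (sets M) (\<lambda>A. emeasure N1 A + emeasure N2 A)"
      unfolding countably_additive_def
    proof (intro allI impI)
      fix A :: "nat \<Rightarrow> 'a set" assume A: "range A \<subseteq> sets M" "disjoint_family A" "\<Union> (range A) \<in> sets M"
      show "(\<Sum>i. emeasure N1 (A i) + emeasure N2 (A i)) = emeasure N1 (\<Union> (range A)) + emeasure N2 (\<Union> (range A))"
        using A assms by (subst suminf_add[symmetric]) (auto simp: suminf_emeasure)
    qed
  qed (auto simp: positive_def sets.sigma_algebra_axioms)
  interpret N1: finite_measure N1 by fact
  interpret N2: finite_measure N2 by fact
  have "finite_measure P"
    by (rule finite_measureI) (use e[OF sets.top] s in \<open>simp add: N1.emeasure_eq_measure N2.emeasure_eq_measure\<close>)
  then show ?thesis using s e that by blast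
qed

text \<open>Domination gives absolute continuity. The Radon--Nikodym derivative is taken in a
  version that is real and nonnegative everywhere, so that it can enter a complex density.\<close>

lemma finite_measure_density_exists:
  assumes "finite_measure N" "finite_measure P" "sets N = sets P"
    "\<And>A. A \<in> sets P \<Longrightarrow> emeasure N A \<le> emeasure P A"
  obtains D :: "'a \<Rightarrow> real" where "D \<in> borel_measurable P" "\<And>x. D x \<ge> 0" "N = density P D" "integrable P D"
proof -
  interpret P: finite_measure P by fact
  interpret N: finite_measure N by fact
  have ac: "absolutely_continuous P N"
    unfolding absolutely_continuous_def
  proof
    fix A assume A: "A \<in> null_sets P"
    then have "emeasure N A \<le> emeasure P A" by (intro assms(4)) auto
    then show "A \<in> null_sets N" using A assms(3) unfolding null_sets_def by simp
  qed
  obtain D :: "'a \<Rightarrow> real" where D: "D \<in> borel_measurable P" "AE x in P. RN_deriv P N x = ennreal (D x)"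
    "AE x in N. 0 < D x" "\<And>x. 0 \<le> D x"
    using P.real_RN_deriv[OF assms(1) ac assms(3)] by blast
  have N: "N = density P D"
  proof -
    have "density P (RN_deriv P N) = density P D"
      by (rule density_cong[OF _ _ D(2)]) (use D(1) in auto)
    then show ?thesis using P.density_RN_deriv[OF ac assms(3)] by simp
  qed
  have "integrable P D"
  proof (rule integrableI_nonneg)
    have "(\<integral>\<^sup>+ x. ennreal (D x) \<partial>P) = emeasure N (space P)"
      unfolding N using D(1) by (subst emeasure_density) (auto intro!: nn_integral_cong)
    also have "\<dots> < \<infinity>" by (simp add: less_top[symmetric])
    finally show "(\<integral>\<^sup>+ x. ennreal (D x) \<partial>P) < \<infinity>" .
  qed (use D in auto)
  then show ?thesis using that D N by blast
qed

text \<open>A complex measure on \<open>M\<close> is handled as the image under \<open>\<psi>\<close> of a measure with integrable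
  complex density \<open>\<rho>\<close> with respect to a finite positive measure \<open>P\<close>.\<close>

definition cm_repr :: "'a measure \<Rightarrow> 'b measure \<Rightarrow> ('b \<Rightarrow> 'a) \<Rightarrow> ('b \<Rightarrow> complex) \<Rightarrow> ('a set \<Rightarrow> complex) \<Rightarrow> bool" where
  "cm_repr M P \<psi> \<rho> f \<longleftrightarrow> finite_measure P \<and> \<psi> \<in> P \<rightarrow>\<^sub>M M \<and> integrable P \<rho> \<and>
     (\<forall>A\<in>sets M. f A = (LINT \<omega>|P. indicator A (\<psi> \<omega>) * \<rho> \<omega>))"

lemma integrable_bounded_mult:
  fixes \<rho> \<Phi> :: "'b \<Rightarrow> complex"
  assumes "integrable P \<rho>" "\<Phi> \<in> borel_measurable P" "\<And>x. x \<in> space P \<Longrightarrow> norm (\<Phi> x) \<le> C"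
  shows "integrable P (\<lambda>x. \<Phi> x * \<rho> x)"
proof (rule Bochner_Integration.integrable_bound)
  show "integrable P (\<lambda>x. of_real C * \<rho> x)" using assms(1) by simp
  show "AE x in P. norm (\<Phi> x * \<rho> x) \<le> norm (of_real C * \<rho> x)"
    using assms(3) by (intro AE_I2) (auto simp: norm_mult intro!: mult_right_mono order_trans[OF assms(3)])
qed (use assms in measurable)

lemma cm_repr_imp_complex_measures:
  assumes r: "cm_repr M P \<psi> \<rho> f"
  shows "f \<in> complex_measures M"
  unfolding complex_measures_def
proof (intro CollectI allI impI)
  fix A :: "nat \<Rightarrow> 'a set" assume A: "range A \<subseteq> sets M \<and> disjoint_family A"
  have [measurable]: "\<psi> \<in> P \<rightarrow>\<^sub>M M" "\<rho> \<in> borel_measurable P" and \<rho>: "integrable P \<rho>"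
    and f: "\<And>A. A \<in> sets M \<Longrightarrow> f A = (LINT \<omega>|P. indicator A (\<psi> \<omega>) * \<rho> \<omega>)"
    using r unfolding cm_repr_def by auto
  have [measurable]: "A i \<in> sets M" for i using A by auto
  have int: "integrable P (\<lambda>\<omega>. indicator (A i) (\<psi> \<omega>) * \<rho> \<omega>)" for i
    by (rule integrable_bounded_mult[OF \<rho>, where C = 1]) (auto simp: indicator_def[abs_def])
  have [measurable]: "(\<Union>i<n. A i) \<in> sets M" for n by auto
  have disj: "disjoint_family A" and UA: "(\<Union>n. A n) \<in> sets M" using A by auto
  have finU: "(\<Sum>i<n. indicator (A i) (\<psi> \<omega>) * \<rho> \<omega>) = indicator (\<Union>i<n. A i) (\<psi> \<omega>) * \<rho> \<omega>" for n \<omega>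
  proof -
    have d: "disjoint_family_on A {..<n}" using disj by (rule disjoint_family_on_mono[rotated]) simp
    show ?thesis unfolding sum_distrib_right[symmetric] indicator_UN_disjoint[OF finite_lessThan d] ..
  qed
  have "(\<lambda>n. LINT \<omega>|P. indicator (\<Union>i<n. A i) (\<psi> \<omega>) * \<rho> \<omega>) \<longlonglongrightarrow> (LINT \<omega>|P. indicator (\<Union>n. A n) (\<psi> \<omega>) * \<rho> \<omega>)"
  proof (rule integral_dominated_convergence[where w = "\<lambda>\<omega>. norm (\<rho> \<omega>)"])
    have "(\<lambda>n. \<Sum>i<n. indicator (A i) (\<psi> \<omega>) * \<rho> \<omega>) \<longlonglongrightarrow> indicator (\<Union>n. A n) (\<psi> \<omega>) * \<rho> \<omega>" for \<omega>
    proof -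
      have "(\<lambda>i. of_real (indicator (A i) (\<psi> \<omega>)) * \<rho> \<omega>) sums (of_real (indicator (\<Union>n. A n) (\<psi> \<omega>)) * \<rho> \<omega>)"
        by (intro sums_mult2 sums_of_real indicator_sums disjoint_family_onD[OF disj]) auto
      then show ?thesis unfolding sums_def by (simp only: of_real_indicator)
    qed
    then show "AE \<omega> in P. (\<lambda>n. indicator (\<Union>i<n. A i) (\<psi> \<omega>) * \<rho> \<omega>) \<longlonglongrightarrow> indicator (\<Union>n. A n) (\<psi> \<omega>) * \<rho> \<omega>"
      unfolding finU by (intro AE_I2)
    show "AE \<omega> in P. norm (indicator (\<Union>i<n. A i) (\<psi> \<omega>) * \<rho> \<omega>) \<le> norm (\<rho> \<omega>)" for n
      by (intro AE_I2) (simp add: norm_mult indicator_def)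
    show "(\<lambda>\<omega>. indicator (\<Union>n. A n) (\<psi> \<omega>) * \<rho> \<omega>) \<in> borel_measurable P" using UA by measurable
    show "(\<lambda>\<omega>. indicator (\<Union>i<n. A i) (\<psi> \<omega>) * \<rho> \<omega>) \<in> borel_measurable P" for n by measurable
  qed (use \<rho> in auto)
  then show "(\<lambda>n. f (A n)) sums f (\<Union>n. A n)"
    unfolding sums_def finU[symmetric] f[OF UA]
    by (simp only: Bochner_Integration.integral_sum[OF int] f[OF \<open>A _ \<in> sets M\<close>])
qed

text \<open>On simple functions the integral sees the set function only, through the level sets, and
  bounded functions are dominated limits of simple ones. Parameter space, map and density may
  therefore be exchanged at will.\<close>

lemma cm_repr_integral_unique:
  assumes r: "cm_repr M P \<psi> \<rho> f" and r': "cm_repr M P' \<psi>' \<rho>' f'"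
    and eq: "\<And>A. A \<in> sets M \<Longrightarrow> f A = f' A"
    and \<Phi>: "\<Phi> \<in> borel_measurable M" "\<And>x. x \<in> space M \<Longrightarrow> norm (\<Phi> x) \<le> C"
  shows "(LINT \<omega>|P. \<Phi> (\<psi> \<omega>) * \<rho> \<omega>) = (LINT \<omega>|P'. \<Phi> (\<psi>' \<omega>) * \<rho>' \<omega>)"
proof -
  obtain s where s: "\<And>i. simple_function M (s i)" "\<And>x. x \<in> space M \<Longrightarrow> (\<lambda>i. s i x) \<longlonglongrightarrow> \<Phi> x"
    "\<And>i x. x \<in> space M \<Longrightarrow> dist (s i x) 0 \<le> 2 * dist (\<Phi> x) 0"
    using borel_measurable_implies_sequence_metric[OF \<Phi>(1), of 0] by blast
  have bound: "norm (s i x) \<le> 2 * C" if "x \<in> space M" for i x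
    using s(3)[OF that, of i] \<Phi>(2)[OF that] by simp
  have sm: "s i \<in> borel_measurable M" for i by (rule borel_measurable_simple_function[OF s(1)])
  have lim: "(\<lambda>i. LINT \<omega>|P. s i (\<psi> \<omega>) * \<rho> \<omega>) \<longlonglongrightarrow> (LINT \<omega>|P. \<Phi> (\<psi> \<omega>) * \<rho> \<omega>)"
    and simple: "(LINT \<omega>|P. s i (\<psi> \<omega>) * \<rho> \<omega>) = (\<Sum>y\<in>s i ` space M. y * f (s i -` {y} \<inter> space M))"
    if r: "cm_repr M P \<psi> \<rho> f" for P :: "'z measure" and \<psi> \<rho> f i
  proof -
    have \<psi>: "\<psi> \<in> P \<rightarrow>\<^sub>M M" and \<rho>: "integrable P \<rho>"
      and f: "\<And>A. A \<in> sets M \<Longrightarrow> f A = (LINT \<omega>|P. indicator A (\<psi> \<omega>) * \<rho> \<omega>)"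
      using r unfolding cm_repr_def by auto
    note [measurable] = \<psi> borel_measurable_integrable[OF \<rho>] sm \<Phi>(1)
    have sp: "\<psi> \<omega> \<in> space M" if "\<omega> \<in> space P" for \<omega> using measurable_space[OF \<psi> that] .
    show "(\<lambda>i. LINT \<omega>|P. s i (\<psi> \<omega>) * \<rho> \<omega>) \<longlonglongrightarrow> (LINT \<omega>|P. \<Phi> (\<psi> \<omega>) * \<rho> \<omega>)"
    proof (rule integral_dominated_convergence[where w = "\<lambda>\<omega>. 2 * C * norm (\<rho> \<omega>)"])
      show "AE x in P. (\<lambda>i. s i (\<psi> x) * \<rho> x) \<longlonglongrightarrow> \<Phi> (\<psi> x) * \<rho> x"
        by (intro AE_I2 tendsto_mult_right s(2) sp)
      show "AE x in P. norm (s i (\<psi> x) * \<rho> x) \<le> 2 * C * norm (\<rho> x)" for i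
        unfolding norm_mult by (intro AE_I2 mult_right_mono bound sp) auto
    qed (use \<rho> in auto)
    have A: "s i -` {y} \<inter> space M \<in> sets M" for y by (rule simple_functionD(2)[OF s(1)])
    have int: "integrable P (\<lambda>\<omega>. y * (indicator (s i -` {y} \<inter> space M) (\<psi> \<omega>) * \<rho> \<omega>))" for y
    proof -
      have [measurable]: "s i -` {y} \<inter> space M \<in> sets M" by (rule A)
      show ?thesis by (intro integrable_mult_right integrable_bounded_mult[OF \<rho>, where C = 1]) (auto simp: indicator_def[abs_def])
    qed
    have "(LINT \<omega>|P. s i (\<psi> \<omega>) * \<rho> \<omega>) = (LINT \<omega>|P. (\<Sum>y\<in>s i ` space M. y * (indicator (s i -` {y} \<inter> space M) (\<psi> \<omega>) * \<rho> \<omega>)))"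
    proof (rule Bochner_Integration.integral_cong[OF refl])
      fix \<omega> assume "\<omega> \<in> space P"
      then have "\<psi> \<omega> \<in> space M" by (rule sp)
      have fin: "finite (s i ` space M)" by (rule simple_functionD(1)[OF s(1)])
      have "(\<Sum>y\<in>s i ` space M. y * (indicator (s i -` {y} \<inter> space M) (\<psi> \<omega>) * \<rho> \<omega>)) =
          (\<Sum>y\<in>s i ` space M. if y = s i (\<psi> \<omega>) then y * \<rho> \<omega> else 0)"
        using \<open>\<psi> \<omega> \<in> space M\<close> by (intro sum.cong) (auto simp: indicator_def)
      also have "\<dots> = s i (\<psi> \<omega>) * \<rho> \<omega>"
        using fin \<open>\<psi> \<omega> \<in> space M\<close> by (simp add: sum.delta)
      finally show "s i (\<psi> \<omega>) * \<rho> \<omega> = (\<Sum>y\<in>s i ` space M. y * (indicator (s i -` {y} \<inter> space M) (\<psi> \<omega>) * \<rho> \<omega>))" ..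
    qed
    also have "\<dots> = (\<Sum>y\<in>s i ` space M. y * f (s i -` {y} \<inter> space M))"
      by (simp only: Bochner_Integration.integral_sum[OF int] integral_mult_right_zero f[OF A])
    finally show "(LINT \<omega>|P. s i (\<psi> \<omega>) * \<rho> \<omega>) = (\<Sum>y\<in>s i ` space M. y * f (s i -` {y} \<inter> space M))" .
  qed
  have A: "s i -` {y} \<inter> space M \<in> sets M" for y i by (rule simple_functionD(2)[OF s(1)])
  have "(LINT \<omega>|P. s i (\<psi> \<omega>) * \<rho> \<omega>) = (LINT \<omega>|P'. s i (\<psi>' \<omega>) * \<rho>' \<omega>)" for i
    unfolding simple[OF r] simple[OF r'] eq[OF A] ..
  then show ?thesis using lim[OF r] lim[OF r'] by (simp add: LIMSEQ_unique)
qed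

text \<open>All four Jordan parts are dominated by one finite measure, so their densities combine
  into a single complex density and \<open>cm_integral\<close> becomes one Bochner integral.\<close>

lemma complex_measures_repr:
  assumes f: "f \<in> complex_measures M"
  obtains P \<rho> where "sets P = sets M" "cm_repr M P (\<lambda>x. x) \<rho> f"
    "\<And>\<Phi> C. \<Phi> \<in> borel_measurable M \<Longrightarrow> (\<And>x. x \<in> space M \<Longrightarrow> norm (\<Phi> x) \<le> C) \<Longrightarrow>
       cm_integral M f \<Phi> = (LINT x|P. \<Phi> x * \<rho> x)"
proof -
  note sg = complex_measures_Re_Im[OF f]
  note sg' = sg[THEN signed_sigma_additive_minus]
  define N where "N k = (if k = 0 then upper_variation M (\<lambda>A. Re (f A)) else if k = 1 then upper_variation M (\<lambda>A. - Re (f A))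
     else if k = 2 then upper_variation M (\<lambda>A. Im (f A)) else upper_variation M (\<lambda>A. - Im (f A)))" for k :: nat
  have fin: "finite_measure (N k)" and sets: "sets (N k) = sets M" for k
    unfolding N_def using finite_upper_variation[OF sg(1)] finite_upper_variation[OF sg(2)]
      finite_upper_variation[OF sg'(1)] finite_upper_variation[OF sg'(2)]
      upper_variation_simps(1)[OF sg(1)] upper_variation_simps(1)[OF sg(2)]
      upper_variation_simps(1)[OF sg'(1)] upper_variation_simps(1)[OF sg'(2)] by auto
  \<comment> \<open>The dominating measure is built by adding one part at a time; for
    \<open>n = 0\<close> any finite measure serves as a start.\<close>
  have "\<exists>P. finite_measure P \<and> sets P = sets M \<and> (\<forall>k<n. \<forall>A\<in>sets M. emeasure (N k) A \<le> emeasure P A)" for n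
  proof (induction n)
    case 0
    show ?case using fin[of 0] sets[of 0] by auto
  next
    case (Suc n)
    then obtain P where P: "finite_measure P" "sets P = sets M" "\<forall>k<n. \<forall>A\<in>sets M. emeasure (N k) A \<le> emeasure P A" by blast
    obtain P' where P': "finite_measure P'" "sets P' = sets M"
      "\<And>A. A \<in> sets M \<Longrightarrow> emeasure P' A = emeasure P A + emeasure (N n) A"
      using add_measure_exists[OF P(1) fin[of n] P(2) sets[of n]] by blast
    have "emeasure (N k) A \<le> emeasure P' A" if "k < Suc n" "A \<in> sets M" for k A
    proof (cases "k = n")
      case False
      then have "emeasure (N k) A \<le> emeasure P A" using P(3) that by auto
      then show ?thesis unfolding P'(3)[OF that(2)] by (rule add_increasing2[OF zero_le])
    qed (simp add: P'(3)[OF that(2)])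
    then show ?case using P' by blast
  qed
  from this[of 4] obtain P where P: "finite_measure P" "sets P = sets M" "\<And>k A. k < 4 \<Longrightarrow> A \<in> sets M \<Longrightarrow> emeasure (N k) A \<le> emeasure P A"
    by blast
  have "\<exists>D :: 'a \<Rightarrow> real. D \<in> borel_measurable P \<and> (\<forall>x. D x \<ge> 0) \<and> N k = density P D \<and> integrable P D" if "k < 4" for k
  proof -
    have a: "sets (N k) = sets P" using sets P(2) by simp
    have b: "emeasure (N k) A \<le> emeasure P A" if "A \<in> sets P" for A
      using P(3)[OF \<open>k < 4\<close>] that P(2) by simp
    show ?thesis using finite_measure_density_exists[OF fin P(1) a b] by blast
  qed
  then have "\<forall>k\<in>{..<4}. \<exists>D :: 'a \<Rightarrow> real. D \<in> borel_measurable P \<and> (\<forall>x. D x \<ge> 0) \<and> N k = density P D \<and> integrable P D"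
    by blast
  from bchoice[OF this] obtain D where "\<forall>k\<in>{..<4}. D k \<in> borel_measurable P \<and> (\<forall>x. D k x \<ge> 0) \<and> N k = density P (\<lambda>x. ennreal (D k x)) \<and> integrable P (D k)"
    by blast
  then have D: "\<And>k. k < 4 \<Longrightarrow> D k \<in> borel_measurable P" "\<And>k x. k < 4 \<Longrightarrow> D k x \<ge> 0"
    "\<And>k. k < 4 \<Longrightarrow> N k = density P (\<lambda>x. ennreal (D k x))" "\<And>k. k < 4 \<Longrightarrow> integrable P (D k)" by simp_all
  have N: "N 0 = upper_variation M (\<lambda>A. Re (f A))" "N 1 = upper_variation M (\<lambda>A. - Re (f A))"
    "N 2 = upper_variation M (\<lambda>A. Im (f A))" "N 3 = upper_variation M (\<lambda>A. - Im (f A))"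
    unfolding N_def by simp_all
  define \<rho> where "\<rho> x = of_real (D 0 x) - of_real (D 1 x) + \<i> * (of_real (D 2 x) - of_real (D 3 x))" for x
  have \<rho>: "integrable P \<rho>" unfolding \<rho>_def using D(4) by (intro Bochner_Integration.integrable_add Bochner_Integration.integrable_diff integrable_mult_right integrable_of_real) auto
  have sp: "space P = space M" using P(2) by (rule sets_eq_imp_space_eq)
  have cm: "cm_integral M f \<Phi> = (LINT x|P. \<Phi> x * \<rho> x)"
    if \<Phi>: "\<Phi> \<in> borel_measurable M" "\<And>x. x \<in> space M \<Longrightarrow> norm (\<Phi> x) \<le> C" for \<Phi> C
  proof -
    have \<Phi>': "\<Phi> \<in> borel_measurable P" using \<Phi>(1) measurable_cong_sets[OF P(2) refl] by blast
    have int: "integrable P (\<lambda>x. \<Phi> x * of_real (D k x))" if "k < 4" for k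
      by (rule integrable_bounded_mult[where C = C]) (use D(4)[OF that] \<Phi>' \<Phi>(2) sp in auto)
    have k: "(0::nat) < 4" "(1::nat) < 4" "(2::nat) < 4" "(3::nat) < 4" by simp_all
    have dens: "(LINT x|N k. \<Phi> x) = (LINT x|P. \<Phi> x * of_real (D k x))" if "k < 4" for k
      unfolding D(3)[OF that] using D(1,2)[OF that] \<Phi>'
      by (subst integral_density) (auto simp: scaleR_conv_of_real mult.commute)
    have "cm_integral M f \<Phi> = (LINT x|N 0. \<Phi> x) - (LINT x|N 1. \<Phi> x) + \<i> * ((LINT x|N 2. \<Phi> x) - (LINT x|N 3. \<Phi> x))"
      unfolding cm_integral_def signed_integral_def N ..
    also have "\<dots> = (LINT x|P. \<Phi> x * of_real (D 0 x) - \<Phi> x * of_real (D 1 x) + \<i> * (\<Phi> x * of_real (D 2 x) - \<Phi> x * of_real (D 3 x)))"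
      by (simp only: dens[OF k(1)] dens[OF k(2)] dens[OF k(3)] dens[OF k(4)] integral_mult_right_zero
        Bochner_Integration.integral_add Bochner_Integration.integral_diff Bochner_Integration.integrable_diff integrable_mult_right
        int[OF k(1)] int[OF k(2)] int[OF k(3)] int[OF k(4)])
    also have "\<dots> = (LINT x|P. \<Phi> x * \<rho> x)"
      unfolding \<rho>_def by (intro Bochner_Integration.integral_cong refl) (simp add: distrib_left right_diff_distrib mult.left_commute)
    finally show ?thesis .
  qed
  \<comment> \<open>By the Jordan decomposition \<open>f A\<close> is the \<open>cm_integral\<close>
    of the indicator of \<open>A\<close>, so the density found for integrals also reproduces
    \<open>f\<close>.\<close>
  have "f A = (LINT x|P. indicator A x * \<rho> x)" if A: "A \<in> sets M" for A
  proof -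
    have m: "complex_of_real (measure (N k) A) = (LINT x|N k. indicator A x)" for k
    proof -
      have "A \<inter> space (N k) = A" using sets.sets_into_space[OF A] sets_eq_imp_space_eq[OF sets[of k]] by auto
      then show ?thesis unfolding of_real_indicator[symmetric, where 'a = complex] integral_complex_of_real by simp
    qed
    have "f A = of_real (Re (f A)) + \<i> * of_real (Im (f A))" by (rule complex_eq)
    also have "\<dots> = (LINT x|N 0. indicator A x) - (LINT x|N 1. indicator A x) + \<i> * ((LINT x|N 2. indicator A x) - (LINT x|N 3. indicator A x))"
      unfolding jordan_decomposition[OF sg(1) A] jordan_decomposition[OF sg(2) A] N[symmetric] of_real_diff m ..
    also have "\<dots> = cm_integral M f (indicator A)"
      unfolding cm_integral_def signed_integral_def N ..
    also have "\<dots> = (LINT x|P. indicator A x * \<rho> x)"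
      by (rule cm[where C = 1]) (use A in \<open>auto simp: indicator_def[abs_def]\<close>)
    finally show ?thesis .
  qed
  then have "cm_repr M P (\<lambda>x. x) \<rho> f"
    unfolding cm_repr_def using P(1) \<rho> measurable_ident_sets[OF P(2)] by simp
  from that[OF P(2) this cm] show ?thesis .
qed

text \<open>The Jordan parts inside \<open>cm_integral\<close> are replaced by whatever
  representation is at hand, in particular one over a product space.\<close>

lemma cm_integral_repr:
  assumes r: "cm_repr M P \<psi> \<rho> f"
    and \<Phi>: "\<Phi> \<in> borel_measurable M" "\<And>x. x \<in> space M \<Longrightarrow> norm (\<Phi> x) \<le> C"
  shows "cm_integral M f \<Phi> = (LINT \<omega>|P. \<Phi> (\<psi> \<omega>) * \<rho> \<omega>)"
proof -
  obtain P' \<rho>' where r': "cm_repr M P' (\<lambda>x. x) \<rho>' f"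
    and eq: "cm_integral M f \<Phi> = (LINT x|P'. \<Phi> x * \<rho>' x)"
    using complex_measures_repr[OF cm_repr_imp_complex_measures[OF r]] \<Phi> by metis
  show ?thesis unfolding eq by (rule cm_repr_integral_unique[OF r' r refl \<Phi>])
qed


section \<open>The Hilbert space of square-integrable functions\<close>


lemma L2_mult_integrable:
  assumes "u \<in> L2 S T" "v \<in> L2 S T"
  shows "integrable (Leb S T) (\<lambda>p. u p * v p)"
proof (rule Bochner_Integration.integrable_bound)
  show "integrable (Leb S T) (\<lambda>p. (u p)\<^sup>2 + (v p)\<^sup>2)"
    using assms unfolding L2_def by auto
  have "\<bar>a * b\<bar> \<le> a\<^sup>2 + b\<^sup>2" for a b :: real
  proof -
    have "0 \<le> (\<bar>a\<bar> - \<bar>b\<bar>)\<^sup>2" by simp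
    then have "2 * (\<bar>a\<bar> * \<bar>b\<bar>) \<le> a\<^sup>2 + b\<^sup>2" by (simp add: power2_diff)
    moreover have "0 \<le> \<bar>a\<bar> * \<bar>b\<bar>" by simp
    ultimately show ?thesis unfolding abs_mult by linarith
  qed
  then show "AE p in Leb S T. norm (u p * v p) \<le> norm ((u p)\<^sup>2 + (v p)\<^sup>2)" by simp
qed (use assms in \<open>auto simp: L2_def\<close>)

lemma L2_scale:
  assumes "u \<in> L2 S T"
  shows "(\<lambda>p. a * u p) \<in> L2 S T"
  using assms unfolding L2_def by (auto simp: power_mult_distrib)

lemma L2_add:
  assumes "u \<in> L2 S T" "v \<in> L2 S T"
  shows "(\<lambda>p. u p + v p) \<in> L2 S T"
proof -
  have "integrable (Leb S T) (\<lambda>p. (u p)\<^sup>2 + (v p)\<^sup>2 + 2 * (u p * v p))"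
    using assms L2_mult_integrable[OF assms] unfolding L2_def by (intro Bochner_Integration.integrable_add) auto
  moreover have "u \<in> borel_measurable (Leb S T)" "v \<in> borel_measurable (Leb S T)" using assms unfolding L2_def by auto
  ultimately show ?thesis unfolding L2_def by (simp add: power2_sum mult.assoc)
qed

lemma L2_diff:
  assumes "u \<in> L2 S T" "v \<in> L2 S T"
  shows "(\<lambda>p. u p - v p) \<in> L2 S T"
  using L2_add[OF assms(1) L2_scale[OF assms(2), of "-1"]] by simp

lemma L2_zero: "(\<lambda>p. 0) \<in> L2 S T"
  unfolding L2_def by simp

lemma L2_sum:
  assumes "\<And>i. i \<in> I \<Longrightarrow> u i \<in> L2 S T"
  shows "(\<lambda>p. \<Sum>i\<in>I. u i p) \<in> L2 S T"
  using assms by (induction I rule: infinite_finite_induct) (auto intro: L2_add L2_zero)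

lemma L2_mult_bounded:
  assumes u: "u \<in> L2 S T" and h: "h \<in> borel_measurable (Leb S T)" and C: "\<And>p. p \<in> Q S T \<Longrightarrow> \<bar>h p\<bar> \<le> C"
  shows "(\<lambda>p. u p * h p) \<in> L2 S T"
proof -
  have um: "u \<in> borel_measurable (Leb S T)" and ui: "integrable (Leb S T) (\<lambda>p. (u p)\<^sup>2)"
    using u unfolding L2_def by auto
  have "integrable (Leb S T) (\<lambda>p. (u p * h p)\<^sup>2)"
  proof (rule Bochner_Integration.integrable_bound)
    show "integrable (Leb S T) (\<lambda>p. C\<^sup>2 * (u p)\<^sup>2)" using ui by simp
    show "AE p in Leb S T. norm ((u p * h p)\<^sup>2) \<le> norm (C\<^sup>2 * (u p)\<^sup>2)"
    proof (rule AE_I2)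
      fix p assume "p \<in> space (Leb S T)"
      then have "(h p)\<^sup>2 \<le> C\<^sup>2" using power_mono[OF C[of p], of 2] by simp
      then have "(u p)\<^sup>2 * (h p)\<^sup>2 \<le> (u p)\<^sup>2 * C\<^sup>2" by (rule mult_left_mono) simp
      then show "norm ((u p * h p)\<^sup>2) \<le> norm (C\<^sup>2 * (u p)\<^sup>2)" by (simp add: power_mult_distrib mult.commute)
    qed
  qed (use um h in measurable)
  then show ?thesis using um h unfolding L2_def by auto
qed

lemma osc_bounded_L2:
  assumes "S > 0" "T > 0" "osc_bounded S T g"
  shows "g \<in> L2 S T"
proof -
  have m: "g \<in> borel_measurable (Leb S T)" by (rule osc_bounded_measurable[OF assms])
  obtain C where C: "C \<ge> 0" "\<And>p. p \<in> Q S T \<Longrightarrow> \<bar>g p\<bar> \<le> C" using osc_bounded_bound[OF assms] by blast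
  have "(\<lambda>p. 1) \<in> L2 S T"
    unfolding L2_def using integrable_Leb_bounded[of "\<lambda>p. 1" S T 1] by simp
  from L2_mult_bounded[OF this m C(2)] show ?thesis by simp
qed

lemma l2_inner_commute: "l2_inner S T u v = l2_inner S T v u"
  unfolding l2_inner_def by (simp add: mult.commute)

lemma l2_inner_add_left:
  assumes "u \<in> L2 S T" "v \<in> L2 S T" "w \<in> L2 S T"
  shows "l2_inner S T (\<lambda>p. u p + v p) w = l2_inner S T u w + l2_inner S T v w"
  unfolding l2_inner_def distrib_right
  by (rule Bochner_Integration.integral_add) (intro L2_mult_integrable assms)+

lemma l2_inner_scale_left: "l2_inner S T (\<lambda>p. a * u p) w = a * l2_inner S T u w"
  unfolding l2_inner_def by (simp add: mult.assoc)

lemma l2_inner_diff_left: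
  assumes "u \<in> L2 S T" "v \<in> L2 S T" "w \<in> L2 S T"
  shows "l2_inner S T (\<lambda>p. u p - v p) w = l2_inner S T u w - l2_inner S T v w"
  unfolding l2_inner_def left_diff_distrib
  by (rule Bochner_Integration.integral_diff) (intro L2_mult_integrable assms)+

lemma l2_inner_zero_left: "l2_inner S T (\<lambda>p. 0) w = 0"
  unfolding l2_inner_def by simp

lemma l2_inner_sum_left:
  assumes "\<And>i. i \<in> I \<Longrightarrow> u i \<in> L2 S T" "w \<in> L2 S T"
  shows "l2_inner S T (\<lambda>p. \<Sum>i\<in>I. u i p) w = (\<Sum>i\<in>I. l2_inner S T (u i) w)"
  using assms
  by (induction I rule: infinite_finite_induct) (simp_all add: l2_inner_zero_left l2_inner_add_left L2_sum)

lemma l2_inner_self_nonneg: "l2_inner S T u u \<ge> 0"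
  unfolding l2_inner_def by (intro Bochner_Integration.integral_nonneg) simp

text \<open>Squared distances avoid square roots; the price is a factor 2 in the triangle
  inequality.\<close>

abbreviation dist2 :: "real \<Rightarrow> real \<Rightarrow> (real \<times> real \<Rightarrow> real) \<Rightarrow> (real \<times> real \<Rightarrow> real) \<Rightarrow> real" where
  "dist2 S T u v \<equiv> l2_inner S T (\<lambda>p. u p - v p) (\<lambda>p. u p - v p)"

lemma dist2_expand:
  assumes "u \<in> L2 S T" "v \<in> L2 S T"
  shows "dist2 S T u v = l2_inner S T u u - 2 * l2_inner S T u v + l2_inner S T v v"
proof -
  have "dist2 S T u v = l2_inner S T u (\<lambda>p. u p - v p) - l2_inner S T v (\<lambda>p. u p - v p)"
    by (intro l2_inner_diff_left assms L2_diff)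
  moreover have "l2_inner S T u (\<lambda>p. u p - v p) = l2_inner S T u u - l2_inner S T u v"
    using l2_inner_diff_left[OF assms assms(1)]
    unfolding l2_inner_commute[of S T u "\<lambda>p. u p - v p"] l2_inner_commute[of S T u v] .
  moreover have "l2_inner S T v (\<lambda>p. u p - v p) = l2_inner S T u v - l2_inner S T v v"
    unfolding l2_inner_commute[of S T v "\<lambda>p. u p - v p"] by (rule l2_inner_diff_left[OF assms assms(2)])
  ultimately show ?thesis by linarith
qed

lemma dist2_triangle:
  assumes "u \<in> L2 S T" "v \<in> L2 S T" "w \<in> L2 S T"
  shows "dist2 S T u w \<le> 2 * dist2 S T u v + 2 * dist2 S T v w"
proof -
  have i: "integrable (Leb S T) (\<lambda>p. (u p - v p) * (u p - v p))" "integrable (Leb S T) (\<lambda>p. (v p - w p) * (v p - w p))"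
    "integrable (Leb S T) (\<lambda>p. (u p - w p) * (u p - w p))"
    by (intro L2_mult_integrable L2_diff assms)+
  have "dist2 S T u w \<le> (LINT p|Leb S T. 2 * ((u p - v p) * (u p - v p)) + 2 * ((v p - w p) * (v p - w p)))"
    unfolding l2_inner_def
  proof (rule integral_mono)
    fix p
    have "0 \<le> ((u p - v p) - (v p - w p))\<^sup>2" by simp
    then show "(u p - w p) * (u p - w p) \<le> 2 * ((u p - v p) * (u p - v p)) + 2 * ((v p - w p) * (v p - w p))"
      by (simp add: power2_eq_square algebra_simps)
  qed (use i in auto)
  also have "\<dots> = 2 * dist2 S T u v + 2 * dist2 S T v w"
    unfolding l2_inner_def using i by simp
  finally show ?thesis .
qed

lemma dist2_commute: "dist2 S T u v = dist2 S T v u"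
  unfolding l2_inner_def by (rule Bochner_Integration.integral_cong) (auto simp: algebra_simps)

section \<open>Coordinates with respect to the orthonormal system\<close>

locale onb =
  fixes S T :: real and \<phi> :: "nat \<Rightarrow> real \<times> real \<Rightarrow> real"
  assumes S: "S > 0" and T: "T > 0" and onb: "complete_orthonormal_BV S T \<phi>"
begin

abbreviation "ip \<equiv> l2_inner S T"

definition lincomb :: "(nat \<Rightarrow> real) \<Rightarrow> nat \<Rightarrow> real \<times> real \<Rightarrow> real" where
  "lincomb a n = (\<lambda>p. \<Sum>j<n. a j * \<phi> j p)"

lemma phi_L2: "\<phi> j \<in> L2 S T"
  using onb unfolding complete_orthonormal_BV_def by auto

lemma phi_BV: "BV_HK S T (\<phi> j)"
  using onb unfolding complete_orthonormal_BV_def by auto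

lemma ip_phi: "ip (\<phi> i) (\<phi> j) = (if i = j then 1 else 0)"
  using onb unfolding complete_orthonormal_BV_def by auto

lemma lincomb_L2: "lincomb a n \<in> L2 S T"
  unfolding lincomb_def by (intro L2_sum L2_scale phi_L2)

lemma ip_lincomb_left:
  assumes "u \<in> L2 S T"
  shows "ip (lincomb a n) u = (\<Sum>j<n. a j * ip u (\<phi> j))"
proof -
  have "ip (lincomb a n) u = (\<Sum>j<n. ip (\<lambda>p. a j * \<phi> j p) u)"
    unfolding lincomb_def by (intro l2_inner_sum_left L2_scale phi_L2 assms)
  then show ?thesis by (simp add: l2_inner_scale_left l2_inner_commute[of S T u])
qed

lemma ip_lincomb_phi: "ip (lincomb a n) (\<phi> j) = (if j < n then a j else 0)"
  unfolding ip_lincomb_left[OF phi_L2] ip_phi by (simp add: if_distrib sum.delta cong: if_cong)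

lemma ip_lincomb_self: "ip (lincomb a n) (lincomb a n) = (\<Sum>j<n. (a j)\<^sup>2)"
  unfolding ip_lincomb_left[OF lincomb_L2] ip_lincomb_phi by (simp add: power2_eq_square)

text \<open>Completing the square in each coordinate. The exact coordinates give Bessel's
  inequality, nearby rational ones give density.\<close>

lemma dist2_lincomb:
  assumes u: "u \<in> L2 S T"
  shows "dist2 S T u (lincomb a n) = ip u u - (\<Sum>j<n. (ip u (\<phi> j))\<^sup>2) + (\<Sum>j<n. (ip u (\<phi> j) - a j)\<^sup>2)"
proof -
  have "dist2 S T u (lincomb a n) = ip u u - 2 * (\<Sum>j<n. a j * ip u (\<phi> j)) + (\<Sum>j<n. (a j)\<^sup>2)"
    unfolding dist2_expand[OF u lincomb_L2] l2_inner_commute[of S T u "lincomb a n"] ip_lincomb_left[OF u] ip_lincomb_self ..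
  also have "\<dots> = ip u u - (\<Sum>j<n. (ip u (\<phi> j))\<^sup>2) + (\<Sum>j<n. (ip u (\<phi> j) - a j)\<^sup>2)"
    by (simp add: power2_diff sum.distrib sum_subtractf sum_distrib_left mult_ac)
  finally show ?thesis .
qed

lemma bessel:
  assumes u: "u \<in> L2 S T"
  shows "(\<Sum>j<n. (ip u (\<phi> j))\<^sup>2) \<le> ip u u"
  using dist2_lincomb[OF u, of "\<lambda>j. ip u (\<phi> j)" n] l2_inner_self_nonneg[of S T "\<lambda>p. u p - lincomb (\<lambda>j. ip u (\<phi> j)) n p"]
  by simp

lemma coord_le:
  assumes u: "u \<in> L2 S T"
  shows "(ip u (\<phi> j))\<^sup>2 \<le> ip u u"
proof -
  have "(ip u (\<phi> j))\<^sup>2 \<le> (\<Sum>j<Suc j. (ip u (\<phi> j))\<^sup>2)" by (rule member_le_sum) auto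
  then show ?thesis using bessel[OF u, of "Suc j"] by linarith
qed

lemma coords_summable:
  assumes u: "u \<in> L2 S T"
  shows "summable (\<lambda>j. (ip u (\<phi> j))\<^sup>2)"
  by (rule summableI_nonneg_bounded[where x = "ip u u"]) (auto intro: bessel[OF u])

lemma lincomb_diff: "m \<le> n \<Longrightarrow> lincomb a n p - lincomb a m p = lincomb (\<lambda>j. if m \<le> j then a j else 0) n p"
proof -
  assume mn: "m \<le> n"
  have "(\<Sum>j<n. a j * \<phi> j p) = (\<Sum>j<m. a j * \<phi> j p) + (\<Sum>j\<in>{m..<n}. a j * \<phi> j p)"
    using sum.atLeastLessThan_concat[of 0 m n "\<lambda>j. a j * \<phi> j p"] mn by (simp add: atLeast0LessThan)
  moreover have "(\<Sum>j<n. (if m \<le> j then a j else 0) * \<phi> j p) = (\<Sum>j\<in>{m..<n}. a j * \<phi> j p)"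
    by (rule sum.mono_neutral_cong_right) auto
  ultimately show ?thesis unfolding lincomb_def by simp
qed

lemma dist2_lincomb_lincomb:
  assumes "m \<le> n"
  shows "dist2 S T (lincomb a n) (lincomb a m) = (\<Sum>j\<in>{m..<n}. (a j)\<^sup>2)"
proof -
  have "dist2 S T (lincomb a n) (lincomb a m) = (\<Sum>j<n. (if m \<le> j then a j else 0)\<^sup>2)"
    unfolding lincomb_diff[OF assms] by (rule ip_lincomb_self)
  also have "\<dots> = (\<Sum>j\<in>{m..<n}. (a j)\<^sup>2)"
    by (rule sum.mono_neutral_cong_right) auto
  finally show ?thesis .
qed

text \<open>Riesz--Fischer: along a subsequence with \<open>\<parallel>D k\<parallel>\<^sup>2 \<le> 4\<^sup>-\<^sup>k\<close> for the increments, the inequality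
  \<open>\<bar>D\<bar> \<le> 2\<^sup>-\<^sup>k + 2\<^sup>k D\<^sup>2\<close> makes the increments summable almost everywhere.\<close>

lemma riesz_fischer:
  assumes a: "summable (\<lambda>j. (a j)\<^sup>2)"
  obtains w where "w \<in> L2 S T" "\<And>n. dist2 S T w (lincomb a n) \<le> (\<Sum>j. (a (j + n))\<^sup>2)"
proof -
  define R where "R n = (\<Sum>j. (a (j + n))\<^sup>2)" for n
  have R: "(\<Sum>j\<in>{m..<n}. (a j)\<^sup>2) \<le> R m" if "m \<le> n" for m n
  proof -
    have "(\<Sum>j\<in>{m..<n}. (a j)\<^sup>2) = (\<Sum>j<n-m. (a (j + m))\<^sup>2)"
      using that sum.shift_bounds_nat_ivl[of "\<lambda>j. (a j)\<^sup>2" 0 m "n - m"] by (simp add: atLeast0LessThan)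
    also have "\<dots> \<le> R m" unfolding R_def by (rule sum_le_suminf) (use summable_ignore_initial_segment[OF a] in auto)
    finally show ?thesis .
  qed
  have R0: "R \<longlonglongrightarrow> 0" unfolding R_def using a by (rule suminf_exist_split2)
  have "\<exists>N. \<forall>n\<ge>N. R n < (1/4) ^ k" for k
    using order_tendstoD(2)[OF R0, of "(1/4) ^ k"] by (auto simp: eventually_sequentially)
  then obtain N where N: "\<And>k n. n \<ge> N k \<Longrightarrow> R n < (1/4) ^ k" by metis
  \<comment> \<open>The 1 belongs to the summand, so that \<open>r k \<ge> k\<close>; summation
    makes \<open>r\<close> monotone and at least \<open>N k\<close>.\<close>
  define r where "r k = (\<Sum>i\<le>k. N i + 1)" for k
  have rN: "r k \<ge> N k" for k unfolding r_def by (induction k) auto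
  have rmono: "r k \<le> r (Suc k)" for k unfolding r_def by simp
  have rk: "r k \<ge> k" for k unfolding r_def by (induction k) auto
  define s where "s n = lincomb a n" for n
  define D where "D k p = s (r (Suc k)) p - s (r k) p" for k p
  have sL: "s n \<in> L2 S T" for n unfolding s_def by (rule lincomb_L2)
  have sm [measurable]: "s n \<in> borel_measurable (Leb S T)" for n using sL[of n] unfolding L2_def by simp
  have Dm [measurable]: "D k \<in> borel_measurable (Leb S T)" for k unfolding D_def by measurable
  have D2: "(LINT p|Leb S T. (D k p)\<^sup>2) \<le> (1/4) ^ k" for k
  proof -
    have "(LINT p|Leb S T. (D k p)\<^sup>2) = dist2 S T (lincomb a (r (Suc k))) (lincomb a (r k))"
      unfolding D_def s_def l2_inner_def by (simp add: power2_eq_square)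
    also have "\<dots> = (\<Sum>j\<in>{r k..<r (Suc k)}. (a j)\<^sup>2)" by (rule dist2_lincomb_lincomb[OF rmono])
    also have "\<dots> \<le> R (r k)" by (rule R[OF rmono])
    also have "\<dots> \<le> (1/4) ^ k" using N[OF rN] by (rule less_imp_le)
    finally show ?thesis .
  qed
  have DL: "D k \<in> L2 S T" for k unfolding D_def by (intro L2_diff sL)
  interpret finite_measure "Leb S T" by (rule finite_measure_Leb)
  define m where "m = measure (Leb S T) (space (Leb S T))"
  have D1: "(LINT p|Leb S T. \<bar>D k p\<bar>) \<le> (1/2) ^ k * (m + 1)" for k
  proof -
    have i2: "integrable (Leb S T) (\<lambda>p. (D k p)\<^sup>2)" using DL[of k] unfolding L2_def by simp
    have "(LINT p|Leb S T. \<bar>D k p\<bar>) \<le> (LINT p|Leb S T. (1/2) ^ k + 2 ^ k * (D k p)\<^sup>2)"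
    proof (rule integral_mono)
      show "integrable (Leb S T) (\<lambda>p. \<bar>D k p\<bar>)"
        using L2_mult_integrable[OF DL osc_bounded_L2[OF S T osc_bounded_const[of _ _ 1]]] by (intro integrable_abs) simp
      fix p
      define x where "x = 2 ^ k * \<bar>D k p\<bar>"
      have "x \<le> 1 + x\<^sup>2"
      proof -
        have "0 \<le> (x - 1)\<^sup>2" "0 \<le> x" by (simp_all add: x_def)
        then show ?thesis by (simp add: power2_diff)
      qed
      then have "(1/2)^k * x \<le> (1/2)^k * (1 + x\<^sup>2)" by (intro mult_left_mono) auto
      moreover have "(1/2)^k * x = \<bar>D k p\<bar>" by (simp add: x_def power_one_over)
      moreover have "(1/2)^k * (1 + x\<^sup>2) = (1/2) ^ k + 2 ^ k * (D k p)\<^sup>2"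
        by (simp add: x_def power_mult_distrib power_one_over distrib_left power2_eq_square)
      ultimately show "\<bar>D k p\<bar> \<le> (1/2) ^ k + 2 ^ k * (D k p)\<^sup>2" by simp
    qed (use i2 in auto)
    also have "\<dots> = (1/2) ^ k * m + 2 ^ k * (LINT p|Leb S T. (D k p)\<^sup>2)"
      using i2 by (simp add: m_def mult.commute)
    also have "\<dots> \<le> (1/2) ^ k * m + 2 ^ k * (1/4) ^ k" using D2[of k] by simp
    also have "\<dots> = (1/2) ^ k * (m + 1)"
      by (simp add: distrib_left power_mult_distrib[symmetric])
    finally show ?thesis .
  qed
  have "(\<integral>\<^sup>+p. (\<Sum>k. ennreal \<bar>D k p\<bar>) \<partial>Leb S T) = (\<Sum>k. \<integral>\<^sup>+p. ennreal \<bar>D k p\<bar> \<partial>Leb S T)"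
    by (rule nn_integral_suminf) measurable
  also have "\<dots> \<le> (\<Sum>k. ennreal ((1/2) ^ k * (m + 1)))"
  proof (rule suminf_le)
    fix k
    have "integrable (Leb S T) (\<lambda>p. \<bar>D k p\<bar>)"
      using L2_mult_integrable[OF DL osc_bounded_L2[OF S T osc_bounded_const[of _ _ 1]]] by (intro integrable_abs) simp
    then have "(\<integral>\<^sup>+p. ennreal \<bar>D k p\<bar> \<partial>Leb S T) = ennreal (LINT p|Leb S T. \<bar>D k p\<bar>)"
      by (intro nn_integral_eq_integral) auto
    then show "(\<integral>\<^sup>+p. ennreal \<bar>D k p\<bar> \<partial>Leb S T) \<le> ennreal ((1/2) ^ k * (m + 1))"
      using D1[of k] by (simp add: ennreal_leI)
  qed auto
  also have "\<dots> = ennreal (\<Sum>k. (1/2) ^ k * (m + 1))"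
    by (rule suminf_ennreal2) (auto simp: m_def intro!: summable_mult2 summable_geometric)
  also have "\<dots> < \<infinity>" by simp
  finally have fin: "(\<integral>\<^sup>+p. (\<Sum>k. ennreal \<bar>D k p\<bar>) \<partial>Leb S T) \<noteq> \<infinity>" by simp
  have "AE p in Leb S T. (\<Sum>k. ennreal \<bar>D k p\<bar>) \<noteq> \<infinity>"
    by (rule nn_integral_PInf_AE[OF _ fin]) measurable
  then have conv: "AE p in Leb S T. convergent (\<lambda>k. s (r k) p)"
  proof eventually_elim
    case (elim p)
    then have "summable (\<lambda>k. \<bar>D k p\<bar>)" by (intro summable_suminf_not_top) auto
    then have "summable (\<lambda>k. D k p)" by (rule summable_rabs_cancel)
    then have "convergent (\<lambda>n. \<Sum>k<n. D k p)" by (simp add: summable_iff_convergent)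
    moreover have "(\<Sum>k<n. D k p) = s (r n) p - s (r 0) p" for n
      unfolding D_def by (rule sum_lessThan_telescope)
    ultimately have "convergent (\<lambda>n. s (r n) p - s (r 0) p)" by simp
    from convergent_add[OF this convergent_const[of "s (r 0) p"]] show ?case by simp
  qed
  \<comment> \<open>Where the subsequence diverges, \<open>lim\<close> is some arbitrary value;
    \<open>w\<close> is measurable all the same, and this happens on a null set only.\<close>
  define w where "w p = lim (\<lambda>k. s (r k) p)" for p
  have wm [measurable]: "w \<in> borel_measurable (Leb S T)" unfolding w_def by measurable
  \<comment> \<open>Fatou's lemma passes the bound on tails from the subsequence to the limit, and
    yields integrability along with the estimate.\<close>
  have fatou: "(\<integral>\<^sup>+p. ennreal ((w p - s n p)\<^sup>2) \<partial>Leb S T) \<le> ennreal (R n)" for n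
  proof -
    have "(\<integral>\<^sup>+p. ennreal ((w p - s n p)\<^sup>2) \<partial>Leb S T) = (\<integral>\<^sup>+p. liminf (\<lambda>k. ennreal ((s (r k) p - s n p)\<^sup>2)) \<partial>Leb S T)"
      using conv
    proof (intro nn_integral_cong_AE, eventually_elim)
      case (elim p)
      then have "(\<lambda>k. s (r k) p) \<longlonglongrightarrow> w p" unfolding w_def by (simp add: convergent_LIMSEQ_iff)
      then have "(\<lambda>k. ennreal ((s (r k) p - s n p)\<^sup>2)) \<longlonglongrightarrow> ennreal ((w p - s n p)\<^sup>2)"
        by (intro tendsto_ennrealI tendsto_intros)
      then show ?case by (rule lim_imp_Liminf[OF sequentially_bot, symmetric])
    qed
    also have "\<dots> \<le> liminf (\<lambda>k. \<integral>\<^sup>+p. ennreal ((s (r k) p - s n p)\<^sup>2) \<partial>Leb S T)"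
      by (rule nn_integral_liminf) measurable
    also have "\<dots> \<le> liminf (\<lambda>k. ennreal (R n))"
    proof (rule Liminf_mono)
      show "\<forall>\<^sub>F k in sequentially. (\<integral>\<^sup>+p. ennreal ((s (r k) p - s n p)\<^sup>2) \<partial>Leb S T) \<le> ennreal (R n)"
        using eventually_ge_at_top[of n]
      proof eventually_elim
        case (elim k)
        then have nr: "n \<le> r k" using rk[of k] by simp
        have "(\<lambda>p. s (r k) p - s n p) \<in> L2 S T" by (intro L2_diff sL)
        then have "(\<integral>\<^sup>+p. ennreal ((s (r k) p - s n p)\<^sup>2) \<partial>Leb S T) = ennreal (LINT p|Leb S T. (s (r k) p - s n p)\<^sup>2)"
          unfolding L2_def by (intro nn_integral_eq_integral) auto
        also have "(LINT p|Leb S T. (s (r k) p - s n p)\<^sup>2) = dist2 S T (lincomb a (r k)) (lincomb a n)"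
          unfolding s_def l2_inner_def by (simp add: power2_eq_square)
        also have "\<dots> \<le> R n" unfolding dist2_lincomb_lincomb[OF nr] by (rule R[OF nr])
        finally show ?case by (simp add: ennreal_leI)
      qed
    qed
    also have "\<dots> = ennreal (R n)" by (rule Liminf_const) simp
    finally show ?thesis .
  qed
  have wi: "integrable (Leb S T) (\<lambda>p. (w p - s n p)\<^sup>2)" for n
    by (rule integrableI_nonneg) (use fatou[of n] in \<open>auto intro: le_less_trans\<close>)
  have wsL: "(\<lambda>p. w p - s n p) \<in> L2 S T" for n using wi[of n] unfolding L2_def by simp
  have "w \<in> L2 S T" using L2_add[OF wsL[of 0] sL[of 0]] by simp
  moreover have "dist2 S T w (lincomb a n) \<le> (\<Sum>j. (a (j + n))\<^sup>2)" for n
  proof -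
    have "ennreal (LINT p|Leb S T. (w p - s n p)\<^sup>2) \<le> ennreal (R n)"
      using fatou[of n] nn_integral_eq_integral[OF wi[of n]] by simp
    moreover have "R n \<ge> 0" unfolding R_def
      by (rule suminf_nonneg) (use summable_ignore_initial_segment[OF a] in auto)
    ultimately have "(LINT p|Leb S T. (w p - s n p)\<^sup>2) \<le> R n" by simp
    then show ?thesis unfolding R_def s_def l2_inner_def by (simp add: power2_eq_square)
  qed
  ultimately show ?thesis using that by blast
qed

text \<open>The Riesz--Fischer limit \<open>w\<close> of the coordinates of \<open>u\<close> has the
  same coordinates as \<open>u\<close>. Completeness forces \<open>u - w\<close> to have norm 0, and
  the tail estimate for \<open>w\<close> becomes one for \<open>u\<close>.\<close>

lemma parseval:
  assumes u: "u \<in> L2 S T"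
  shows "(\<lambda>j. (ip u (\<phi> j))\<^sup>2) sums ip u u"
proof -
  define a where "a j = ip u (\<phi> j)" for j
  have a: "summable (\<lambda>j. (a j)\<^sup>2)" unfolding a_def by (rule coords_summable[OF u])
  obtain w where w: "w \<in> L2 S T" "\<And>n. dist2 S T w (lincomb a n) \<le> (\<Sum>j. (a (j + n))\<^sup>2)"
    using riesz_fischer[OF a] by blast
  have R0: "(\<lambda>n. \<Sum>j. (a (j + n))\<^sup>2) \<longlonglongrightarrow> 0" using a by (rule suminf_exist_split2)
  have uw: "(\<lambda>p. u p - w p) \<in> L2 S T" by (rule L2_diff[OF u w(1)])
  have "ip (\<lambda>p. u p - w p) (\<phi> i) = 0" for i
  proof -
    \<comment> \<open>For \<open>n > i\<close> the partial sum has the \<open>i\<close>-th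
      coordinate of \<open>u\<close>, so this coordinate of \<open>u - w\<close> is controlled by
      the distance of \<open>w\<close> from the partial sum.\<close>
    have "(ip (\<lambda>p. u p - w p) (\<phi> i))\<^sup>2 \<le> (\<Sum>j. (a (j + n))\<^sup>2)" if "n > i" for n
    proof -
      have "(\<lambda>p. w p - lincomb a n p) \<in> L2 S T" by (rule L2_diff[OF w(1) lincomb_L2])
      from coord_le[OF this, of i] w(2)[of n]
      have "(ip (\<lambda>p. w p - lincomb a n p) (\<phi> i))\<^sup>2 \<le> (\<Sum>j. (a (j + n))\<^sup>2)" by linarith
      moreover have "ip (\<lambda>p. w p - lincomb a n p) (\<phi> i) = - ip (\<lambda>p. u p - w p) (\<phi> i)"
        using that by (simp add: l2_inner_diff_left w(1) u lincomb_L2 phi_L2 ip_lincomb_phi a_def)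
      ultimately show ?thesis by simp
    qed
    then have "eventually (\<lambda>n. (ip (\<lambda>p. u p - w p) (\<phi> i))\<^sup>2 \<le> (\<Sum>j. (a (j + n))\<^sup>2)) sequentially"
      by (rule eventually_mono[OF eventually_gt_at_top[of i]])
    from tendsto_lowerbound[OF R0 this] show ?thesis by simp
  qed
  then have "l2_norm S T (\<lambda>p. u p - w p) = 0"
    using onb uw unfolding complete_orthonormal_BV_def by blast
  then have uw0: "dist2 S T u w = 0"
    unfolding l2_norm_def using l2_inner_self_nonneg by simp
  have b: "\<bar>ip u u - (\<Sum>j<n. (a j)\<^sup>2)\<bar> \<le> 2 * (\<Sum>j. (a (j + n))\<^sup>2)" for n
  proof -
    have "ip u u - (\<Sum>j<n. (a j)\<^sup>2) = dist2 S T u (lincomb a n)"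
      unfolding dist2_lincomb[OF u] a_def by simp
    moreover have "\<dots> \<ge> 0" by (rule l2_inner_self_nonneg)
    moreover have "dist2 S T u (lincomb a n) \<le> 2 * dist2 S T u w + 2 * dist2 S T w (lincomb a n)"
      by (rule dist2_triangle[OF u w(1) lincomb_L2])
    ultimately show ?thesis using w(2)[of n] uw0 by linarith
  qed
  have "(\<lambda>n. ip u u - (\<Sum>j<n. (a j)\<^sup>2)) \<longlonglongrightarrow> 0"
  proof (rule tendsto_rabs_zero_cancel, rule tendsto_sandwich[OF _ _ tendsto_const])
    show "(\<lambda>n. 2 * (\<Sum>j. (a (j + n))\<^sup>2)) \<longlonglongrightarrow> 0" using tendsto_mult_right_zero[OF R0, of 2] .
  qed (use b in auto)
  from tendsto_diff[OF tendsto_const[of "ip u u"] this] show ?thesis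
    unfolding sums_def a_def by simp
qed

lemma parseval_inner:
  assumes u: "u \<in> L2 S T" and v: "v \<in> L2 S T"
  shows "(\<lambda>j. ip u (\<phi> j) * ip v (\<phi> j)) sums ip u v"
proof -
  have "(\<lambda>j. (1/2) * ((ip u (\<phi> j))\<^sup>2 + (ip v (\<phi> j))\<^sup>2 - (ip (\<lambda>p. u p - v p) (\<phi> j))\<^sup>2)) sums
      ((1/2) * (ip u u + ip v v - dist2 S T u v))"
    by (intro sums_mult sums_add sums_diff parseval u v L2_diff)
  moreover have "(1/2) * (ip u u + ip v v - dist2 S T u v) = ip u v"
    unfolding dist2_expand[OF u v] by simp
  moreover have "(1/2) * ((ip u (\<phi> j))\<^sup>2 + (ip v (\<phi> j))\<^sup>2 - (ip (\<lambda>p. u p - v p) (\<phi> j))\<^sup>2) = ip u (\<phi> j) * ip v (\<phi> j)" for j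
    unfolding l2_inner_diff_left[OF u v phi_L2] by (simp add: power2_eq_square algebra_simps)
  ultimately show ?thesis by simp
qed

section \<open>Measurability in terms of coordinates\<close>

lemma space_L2_borel: "space (L2_borel S T) = L2 S T"
  unfolding L2_borel_def by (rule space_measure_of) (auto simp: L2_open_def)

lemma sets_L2_borel: "sets (L2_borel S T) = sigma_sets (L2 S T) {U. L2_open S T U}"
  unfolding L2_borel_def by (rule sets_measure_of) (auto simp: L2_open_def)

lemma L2_open_sets: "L2_open S T U \<Longrightarrow> U \<in> sets (L2_borel S T)"
  unfolding sets_L2_borel by (rule sigma_sets.Basic) simp

lemma L2_openD:
  assumes "L2_open S T U" "u \<in> U"
  obtains e where "e > 0" "\<And>v. v \<in> L2 S T \<Longrightarrow> dist2 S T v u < e \<Longrightarrow> v \<in> U"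
proof -
  from assms obtain e where e: "e > 0" "\<And>v. v \<in> L2 S T \<Longrightarrow> l2_norm S T (\<lambda>p. v p - u p) < e \<Longrightarrow> v \<in> U"
    unfolding L2_open_def by blast
  have "v \<in> U" if "v \<in> L2 S T" "dist2 S T v u < e\<^sup>2" for v
  proof (rule e(2)[OF that(1)])
    have "l2_norm S T (\<lambda>p. v p - u p) < sqrt (e\<^sup>2)" unfolding l2_norm_def using that(2) by (rule real_sqrt_less_mono)
    then show "l2_norm S T (\<lambda>p. v p - u p) < e" using e(1) by simp
  qed
  then show ?thesis using that[of "e\<^sup>2"] e(1) by simp
qed

lemma coord_measurable: "(\<lambda>u. ip u (\<phi> j)) \<in> borel_measurable (L2_borel S T)"
proof (rule borel_measurableI)
  fix B :: "real set" assume B: "open B"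
  have "L2_open S T ((\<lambda>u. ip u (\<phi> j)) -` B \<inter> L2 S T)"
    unfolding L2_open_def
  proof (intro conjI ballI)
    fix u assume u: "u \<in> (\<lambda>u. ip u (\<phi> j)) -` B \<inter> L2 S T"
    then obtain e where e: "e > 0" "\<And>y. dist y (ip u (\<phi> j)) < e \<Longrightarrow> y \<in> B"
      using B unfolding open_dist by blast
    have "v \<in> (\<lambda>u. ip u (\<phi> j)) -` B \<inter> L2 S T" if v: "v \<in> L2 S T" "l2_norm S T (\<lambda>p. v p - u p) < e" for v
    proof -
      have vu: "(\<lambda>p. v p - u p) \<in> L2 S T" using u v by (intro L2_diff) auto
      have "\<bar>ip v (\<phi> j) - ip u (\<phi> j)\<bar> = sqrt ((ip (\<lambda>p. v p - u p) (\<phi> j))\<^sup>2)"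
        using u v by (simp add: l2_inner_diff_left phi_L2)
      also have "\<dots> \<le> l2_norm S T (\<lambda>p. v p - u p)"
        unfolding l2_norm_def by (rule real_sqrt_le_mono[OF coord_le[OF vu]])
      finally show ?thesis using v e(2) by (auto simp: dist_real_def)
    qed
    then show "\<exists>\<epsilon>>0. \<forall>v\<in>L2 S T. l2_norm S T (\<lambda>p. v p - u p) < \<epsilon> \<longrightarrow> v \<in> (\<lambda>u. ip u (\<phi> j)) -` B \<inter> L2 S T"
      using e(1) by blast
  qed auto
  then show "(\<lambda>u. ip u (\<phi> j)) -` B \<inter> space (L2_borel S T) \<in> sets (L2_borel S T)"
    unfolding space_L2_borel by (rule L2_open_sets)
qed

definition L2_ball :: "(real \<times> real \<Rightarrow> real) \<Rightarrow> real \<Rightarrow> (real \<times> real \<Rightarrow> real) set" where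
  "L2_ball v r = {u \<in> L2 S T. dist2 S T u v < r}"

text \<open>Finite rational combinations, indexed by lists so that countability is
  immediate.\<close>

definition rat_centers :: "(real \<times> real \<Rightarrow> real) set" where
  "rat_centers = range (\<lambda>qs :: rat list. lincomb (\<lambda>j. of_rat (qs ! j)) (length qs))"

lemma countable_rat_centers: "countable rat_centers"
  unfolding rat_centers_def by (rule countable_image) simp

lemma rat_centers_L2: "d \<in> rat_centers \<Longrightarrow> d \<in> L2 S T"
  unfolding rat_centers_def using lincomb_L2 by auto

lemma rat_centers_dense:
  assumes u: "u \<in> L2 S T" and e: "e > 0"
  shows "\<exists>d\<in>rat_centers. dist2 S T u d < e"
proof -
  have "(\<lambda>n. ip u u - (\<Sum>j<n. (ip u (\<phi> j))\<^sup>2)) \<longlonglongrightarrow> ip u u - ip u u"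
    using parseval[OF u] unfolding sums_def by (intro tendsto_intros)
  then have "eventually (\<lambda>n. ip u u - (\<Sum>j<n. (ip u (\<phi> j))\<^sup>2) < e / 2) sequentially"
    using e by (intro order_tendstoD(2)) auto
  then obtain n where n: "ip u u - (\<Sum>j<n. (ip u (\<phi> j))\<^sup>2) < e / 2" by (auto simp: eventually_sequentially)
  \<comment> \<open>Chosen so that \<open>n\<close> squared errors sum to at most
    \<open>e / 2\<close>; \<open>Suc n\<close> covers \<open>n = 0\<close>.\<close>
  define \<eta> where "\<eta> = sqrt (e / (2 * real (Suc n)))"
  have \<eta>: "\<eta> > 0" "\<eta>\<^sup>2 = e / (2 * real (Suc n))" using e by (auto simp: \<eta>_def)
  have "\<exists>q :: rat. \<bar>ip u (\<phi> j) - of_rat q\<bar> < \<eta>" for j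
  proof -
    obtain q :: rat where "ip u (\<phi> j) - \<eta> < of_rat q" "of_rat q < ip u (\<phi> j) + \<eta>"
      using of_rat_dense[of "ip u (\<phi> j) - \<eta>" "ip u (\<phi> j) + \<eta>"] \<eta>(1) by auto
    then show ?thesis by (intro exI[of _ q]) (simp add: abs_if)
  qed
  then obtain q :: "nat \<Rightarrow> rat" where q: "\<And>j. \<bar>ip u (\<phi> j) - of_rat (q j)\<bar> < \<eta>" by metis
  define qs where "qs = map q [0..<n]"
  define d where "d = lincomb (\<lambda>j. of_rat (qs ! j)) (length qs)"
  have "d \<in> rat_centers" unfolding d_def rat_centers_def by simp
  have dn: "d = lincomb (\<lambda>j. of_rat (q j)) n"
    unfolding d_def qs_def lincomb_def by (intro ext) simp
  have "(\<Sum>j<n. (ip u (\<phi> j) - of_rat (q j))\<^sup>2) \<le> (\<Sum>j<n. e / (2 * real (Suc n)))"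
    unfolding \<eta>(2)[symmetric] by (intro sum_mono abs_le_square_iff[THEN iffD1]) (use q \<eta>(1) less_imp_le in auto)
  also have "\<dots> \<le> e / 2" using e by (simp add: field_simps)
  finally have "dist2 S T u d < e" unfolding dn dist2_lincomb[OF u] using n by linarith
  then show ?thesis using \<open>d \<in> rat_centers\<close> by blast
qed

lemma L2_open_countable_balls:
  assumes U: "L2_open S T U"
  shows "U = (\<Union>(d, k)\<in>{(d, k :: nat). d \<in> rat_centers \<and> L2_ball d (1 / real (Suc k)) \<subseteq> U}. L2_ball d (1 / real (Suc k)))"
proof
  show "U \<subseteq> (\<Union>(d, k)\<in>{(d, k :: nat). d \<in> rat_centers \<and> L2_ball d (1 / real (Suc k)) \<subseteq> U}. L2_ball d (1 / real (Suc k)))"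
  proof
    fix u assume uU: "u \<in> U"
    then have u: "u \<in> L2 S T" using U unfolding L2_open_def by auto
    obtain e where e: "e > 0" "\<And>v. v \<in> L2 S T \<Longrightarrow> dist2 S T v u < e \<Longrightarrow> v \<in> U"
      using L2_openD[OF U uU] by blast
    \<comment> \<open>Any point of the small ball and \<open>u\<close> are both within squared
      distance \<open>1 / Suc k\<close> of the centre, so the triangle inequality with factor 2
      gives \<open>4 / Suc k < e\<close>.\<close>
    obtain k where k: "1 / real (Suc k) < e / 4"
      using reals_Archimedean[of "e / 4"] e(1) by (auto simp: inverse_eq_divide simp del: of_nat_Suc)
    obtain d where d: "d \<in> rat_centers" "dist2 S T u d < 1 / real (Suc k)"
      using rat_centers_dense[OF u, of "1 / real (Suc k)"] by auto
    have "L2_ball d (1 / real (Suc k)) \<subseteq> U"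
    proof
      fix v assume v: "v \<in> L2_ball d (1 / real (Suc k))"
      have vL: "v \<in> L2 S T" using v unfolding L2_ball_def by simp
      have "dist2 S T v u \<le> 2 * dist2 S T v d + 2 * dist2 S T d u"
        by (rule dist2_triangle[OF vL rat_centers_L2[OF d(1)] u])
      also have "\<dots> < e" using v d(2) k dist2_commute[of S T d u] unfolding L2_ball_def by simp
      finally show "v \<in> U" by (rule e(2)[OF vL])
    qed
    moreover have "u \<in> L2_ball d (1 / real (Suc k))" unfolding L2_ball_def using u d by simp
    ultimately show "u \<in> (\<Union>(d, k)\<in>{(d, k :: nat). d \<in> rat_centers \<and> L2_ball d (1 / real (Suc k)) \<subseteq> U}. L2_ball d (1 / real (Suc k)))"
      using d(1) by (intro UN_I[of "(d, k)"]) auto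
  qed
  show "(\<Union>(d, k)\<in>{(d, k :: nat). d \<in> rat_centers \<and> L2_ball d (1 / real (Suc k)) \<subseteq> U}. L2_ball d (1 / real (Suc k))) \<subseteq> U"
    by (rule UN_least) (simp add: split_beta)
qed

text \<open>By separability an open set is a countable union of balls, and Parseval expresses a ball
  through coordinates. Measurability of coordinates is thus a sufficient criterion for all maps
  below.\<close>

lemma measurable_L2_borelI:
  assumes sp: "\<And>\<omega>. \<omega> \<in> space N \<Longrightarrow> \<psi> \<omega> \<in> L2 S T"
    and coord: "\<And>j. (\<lambda>\<omega>. ip (\<psi> \<omega>) (\<phi> j)) \<in> borel_measurable N"
  shows "\<psi> \<in> N \<rightarrow>\<^sub>M L2_borel S T"
  unfolding L2_borel_def
proof (rule measurable_measure_of)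
  fix U assume "U \<in> {U. L2_open S T U}"
  then have U: "L2_open S T U" by simp
  have ball: "\<psi> -` L2_ball d r \<inter> space N \<in> sets N" if d: "d \<in> L2 S T" for d r
  proof -
    have "\<psi> -` L2_ball d r \<inter> space N = {\<omega> \<in> space N. (\<Sum>j. (ip (\<psi> \<omega>) (\<phi> j) - ip d (\<phi> j))\<^sup>2) < r}"
    proof -
      have "dist2 S T (\<psi> \<omega>) d = (\<Sum>j. (ip (\<psi> \<omega>) (\<phi> j) - ip d (\<phi> j))\<^sup>2)" if "\<omega> \<in> space N" for \<omega>
        using sums_unique[OF parseval[OF L2_diff[OF sp[OF that] d]]] sp[OF that] d
        by (simp add: l2_inner_diff_left phi_L2)
      then show ?thesis using sp unfolding L2_ball_def by auto
    qed
    also have "\<dots> \<in> sets N" using coord by measurable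
    finally show ?thesis .
  qed
  define C where "C = {(d, k :: nat). d \<in> rat_centers \<and> L2_ball d (1 / real (Suc k)) \<subseteq> U}"
  have Csub: "C \<subseteq> rat_centers \<times> UNIV" unfolding C_def by auto
  then have C: "countable C" by (rule countable_subset) (intro countable_SIGMA countable_rat_centers, simp)
  have "U = (\<Union>x\<in>C. L2_ball (fst x) (1 / real (Suc (snd x))))"
    using L2_open_countable_balls[OF U] unfolding C_def split_beta .
  then have "\<psi> -` U \<inter> space N = (\<Union>x\<in>C. \<psi> -` L2_ball (fst x) (1 / real (Suc (snd x))) \<inter> space N)"
    by blast
  also have "\<dots> \<in> sets N"
    by (rule sets.countable_UN'[OF C]) (use Csub in \<open>auto intro!: ball rat_centers_L2\<close>)
  finally show "\<psi> -` U \<inter> space N \<in> sets N" .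
qed (use sp in \<open>auto simp: L2_open_def\<close>)

lemma L2_measurable_space: "\<psi> \<in> N \<rightarrow>\<^sub>M L2_borel S T \<Longrightarrow> \<omega> \<in> space N \<Longrightarrow> \<psi> \<omega> \<in> L2 S T"
  using measurable_space[of \<psi> N "L2_borel S T" \<omega>] by (simp add: space_L2_borel)

lemma measurable_coord: "\<psi> \<in> N \<rightarrow>\<^sub>M L2_borel S T \<Longrightarrow> (\<lambda>\<omega>. ip (\<psi> \<omega>) (\<phi> j)) \<in> borel_measurable N"
  by (rule measurable_compose[OF _ coord_measurable])

text \<open>Both arguments vary with \<open>\<omega>\<close>; the series of products of coordinates
  reduces this to real functions.\<close>

lemma measurable_ip:
  assumes 1: "\<psi> \<in> N \<rightarrow>\<^sub>M L2_borel S T" and 2: "\<psi>' \<in> N \<rightarrow>\<^sub>M L2_borel S T"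
  shows "(\<lambda>\<omega>. ip (\<psi> \<omega>) (\<psi>' \<omega>)) \<in> borel_measurable N"
proof -
  note [measurable] = measurable_coord[OF 1] measurable_coord[OF 2]
  have "(\<lambda>\<omega>. \<Sum>j. ip (\<psi> \<omega>) (\<phi> j) * ip (\<psi>' \<omega>) (\<phi> j)) \<in> borel_measurable N" by measurable
  moreover have "(\<Sum>j. ip (\<psi> \<omega>) (\<phi> j) * ip (\<psi>' \<omega>) (\<phi> j)) = ip (\<psi> \<omega>) (\<psi>' \<omega>)" if "\<omega> \<in> space N" for \<omega>
    by (rule sums_unique[symmetric, OF parseval_inner[OF L2_measurable_space[OF 1 that] L2_measurable_space[OF 2 that]]])
  ultimately show ?thesis by (simp cong: measurable_cong)
qed

lemma measurable_L2_const: "v \<in> L2 S T \<Longrightarrow> (\<lambda>\<omega>. v) \<in> N \<rightarrow>\<^sub>M L2_borel S T"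
  by (rule measurable_const) (simp add: space_L2_borel)

lemma measurable_L2_lin:
  assumes 1: "\<psi> \<in> N \<rightarrow>\<^sub>M L2_borel S T" and 2: "\<psi>' \<in> N \<rightarrow>\<^sub>M L2_borel S T"
  shows "(\<lambda>\<omega> p. a * \<psi> \<omega> p + b * \<psi>' \<omega> p) \<in> N \<rightarrow>\<^sub>M L2_borel S T"
proof (rule measurable_L2_borelI)
  note L = L2_measurable_space[OF 1] L2_measurable_space[OF 2]
  show "(\<lambda>p. a * \<psi> \<omega> p + b * \<psi>' \<omega> p) \<in> L2 S T" if "\<omega> \<in> space N" for \<omega>
    by (intro L2_add L2_scale L that)
  fix j
  have "(\<lambda>\<omega>. a * ip (\<psi> \<omega>) (\<phi> j) + b * ip (\<psi>' \<omega>) (\<phi> j)) \<in> borel_measurable N"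
    using measurable_coord[OF 1] measurable_coord[OF 2] by measurable
  moreover have "ip (\<lambda>p. a * \<psi> \<omega> p + b * \<psi>' \<omega> p) (\<phi> j) = a * ip (\<psi> \<omega>) (\<phi> j) + b * ip (\<psi>' \<omega>) (\<phi> j)" if "\<omega> \<in> space N" for \<omega>
    using L[OF that] by (simp add: l2_inner_add_left l2_inner_scale_left L2_scale phi_L2)
  ultimately show "(\<lambda>\<omega>. ip (\<lambda>p. a * \<psi> \<omega> p + b * \<psi>' \<omega> p) (\<phi> j)) \<in> borel_measurable N"
    by (simp cong: measurable_cong)
qed

lemma L2_mult_osc:
  assumes "u \<in> L2 S T" "osc_bounded S T h"
  shows "(\<lambda>p. u p * h p) \<in> L2 S T"
proof -
  obtain C where C: "\<And>p. p \<in> Q S T \<Longrightarrow> \<bar>h p\<bar> \<le> C" using osc_bounded_bound[OF S T assms(2)] by blast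
  show ?thesis by (rule L2_mult_bounded[OF assms(1) osc_bounded_measurable[OF S T assms(2)] C])
qed

text \<open>Multiplication by \<open>h\<close> is symmetric, so the coordinates of the product are
  inner products of \<open>\<psi> \<omega>\<close> with the fixed functions
  \<open>\<phi> j * h\<close>.\<close>

lemma measurable_L2_mult:
  assumes 1: "\<psi> \<in> N \<rightarrow>\<^sub>M L2_borel S T" and h: "osc_bounded S T h"
  shows "(\<lambda>\<omega> p. \<psi> \<omega> p * h p) \<in> N \<rightarrow>\<^sub>M L2_borel S T"
proof (rule measurable_L2_borelI)
  show "(\<lambda>p. \<psi> \<omega> p * h p) \<in> L2 S T" if "\<omega> \<in> space N" for \<omega>
    by (intro L2_mult_osc h L2_measurable_space[OF 1 that])
  fix j
  have "(\<lambda>\<omega>. ip (\<psi> \<omega>) (\<lambda>p. \<phi> j p * h p)) \<in> borel_measurable N"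
    by (intro measurable_ip 1 measurable_L2_const L2_mult_osc phi_L2 h)
  moreover have "ip (\<lambda>p. \<psi> \<omega> p * h p) (\<phi> j) = ip (\<psi> \<omega>) (\<lambda>p. \<phi> j p * h p)" for \<omega>
    unfolding l2_inner_def by (simp add: mult_ac)
  ultimately show "(\<lambda>\<omega>. ip (\<lambda>p. \<psi> \<omega> p * h p) (\<phi> j)) \<in> borel_measurable N" by simp
qed

lemma Supp_BV_osc: "h \<in> Supp_BV S T \<Longrightarrow> osc_bounded S T h"
  unfolding Supp_BV_def using BV_HK_osc_bounded[OF S T] by simp

end


section \<open>Gaussian law of the Riemann--Stieltjes integrals\<close>


lemma normal_moment_2_4:
  assumes "\<sigma> > 0"
  shows "has_bochner_integral lborel (\<lambda>x. normal_density 0 \<sigma> x * x\<^sup>2) (\<sigma>\<^sup>2)"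
    "has_bochner_integral lborel (\<lambda>x. normal_density 0 \<sigma> x * x ^ 4) (3 * \<sigma> ^ 4)"
proof -
  have 2: "fact (2 * 1) / ((2 / \<sigma>\<^sup>2) ^ 1 * fact 1) = \<sigma>\<^sup>2" by (simp add: fact_numeral)
  have 4: "fact (2 * 2) / ((2 / \<sigma>\<^sup>2) ^ 2 * fact 2) = 3 * \<sigma> ^ 4"
    using assms by (simp add: fact_numeral power_divide power2_eq_square power4_eq_xxxx)
  show "has_bochner_integral lborel (\<lambda>x. normal_density 0 \<sigma> x * x\<^sup>2) (\<sigma>\<^sup>2)"
    using normal_moment_even[OF assms, of 0 1] unfolding 2 by simp
  show "has_bochner_integral lborel (\<lambda>x. normal_density 0 \<sigma> x * x ^ 4) (3 * \<sigma> ^ 4)"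
    using normal_moment_even[OF assms, of 0 2] unfolding 4 by simp
qed

lemma normal_char:
  assumes "\<sigma> > 0"
  shows "(LINT x|lborel. normal_density 0 \<sigma> x *\<^sub>R exp (\<i> * complex_of_real (\<theta> * x))) = complex_of_real (exp (- (\<theta>\<^sup>2 * \<sigma>\<^sup>2 / 2)))"
proof -
  have dens: "\<sigma> * normal_density 0 \<sigma> (\<sigma> * x) = std_normal_density x" for x
    using assms unfolding normal_density_def std_normal_density_def
    by (simp add: real_sqrt_mult power_mult_distrib)
  have "(LINT x|lborel. normal_density 0 \<sigma> x *\<^sub>R exp (\<i> * complex_of_real (\<theta> * x))) =
      \<bar>\<sigma>\<bar> *\<^sub>R (LINT x|lborel. normal_density 0 \<sigma> (0 + \<sigma> * x) *\<^sub>R exp (\<i> * complex_of_real (\<theta> * (0 + \<sigma> * x))))"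
    by (rule lborel_integral_real_affine) (use assms in simp)
  also have "\<dots> = (LINT x|lborel. (\<sigma> * normal_density 0 \<sigma> (\<sigma> * x)) *\<^sub>R exp (\<i> * complex_of_real (\<theta> * \<sigma> * x)))"
    using assms by (simp add: integral_scaleR_right[symmetric] mult.assoc del: integral_scaleR_right)
  also have "\<dots> = (LINT x|lborel. std_normal_density x *\<^sub>R exp (\<i> * complex_of_real (\<theta> * \<sigma> * x)))"
    unfolding dens ..
  also have "\<dots> = char std_normal_distribution (\<theta> * \<sigma>)"
    unfolding char_def by (subst integral_density) (auto simp: normal_density_nonneg)
  also have "\<dots> = complex_of_real (exp (- (\<theta>\<^sup>2 * \<sigma>\<^sup>2 / 2)))"
    unfolding char_std_normal_distribution by (simp add: power_mult_distrib)
  finally show ?thesis .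
qed

text \<open>Everything is expressed by the second moment, so that the degenerate law is covered and
  limits of variances can be taken. The fourth moment is an \<open>nn_integral\<close> because
  Fatou's lemma will be applied to it.\<close>

lemma centered_normal_facts:
  assumes "centered_normal \<nu>"
  shows "integrable \<nu> (\<lambda>r. r\<^sup>2)"
    "(LINT r|\<nu>. exp (\<i> * complex_of_real (\<theta> * r))) = complex_of_real (exp (- (\<theta>\<^sup>2 * (LINT r|\<nu>. r\<^sup>2) / 2)))"
    "(\<integral>\<^sup>+r. ennreal (r ^ 4) \<partial>\<nu>) = ennreal (3 * (LINT r|\<nu>. r\<^sup>2)\<^sup>2)"
proof -
  have "integrable \<nu> (\<lambda>r. r\<^sup>2) \<and>
    (LINT r|\<nu>. exp (\<i> * complex_of_real (\<theta> * r))) = complex_of_real (exp (- (\<theta>\<^sup>2 * (LINT r|\<nu>. r\<^sup>2) / 2))) \<and>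
    (\<integral>\<^sup>+r. ennreal (r ^ 4) \<partial>\<nu>) = ennreal (3 * (LINT r|\<nu>. r\<^sup>2)\<^sup>2)"
    using assms unfolding centered_normal_def
  proof (elim disjE exE conjE)
    assume \<nu>: "\<nu> = return borel 0"
    have "integrable \<nu> (\<lambda>r. r\<^sup>2)"
      unfolding \<nu> by (rule integrableI_bounded) (auto simp: nn_integral_return)
    then show ?thesis unfolding \<nu> by (simp add: integral_return nn_integral_return)
  next
    fix \<sigma> :: real assume \<sigma>: "\<sigma> > 0" and \<nu>: "\<nu> = density lborel (\<lambda>r. ennreal (normal_density 0 \<sigma> r))"
    note m = normal_moment_2_4[OF \<sigma>]
    have i: "integrable \<nu> (\<lambda>r. r\<^sup>2)"
      unfolding \<nu> using m(1) by (subst integrable_density) (auto simp: has_bochner_integral_iff)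
    have v: "(LINT r|\<nu>. r\<^sup>2) = \<sigma>\<^sup>2"
      unfolding \<nu> using m(1) by (subst integral_density) (auto simp: has_bochner_integral_iff)
    have c: "(LINT r|\<nu>. exp (\<i> * complex_of_real (\<theta> * r))) = (LINT x|lborel. normal_density 0 \<sigma> x *\<^sub>R exp (\<i> * complex_of_real (\<theta> * x)))"
      unfolding \<nu> by (subst integral_density) auto
    have "(\<integral>\<^sup>+r. ennreal (r ^ 4) \<partial>\<nu>) = (\<integral>\<^sup>+r. ennreal (normal_density 0 \<sigma> r * r ^ 4) \<partial>lborel)"
      unfolding \<nu> by (subst nn_integral_density) (auto simp: ennreal_mult)
    also have "\<dots> = ennreal (3 * \<sigma> ^ 4)"
      using m(2) by (subst nn_integral_eq_integral) (auto simp: has_bochner_integral_iff)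
    also have "\<dots> = ennreal (3 * (LINT r|\<nu>. r\<^sup>2)\<^sup>2)" unfolding v by (simp add: power_mult[symmetric])
    finally show ?thesis using i v c normal_char[OF \<sigma>, of \<theta>] by simp
  qed
  then show "integrable \<nu> (\<lambda>r. r\<^sup>2)"
    "(LINT r|\<nu>. exp (\<i> * complex_of_real (\<theta> * r))) = complex_of_real (exp (- (\<theta>\<^sup>2 * (LINT r|\<nu>. r\<^sup>2) / 2)))"
    "(\<integral>\<^sup>+r. ennreal (r ^ 4) \<partial>\<nu>) = ennreal (3 * (LINT r|\<nu>. r\<^sup>2)\<^sup>2)" by auto
qed

lemma centered_normal_distr_facts:
  assumes X: "X \<in> borel_measurable M" and cn: "centered_normal (distr M borel X)"
  shows "integrable M (\<lambda>x. (X x)\<^sup>2)"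
    "(LINT x|M. exp (\<i> * complex_of_real (\<theta> * X x))) = complex_of_real (exp (- (\<theta>\<^sup>2 * (LINT x|M. (X x)\<^sup>2) / 2)))"
    "(\<integral>\<^sup>+x. ennreal (X x ^ 4) \<partial>M) = ennreal (3 * (LINT x|M. (X x)\<^sup>2)\<^sup>2)"
proof -
  note f = centered_normal_facts[OF cn]
  have v: "(LINT r|distr M borel X. r\<^sup>2) = (LINT x|M. (X x)\<^sup>2)" by (rule integral_distr[OF X]) simp
  show "integrable M (\<lambda>x. (X x)\<^sup>2)" using f(1) by (subst (asm) integrable_distr_eq[OF X]) auto
  show "(LINT x|M. exp (\<i> * complex_of_real (\<theta> * X x))) = complex_of_real (exp (- (\<theta>\<^sup>2 * (LINT x|M. (X x)\<^sup>2) / 2)))"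
    using f(2)[of \<theta>] unfolding v by (subst (asm) integral_distr[OF X]) auto
  show "(\<integral>\<^sup>+x. ennreal (X x ^ 4) \<partial>M) = ennreal (3 * (LINT x|M. (X x)\<^sup>2)\<^sup>2)"
    using f(3) unfolding v by (subst (asm) nn_integral_distr[OF X]) auto
qed

text \<open>\<open>m0\<close> is the measure before completion. Fubini and measurability arguments
  take place there; the completion returns only in \<open>s_ae_iff\<close> and in the analytic
  limits.\<close>

locale yw = onb +
  fixes m0 :: "(real \<times> real \<Rightarrow> real) measure"
  assumes prob_m0: "prob_space m0" and space_m0: "space m0 = C0 S T"
    and sets_m0: "sets m0 = sets (sigma (C0 S T)
          {(\<lambda>x. x p) -` B \<inter> C0 S T | p B. p \<in> Q S T \<and> B \<in> sets (borel :: real measure)})"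
    and gauss_m0: "\<And>P a. finite P \<Longrightarrow> P \<subseteq> Q S T \<Longrightarrow>
           centered_normal (distr m0 borel (\<lambda>x. \<Sum>p\<in>P. a p * x p))"
    and cov_m0: "\<And>s t s' t'. \<lbrakk>s\<in>{0..S}; t\<in>{0..T}; s'\<in>{0..S}; t'\<in>{0..T}\<rbrakk> \<Longrightarrow>
           (LINT x|m0. x (s, t) * x (s', t')) = min s s' * min t t'"
begin

sublocale m0: prob_space m0 by (rule prob_m0)

lemma eval_measurable: "p \<in> Q S T \<Longrightarrow> (\<lambda>x. x p) \<in> borel_measurable m0"
proof (rule measurableI)
  fix B :: "real set" assume p: "p \<in> Q S T" and B: "B \<in> sets borel"
  let ?G = "{(\<lambda>x. x p) -` B \<inter> C0 S T | p B. p \<in> Q S T \<and> B \<in> sets (borel :: real measure)}"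
  have "(\<lambda>x. x p) -` B \<inter> C0 S T \<in> sets (sigma (C0 S T) ?G)"
  proof (rule in_measure_of)
    show "?G \<subseteq> Pow (C0 S T)" by auto
    show "(\<lambda>x. x p) -` B \<inter> C0 S T \<in> ?G" using p B by blast
  qed
  then show "(\<lambda>x. x p) -` B \<inter> space m0 \<in> sets m0" unfolding space_m0 sets_m0 .
qed simp

text \<open>The functionals to which the Gaussian hypothesis applies directly. They form a linear
  space, so every Stieltjes sum in the path is one of them.\<close>

definition evcomb :: "((real \<times> real \<Rightarrow> real) \<Rightarrow> real) \<Rightarrow> bool" where
  "evcomb f \<longleftrightarrow> (\<exists>P a. finite P \<and> P \<subseteq> Q S T \<and> f = (\<lambda>x. \<Sum>p\<in>P. a p * x p))"

lemma evcomb_eval: "p \<in> Q S T \<Longrightarrow> evcomb (\<lambda>x. x p)"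
  unfolding evcomb_def by (rule exI[of _ "{p}"], rule exI[of _ "\<lambda>_. 1"]) auto

lemma evcomb_zero: "evcomb (\<lambda>x. 0)"
  unfolding evcomb_def by (rule exI[of _ "{}"]) auto

lemma evcomb_scale:
  assumes "evcomb f"
  shows "evcomb (\<lambda>x. c * f x)"
proof -
  from assms obtain P a where "finite P" "P \<subseteq> Q S T" "f = (\<lambda>x. \<Sum>p\<in>P. a p * x p)" unfolding evcomb_def by blast
  then show ?thesis unfolding evcomb_def
    by (intro exI[of _ P] exI[of _ "\<lambda>p. c * a p"]) (simp add: sum_distrib_left mult.assoc)
qed

lemma evcomb_add:
  assumes "evcomb f" "evcomb g"
  shows "evcomb (\<lambda>x. f x + g x)"
proof -
  from assms(1) obtain P a where f: "finite P" "P \<subseteq> Q S T" "f = (\<lambda>x. \<Sum>p\<in>P. a p * x p)" unfolding evcomb_def by blast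
  from assms(2) obtain P' a' where g: "finite P'" "P' \<subseteq> Q S T" "g = (\<lambda>x. \<Sum>p\<in>P'. a' p * x p)" unfolding evcomb_def by blast
  \<comment> \<open>The hypothesis speaks of sets of points, so common points must be merged: both
    coefficient functions are extended by 0 to the union.\<close>
  have "f x + g x = (\<Sum>p\<in>P \<union> P'. ((if p \<in> P then a p else 0) + (if p \<in> P' then a' p else 0)) * x p)" for x
  proof -
    have "(\<Sum>p\<in>P \<union> P'. (if p \<in> P then a p else 0) * x p) = f x"
      unfolding f(3) by (rule sum.mono_neutral_cong_right) (use f g in auto)
    moreover have "(\<Sum>p\<in>P \<union> P'. (if p \<in> P' then a' p else 0) * x p) = g x"
      unfolding g(3) by (rule sum.mono_neutral_cong_right) (use f g in auto)
    ultimately show ?thesis by (simp only: distrib_right sum.distrib)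
  qed
  then show ?thesis unfolding evcomb_def
    by (intro exI[of _ "P \<union> P'"] exI[of _ "\<lambda>p. (if p \<in> P then a p else 0) + (if p \<in> P' then a' p else 0)"])
      (use f g in auto)
qed

lemma evcomb_sum: "(\<And>i. i \<in> I \<Longrightarrow> evcomb (f i)) \<Longrightarrow> evcomb (\<lambda>x. \<Sum>i\<in>I. f i x)"
  by (induction I rule: infinite_finite_induct) (auto intro: evcomb_add evcomb_zero)

lemma evcomb_diff: "evcomb f \<Longrightarrow> evcomb g \<Longrightarrow> evcomb (\<lambda>x. f x - g x)"
  using evcomb_add[OF _ evcomb_scale[of g "-1"], of f] by simp

lemma evcomb_rect:
  assumes "a \<in> {0..S}" "b \<in> {0..S}" "c \<in> {0..T}" "d \<in> {0..T}"
  shows "evcomb (\<lambda>x. rect_increment x a b c d)"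
  unfolding rect_increment_def using assms
  by (intro evcomb_add evcomb_diff evcomb_eval) (auto simp: Q_def)

lemma evcomb_measurable: "evcomb f \<Longrightarrow> f \<in> borel_measurable m0"
  unfolding evcomb_def by (auto intro!: borel_measurable_sum borel_measurable_times eval_measurable)

lemma evcomb_normal: "evcomb f \<Longrightarrow> centered_normal (distr m0 borel f)"
  unfolding evcomb_def using gauss_m0 by auto

lemma evcomb_mult_integrable:
  assumes "evcomb f" "evcomb g"
  shows "integrable m0 (\<lambda>x. f x * g x)"
proof (rule Bochner_Integration.integrable_bound)
  show "integrable m0 (\<lambda>x. (f x)\<^sup>2 + (g x)\<^sup>2)"
    by (intro Bochner_Integration.integrable_add centered_normal_distr_facts(1) evcomb_measurable evcomb_normal assms)
  have "\<bar>a * b\<bar> \<le> a\<^sup>2 + b\<^sup>2" for a b :: real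
  proof -
    have "0 \<le> (\<bar>a\<bar> - \<bar>b\<bar>)\<^sup>2" by simp
    then have "2 * (\<bar>a\<bar> * \<bar>b\<bar>) \<le> a\<^sup>2 + b\<^sup>2" by (simp add: power2_diff)
    moreover have "0 \<le> \<bar>a\<bar> * \<bar>b\<bar>" by simp
    ultimately show ?thesis unfolding abs_mult by linarith
  qed
  then show "AE x in m0. norm (f x * g x) \<le> norm ((f x)\<^sup>2 + (g x)\<^sup>2)" by simp
qed (use evcomb_measurable assms in auto)

lemma E_rect_mult:
  assumes Y: "evcomb Y" and r: "a \<in> {0..S}" "b \<in> {0..S}" "c \<in> {0..T}" "d \<in> {0..T}"
  shows "(LINT x|m0. rect_increment x a b c d * Y x) =
     (LINT x|m0. x (b, d) * Y x) - (LINT x|m0. x (a, d) * Y x) - (LINT x|m0. x (b, c) * Y x) + (LINT x|m0. x (a, c) * Y x)"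
proof -
  have i: "integrable m0 (\<lambda>x. x (b, d) * Y x)" "integrable m0 (\<lambda>x. x (a, d) * Y x)"
    "integrable m0 (\<lambda>x. x (b, c) * Y x)" "integrable m0 (\<lambda>x. x (a, c) * Y x)"
    using r by (auto intro!: evcomb_mult_integrable evcomb_eval Y simp: Q_def)
  show ?thesis unfolding rect_increment_def distrib_right left_diff_distrib
    by (simp only: Bochner_Integration.integral_add Bochner_Integration.integral_diff
      Bochner_Integration.integrable_add Bochner_Integration.integrable_diff i)
qed

lemma E_rect_eval:
  assumes r: "a \<in> {0..S}" "b \<in> {0..S}" "c \<in> {0..T}" "d \<in> {0..T}" and st: "s \<in> {0..S}" "t \<in> {0..T}"
  shows "(LINT x|m0. rect_increment x a b c d * x (s, t)) = (min b s - min a s) * (min d t - min c t)"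
  using E_rect_mult[OF evcomb_eval[of "(s, t)"] r] r st
  by (simp add: Q_def cov_m0 algebra_simps)

lemma E_rect_rect:
  assumes r: "a \<in> {0..S}" "b \<in> {0..S}" "c \<in> {0..T}" "d \<in> {0..T}"
    and r': "a' \<in> {0..S}" "b' \<in> {0..S}" "c' \<in> {0..T}" "d' \<in> {0..T}"
  shows "(LINT x|m0. rect_increment x a b c d * rect_increment x a' b' c' d') =
     ((min b' b - min a' b) - (min b' a - min a' a)) * ((min d' d - min c' d) - (min d' c - min c' c))"
proof -
  have *: "(LINT x|m0. x (s, t) * rect_increment x a' b' c' d') = (min b' s - min a' s) * (min d' t - min c' t)"
    if "s \<in> {0..S}" "t \<in> {0..T}" for s t
    using E_rect_eval[OF r' that] by (simp add: mult.commute)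
  show ?thesis
    unfolding E_rect_mult[OF evcomb_rect[OF r'] r] *[OF r(2,4)] *[OF r(1,4)] *[OF r(2,3)] *[OF r(1,3)]
    by algebra
qed

text \<open>The covariance of two increments of Brownian motion over intervals of one subdivision:
  orthogonal if the intervals differ, of variance equal to the length otherwise.\<close>

lemma min_increment:
  fixes s :: "nat \<Rightarrow> real"
  assumes mono: "\<And>i j. i \<le> j \<Longrightarrow> j \<le> n \<Longrightarrow> s i \<le> s j" and ij: "i < n" "j < n"
  shows "(min (s (Suc j)) (s (Suc i)) - min (s j) (s (Suc i))) - (min (s (Suc j)) (s i) - min (s j) (s i)) =
     (if i = j then s (Suc i) - s i else 0)"
proof (cases i j rule: linorder_cases)
  case less
  then have "s (Suc i) \<le> s j" "s i \<le> s (Suc i)" "s j \<le> s (Suc j)" using ij by (auto intro!: mono)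
  then show ?thesis using less by (simp add: min_def)
next
  case equal
  then have "s i \<le> s (Suc i)" using ij by (auto intro!: mono)
  then show ?thesis using equal by simp
next
  case greater
  then have "s (Suc j) \<le> s i" "s i \<le> s (Suc i)" "s j \<le> s (Suc j)" using ij by (auto intro!: mono)
  then show ?thesis using greater by (simp add: min_def)
qed

text \<open>A single mesh, strictly larger than both cell lengths because \<open>S\<close> and
  \<open>T\<close> are positive.\<close>

lemma unif_tags:
  "fine_tags S ((S + T) / real (Suc k)) (Suc k) (unif_grid S k) (unif_grid S k)"
  "fine_tags T ((S + T) / real (Suc k)) (Suc k) (unif_grid T k) (unif_grid T k)"
  using S T by (auto intro!: fine_tags_unif_grid divide_strict_right_mono simp del: of_nat_Suc)

lemma evcomb_unif_RS_sum: "evcomb (\<lambda>x. unif_RS_sum S T g x k)"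
  unfolding unif_RS_sum_def RS_sum_def
  using fine_tags_range(1)[OF unif_tags(1)[of k]] fine_tags_range(1)[OF unif_tags(2)[of k]]
  by (intro evcomb_sum evcomb_scale evcomb_rect) auto

text \<open>Increments of the path over distinct cells are orthogonal, so the variance of the
  Stieltjes sum is a Riemann sum of the squared integrand.\<close>

lemma E_unif_RS_sum_sq:
  "(LINT x|m0. (unif_RS_sum S T g x k)\<^sup>2) =
    (\<Sum>i<Suc k. \<Sum>j<Suc k. (g (unif_grid S k i, unif_grid T k j))\<^sup>2 *
      ((unif_grid S k (Suc i) - unif_grid S k i) * (unif_grid T k (Suc j) - unif_grid T k j)))"
proof -
  define s where "s = unif_grid S k"
  define t where "t = unif_grid T k"
  define n where "n = Suc k"
  note rs = fine_tags_range[OF unif_tags(1)[of k], folded s_def n_def]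
  note rt = fine_tags_range[OF unif_tags(2)[of k], folded t_def n_def]
  have ms: "s i \<le> s j" "t i \<le> t j" if "i \<le> j" "j \<le> n" for i j
    using subdivision_le[of 0 S n s i j] subdivision_le[of 0 T n t i j] that unif_tags[of k]
    unfolding fine_tags_def s_def t_def n_def by auto
  define I where "I = {..<n} \<times> {..<n}"
  define R where "R a x = rect_increment x (s (fst a)) (s (Suc (fst a))) (t (snd a)) (t (Suc (snd a)))" for a x
  define c where "c a = g (s (fst a), t (snd a))" for a
  have ev: "evcomb (R a)" if "a \<in> I" for a
    unfolding R_def using that rs(1)[of "fst a"] rs(1)[of "Suc (fst a)"] rt(1)[of "snd a"] rt(1)[of "Suc (snd a)"]
    by (intro evcomb_rect) (auto simp: I_def)
  have ER: "(LINT x|m0. R a x * R b x) = (if a = b then (s (Suc (fst a)) - s (fst a)) * (t (Suc (snd a)) - t (snd a)) else 0)"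
    if ab: "a \<in> I" "b \<in> I" for a b
  proof -
    have lt: "fst a < n" "snd a < n" "fst b < n" "snd b < n" using ab by (auto simp: I_def)
    have "(LINT x|m0. R a x * R b x) =
      ((min (s (Suc (fst b))) (s (Suc (fst a))) - min (s (fst b)) (s (Suc (fst a)))) - (min (s (Suc (fst b))) (s (fst a)) - min (s (fst b)) (s (fst a)))) *
      ((min (t (Suc (snd b))) (t (Suc (snd a))) - min (t (snd b)) (t (Suc (snd a)))) - (min (t (Suc (snd b))) (t (snd a)) - min (t (snd b)) (t (snd a))))"
      unfolding R_def by (rule E_rect_rect) (use lt in \<open>auto intro!: rs(1) rt(1) simp del: atLeastAtMost_iff\<close>)
    also have "\<dots> = (if fst a = fst b then s (Suc (fst a)) - s (fst a) else 0) * (if snd a = snd b then t (Suc (snd a)) - t (snd a) else 0)"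
      by (intro arg_cong2[where f = times] min_increment[of n]) (use ms lt in auto)
    finally show ?thesis by (auto simp: prod_eq_iff)
  qed
  have "unif_RS_sum S T g x k = (\<Sum>a\<in>I. c a * R a x)" for x
    unfolding unif_RS_sum_def RS_sum_def s_def[symmetric] t_def[symmetric] n_def[symmetric] I_def c_def R_def
    by (simp add: sum.cartesian_product split_beta)
  then have "(LINT x|m0. (unif_RS_sum S T g x k)\<^sup>2) = (LINT x|m0. (\<Sum>a\<in>I. \<Sum>b\<in>I. (c a * c b) * (R a x * R b x)))"
    by (simp add: power2_eq_square sum_product mult_ac)
  also have "\<dots> = (\<Sum>a\<in>I. \<Sum>b\<in>I. (c a * c b) * (LINT x|m0. R a x * R b x))"
    by (subst Bochner_Integration.integral_sum, intro Bochner_Integration.integrable_sum integrable_mult_right evcomb_mult_integrable ev, assumption+,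
        intro sum.cong refl, subst Bochner_Integration.integral_sum, intro integrable_mult_right evcomb_mult_integrable ev, assumption+, simp)
  also have "\<dots> = (\<Sum>a\<in>I. \<Sum>b\<in>I. if a = b then (c a)\<^sup>2 * ((s (Suc (fst a)) - s (fst a)) * (t (Suc (snd a)) - t (snd a))) else 0)"
    by (intro sum.cong refl) (simp add: ER power2_eq_square)
  also have "\<dots> = (\<Sum>a\<in>I. (c a)\<^sup>2 * ((s (Suc (fst a)) - s (fst a)) * (t (Suc (snd a)) - t (snd a))))"
    by (intro sum.cong refl) (simp add: sum.delta I_def)
  also have "\<dots> = (\<Sum>i<n. \<Sum>j<n. (g (s i, t j))\<^sup>2 * ((s (Suc i) - s i) * (t (Suc j) - t j)))"
    unfolding I_def c_def by (simp add: sum.cartesian_product split_beta)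
  finally show ?thesis unfolding s_def t_def n_def .
qed

lemma E_unif_RS_sum_sq_LIMSEQ:
  assumes g: "osc_bounded S T g"
  shows "(\<lambda>k. LINT x|m0. (unif_RS_sum S T g x k)\<^sup>2) \<longlonglongrightarrow> ip g g"
proof -
  \<comment> \<open>The variances are Riemann sums of \<open>g * g\<close> with weight 1, and
    squares stay in the class for which such sums converge.\<close>
  have g2: "osc_bounded S T (\<lambda>p. g p * g p)" by (rule osc_bounded_mult[OF S T g g])
  have one: "(\<lambda>p. 1) \<in> borel_measurable (Leb S T)" "\<bar>1\<bar> \<le> (1::real)" by auto
  obtain K where K: "K \<ge> 0" "\<And>m s \<xi> n t \<eta> \<delta>. \<lbrakk>fine_tags S \<delta> m s \<xi>; fine_tags T \<delta> n t \<eta>\<rbrakk> \<Longrightarrow>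
    \<bar>(\<Sum>i<m. \<Sum>j<n. (g (\<xi> i, \<eta> j) * g (\<xi> i, \<eta> j)) * (LINT p|Leb S T. indicator (cell (s i) (s (Suc i)) (t j) (t (Suc j))) p * 1))
      - (LINT p|Leb S T. (g p * g p) * 1)\<bar> \<le> K * \<delta>"
  proof (rule osc_bounded_riemann[OF S T g2 one], goal_cases)
    case (1 K)
    show thesis by (rule 1(1)[OF 1(2) 1(3)])
  qed
  have "\<bar>(LINT x|m0. (unif_RS_sum S T g x k)\<^sup>2) - ip g g\<bar> \<le> K * ((S + T) / real (Suc k))" for k
  proof -
    note rs = fine_tags_range[OF unif_tags(1)[of k]] and rt = fine_tags_range[OF unif_tags(2)[of k]]
    have eq: "(LINT x|m0. (unif_RS_sum S T g x k)\<^sup>2) =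
      (\<Sum>i<Suc k. \<Sum>j<Suc k. (g (unif_grid S k i, unif_grid T k j) * g (unif_grid S k i, unif_grid T k j)) *
        (LINT p|Leb S T. indicator (cell (unif_grid S k i) (unif_grid S k (Suc i)) (unif_grid T k j) (unif_grid T k (Suc j))) p * 1))"
      unfolding E_unif_RS_sum_sq unfolding power2_eq_square mult_1_right
    proof (intro sum.cong refl arg_cong2[where f = times])
      fix i j assume ij: "i \<in> {..<Suc k}" "j \<in> {..<Suc k}"
      show "(unif_grid S k (Suc i) - unif_grid S k i) * (unif_grid T k (Suc j) - unif_grid T k j) =
         (LINT p|Leb S T. indicator (cell (unif_grid S k i) (unif_grid S k (Suc i)) (unif_grid T k j) (unif_grid T k (Suc j))) p)"
        using ij rs(1)[of i] rs(1)[of "Suc i"] rs(3)[of i] rt(1)[of j] rt(1)[of "Suc j"] rt(3)[of j]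
        by (subst measure_cell) auto
    qed
    show ?thesis using K(2)[OF unif_tags(1)[of k] unif_tags(2)[of k]] unfolding eq l2_inner_def mult_1_right .
  qed
  then have bd: "norm ((LINT x|m0. (unif_RS_sum S T g x k)\<^sup>2) - ip g g) \<le> K * ((S + T) / real (Suc k))" for k
    unfolding real_norm_def .
  have "(\<lambda>k. K * ((S + T) * inverse (real (Suc k)))) \<longlonglongrightarrow> K * ((S + T) * 0)"
    by (intro tendsto_mult tendsto_const LIMSEQ_inverse_real_of_nat)
  then have lim: "(\<lambda>k. K * ((S + T) / real (Suc k))) \<longlonglongrightarrow> 0" by (simp add: divide_inverse)
  have "(\<lambda>k. (LINT x|m0. (unif_RS_sum S T g x k)\<^sup>2) - ip g g) \<longlonglongrightarrow> 0"
    by (rule Lim_null_comparison[OF always_eventually lim]) (intro allI bd)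
  then show ?thesis by (rule LIM_zero_cancel)
qed

text \<open>What the Gaussian limit requires of an integrand: a modulus, for convergence of
  variances, and existence of the integral for every path. Finite linear combinations inherit both
  by linearity.\<close>

definition RS_integrand :: "(real \<times> real \<Rightarrow> real) \<Rightarrow> bool" where
  "RS_integrand g \<longleftrightarrow> osc_bounded S T g \<and> (\<forall>x\<in>C0 S T. \<exists>I. has_RS_integral S T g x I)"

lemma RS_integrand_phi: "RS_integrand (\<phi> j)"
  unfolding RS_integrand_def
  using BV_HK_osc_bounded[OF S T phi_BV] BV_HK_has_RS_integral[OF S T phi_BV] unfolding C0_def by auto

lemma has_RS_integral_RS_integral:
  "RS_integrand g \<Longrightarrow> x \<in> C0 S T \<Longrightarrow> has_RS_integral S T g x (RS_integral S T g x)"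
  unfolding RS_integrand_def using RS_integral_eqI[OF S T] by metis

lemma RS_integral_tendsto:
  "RS_integrand g \<Longrightarrow> x \<in> C0 S T \<Longrightarrow> unif_RS_sum S T g x \<longlonglongrightarrow> RS_integral S T g x"
  by (rule unif_RS_sum_LIMSEQ[OF S T has_RS_integral_RS_integral])

lemma RS_integral_measurable:
  assumes "RS_integrand g"
  shows "RS_integral S T g \<in> borel_measurable m0"
proof (rule borel_measurable_LIMSEQ_real)
  show "(\<lambda>k. unif_RS_sum S T g x k) \<longlonglongrightarrow> RS_integral S T g x" if "x \<in> space m0" for x
    using RS_integral_tendsto[OF assms] that unfolding space_m0 .
qed (rule evcomb_measurable[OF evcomb_unif_RS_sum])

text \<open>Stieltjes sums are exactly Gaussian. Their characteristic functions converge by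
  dominated convergence on one side and through the variances on the other.\<close>

lemma RS_integral_char:
  assumes g: "RS_integrand g"
  shows "(LINT x|m0. exp (\<i> * complex_of_real (\<theta> * RS_integral S T g x))) = complex_of_real (exp (- (\<theta>\<^sup>2 * ip g g / 2)))"
proof (rule LIMSEQ_unique)
  have [measurable]: "RS_integral S T g \<in> borel_measurable m0" by (rule RS_integral_measurable[OF g])
  have [measurable]: "(\<lambda>x. unif_RS_sum S T g x k) \<in> borel_measurable m0" for k by (rule evcomb_measurable[OF evcomb_unif_RS_sum])
  show "(\<lambda>k. LINT x|m0. exp (\<i> * complex_of_real (\<theta> * unif_RS_sum S T g x k))) \<longlonglongrightarrow>
      (LINT x|m0. exp (\<i> * complex_of_real (\<theta> * RS_integral S T g x)))"
  proof (rule integral_dominated_convergence[where w = "\<lambda>_. 1"])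
    show "AE x in m0. (\<lambda>k. exp (\<i> * complex_of_real (\<theta> * unif_RS_sum S T g x k))) \<longlonglongrightarrow> exp (\<i> * complex_of_real (\<theta> * RS_integral S T g x))"
      by (intro AE_I2 tendsto_intros RS_integral_tendsto g) (simp add: space_m0)
  qed auto
  have "(LINT x|m0. exp (\<i> * complex_of_real (\<theta> * unif_RS_sum S T g x k))) =
      complex_of_real (exp (- (\<theta>\<^sup>2 * (LINT x|m0. (unif_RS_sum S T g x k)\<^sup>2) / 2)))" for k
    by (rule centered_normal_distr_facts(2)[OF evcomb_measurable evcomb_normal]) (rule evcomb_unif_RS_sum)+
  moreover have "(\<lambda>k. complex_of_real (exp (- (\<theta>\<^sup>2 * (LINT x|m0. (unif_RS_sum S T g x k)\<^sup>2) / 2)))) \<longlonglongrightarrow>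
      complex_of_real (exp (- (\<theta>\<^sup>2 * ip g g / 2)))"
    by (intro tendsto_intros E_unif_RS_sum_sq_LIMSEQ) (use g in \<open>auto simp: RS_integrand_def\<close>)
  ultimately show "(\<lambda>k. LINT x|m0. exp (\<i> * complex_of_real (\<theta> * unif_RS_sum S T g x k))) \<longlonglongrightarrow>
      complex_of_real (exp (- (\<theta>\<^sup>2 * ip g g / 2)))" by simp
qed

text \<open>Fatou's lemma yields an upper bound, which is what the maximal inequality takes as
  input.\<close>

lemma RS_integral_fourth_moment:
  assumes g: "RS_integrand g"
  shows "(\<integral>\<^sup>+x. ennreal (RS_integral S T g x ^ 4) \<partial>m0) \<le> ennreal (3 * (ip g g)\<^sup>2)"
proof -
  have [measurable]: "(\<lambda>x. unif_RS_sum S T g x k) \<in> borel_measurable m0" for k by (rule evcomb_measurable[OF evcomb_unif_RS_sum])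
  have "(\<integral>\<^sup>+x. ennreal (RS_integral S T g x ^ 4) \<partial>m0) = (\<integral>\<^sup>+x. liminf (\<lambda>k. ennreal (unif_RS_sum S T g x k ^ 4)) \<partial>m0)"
  proof (intro nn_integral_cong)
    fix x assume "x \<in> space m0"
    then have "(\<lambda>k. ennreal (unif_RS_sum S T g x k ^ 4)) \<longlonglongrightarrow> ennreal (RS_integral S T g x ^ 4)"
      unfolding space_m0 by (intro tendsto_ennrealI tendsto_power RS_integral_tendsto g)
    then show "ennreal (RS_integral S T g x ^ 4) = liminf (\<lambda>k. ennreal (unif_RS_sum S T g x k ^ 4))"
      by (rule lim_imp_Liminf[OF sequentially_bot, symmetric])
  qed
  also have "\<dots> \<le> liminf (\<lambda>k. \<integral>\<^sup>+x. ennreal (unif_RS_sum S T g x k ^ 4) \<partial>m0)"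
    by (rule nn_integral_liminf) measurable
  also have "\<dots> = ennreal (3 * (ip g g)\<^sup>2)"
  proof (rule lim_imp_Liminf[OF sequentially_bot])
    have "(\<integral>\<^sup>+x. ennreal (unif_RS_sum S T g x k ^ 4) \<partial>m0) = ennreal (3 * (LINT x|m0. (unif_RS_sum S T g x k)\<^sup>2)\<^sup>2)" for k
      by (rule centered_normal_distr_facts(3)[OF evcomb_measurable evcomb_normal]) (rule evcomb_unif_RS_sum)+
    moreover have "(\<lambda>k. ennreal (3 * (LINT x|m0. (unif_RS_sum S T g x k)\<^sup>2)\<^sup>2)) \<longlonglongrightarrow> ennreal (3 * (ip g g)\<^sup>2)"
      by (intro tendsto_ennrealI tendsto_intros E_unif_RS_sum_sq_LIMSEQ) (use g in \<open>auto simp: RS_integrand_def\<close>)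
    ultimately show "(\<lambda>k. \<integral>\<^sup>+x. ennreal (unif_RS_sum S T g x k ^ 4) \<partial>m0) \<longlonglongrightarrow> ennreal (3 * (ip g g)\<^sup>2)" by simp
  qed
  finally show ?thesis .
qed

lemma has_RS_integral_lincomb:
  assumes "x \<in> C0 S T"
  shows "has_RS_integral S T (lincomb a n) x (\<Sum>j<n. a j * RS_integral S T (\<phi> j) x)"
proof (induction n)
  case 0
  have "RS_sum (lincomb a 0) x m s \<xi> n t \<eta> = 0" for m s \<xi> n t \<eta>
    unfolding RS_sum_def lincomb_def by simp
  then show ?case unfolding has_RS_integral_fine_tags by (auto intro!: exI[of _ 1])
next
  case (Suc n)
  have eq: "RS_sum (lincomb a (Suc n)) x m s \<xi> k t \<eta> = 1 * RS_sum (lincomb a n) x m s \<xi> k t \<eta> + a n * RS_sum (\<phi> n) x m s \<xi> k t \<eta>"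
    for m s \<xi> k t \<eta>
    unfolding lincomb_def by (simp add: RS_sum_add_left RS_sum_cmult_left)
  from has_RS_integral_combine[OF Suc.IH has_RS_integral_RS_integral[OF RS_integrand_phi assms] eq] show ?case by simp
qed

lemma RS_integrand_lincomb: "RS_integrand (lincomb a n)"
  unfolding RS_integrand_def
proof
  show "osc_bounded S T (lincomb a n)" unfolding lincomb_def
    by (intro osc_bounded_sum osc_bounded_mult[OF S T] osc_bounded_const BV_HK_osc_bounded[OF S T phi_BV])
qed (use has_RS_integral_lincomb in blast)

lemma RS_integral_lincomb:
  "x \<in> C0 S T \<Longrightarrow> RS_integral S T (lincomb a n) x = (\<Sum>j<n. a j * RS_integral S T (\<phi> j) x)"
  by (rule RS_integral_eqI[OF S T has_RS_integral_lincomb])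

lemma rescale_C0: "x \<in> C0 S T \<Longrightarrow> rescale \<rho> x \<in> C0 S T"
  unfolding C0_def rescale_def by (auto intro: continuous_intros)

lemma RS_integral_rescale:
  assumes "x \<in> C0 S T"
  shows "RS_integral S T (\<phi> j) (rescale \<rho> x) = \<rho> * RS_integral S T (\<phi> j) x"
proof (rule RS_integral_eqI[OF S T])
  note h = has_RS_integral_RS_integral[OF RS_integrand_phi assms, of j]
  have eq: "RS_sum (\<phi> j) (rescale \<rho> x) m s \<xi> k t \<eta> = \<rho> * RS_sum (\<phi> j) x m s \<xi> k t \<eta> + 0 * RS_sum (\<phi> j) x m s \<xi> k t \<eta>" for m s \<xi> k t \<eta>
    unfolding rescale_def RS_sum_cmult_right by simp
  from has_RS_integral_combine[OF h h eq] show "has_RS_integral S T (\<phi> j) (rescale \<rho> x) (\<rho> * RS_integral S T (\<phi> j) x)" by simp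
qed

end


section \<open>Almost sure convergence of the Paley--Wiener--Zygmund integral\<close>


text \<open>The inequality for squares, with weights \<open>1 + 9\<close> and
  \<open>1 + 1/9\<close>, applied twice. The second constant is the cube of \<open>10 / 9\<close>,
  well below 2, at the cost of the large first one.\<close>

lemma power4_add_le: "(a + b) ^ 4 \<le> 1000 * a ^ 4 + 1000 / 729 * b ^ 4" for a b :: real
proof -
  have sq: "(a + b)\<^sup>2 \<le> 10 * a\<^sup>2 + 10 / 9 * b\<^sup>2" for a b :: real
  proof -
    have "0 \<le> (3 * a - b / 3)\<^sup>2" by simp
    then show ?thesis by (simp add: power2_eq_square algebra_simps)
  qed
  have "(a + b) ^ 4 = ((a + b)\<^sup>2)\<^sup>2" by simp
  also have "\<dots> \<le> (10 * a\<^sup>2 + 10 / 9 * b\<^sup>2)\<^sup>2" by (intro power_mono sq) auto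
  also have "\<dots> \<le> 10 * (10 * a\<^sup>2)\<^sup>2 + 10 / 9 * (10 / 9 * b\<^sup>2)\<^sup>2" by (rule sq)
  also have "\<dots> = 1000 * a ^ 4 + 1000 / 729 * b ^ 4" by (simp add: power_mult_distrib power_divide)
  finally show ?thesis .
qed

text \<open>Maximal inequality from fourth moments, without independence: the range is cut at an index
  \<open>h\<close> for which both parts carry at most half of the total weight, and
  \<open>\<bar>a + b\<bar>\<^sup>4 \<le> A a\<^sup>4 + B b\<^sup>4\<close> with \<open>B < 2\<close> lets the constant reproduce itself.\<close>

lemma bisection_maximal_inequality:
  fixes \<xi> :: "nat \<Rightarrow> 'a \<Rightarrow> real" and u :: "nat \<Rightarrow> real"
  assumes \<xi> [measurable]: "\<And>j. \<xi> j \<in> borel_measurable M"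
    and u: "\<And>j. u j \<ge> 0" and C: "C \<ge> 0"
    and mom: "\<And>i k. i \<le> k \<Longrightarrow> (\<integral>\<^sup>+x. ennreal ((\<Sum>j\<in>{i..<k}. \<xi> j x) ^ 4) \<partial>M) \<le> ennreal (C * (\<Sum>j\<in>{i..<k}. u j)\<^sup>2)"
  shows "i \<le> k \<Longrightarrow> (\<integral>\<^sup>+x. (SUP l\<in>{i..k}. ennreal ((\<Sum>j\<in>{i..<l}. \<xi> j x) ^ 4)) \<partial>M) \<le> ennreal (4000 * C * (\<Sum>j\<in>{i..<k}. u j)\<^sup>2)"
proof (induction "k - i" arbitrary: i k rule: less_induct)
  case less
  define X where "X a b x = (\<Sum>j\<in>{a..<b}. \<xi> j x)" for a b x
  define U where "U a b = (\<Sum>j\<in>{a..<b}. u j)" for a b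
  define G where "G a b x = (SUP l\<in>{a..b}. ennreal (X a l x ^ 4))" for a b x
  have [measurable]: "X a b \<in> borel_measurable M" for a b unfolding X_def by measurable
  have [measurable]: "G a b \<in> borel_measurable M" for a b unfolding G_def by measurable
  have U0: "U a b \<ge> 0" for a b unfolding U_def by (intro sum_nonneg u)
  have Xadd: "X a c x = X a b x + X b c x" if "a \<le> b" "b \<le> c" for a b c x
    unfolding X_def using that by (simp add: sum.atLeastLessThan_concat)
  have Uadd: "U a c = U a b + U b c" if "a \<le> b" "b \<le> c" for a b c
    unfolding U_def using that by (simp add: sum.atLeastLessThan_concat)
  have goal: "(\<integral>\<^sup>+x. G i k x \<partial>M) \<le> ennreal (4000 * C * (U i k)\<^sup>2)"
  proof (cases "i = k")
    case True
    then have "G i k x = 0" for x unfolding G_def X_def by simp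
    then show ?thesis by simp
  next
    case False
    then have ik: "i < k" using less.prems by simp
    \<comment> \<open>\<open>h\<close> is the first index at which the weight accumulated up to and
      including it reaches one half. The possibly heavy index \<open>h\<close> belongs to neither of
      the two parts treated by induction; it enters only the block sum \<open>X i (Suc h)\<close>,
      to which \<open>mom\<close> applies.\<close>
    define P where "P h \<longleftrightarrow> i \<le> h \<and> U i (Suc h) \<ge> U i k / 2" for h
    define h where "h = (LEAST h. P h)"
    have Pk: "P (k - 1)" unfolding P_def using ik U0[of i k] by auto
    have Ph: "P h" unfolding h_def by (rule LeastI[of P, OF Pk])
    have hk: "h < k" using Least_le[of P, OF Pk] ik unfolding h_def by simp
    have ih: "i \<le> h" and Uh: "U i (Suc h) \<ge> U i k / 2" using Ph unfolding P_def by auto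
    have U1: "U i h \<le> U i k / 2"
    proof (cases "h = i")
      case True
      then show ?thesis using U0[of i k] by (simp add: U_def)
    next
      case False
      then have "\<not> P (h - 1)" using not_less_Least[of "h - 1" P] ih unfolding h_def[symmetric] by simp
      then show ?thesis using False ih unfolding P_def by auto
    qed
    have U2: "U (Suc h) k \<le> U i k / 2" using Uadd[of i "Suc h" k] ih hk Uh by simp
    have U3: "U i (Suc h) \<le> U i k" using Uadd[of i "Suc h" k] ih hk U0[of "Suc h" k] by simp
    have sq: "(U a b)\<^sup>2 \<le> (U i k / 2)\<^sup>2" if "U a b \<le> U i k / 2" for a b
      by (rule power_mono[OF that U0])
    have IH1: "(\<integral>\<^sup>+x. G i h x \<partial>M) \<le> ennreal (4000 * C * (U i k / 2)\<^sup>2)"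
    proof -
      have "(\<integral>\<^sup>+x. G i h x \<partial>M) \<le> ennreal (4000 * C * (U i h)\<^sup>2)"
        unfolding G_def X_def U_def by (rule less.hyps) (use ih hk in auto)
      also have "\<dots> \<le> ennreal (4000 * C * (U i k / 2)\<^sup>2)"
        by (intro ennreal_leI mult_left_mono sq U1) (use C in auto)
      finally show ?thesis .
    qed
    have IH2: "(\<integral>\<^sup>+x. G (Suc h) k x \<partial>M) \<le> ennreal (4000 * C * (U i k / 2)\<^sup>2)"
    proof -
      have "(\<integral>\<^sup>+x. G (Suc h) k x \<partial>M) \<le> ennreal (4000 * C * (U (Suc h) k)\<^sup>2)"
        unfolding G_def X_def U_def by (rule less.hyps) (use ih hk in auto)
      also have "\<dots> \<le> ennreal (4000 * C * (U i k / 2)\<^sup>2)"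
        by (intro ennreal_leI mult_left_mono sq U2) (use C in auto)
      finally show ?thesis .
    qed
    have mid: "(\<integral>\<^sup>+x. ennreal (X i (Suc h) x ^ 4) \<partial>M) \<le> ennreal (C * (U i k)\<^sup>2)"
    proof -
      have "(\<integral>\<^sup>+x. ennreal (X i (Suc h) x ^ 4) \<partial>M) \<le> ennreal (C * (U i (Suc h))\<^sup>2)"
        unfolding X_def U_def by (rule mom) (use ih in simp)
      also have "\<dots> \<le> ennreal (C * (U i k)\<^sup>2)"
        by (intro ennreal_leI mult_left_mono power_mono U3 U0 C)
      finally show ?thesis .
    qed
    have comb: "ennreal (1000 * a + 1000 / 729 * b) = ennreal 1000 * ennreal a + ennreal (1000 / 729) * ennreal b"
      if "a \<ge> 0" "b \<ge> 0" for a b :: real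
    proof -
      have "ennreal (1000 * a) = ennreal 1000 * ennreal a" "ennreal (1000 / 729 * b) = ennreal (1000 / 729) * ennreal b"
        by (rule ennreal_mult; use that in simp)+
      moreover have "ennreal (1000 * a + 1000 / 729 * b) = ennreal (1000 * a) + ennreal (1000 / 729 * b)"
        by (rule ennreal_plus) (use that in auto)
      ultimately show ?thesis by (simp only:)
    qed
    \<comment> \<open>A maximum attained up to \<open>h\<close> lies in the left part; beyond
      \<open>h\<close> the sum is split at \<open>Suc h\<close> into a fixed block and a sum in the
      right part.\<close>
    have pw: "G i k x \<le> ennreal 1000 * ennreal (X i (Suc h) x ^ 4) + ennreal (1000 / 729) * (G i h x + G (Suc h) k x)" for x
      unfolding G_def[of i k]
    proof (rule SUP_least)
      fix l assume l: "l \<in> {i..k}"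
      show "ennreal (X i l x ^ 4) \<le> ennreal 1000 * ennreal (X i (Suc h) x ^ 4) + ennreal (1000 / 729) * (G i h x + G (Suc h) k x)"
      proof (cases "l \<le> h")
        case True
        have "ennreal (X i l x ^ 4) \<le> G i h x" unfolding G_def by (rule SUP_upper) (use l True in simp)
        also have "\<dots> \<le> ennreal (1000 / 729) * (G i h x + G (Suc h) k x)"
        proof -
          have "1 * G i h x \<le> ennreal (1000 / 729) * (G i h x + G (Suc h) k x)"
            by (rule mult_mono) (auto simp: ennreal_1[symmetric] simp del: ennreal_1 intro!: ennreal_leI add_increasing2)
          then show ?thesis by simp
        qed
        finally show ?thesis by (rule add_increasing[rotated]) simp
      next
        case False
        have "ennreal (X i l x ^ 4) \<le> ennreal (1000 * X i (Suc h) x ^ 4 + 1000 / 729 * X (Suc h) l x ^ 4)"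
          using Xadd[of i "Suc h" l x] ih False l power4_add_le by (intro ennreal_leI) auto
        also have "\<dots> = ennreal 1000 * ennreal (X i (Suc h) x ^ 4) + ennreal (1000 / 729) * ennreal (X (Suc h) l x ^ 4)"
          by (rule comb) auto
        also have "\<dots> \<le> ennreal 1000 * ennreal (X i (Suc h) x ^ 4) + ennreal (1000 / 729) * (G i h x + G (Suc h) k x)"
        proof (intro add_left_mono mult_left_mono)
          have "ennreal (X (Suc h) l x ^ 4) \<le> G (Suc h) k x" unfolding G_def by (rule SUP_upper) (use l False in auto)
          then show "ennreal (X (Suc h) l x ^ 4) \<le> G i h x + G (Suc h) k x" by (rule add_increasing[OF zero_le])
        qed simp
        finally show ?thesis .
      qed
    qed
    have "(\<integral>\<^sup>+x. G i k x \<partial>M) \<le> (\<integral>\<^sup>+x. ennreal 1000 * ennreal (X i (Suc h) x ^ 4) + ennreal (1000 / 729) * (G i h x + G (Suc h) k x) \<partial>M)"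
      by (intro nn_integral_mono pw)
    also have "\<dots> = ennreal 1000 * (\<integral>\<^sup>+x. ennreal (X i (Suc h) x ^ 4) \<partial>M) + ennreal (1000 / 729) * ((\<integral>\<^sup>+x. G i h x \<partial>M) + (\<integral>\<^sup>+x. G (Suc h) k x \<partial>M))"
      by (subst nn_integral_add, measurable, subst nn_integral_cmult, measurable, subst nn_integral_cmult, measurable, subst nn_integral_add, measurable)
    also have "\<dots> \<le> ennreal 1000 * ennreal (C * (U i k)\<^sup>2) + ennreal (1000 / 729) * (ennreal (4000 * C * (U i k / 2)\<^sup>2) + ennreal (4000 * C * (U i k / 2)\<^sup>2))"
      by (intro add_mono mult_left_mono mid IH1 IH2) auto
    also have "\<dots> = ennreal (1000 * (C * (U i k)\<^sup>2) + 1000 / 729 * (4000 * C * (U i k / 2)\<^sup>2 + 4000 * C * (U i k / 2)\<^sup>2))"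
    proof -
      have c0: "0 \<le> 4000 * C * (U i k / 2)\<^sup>2" "0 \<le> C * (U i k)\<^sup>2" using C by auto
      show ?thesis unfolding ennreal_plus[OF c0(1) c0(1), symmetric]
        by (rule comb[symmetric]) (use c0 in auto)
    qed
    \<comment> \<open>Each half has a quarter of the squared weight, so both together give
      \<open>2 * 1000 / 729 * 1000\<close>, less than 2744; the block adds 1000, and 4000 exceeds
      the total.\<close>
    also have "\<dots> \<le> ennreal (4000 * C * (U i k)\<^sup>2)"
    proof (rule ennreal_leI)
      have "0 \<le> C * (U i k)\<^sup>2" using C by simp
      then show "1000 * (C * (U i k)\<^sup>2) + 1000 / 729 * (4000 * C * (U i k / 2)\<^sup>2 + 4000 * C * (U i k / 2)\<^sup>2) \<le> 4000 * C * (U i k)\<^sup>2"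
        by (simp add: power_divide)
    qed
    finally show ?thesis .
  qed
  then show ?case unfolding G_def X_def U_def .
qed

text \<open>\<open>G i\<close> is the largest fourth power of a deviation from the
  \<open>i\<close>-th partial sum. Its integral is bounded by a multiple of the squared tail of
  \<open>u\<close>, so the infimum over \<open>i\<close> vanishes almost everywhere, which is the
  Cauchy criterion.\<close>

lemma AE_convergent_of_fourth_moments:
  fixes \<xi> :: "nat \<Rightarrow> 'a \<Rightarrow> real" and u :: "nat \<Rightarrow> real"
  assumes \<xi> [measurable]: "\<And>j. \<xi> j \<in> borel_measurable M"
    and u: "\<And>j. u j \<ge> 0" "summable u" and C: "C \<ge> 0"
    and mom: "\<And>i k. i \<le> k \<Longrightarrow> (\<integral>\<^sup>+x. ennreal ((\<Sum>j\<in>{i..<k}. \<xi> j x) ^ 4) \<partial>M) \<le> ennreal (C * (\<Sum>j\<in>{i..<k}. u j)\<^sup>2)"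
  shows "AE x in M. convergent (\<lambda>n. \<Sum>j<n. \<xi> j x)"
proof -
  define R where "R i = (\<Sum>j. u (j + i))" for i
  have R0: "R \<longlonglongrightarrow> 0" unfolding R_def using u(2) by (rule suminf_exist_split2)
  have Rge: "(\<Sum>j\<in>{i..<k}. u j) \<le> R i" if "i \<le> k" for i k
  proof -
    have "(\<Sum>j\<in>{i..<k}. u j) = (\<Sum>j<k-i. u (j + i))"
      using that sum.shift_bounds_nat_ivl[of u 0 i "k - i"] by (simp add: atLeast0LessThan)
    also have "\<dots> \<le> R i" unfolding R_def
      by (rule sum_le_suminf) (use u summable_ignore_initial_segment[OF u(2)] in auto)
    finally show ?thesis .
  qed
  define f where "f i l x = ennreal ((\<Sum>j\<in>{i..<l}. \<xi> j x) ^ 4)" for i l x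
  have [measurable]: "f i l \<in> borel_measurable M" for i l unfolding f_def by measurable
  define G where "G i x = (SUP l\<in>{i..}. f i l x)" for i x
  have [measurable]: "G i \<in> borel_measurable M" for i unfolding G_def by measurable
  have G: "(\<integral>\<^sup>+x. G i x \<partial>M) \<le> ennreal (4000 * C * (R i)\<^sup>2)" for i
  proof -
    \<comment> \<open>The maximal inequality covers finite ranges; monotone convergence in
      \<open>n\<close> extends it to the full supremum.\<close>
    define H where "H n x = (SUP l\<in>{i..i+n}. f i l x)" for n x
    have [measurable]: "H n \<in> borel_measurable M" for n unfolding H_def by measurable
    have "G i x = (SUP n. H n x)" for x
    proof (rule antisym)
      show "G i x \<le> (SUP n. H n x)" unfolding G_def
      proof (rule SUP_least)
        fix l assume "l \<in> {i..}"
        then have "f i l x \<le> H (l - i) x" unfolding H_def by (intro SUP_upper) auto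
        also have "\<dots> \<le> (SUP n. H n x)" by (rule SUP_upper) simp
        finally show "f i l x \<le> (SUP n. H n x)" .
      qed
      show "(SUP n. H n x) \<le> G i x" unfolding G_def H_def
        by (intro SUP_least SUP_upper) auto
    qed
    then have "(\<integral>\<^sup>+x. G i x \<partial>M) = (SUP n. \<integral>\<^sup>+x. H n x \<partial>M)"
      by (simp, intro nn_integral_monotone_convergence_SUP)
        (auto simp: incseq_def le_fun_def H_def intro!: SUP_subset_mono)
    also have "\<dots> \<le> ennreal (4000 * C * (R i)\<^sup>2)"
    proof (rule SUP_least)
      fix n
      have "(\<integral>\<^sup>+x. H n x \<partial>M) \<le> ennreal (4000 * C * (\<Sum>j\<in>{i..<i+n}. u j)\<^sup>2)"
        unfolding H_def f_def by (rule bisection_maximal_inequality[OF \<xi> u(1) C mom]) auto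
      also have "\<dots> \<le> ennreal (4000 * C * (R i)\<^sup>2)"
        using Rge[of i "i + n"] u(1) C by (intro ennreal_leI mult_left_mono power_mono sum_nonneg) auto
      finally show "(\<integral>\<^sup>+x. H n x \<partial>M) \<le> ennreal (4000 * C * (R i)\<^sup>2)" .
    qed
    finally show ?thesis .
  qed
  have "(\<integral>\<^sup>+x. (INF i. G i x) \<partial>M) \<le> ennreal (4000 * C * (R i)\<^sup>2)" for i
    by (rule order_trans[OF nn_integral_mono G]) (auto intro: INF_lower)
  moreover have "(\<lambda>i. ennreal (4000 * C * (R i)\<^sup>2)) \<longlonglongrightarrow> ennreal (4000 * C * 0\<^sup>2)"
    by (intro tendsto_ennrealI tendsto_intros R0)
  ultimately have "(\<integral>\<^sup>+x. (INF i. G i x) \<partial>M) \<le> ennreal (4000 * C * 0\<^sup>2)"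
    by (intro LIMSEQ_le_const) auto
  then have "(\<integral>\<^sup>+x. (INF i. G i x) \<partial>M) = 0" by simp
  then have "AE x in M. (INF i. G i x) = 0" by (subst (asm) nn_integral_0_iff_AE) auto
  then show ?thesis
  proof eventually_elim
    case (elim x)
    have "Cauchy (\<lambda>n. \<Sum>j<n. \<xi> j x)"
    proof (rule metric_CauchyI)
      fix e :: real assume e: "e > 0"
      then have "(INF i. G i x) < ennreal ((e/2) ^ 4)" unfolding elim by simp
      then obtain i where i: "G i x < ennreal ((e/2) ^ 4)" by (auto simp: INF_less_iff)
      have near: "\<bar>(\<Sum>j<l. \<xi> j x) - (\<Sum>j<i. \<xi> j x)\<bar> < e/2" if "l \<ge> i" for l
      proof -
        have "f i l x \<le> G i x" unfolding G_def by (rule SUP_upper) (use that in simp)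
        then have "ennreal ((\<Sum>j\<in>{i..<l}. \<xi> j x) ^ 4) < ennreal ((e/2) ^ 4)" using i unfolding f_def by simp
        then have "\<bar>\<Sum>j\<in>{i..<l}. \<xi> j x\<bar> ^ 4 < (e/2) ^ 4" by (simp add: ennreal_less_iff)
        then have "\<bar>\<Sum>j\<in>{i..<l}. \<xi> j x\<bar> < e/2" by (rule power_less_imp_less_base) (use e in simp)
        moreover have "(\<Sum>j<l. \<xi> j x) = (\<Sum>j<i. \<xi> j x) + (\<Sum>j\<in>{i..<l}. \<xi> j x)"
          using sum.atLeastLessThan_concat[of 0 i l "\<lambda>j. \<xi> j x"] that by (simp add: atLeast0LessThan)
        ultimately show ?thesis by simp
      qed
      have "dist (\<Sum>j<l. \<xi> j x) (\<Sum>j<l'. \<xi> j x) < e" if "l \<ge> i" "l' \<ge> i" for l l'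
        using near[OF that(1)] near[OF that(2)] unfolding dist_real_def by linarith
      then show "\<exists>N. \<forall>m\<ge>N. \<forall>n\<ge>N. dist (\<Sum>j<m. \<xi> j x) (\<Sum>j<n. \<xi> j x) < e" by blast
    qed
    then show ?case by (simp add: Cauchy_convergent_iff)
  qed
qed

section \<open>Law, linearity and scaling of the Paley--Wiener--Zygmund integral\<close>

context yw
begin

definition Z :: "nat \<Rightarrow> (real \<times> real \<Rightarrow> real) \<Rightarrow> real" where
  "Z j x = RS_integral S T (\<phi> j) x"

lemma Z_measurable: "Z j \<in> borel_measurable m0"
  unfolding Z_def using RS_integral_measurable[OF RS_integrand_phi] by simp

lemma pwz_partial_eq: "x \<in> C0 S T \<Longrightarrow> pwz_partial S T \<phi> v x = (\<lambda>n. \<Sum>j<n. ip v (\<phi> j) * Z j x)"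
  using RS_integral_lincomb[of x "\<lambda>j. ip v (\<phi> j)"] unfolding pwz_partial_def Z_def lincomb_def by (intro ext) simp

text \<open>Separates genuine limits from the default value 0 of \<open>pwz\<close>; linearity in
  the vector is proved only where \<open>conv\<close> holds.\<close>

definition conv :: "(real \<times> real \<Rightarrow> real) \<Rightarrow> (real \<times> real \<Rightarrow> real) \<Rightarrow> bool" where
  "conv v x \<longleftrightarrow> convergent (pwz_partial S T \<phi> v x)"

abbreviation "pz \<equiv> pwz S T \<phi>"

lemma conv_tendsto: "conv v x \<Longrightarrow> pwz_partial S T \<phi> v x \<longlonglongrightarrow> pz v x"
  unfolding conv_def pwz_def by (simp add: convergent_LIMSEQ_iff)

lemma conv_eqI: "pwz_partial S T \<phi> v x \<longlonglongrightarrow> l \<Longrightarrow> conv v x \<and> pz v x = l"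
  unfolding conv_def pwz_def by (auto simp: convergentI limI)

lemma AE_conv:
  assumes v: "v \<in> L2 S T"
  shows "AE x in m0. conv v x"
proof -
  define a where "a j = ip v (\<phi> j)" for j
  have "AE x in m0. convergent (\<lambda>n. \<Sum>j<n. a j * Z j x)"
  proof (rule AE_convergent_of_fourth_moments[where u = "\<lambda>j. (a j)\<^sup>2" and C = 3])
    show "(\<lambda>x. a j * Z j x) \<in> borel_measurable m0" for j using Z_measurable by measurable
    show "summable (\<lambda>j. (a j)\<^sup>2)" unfolding a_def by (rule coords_summable[OF v])
    fix i k :: nat assume ik: "i \<le> k"
    \<comment> \<open>Dropping the first \<open>i\<close> coefficients turns a block of the series
      into the integral of one linear combination.\<close>
    define b where "b j = (if i \<le> j then a j else 0)" for j
    have "(\<integral>\<^sup>+x. ennreal ((\<Sum>j\<in>{i..<k}. a j * Z j x) ^ 4) \<partial>m0) = (\<integral>\<^sup>+x. ennreal (RS_integral S T (lincomb b k) x ^ 4) \<partial>m0)"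
    proof (rule nn_integral_cong)
      fix x assume "x \<in> space m0"
      then have "RS_integral S T (lincomb b k) x = (\<Sum>j<k. b j * Z j x)"
        unfolding space_m0 Z_def by (rule RS_integral_lincomb)
      also have "\<dots> = (\<Sum>j\<in>{i..<k}. a j * Z j x)"
        by (rule sum.mono_neutral_cong_right) (auto simp: b_def)
      finally show "ennreal ((\<Sum>j\<in>{i..<k}. a j * Z j x) ^ 4) = ennreal (RS_integral S T (lincomb b k) x ^ 4)" by simp
    qed
    also have "\<dots> \<le> ennreal (3 * (ip (lincomb b k) (lincomb b k))\<^sup>2)"
      by (rule RS_integral_fourth_moment[OF RS_integrand_lincomb])
    also have "ip (lincomb b k) (lincomb b k) = (\<Sum>j\<in>{i..<k}. (a j)\<^sup>2)"
      unfolding ip_lincomb_self by (rule sum.mono_neutral_cong_right) (auto simp: b_def)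
    finally show "(\<integral>\<^sup>+x. ennreal ((\<Sum>j\<in>{i..<k}. a j * Z j x) ^ 4) \<partial>m0) \<le> ennreal (3 * (\<Sum>j\<in>{i..<k}. (a j)\<^sup>2)\<^sup>2)" .
  qed auto
  then show ?thesis unfolding conv_def
    using AE_space by eventually_elim (simp add: pwz_partial_eq space_m0 a_def)
qed

text \<open>Joint measurability in vector and path, both depending on \<open>\<omega>\<close>, as
  Fubini on a product with \<open>m0\<close> demands.\<close>

lemma pz_measurable:
  assumes \<psi>: "\<psi> \<in> N \<rightarrow>\<^sub>M L2_borel S T" and \<zeta>: "\<zeta> \<in> N \<rightarrow>\<^sub>M m0"
  shows "(\<lambda>\<omega>. pz (\<psi> \<omega>) (\<zeta> \<omega>)) \<in> borel_measurable N" "Measurable.pred N (\<lambda>\<omega>. conv (\<psi> \<omega>) (\<zeta> \<omega>))"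
proof -
  have sp: "\<zeta> \<omega> \<in> C0 S T" if "\<omega> \<in> space N" for \<omega>
    using measurable_space[OF \<zeta> that] by (simp add: space_m0)
  have [measurable]: "(\<lambda>\<omega>. ip (\<psi> \<omega>) (\<phi> j)) \<in> borel_measurable N" for j by (rule measurable_coord[OF \<psi>])
  have [measurable]: "(\<lambda>\<omega>. Z j (\<zeta> \<omega>)) \<in> borel_measurable N" for j by (rule measurable_compose[OF \<zeta> Z_measurable])
  define s where "s n \<omega> = (\<Sum>j<n. ip (\<psi> \<omega>) (\<phi> j) * Z j (\<zeta> \<omega>))" for n \<omega>
  have [measurable]: "s n \<in> borel_measurable N" for n unfolding s_def by measurable
  have C: "Measurable.pred N (\<lambda>\<omega>. Cauchy (\<lambda>n. s n \<omega>))"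
    unfolding pred_def by (rule sets_Collect_Cauchy) measurable
  have eq: "pwz_partial S T \<phi> (\<psi> \<omega>) (\<zeta> \<omega>) = (\<lambda>n. s n \<omega>)" if "\<omega> \<in> space N" for \<omega>
    unfolding s_def by (rule pwz_partial_eq[OF sp[OF that]])
  show "Measurable.pred N (\<lambda>\<omega>. conv (\<psi> \<omega>) (\<zeta> \<omega>))"
    using C by (simp add: conv_def eq Cauchy_convergent_iff cong: measurable_cong)
  have "(\<lambda>\<omega>. if Cauchy (\<lambda>n. s n \<omega>) then lim (\<lambda>n. s n \<omega>) else 0) \<in> borel_measurable N"
    using C by measurable
  moreover have "pz (\<psi> \<omega>) (\<zeta> \<omega>) = (if Cauchy (\<lambda>n. s n \<omega>) then lim (\<lambda>n. s n \<omega>) else 0)" if "\<omega> \<in> space N" for \<omega>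
    unfolding pwz_def eq[OF that] Cauchy_convergent_iff ..
  ultimately show "(\<lambda>\<omega>. pz (\<psi> \<omega>) (\<zeta> \<omega>)) \<in> borel_measurable N"
    by (subst measurable_cong)
qed

lemma pz_char:
  assumes v: "v \<in> L2 S T"
  shows "(LINT x|m0. exp (\<i> * complex_of_real (\<theta> * pz v x))) = complex_of_real (exp (- (\<theta>\<^sup>2 * ip v v / 2)))"
proof (rule LIMSEQ_unique)
  define g where "g n = lincomb (\<lambda>j. ip v (\<phi> j)) n" for n
  have gx: "RS_integral S T (g n) x = pwz_partial S T \<phi> v x n" if "x \<in> C0 S T" for n x
    unfolding g_def RS_integral_lincomb[OF that] pwz_partial_eq[OF that] Z_def ..
  have [measurable]: "RS_integral S T (g n) \<in> borel_measurable m0" for n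
    unfolding g_def by (rule RS_integral_measurable[OF RS_integrand_lincomb])
  have [measurable]: "pz v \<in> borel_measurable m0"
    using pz_measurable(1)[OF measurable_L2_const[OF v] measurable_ident] by simp
  show "(\<lambda>n. LINT x|m0. exp (\<i> * complex_of_real (\<theta> * RS_integral S T (g n) x))) \<longlonglongrightarrow> (LINT x|m0. exp (\<i> * complex_of_real (\<theta> * pz v x)))"
  proof (rule integral_dominated_convergence[where w = "\<lambda>_. 1"])
    show "AE x in m0. (\<lambda>n. exp (\<i> * complex_of_real (\<theta> * RS_integral S T (g n) x))) \<longlonglongrightarrow> exp (\<i> * complex_of_real (\<theta> * pz v x))"
      using AE_conv[OF v] AE_space
    proof eventually_elim
      case (elim x)
      then show ?case using conv_tendsto[OF elim(1)] gx[of x]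
        by (intro tendsto_intros) (simp add: space_m0)
    qed
  qed auto
  have L: "(\<lambda>n. ip (g n) (g n)) \<longlonglongrightarrow> ip v v"
    using parseval[OF v] unfolding g_def ip_lincomb_self sums_def .
  have c: "(LINT x|m0. exp (\<i> * complex_of_real (\<theta> * RS_integral S T (g n) x))) =
      complex_of_real (exp (- (\<theta>\<^sup>2 * ip (g n) (g n) / 2)))" for n
    unfolding g_def by (rule RS_integral_char[OF RS_integrand_lincomb])
  show "(\<lambda>n. LINT x|m0. exp (\<i> * complex_of_real (\<theta> * RS_integral S T (g n) x))) \<longlonglongrightarrow> complex_of_real (exp (- (\<theta>\<^sup>2 * ip v v / 2)))"
    unfolding c by (intro tendsto_intros L) simp
qed

lemma conv_lin:
  assumes "u \<in> L2 S T" "v \<in> L2 S T" "x \<in> C0 S T" "conv u x" "conv v x"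
  shows "conv (\<lambda>p. a * u p + b * v p) x" "pz (\<lambda>p. a * u p + b * v p) x = a * pz u x + b * pz v x"
proof -
  have "ip (\<lambda>p. a * u p + b * v p) (\<phi> j) = a * ip u (\<phi> j) + b * ip v (\<phi> j)" for j
    using assms by (simp add: l2_inner_add_left l2_inner_scale_left L2_scale phi_L2)
  then have "pwz_partial S T \<phi> (\<lambda>p. a * u p + b * v p) x = (\<lambda>n. a * pwz_partial S T \<phi> u x n + b * pwz_partial S T \<phi> v x n)"
    unfolding pwz_partial_eq[OF assms(3)] by (simp add: distrib_right sum.distrib sum_distrib_left mult.assoc)
  moreover have "(\<lambda>n. a * pwz_partial S T \<phi> u x n + b * pwz_partial S T \<phi> v x n) \<longlonglongrightarrow> a * pz u x + b * pz v x"
    by (intro tendsto_intros conv_tendsto assms)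
  ultimately have "pwz_partial S T \<phi> (\<lambda>p. a * u p + b * v p) x \<longlonglongrightarrow> a * pz u x + b * pz v x" by simp
  from conv_eqI[OF this] show "conv (\<lambda>p. a * u p + b * v p) x" "pz (\<lambda>p. a * u p + b * v p) x = a * pz u x + b * pz v x"
    by simp_all
qed

text \<open>The scaling rule holds at every path in \<open>C0\<close>: the partial sums are
  multiplied by \<open>\<rho>\<close>, and the default value 0 is compatible with this.\<close>

lemma conv_rescale:
  assumes "x \<in> C0 S T" "\<rho> \<noteq> 0"
  shows "conv v (rescale \<rho> x) \<longleftrightarrow> conv v x" "pz v (rescale \<rho> x) = \<rho> * pz v x"
proof -
  have eq: "pwz_partial S T \<phi> v (rescale \<rho> x) = (\<lambda>n. \<rho> * pwz_partial S T \<phi> v x n)"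
    unfolding pwz_partial_eq[OF assms(1)] pwz_partial_eq[OF rescale_C0[OF assms(1)]] Z_def RS_integral_rescale[OF assms(1)]
    by (simp add: sum_distrib_left mult_ac)
  show c: "conv v (rescale \<rho> x) \<longleftrightarrow> conv v x"
    unfolding conv_def eq using assms(2) by (simp add: convergent_mult_const_iff)
  show "pz v (rescale \<rho> x) = \<rho> * pz v x"
  proof (cases "conv v x")
    case True
    have "(\<lambda>n. \<rho> * pwz_partial S T \<phi> v x n) \<longlonglongrightarrow> \<rho> * pz v x" by (intro tendsto_intros conv_tendsto True)
    then show ?thesis using conv_eqI unfolding eq[symmetric] by blast
  next
    case False
    then have "\<not> conv v (rescale \<rho> x)" using c by simp
    then show ?thesis using False unfolding conv_def pwz_def by simp
  qed
qed

text \<open>Rescaling by \<open>\<rho>\<close> and by \<open>1 / \<rho>\<close> are inverse to each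
  other. Conversely the set of all failures serves as exceptional set; its rescaled images are
  measurable because the measure is complete.\<close>

lemma s_ae_iff: "s_ae (completion m0) P \<longleftrightarrow> (\<forall>\<rho>>0. AE x in m0. P (rescale \<rho> x))"
proof
  assume "s_ae (completion m0) P"
  then obtain N where N: "\<And>\<rho>. \<rho> > 0 \<Longrightarrow> rescale \<rho> ` N \<in> sets (completion m0) \<and> emeasure (completion m0) (rescale \<rho> ` N) = 0"
    "\<And>x. x \<in> C0 S T \<Longrightarrow> x \<notin> N \<Longrightarrow> P x"
    unfolding s_ae_def scale_invariant_null_def by (auto simp: space_m0)
  show "\<forall>\<rho>>0. AE x in m0. P (rescale \<rho> x)"
  proof (intro allI impI)
    fix \<rho> :: real assume \<rho>: "\<rho> > 0"
    then have "rescale (1 / \<rho>) ` N \<in> null_sets (completion m0)" using N(1)[of "1 / \<rho>"] by auto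
    from AE_not_in[OF this] have "AE x in completion m0. P (rescale \<rho> x)"
      using AE_space
    proof eventually_elim
      case (elim x)
      have "rescale \<rho> x \<notin> N"
      proof
        assume "rescale \<rho> x \<in> N"
        then have "rescale (1 / \<rho>) (rescale \<rho> x) \<in> rescale (1 / \<rho>) ` N" by simp
        moreover have "rescale (1 / \<rho>) (rescale \<rho> x) = x" using \<rho> by (simp add: rescale_def)
        ultimately show False using elim by simp
      qed
      then show ?case using N(2) elim rescale_C0 by (simp add: space_m0)
    qed
    then show "AE x in m0. P (rescale \<rho> x)" unfolding AE_completion_iff .
  qed
next
  assume P: "\<forall>\<rho>>0. AE x in m0. P (rescale \<rho> x)"
  define N where "N = {x \<in> C0 S T. \<not> P x}"
  have "rescale \<rho> ` N \<in> null_sets (completion m0)" if \<rho>: "\<rho> > 0" for \<rho>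
  proof (rule completion.complete2)
    have "AE x in completion m0. P (rescale (1 / \<rho>) x)"
      using P \<rho> unfolding AE_completion_iff by simp
    then show "{x \<in> space (completion m0). \<not> P (rescale (1 / \<rho>) x)} \<in> null_sets (completion m0)"
      unfolding completion.AE_iff_null_sets .
    show "rescale \<rho> ` N \<subseteq> {x \<in> space (completion m0). \<not> P (rescale (1 / \<rho>) x)}"
    proof
      fix y assume "y \<in> rescale \<rho> ` N"
      then obtain x where x: "x \<in> N" "y = rescale \<rho> x" by auto
      have "rescale (1 / \<rho>) y = x" unfolding x using \<rho> by (simp add: rescale_def)
      then show "y \<in> {x \<in> space (completion m0). \<not> P (rescale (1 / \<rho>) x)}"
        using x rescale_C0 unfolding N_def by (simp add: space_m0)
    qed
  qed
  then have "scale_invariant_null (completion m0) N" unfolding scale_invariant_null_def by auto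
  moreover have "\<forall>x\<in>space (completion m0) - N. P x" unfolding N_def by (simp add: space_m0)
  ultimately show "s_ae (completion m0) P" unfolding s_ae_def by blast
qed

text \<open>For each vector the exceptional paths form a null set depending on that vector. Fubini
  exchanges the order: a typical path has convergence for almost every parameter.\<close>

lemma AE_AE_conv:
  assumes P: "finite_measure P" and \<psi>: "\<psi> \<in> P \<rightarrow>\<^sub>M L2_borel S T"
  shows "AE x in m0. AE \<omega> in P. conv (\<psi> \<omega>) x"
proof -
  interpret P: finite_measure P by fact
  interpret pair_sigma_finite m0 P ..
  have "Measurable.pred (m0 \<Otimes>\<^sub>M P) (\<lambda>z. conv (\<psi> (snd z)) (fst z))"
    by (rule pz_measurable(2)[OF measurable_compose[OF measurable_snd \<psi>] measurable_fst])
  then have m: "{z \<in> space (m0 \<Otimes>\<^sub>M P). conv (\<psi> (snd z)) (fst z)} \<in> sets (m0 \<Otimes>\<^sub>M P)" by (simp add: pred_def)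
  have "AE \<omega> in P. AE x in m0. conv (\<psi> \<omega>) x"
    by (rule AE_I2) (rule AE_conv, rule L2_measurable_space[OF \<psi>])
  moreover have "{z \<in> space (m0 \<Otimes>\<^sub>M P). (\<lambda>x \<omega>. conv (\<psi> \<omega>) x) (fst z) (snd z)} \<in> sets (m0 \<Otimes>\<^sub>M P)" using m by simp
  ultimately show ?thesis using AE_commute[of "\<lambda>x \<omega>. conv (\<psi> \<omega>) x"] by blast
qed

end


section \<open>Analytic continuation of Gaussian averages\<close>


lemma norm_exp_neg_mult_le:
  fixes z :: complex
  assumes "Re z \<ge> 0" "b \<ge> 0"
  shows "norm (exp (- z * complex_of_real b)) \<le> 1"
  using assms by (simp add: norm_exp_eq_Re)

text \<open>The derivative in \<open>z\<close> is at most \<open>b * exp (- r / 2 * b)\<close>, and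
  \<open>x \<le> exp x\<close> bounds this by \<open>2 / r\<close> for every
  \<open>b \<ge> 0\<close>. The bound is uniform in \<open>b\<close>, so differentiation under the
  integral asks for no moment of \<open>b\<close>.\<close>

lemma exp_neg_mult_diff_bound:
  fixes z0 h :: complex
  assumes r: "r > 0" "Re z0 = r" "norm h \<le> r / 2" and b: "b \<ge> 0"
  shows "norm (exp (- (z0 + h) * complex_of_real b) - exp (- z0 * complex_of_real b)) \<le> 2 / r * norm h"
proof -
  define H where "H = {z. Re z \<ge> r / 2}"
  have "convex H" unfolding H_def by (rule convex_halfspace_Re_ge)
  moreover have "((\<lambda>z. exp (- z * complex_of_real b)) has_field_derivative - complex_of_real b * exp (- z * complex_of_real b)) (at z within H)" for z
    by (auto intro!: derivative_eq_intros)
  moreover have "norm (- complex_of_real b * exp (- z * complex_of_real b)) \<le> 2 / r" if "z \<in> H" for z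
  proof -
    have "norm (- complex_of_real b * exp (- z * complex_of_real b)) = b * exp (- (Re z * b))"
      using b by (simp add: norm_mult norm_exp_eq_Re)
    also have "\<dots> \<le> b * exp (- (r / 2 * b))"
    proof -
      have "r / 2 * b \<le> Re z * b" using that b unfolding H_def by (intro mult_right_mono) auto
      then show ?thesis using b by (intro mult_left_mono) auto
    qed
    also have "\<dots> \<le> 2 / r"
    proof -
      have "r / 2 * b \<le> exp (r / 2 * b)" using exp_ge_add_one_self[of "r / 2 * b"] by linarith
      then show ?thesis using r(1) by (simp add: exp_minus field_simps)
    qed
    finally show ?thesis .
  qed
  moreover have "z0 + h \<in> H"
  proof -
    have "\<bar>Re h\<bar> \<le> norm h" by (rule abs_Re_le_cmod)
    then show ?thesis using r unfolding H_def by simp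
  qed
  moreover have "z0 \<in> H" using r unfolding H_def by simp
  ultimately have "norm (exp (- (z0 + h) * complex_of_real b) - exp (- z0 * complex_of_real b)) \<le> 2 / r * norm (z0 + h - z0)"
    by (rule field_differentiable_bound)
  then show ?thesis by simp
qed

text \<open>The Laplace transform of the image under \<open>b\<close> of the complex measure with
  density \<open>\<rho>\<close>. A Gaussian average with parameter \<open>\<kappa>\<close> is its
  value at \<open>1 / (2 * \<kappa>)\<close>.\<close>

definition laplace :: "'b measure \<Rightarrow> ('b \<Rightarrow> complex) \<Rightarrow> ('b \<Rightarrow> real) \<Rightarrow> complex \<Rightarrow> complex" where
  "laplace P \<rho> b z = (LINT \<omega>|P. exp (- z * complex_of_real (b \<omega>)) * \<rho> \<omega>)"

lemma laplace_integrable: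
  assumes "integrable P \<rho>" "b \<in> borel_measurable P" "\<And>\<omega>. b \<omega> \<ge> 0" "Re z \<ge> 0"
  shows "integrable P (\<lambda>\<omega>. exp (- z * complex_of_real (b \<omega>)) * \<rho> \<omega>)"
  using assms(2) by (intro integrable_bounded_mult[OF assms(1), where C = 1] norm_exp_neg_mult_le assms(3,4)) measurable

text \<open>Continuity includes the imaginary axis, where the limit
  \<open>\<kappa> \<rightarrow> - i q\<close> ends up.\<close>

lemma continuous_on_laplace:
  assumes \<rho>: "integrable P \<rho>" and b [measurable]: "b \<in> borel_measurable P" and b0: "\<And>\<omega>. b \<omega> \<ge> 0"
  shows "continuous_on {z. Re z \<ge> 0} (laplace P \<rho> b)"
  unfolding continuous_on_sequentially
proof (intro ballI allI impI, elim conjE)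
  fix z X assume X: "\<forall>n. X n \<in> {z. Re z \<ge> 0}" "X \<longlonglongrightarrow> z"
  have [measurable]: "\<rho> \<in> borel_measurable P" using \<rho> by auto
  show "(laplace P \<rho> b \<circ> X) \<longlonglongrightarrow> laplace P \<rho> b z"
    unfolding laplace_def o_def
  proof (rule integral_dominated_convergence[where w = "\<lambda>\<omega>. norm (\<rho> \<omega>)"])
    show "AE \<omega> in P. (\<lambda>n. exp (- X n * complex_of_real (b \<omega>)) * \<rho> \<omega>) \<longlonglongrightarrow> exp (- z * complex_of_real (b \<omega>)) * \<rho> \<omega>"
      by (intro AE_I2 tendsto_intros X)
    show "AE \<omega> in P. norm (exp (- X n * complex_of_real (b \<omega>)) * \<rho> \<omega>) \<le> norm (\<rho> \<omega>)" for n
      unfolding norm_mult using X(1) b0 by (intro AE_I2 mult_left_le_one_le norm_exp_neg_mult_le) auto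
  qed (use \<rho> in auto)
qed

lemma laplace_holomorphic:
  assumes \<rho>: "integrable P \<rho>" and b [measurable]: "b \<in> borel_measurable P" and b0: "\<And>\<omega>. b \<omega> \<ge> 0"
  shows "laplace P \<rho> b holomorphic_on {z. Re z > 0}"
proof (rule holomorphic_onI)
  fix z0 assume "z0 \<in> {z. Re z > 0}"
  then have r: "Re z0 > 0" by simp
  have [measurable]: "\<rho> \<in> borel_measurable P" using \<rho> by auto
  define E where "E z \<omega> = exp (- z * complex_of_real (b \<omega>))" for z \<omega>
  have [measurable]: "E z \<in> borel_measurable P" for z unfolding E_def by measurable
  define D where "D = (LINT \<omega>|P. - complex_of_real (b \<omega>) * E z0 \<omega> * \<rho> \<omega>)"
  have int: "integrable P (\<lambda>\<omega>. E z \<omega> * \<rho> \<omega>)" if "Re z \<ge> 0" for z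
    unfolding E_def by (rule laplace_integrable[OF \<rho> b b0 that])
  have "(laplace P \<rho> b has_field_derivative D) (at z0)"
    unfolding DERIV_def tendsto_at_iff_sequentially
  proof (intro allI impI)
    fix X :: "nat \<Rightarrow> complex" assume X0: "\<forall>i. X i \<in> UNIV - {0}" and X: "X \<longlonglongrightarrow> 0"
    have "eventually (\<lambda>n. norm (X n) < Re z0 / 2) sequentially"
      using X r by (auto simp: tendsto_iff dist_norm dest: spec[of _ "Re z0 / 2"])
    then obtain N where N: "\<And>n. n \<ge> N \<Longrightarrow> norm (X n) < Re z0 / 2" by (auto simp: eventually_sequentially)
    \<comment> \<open>Without the first \<open>N\<close> terms the bound on the difference quotients
      holds for every index, as the domination requires.\<close>
    define Y where "Y n = X (n + N)" for n
    have Y: "Y \<longlonglongrightarrow> 0" "\<And>n. Y n \<noteq> 0" "\<And>n. norm (Y n) \<le> Re z0 / 2"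
      unfolding Y_def using X X0 N by (auto intro: LIMSEQ_ignore_initial_segment less_imp_le)
    have ReY: "Re (z0 + Y n) \<ge> 0" for n
      using abs_Re_le_cmod[of "Y n"] Y(3)[of n] r by simp
    have "(\<lambda>n. LINT \<omega>|P. (E (z0 + Y n) \<omega> - E z0 \<omega>) / Y n * \<rho> \<omega>) \<longlonglongrightarrow> D"
      unfolding D_def
    proof (rule integral_dominated_convergence[where w = "\<lambda>\<omega>. 2 / Re z0 * norm (\<rho> \<omega>)"])
      show "AE \<omega> in P. (\<lambda>n. (E (z0 + Y n) \<omega> - E z0 \<omega>) / Y n * \<rho> \<omega>) \<longlonglongrightarrow> - complex_of_real (b \<omega>) * E z0 \<omega> * \<rho> \<omega>"
      proof (intro AE_I2 tendsto_mult_right)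
        fix \<omega>
        have "((\<lambda>z. E z \<omega>) has_field_derivative - complex_of_real (b \<omega>) * E z0 \<omega>) (at z0)"
          unfolding E_def by (auto intro!: derivative_eq_intros)
        then have "((\<lambda>h. (E (z0 + h) \<omega> - E z0 \<omega>) / h) \<longlongrightarrow> - complex_of_real (b \<omega>) * E z0 \<omega>) (at 0)"
          unfolding DERIV_def .
        then show "(\<lambda>n. (E (z0 + Y n) \<omega> - E z0 \<omega>) / Y n) \<longlonglongrightarrow> - complex_of_real (b \<omega>) * E z0 \<omega>"
          unfolding tendsto_at_iff_sequentially using Y by (auto simp: o_def)
      qed
      show "AE \<omega> in P. norm ((E (z0 + Y n) \<omega> - E z0 \<omega>) / Y n * \<rho> \<omega>) \<le> 2 / Re z0 * norm (\<rho> \<omega>)" for n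
      proof (rule AE_I2)
        fix \<omega>
        have "norm (E (z0 + Y n) \<omega> - E z0 \<omega>) \<le> 2 / Re z0 * norm (Y n)"
          unfolding E_def by (rule exp_neg_mult_diff_bound[OF r refl Y(3) b0])
        then have "norm ((E (z0 + Y n) \<omega> - E z0 \<omega>) / Y n) \<le> 2 / Re z0"
          using Y(2)[of n] by (simp add: norm_divide divide_le_eq)
        then show "norm ((E (z0 + Y n) \<omega> - E z0 \<omega>) / Y n * \<rho> \<omega>) \<le> 2 / Re z0 * norm (\<rho> \<omega>)"
          unfolding norm_mult by (rule mult_right_mono) simp
      qed
    qed (use \<rho> in auto)
    moreover have "(LINT \<omega>|P. (E (z0 + Y n) \<omega> - E z0 \<omega>) / Y n * \<rho> \<omega>) = (laplace P \<rho> b (z0 + Y n) - laplace P \<rho> b z0) / Y n" for n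
    proof -
      have "laplace P \<rho> b (z0 + Y n) - laplace P \<rho> b z0 = (LINT \<omega>|P. E (z0 + Y n) \<omega> * \<rho> \<omega> - E z0 \<omega> * \<rho> \<omega>)"
        unfolding laplace_def E_def[symmetric]
        by (rule Bochner_Integration.integral_diff[symmetric]) (intro int ReY less_imp_le[OF r])+
      also have "\<dots> / Y n = (LINT \<omega>|P. (E (z0 + Y n) \<omega> * \<rho> \<omega> - E z0 \<omega> * \<rho> \<omega>) / Y n)" by simp
      finally show ?thesis by (simp add: left_diff_distrib diff_divide_distrib)
    qed
    ultimately have "(\<lambda>n. (laplace P \<rho> b (z0 + Y n) - laplace P \<rho> b z0) / Y n) \<longlonglongrightarrow> D" by (simp only:)
    then show "((\<lambda>h. (laplace P \<rho> b (z0 + h) - laplace P \<rho> b z0) / h) \<circ> X) \<longlonglongrightarrow> D"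
      unfolding Y_def o_def by (rule LIMSEQ_offset)
  qed
  then show "laplace P \<rho> b field_differentiable at z0 within {z. Re z > 0}"
    unfolding field_differentiable_def by (blast intro: DERIV_subset)
qed

text \<open>Two continuations agree on the positive reals, hence on the half-plane by the identity
  theorem, and \<open>- i q\<close> is a limit point of the half-plane. This justifies the
  description operator in \<open>analytic_limit\<close>.\<close>

lemma has_analytic_limit_unique:
  assumes "has_analytic_limit m q \<Phi> z" "has_analytic_limit m q \<Phi> z'"
  shows "z = z'"
proof -
  define H where "H = {\<kappa> :: complex. Re \<kappa> > 0}"
  from assms obtain J J' where J: "J holomorphic_on H" "J' holomorphic_on H"
    and eq: "\<And>\<kappa>. \<kappa> > 0 \<Longrightarrow> has_bochner_integral m (\<Phi> \<kappa>) (J (complex_of_real \<kappa>))"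
      "\<And>\<kappa>. \<kappa> > 0 \<Longrightarrow> has_bochner_integral m (\<Phi> \<kappa>) (J' (complex_of_real \<kappa>))"
    and lim: "(J \<longlongrightarrow> z) (at (- \<i> * complex_of_real q) within H)" "(J' \<longlongrightarrow> z') (at (- \<i> * complex_of_real q) within H)"
    unfolding has_analytic_limit_def H_def by blast
  have oH: "open H" unfolding H_def by (rule open_halfspace_Re_gt)
  have cH: "connected H" unfolding H_def by (intro convex_connected convex_halfspace_Re_gt)
  have lp: "(1 :: complex) islimpt complex_of_real ` {0<..}"
    unfolding islimpt_approachable
  proof (intro allI impI)
    fix e :: real assume "e > 0"
    then show "\<exists>x'\<in>complex_of_real ` {0<..}. x' \<noteq> 1 \<and> dist x' 1 < e"
      by (intro bexI[of _ "complex_of_real (1 + e / 2)"] imageI) (auto simp: dist_norm)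
  qed
  have diff: "J w - J' w = 0" if "w \<in> H" for w
  proof (rule analytic_continuation[where f = "\<lambda>w. J w - J' w" and S = H and U = "complex_of_real ` {0<..}" and \<xi> = 1])
    show "(\<lambda>w. J w - J' w) holomorphic_on H" by (intro holomorphic_intros J)
    show "complex_of_real ` {0<..} \<subseteq> H" "(1 :: complex) \<in> H" unfolding H_def by auto
    show "J w - J' w = 0" if "w \<in> complex_of_real ` {0<..}" for w
      using that has_bochner_integral_eq[OF eq(1) eq(2)] by auto
  qed (use oH cH lp that in auto)
  have "(J' \<longlongrightarrow> z) (at (- \<i> * complex_of_real q) within H)"
    by (rule Lim_transform_eventually[OF lim(1)]) (use diff in \<open>auto simp: eventually_at_filter\<close>)
  moreover have "at (- \<i> * complex_of_real q) within H \<noteq> bot"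
    unfolding trivial_limit_within islimpt_approachable not_not
  proof (intro allI impI)
    fix e :: real assume "e > 0"
    then show "\<exists>x'\<in>H. x' \<noteq> - \<i> * complex_of_real q \<and> dist x' (- \<i> * complex_of_real q) < e"
      unfolding H_def by (intro bexI[of _ "- \<i> * complex_of_real q + complex_of_real (e / 2)"]) (auto simp: dist_norm)
  qed
  ultimately show ?thesis using lim(2) tendsto_unique by blast
qed

lemma analytic_limit_eqI: "has_analytic_limit m q \<Phi> z \<Longrightarrow> analytic_limit m q \<Phi> = Some z"
  unfolding analytic_limit_def using has_analytic_limit_unique by (auto intro!: the_equality)

section \<open>Averages over the path, and Gaussians recovered from a functional\<close>

context yw
begin

lemma fubini_pz:
  assumes P: "finite_measure P" and \<rho>: "integrable P \<rho>"
    and E: "case_prod E \<in> borel_measurable (m0 \<Otimes>\<^sub>M P)" "\<And>x \<omega>. norm (E x \<omega> :: complex) \<le> 1"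
  shows "integrable m0 (\<lambda>x. LINT \<omega>|P. E x \<omega> * \<rho> \<omega>)"
    "(LINT x|m0. LINT \<omega>|P. E x \<omega> * \<rho> \<omega>) = (LINT \<omega>|P. (LINT x|m0. E x \<omega>) * \<rho> \<omega>)"
proof -
  interpret P: finite_measure P by fact
  interpret pair_sigma_finite m0 P ..
  have [measurable]: "\<rho> \<in> borel_measurable P" using \<rho> by auto
  have i: "integrable (m0 \<Otimes>\<^sub>M P) (\<lambda>(x, \<omega>). E x \<omega> * \<rho> \<omega>)"
  proof (rule Fubini_integrable)
    note [measurable] = E(1)
    show "(\<lambda>(x, \<omega>). E x \<omega> * \<rho> \<omega>) \<in> borel_measurable (m0 \<Otimes>\<^sub>M P)" by measurable
    have Ex: "integrable P (\<lambda>\<omega>. E x \<omega> * \<rho> \<omega>)" if x: "x \<in> space m0" for x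
      by (rule integrable_bounded_mult[OF \<rho> _ E(2)]) (use measurable_compose[OF measurable_Pair1'[OF x] E(1)] in simp)
    show "AE x in m0. integrable P (\<lambda>\<omega>. case (x, \<omega>) of (x, \<omega>) \<Rightarrow> E x \<omega> * \<rho> \<omega>)"
      using Ex by (intro AE_I2) simp
    have m: "(\<lambda>x. LINT \<omega>|P. norm (E x \<omega> * \<rho> \<omega>)) \<in> borel_measurable m0" by measurable
    show "integrable m0 (\<lambda>x. LINT \<omega>|P. norm (case (x, \<omega>) of (x, \<omega>) \<Rightarrow> E x \<omega> * \<rho> \<omega>))"
    proof (rule m0.integrable_const_bound[where B = "LINT \<omega>|P. norm (\<rho> \<omega>)"])
      show "AE x in m0. norm (LINT \<omega>|P. norm (case (x, \<omega>) of (x, \<omega>) \<Rightarrow> E x \<omega> * \<rho> \<omega>)) \<le> (LINT \<omega>|P. norm (\<rho> \<omega>))"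
      proof (rule AE_I2)
        fix x assume x: "x \<in> space m0"
        have "(LINT \<omega>|P. norm (E x \<omega> * \<rho> \<omega>)) \<le> (LINT \<omega>|P. norm (\<rho> \<omega>))"
        proof (rule integral_mono)
          show "norm (E x \<omega> * \<rho> \<omega>) \<le> norm (\<rho> \<omega>)" for \<omega>
            unfolding norm_mult by (rule mult_left_le_one_le) (auto intro: E(2))
        qed (use Ex[OF x] \<rho> in auto)
        moreover have "(LINT \<omega>|P. norm (E x \<omega> * \<rho> \<omega>)) \<ge> 0" by simp
        ultimately show "norm (LINT \<omega>|P. norm (case (x, \<omega>) of (x, \<omega>) \<Rightarrow> E x \<omega> * \<rho> \<omega>)) \<le> (LINT \<omega>|P. norm (\<rho> \<omega>))" by simp
      qed
    qed (use m in simp)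
  qed
  show "integrable m0 (\<lambda>x. LINT \<omega>|P. E x \<omega> * \<rho> \<omega>)" using integrable_fst'[OF i] by simp
  show "(LINT x|m0. LINT \<omega>|P. E x \<omega> * \<rho> \<omega>) = (LINT \<omega>|P. (LINT x|m0. E x \<omega>) * \<rho> \<omega>)"
    using Fubini_integral[OF i] by simp
qed

lemma pz_pair_measurable:
  assumes "\<psi> \<in> P \<rightarrow>\<^sub>M L2_borel S T"
  shows "(\<lambda>z. pz (\<psi> (snd z)) (fst z)) \<in> borel_measurable (m0 \<Otimes>\<^sub>M P)"
  by (rule pz_measurable(1)[OF measurable_compose[OF measurable_snd assms] measurable_fst])

lemma norm_exp_i_real: "norm (exp (\<i> * complex_of_real a)) = 1"
  by (simp add: norm_exp_eq_Re)

text \<open>The common core of transform and convolution product: \<open>V \<omega>\<close> is the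
  vector integrated against the averaged path, while \<open>\<rho>\<close> may already contain the
  phase in the fixed path.\<close>

lemma analytic_limit_gaussian:
  assumes P: "finite_measure P" and V: "V \<in> P \<rightarrow>\<^sub>M L2_borel S T" and \<rho>: "integrable P \<rho>" and q: "q \<noteq> 0"
    and \<Phi>: "\<And>\<kappa>. \<kappa> > 0 \<Longrightarrow> \<Phi> \<kappa> \<in> borel_measurable m0"
      "\<And>\<kappa>. \<kappa> > 0 \<Longrightarrow> AE x in m0. \<Phi> \<kappa> x = (LINT \<omega>|P. exp (\<i> * complex_of_real (\<kappa> powr (-1/2) * pz (V \<omega>) x)) * \<rho> \<omega>)"
  shows "analytic_limit (completion m0) q \<Phi> =
     Some (LINT \<omega>|P. exp (- \<i> * complex_of_real (ip (V \<omega>) (V \<omega>) / (2 * q))) * \<rho> \<omega>)"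
proof (rule analytic_limit_eqI)
  define b where "b \<omega> = ip (V \<omega>) (V \<omega>)" for \<omega>
  have b: "b \<in> borel_measurable P" "\<And>\<omega>. b \<omega> \<ge> 0"
    unfolding b_def using measurable_ip[OF V V] l2_inner_self_nonneg by auto
  define J where "J \<kappa> = laplace P \<rho> b (1 / (2 * \<kappa>))" for \<kappa>
  have Re_inv: "Re (1 / (2 * \<kappa>)) > 0" if "Re \<kappa> > 0" for \<kappa> :: complex
    using that by (auto simp: Re_divide intro!: divide_pos_pos add_pos_nonneg)
  have "J holomorphic_on {\<kappa>. Re \<kappa> > 0}"
  proof -
    have "(\<lambda>\<kappa>. 1 / (2 * \<kappa>)) holomorphic_on {\<kappa> :: complex. Re \<kappa> > 0}"
      by (intro holomorphic_intros) auto
    from holomorphic_on_compose_gen[OF this laplace_holomorphic[OF \<rho> b]] show ?thesis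
      unfolding J_def o_def using Re_inv by auto
  qed
  moreover have "has_bochner_integral (completion m0) (\<Phi> \<kappa>) (J (complex_of_real \<kappa>))" if \<kappa>: "\<kappa> > 0" for \<kappa>
  proof -
    define c where "c = \<kappa> powr (-1/2)"
    have c2: "c\<^sup>2 = 1 / \<kappa>" unfolding c_def using \<kappa>
      by (simp add: power2_eq_square powr_add[symmetric] powr_minus_divide)
    have E: "(\<lambda>(x, \<omega>). exp (\<i> * complex_of_real (c * pz (V \<omega>) x))) \<in> borel_measurable (m0 \<Otimes>\<^sub>M P)"
      using pz_pair_measurable[OF V] by (simp add: split_beta)
    note F = fubini_pz[OF P \<rho> E]
    have n1: "norm (exp (\<i> * complex_of_real (c * pz (V \<omega>) x))) \<le> 1" for x \<omega> by (simp add: norm_exp_i_real)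
    have int: "integrable m0 (\<Phi> \<kappa>)" and val: "(LINT x|m0. \<Phi> \<kappa> x) = (LINT x|m0. LINT \<omega>|P. exp (\<i> * complex_of_real (c * pz (V \<omega>) x)) * \<rho> \<omega>)"
    proof -
      have ae: "AE x in m0. (LINT \<omega>|P. exp (\<i> * complex_of_real (c * pz (V \<omega>) x)) * \<rho> \<omega>) = \<Phi> \<kappa> x"
        using \<Phi>(2)[OF \<kappa>] unfolding c_def by auto
      show "integrable m0 (\<Phi> \<kappa>)" by (rule integrable_cong_AE_imp[OF F(1)[OF n1] \<Phi>(1)[OF \<kappa>] ae])
      show "(LINT x|m0. \<Phi> \<kappa> x) = (LINT x|m0. LINT \<omega>|P. exp (\<i> * complex_of_real (c * pz (V \<omega>) x)) * \<rho> \<omega>)"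
        by (rule integral_cong_AE[OF \<Phi>(1)[OF \<kappa>] borel_measurable_integrable[OF F(1)[OF n1]]]) (use ae in auto)
    qed
    have "(LINT x|m0. \<Phi> \<kappa> x) = (LINT \<omega>|P. (LINT x|m0. exp (\<i> * complex_of_real (c * pz (V \<omega>) x))) * \<rho> \<omega>)"
      unfolding val by (rule F(2)[OF n1])
    also have "\<dots> = J (complex_of_real \<kappa>)"
      unfolding J_def laplace_def
    proof (rule Bochner_Integration.integral_cong[OF refl])
      fix \<omega> assume "\<omega> \<in> space P"
      then have "V \<omega> \<in> L2 S T" by (rule L2_measurable_space[OF V])
      from pz_char[OF this, of c]
      have "(LINT x|m0. exp (\<i> * complex_of_real (c * pz (V \<omega>) x))) = complex_of_real (exp (- (1 / \<kappa> * b \<omega> / 2)))"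
        unfolding c2 b_def .
      also have "\<dots> = exp (- (1 / (2 * complex_of_real \<kappa>)) * complex_of_real (b \<omega>))"
        by (simp add: exp_of_real[symmetric] mult.commute)
      finally show "(LINT x|m0. exp (\<i> * complex_of_real (c * pz (V \<omega>) x))) * \<rho> \<omega> =
          exp (- (1 / (2 * complex_of_real \<kappa>)) * complex_of_real (b \<omega>)) * \<rho> \<omega>" by simp
    qed
    finally have v: "(LINT x|m0. \<Phi> \<kappa> x) = J (complex_of_real \<kappa>)" .
    show ?thesis unfolding has_bochner_integral_iff
      using int v integral_completion[OF \<Phi>(1)[OF \<kappa>]] integrable_completion[OF \<Phi>(1)[OF \<kappa>]] by simp
  qed
  moreover have "(J \<longlongrightarrow> (LINT \<omega>|P. exp (- \<i> * complex_of_real (ip (V \<omega>) (V \<omega>) / (2 * q))) * \<rho> \<omega>))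
      (at (- \<i> * complex_of_real q) within {\<kappa>. Re \<kappa> > 0})"
  proof -
    \<comment> \<open>The point \<open>- i q\<close> is sent to \<open>i / (2 q)\<close> on the
      imaginary axis, where \<open>laplace\<close> is still continuous. Points with
      \<open>Re \<kappa> > 0\<close> have images with positive real part, hence different from
      \<open>z\<close>.\<close>
    define z where "z = 1 / (2 * (- \<i> * complex_of_real q))"
    have z: "z = \<i> / (2 * complex_of_real q)" unfolding z_def using q by (simp add: field_simps)
    have "Re z = 0" unfolding z by (simp add: Re_divide)
    then have "(laplace P \<rho> b \<longlongrightarrow> laplace P \<rho> b z) (at z within {z. Re z \<ge> 0})"
      using continuous_on_laplace[OF \<rho> b] unfolding continuous_on_def by auto
    moreover have "filterlim (\<lambda>\<kappa>. 1 / (2 * \<kappa>)) (at z within {z. Re z \<ge> 0}) (at (- \<i> * complex_of_real q) within {\<kappa>. Re \<kappa> > 0})"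
      unfolding filterlim_at
    proof
      show "\<forall>\<^sub>F \<kappa> in at (- \<i> * complex_of_real q) within {\<kappa>. Re \<kappa> > 0}. 1 / (2 * \<kappa>) \<in> {z. Re z \<ge> 0} \<and> 1 / (2 * \<kappa>) \<noteq> z"
      proof -
        have "1 / (2 * \<kappa>) \<in> {z. Re z \<ge> 0} \<and> 1 / (2 * \<kappa>) \<noteq> z" if "Re \<kappa> > 0" for \<kappa>
          using Re_inv[OF that] \<open>Re z = 0\<close> by auto
        then show ?thesis by (auto simp: eventually_at_filter)
      qed
      show "((\<lambda>\<kappa>. 1 / (2 * \<kappa>)) \<longlongrightarrow> z) (at (- \<i> * complex_of_real q) within {\<kappa>. Re \<kappa> > 0})"
        unfolding z_def using q by (intro tendsto_intros) auto
    qed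
    ultimately have "(J \<longlongrightarrow> laplace P \<rho> b z) (at (- \<i> * complex_of_real q) within {\<kappa>. Re \<kappa> > 0})"
      unfolding J_def by (rule filterlim_compose)
    moreover have "laplace P \<rho> b z = (LINT \<omega>|P. exp (- \<i> * complex_of_real (ip (V \<omega>) (V \<omega>) / (2 * q))) * \<rho> \<omega>)"
      unfolding laplace_def z b_def by (intro Bochner_Integration.integral_cong refl) simp
    ultimately show ?thesis by simp
  qed
  ultimately show "has_analytic_limit (completion m0) q \<Phi> (LINT \<omega>|P. exp (- \<i> * complex_of_real (ip (V \<omega>) (V \<omega>) / (2 * q))) * \<rho> \<omega>)"
    unfolding has_analytic_limit_def by blast
qed

lemma dist2_measurable: "v \<in> L2 S T \<Longrightarrow> (\<lambda>u. dist2 S T u v) \<in> borel_measurable (L2_borel S T)"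
proof -
  assume v: "v \<in> L2 S T"
  have "(\<lambda>u p. 1 * u p + (-1) * v p) \<in> L2_borel S T \<rightarrow>\<^sub>M L2_borel S T"
    by (rule measurable_L2_lin[OF measurable_ident measurable_L2_const[OF v], unfolded id_def])
  from measurable_ip[OF this this] show ?thesis by simp
qed

lemma L2_ball_sets: "v \<in> L2 S T \<Longrightarrow> L2_ball v r \<in> sets (L2_borel S T)"
proof -
  assume v: "v \<in> L2 S T"
  have "{u \<in> space (L2_borel S T). dist2 S T u v < r} \<in> sets (L2_borel S T)"
    using dist2_measurable[OF v] by measurable
  then show ?thesis unfolding L2_ball_def space_L2_borel .
qed

text \<open>After Fubini the average over \<open>x\<close> is taken for fixed \<open>u\<close>,
  where linearity of the integral holds for almost every \<open>x\<close>; it gives the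
  characteristic function of the integral of \<open>u - v\<close>.\<close>

lemma gaussian_of_functional:
  assumes P: "finite_measure P" and s: "sets P = sets (L2_borel S T)" and r: "integrable P r" and v: "v \<in> L2 S T"
  shows "(LINT x|m0. (LINT u|P. exp (\<i> * complex_of_real (c * pz u x)) * r u) * exp (- \<i> * complex_of_real (c * pz v x))) =
     (LINT u|P. complex_of_real (exp (- (c\<^sup>2 / 2 * dist2 S T u v))) * r u)"
proof -
  have id: "(\<lambda>u. u) \<in> P \<rightarrow>\<^sub>M L2_borel S T" by (rule measurable_ident_sets[OF s])
  have sp: "u \<in> L2 S T" if "u \<in> space P" for u using L2_measurable_space[OF id that] .
  define E where "E x u = exp (\<i> * complex_of_real (c * (pz u x - pz v x)))" for x u
  have E: "case_prod E \<in> borel_measurable (m0 \<Otimes>\<^sub>M P)"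
    using pz_pair_measurable[OF id] pz_pair_measurable[OF measurable_L2_const[OF v, of P]]
    unfolding E_def by (simp add: split_beta)
  have "(LINT x|m0. (LINT u|P. exp (\<i> * complex_of_real (c * pz u x)) * r u) * exp (- \<i> * complex_of_real (c * pz v x))) =
      (LINT x|m0. LINT u|P. E x u * r u)"
  proof (rule Bochner_Integration.integral_cong[OF refl])
    fix x
    have "exp (\<i> * complex_of_real (c * pz u x)) * r u * exp (- \<i> * complex_of_real (c * pz v x)) = E x u * r u" for u
      unfolding E_def by (simp add: right_diff_distrib exp_diff exp_minus divide_inverse mult_ac)
    then show "(LINT u|P. exp (\<i> * complex_of_real (c * pz u x)) * r u) * exp (- \<i> * complex_of_real (c * pz v x)) = (LINT u|P. E x u * r u)"
      by (simp only: integral_mult_left_zero[symmetric])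
  qed
  also have "\<dots> = (LINT u|P. (LINT x|m0. E x u) * r u)"
    by (rule fubini_pz(2)[OF P r E]) (simp add: E_def norm_exp_i_real)
  also have "\<dots> = (LINT u|P. complex_of_real (exp (- (c\<^sup>2 / 2 * dist2 S T u v))) * r u)"
  proof (rule Bochner_Integration.integral_cong[OF refl])
    fix u assume "u \<in> space P"
    then have u: "u \<in> L2 S T" by (rule sp)
    have w: "(\<lambda>p. 1 * u p + (-1) * v p) \<in> L2 S T" by (intro L2_add L2_scale u v)
    have "(LINT x|m0. E x u) = (LINT x|m0. exp (\<i> * complex_of_real (c * pz (\<lambda>p. 1 * u p + (-1) * v p) x)))"
    proof (rule integral_cong_AE)
      show "AE x in m0. E x u = exp (\<i> * complex_of_real (c * pz (\<lambda>p. 1 * u p + (-1) * v p) x))"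
        using AE_conv[OF u] AE_conv[OF v] AE_space
      proof eventually_elim
        case (elim x)
        then show ?case unfolding E_def using conv_lin(2)[OF u v _ elim(1,2), of 1 "-1"] by (simp add: space_m0)
      qed
      have pm: "pz w \<in> borel_measurable m0" if "w \<in> L2 S T" for w
        using pz_measurable(1)[OF measurable_L2_const[OF that] measurable_ident] by simp
      note [measurable] = pm[OF u] pm[OF v] pm[OF w]
      show "(\<lambda>x. E x u) \<in> borel_measurable m0" unfolding E_def by measurable
      show "(\<lambda>x. exp (\<i> * complex_of_real (c * pz (\<lambda>p. 1 * u p + (-1) * v p) x))) \<in> borel_measurable m0" by measurable
    qed
    also have "\<dots> = complex_of_real (exp (- (c\<^sup>2 / 2 * dist2 S T u v)))"
      unfolding pz_char[OF w] by simp
    finally show "(LINT x|m0. E x u) * r u = complex_of_real (exp (- (c\<^sup>2 / 2 * dist2 S T u v))) * r u" by simp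
  qed
  finally show ?thesis .
qed

text \<open>Completing the square: \<open>v'\<close> is the weighted mean of the centres, and the
  remainder does not depend on \<open>u\<close>.\<close>

lemma gaussian_product:
  assumes u: "u \<in> L2 S T" and v: "v \<in> L2 S T" and w: "w \<in> L2 S T" and a: "a + n > 0"
  defines "v' \<equiv> (\<lambda>p. a / (a + n) * v p + n / (a + n) * w p)"
  shows "a * dist2 S T u v + n * dist2 S T u w =
    (a + n) * dist2 S T u v' + (a * ip v v + n * ip w w - (a + n) * ip v' v')"
proof -
  have v': "v' \<in> L2 S T" unfolding v'_def by (intro L2_add L2_scale v w)
  have "ip v' u = a / (a + n) * ip v u + n / (a + n) * ip w u"
    unfolding v'_def l2_inner_scale_left[symmetric] by (intro l2_inner_add_left L2_scale u v w)
  then have "(a + n) * ip u v' = a * ip u v + n * ip u w"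
    using a unfolding l2_inner_commute[of S T u] by (simp add: distrib_left)
  then show ?thesis
    unfolding dist2_expand[OF u v] dist2_expand[OF u w] dist2_expand[OF u v'] by (simp add: algebra_simps)
qed

end


section \<open>Uniqueness of the representing measure\<close>


text \<open>Two complex measures with densities \<open>r\<close>, \<open>r'\<close> whose integrals agree on all Gaussians
  \<open>u \<mapsto> exp (- a \<parallel>u - v\<parallel>\<^sup>2)\<close> are equal: these Gaussians are closed under products up to constants, so
  finite intersections of balls can be adjoined one at a time, approximating the indicator of a
  ball by polynomials in \<open>exp (- \<parallel>u - w\<parallel>\<^sup>2)\<close>.\<close>

locale gaussian_agree = yw +
  fixes P P' :: "(real \<times> real \<Rightarrow> real) measure" and r r' :: "(real \<times> real \<Rightarrow> real) \<Rightarrow> complex"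
  assumes sets_P: "sets P = sets (L2_borel S T)" and sets_P': "sets P' = sets (L2_borel S T)"
    and r: "integrable P r" and r': "integrable P' r'"
    and gauss: "\<And>a v. a \<ge> 0 \<Longrightarrow> v \<in> L2 S T \<Longrightarrow>
      (LINT u|P. complex_of_real (exp (- (a * dist2 S T u v))) * r u) = (LINT u|P'. complex_of_real (exp (- (a * dist2 S T u v))) * r' u)"
begin

definition agree :: "((real \<times> real \<Rightarrow> real) \<Rightarrow> real) \<Rightarrow> bool" where
  "agree \<Phi> \<longleftrightarrow> \<Phi> \<in> borel_measurable (L2_borel S T) \<and>
     (LINT u|P. complex_of_real (\<Phi> u) * r u) = (LINT u|P'. complex_of_real (\<Phi> u) * r' u)"

lemma measurable_P: "\<Phi> \<in> borel_measurable (L2_borel S T) \<Longrightarrow> \<Phi> \<in> borel_measurable P"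
  "\<Phi> \<in> borel_measurable (L2_borel S T) \<Longrightarrow> \<Phi> \<in> borel_measurable P'"
  using measurable_cong_sets[OF sets_P refl] measurable_cong_sets[OF sets_P' refl] by blast+

lemma space_P: "space P = L2 S T" "space P' = L2 S T"
  using sets_eq_imp_space_eq[OF sets_P] sets_eq_imp_space_eq[OF sets_P'] space_L2_borel by simp_all

lemma agree_integrable:
  assumes "\<Phi> \<in> borel_measurable (L2_borel S T)" "\<And>u. u \<in> L2 S T \<Longrightarrow> \<bar>\<Phi> u\<bar> \<le> C"
  shows "integrable P (\<lambda>u. complex_of_real (\<Phi> u) * r u)" "integrable P' (\<lambda>u. complex_of_real (\<Phi> u) * r' u)"
proof -
  note [measurable] = measurable_P[OF assms(1)]
  show "integrable P (\<lambda>u. complex_of_real (\<Phi> u) * r u)"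
    by (rule integrable_bounded_mult[OF r, where C = C]) (use assms(2) space_P in auto)
  show "integrable P' (\<lambda>u. complex_of_real (\<Phi> u) * r' u)"
    by (rule integrable_bounded_mult[OF r', where C = C]) (use assms(2) space_P in auto)
qed

lemma agree_cong: "(\<And>u. u \<in> L2 S T \<Longrightarrow> \<Phi> u = \<Psi> u) \<Longrightarrow> agree \<Phi> \<Longrightarrow> agree \<Psi>"
proof -
  assume eq: "\<And>u. u \<in> L2 S T \<Longrightarrow> \<Phi> u = \<Psi> u" and ag: "agree \<Phi>"
  have "\<Phi> \<in> borel_measurable (L2_borel S T) \<longleftrightarrow> \<Psi> \<in> borel_measurable (L2_borel S T)"
    by (rule measurable_cong) (simp add: eq space_L2_borel)
  moreover have "(LINT u|P. complex_of_real (\<Phi> u) * r u) = (LINT u|P. complex_of_real (\<Psi> u) * r u)"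
    "(LINT u|P'. complex_of_real (\<Phi> u) * r' u) = (LINT u|P'. complex_of_real (\<Psi> u) * r' u)"
    by (rule Bochner_Integration.integral_cong; simp add: eq space_P)+
  ultimately show "agree \<Psi>" using ag unfolding agree_def by simp
qed

lemma agree_scale: "agree \<Phi> \<Longrightarrow> agree (\<lambda>u. c * \<Phi> u)"
  unfolding agree_def by (auto simp: mult.assoc)

lemma agree_add:
  assumes "agree \<Phi>" "\<And>u. u \<in> L2 S T \<Longrightarrow> \<bar>\<Phi> u\<bar> \<le> C" "agree \<Psi>" "\<And>u. u \<in> L2 S T \<Longrightarrow> \<bar>\<Psi> u\<bar> \<le> D"
  shows "agree (\<lambda>u. \<Phi> u + \<Psi> u)"
proof -
  have m: "\<Phi> \<in> borel_measurable (L2_borel S T)" "\<Psi> \<in> borel_measurable (L2_borel S T)"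
    using assms unfolding agree_def by auto
  note i = agree_integrable[OF m(1) assms(2)] agree_integrable[OF m(2) assms(4)]
  show ?thesis using assms(1,3) i unfolding agree_def by (simp add: distrib_right borel_measurable_add[OF m])
qed

lemma agree_sum:
  assumes "finite I" "\<And>i. i \<in> I \<Longrightarrow> agree (\<Phi> i)" "\<And>i u. i \<in> I \<Longrightarrow> u \<in> L2 S T \<Longrightarrow> \<bar>\<Phi> i u\<bar> \<le> C i"
  shows "agree (\<lambda>u. \<Sum>i\<in>I. \<Phi> i u)"
  using assms
proof (induction I rule: finite_induct)
  case empty
  show ?case unfolding agree_def by simp
next
  case (insert j I)
  have "\<bar>\<Sum>i\<in>I. \<Phi> i u\<bar> \<le> (\<Sum>i\<in>I. C i)" if "u \<in> L2 S T" for u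
    by (rule order_trans[OF sum_abs sum_mono]) (use insert.prems(2) that in auto)
  then have "agree (\<lambda>u. \<Phi> j u + (\<Sum>i\<in>I. \<Phi> i u))"
    using insert.prems insert.IH by (intro agree_add[where C = "C j" and D = "\<Sum>i\<in>I. C i"]) auto
  then show ?case using insert.hyps by simp
qed

lemma agree_lim:
  assumes "\<And>k. agree (\<Phi> k)" "\<And>k u. u \<in> L2 S T \<Longrightarrow> \<bar>\<Phi> k u\<bar> \<le> C"
    "\<And>u. u \<in> L2 S T \<Longrightarrow> (\<lambda>k. \<Phi> k u) \<longlonglongrightarrow> \<Psi> u"
  shows "agree \<Psi>"
proof -
  have m: "\<Phi> k \<in> borel_measurable (L2_borel S T)" for k using assms(1) unfolding agree_def by auto
  have \<Psi>: "\<Psi> \<in> borel_measurable (L2_borel S T)"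
    by (rule borel_measurable_LIMSEQ_real[where u = \<Phi>, OF _ m]) (simp add: assms(3) space_L2_borel)
  have 1: "(\<lambda>k. LINT u|P. complex_of_real (\<Phi> k u) * r u) \<longlonglongrightarrow> (LINT u|P. complex_of_real (\<Psi> u) * r u)"
  proof (rule integral_dominated_convergence[where w = "\<lambda>u. C * norm (r u)"])
    show "AE u in P. norm (complex_of_real (\<Phi> k u) * r u) \<le> C * norm (r u)" for k
      unfolding norm_mult using assms(2) by (intro AE_I2 mult_right_mono) (auto simp: space_P)
    show "AE u in P. (\<lambda>k. complex_of_real (\<Phi> k u) * r u) \<longlonglongrightarrow> complex_of_real (\<Psi> u) * r u"
      by (intro AE_I2 tendsto_intros assms(3)) (simp add: space_P)
  qed (use measurable_P[OF m] measurable_P[OF \<Psi>] r in auto)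
  have 2: "(\<lambda>k. LINT u|P'. complex_of_real (\<Phi> k u) * r' u) \<longlonglongrightarrow> (LINT u|P'. complex_of_real (\<Psi> u) * r' u)"
  proof (rule integral_dominated_convergence[where w = "\<lambda>u. C * norm (r' u)"])
    show "AE u in P'. norm (complex_of_real (\<Phi> k u) * r' u) \<le> C * norm (r' u)" for k
      unfolding norm_mult using assms(2) by (intro AE_I2 mult_right_mono) (auto simp: space_P)
    show "AE u in P'. (\<lambda>k. complex_of_real (\<Phi> k u) * r' u) \<longlonglongrightarrow> complex_of_real (\<Psi> u) * r' u"
      by (intro AE_I2 tendsto_intros assms(3)) (simp add: space_P)
  qed (use measurable_P[OF m] measurable_P[OF \<Psi>] r' in auto)
  have "(LINT u|P. complex_of_real (\<Phi> k u) * r u) = (LINT u|P'. complex_of_real (\<Phi> k u) * r' u)" for k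
    using assms(1)[of k] unfolding agree_def by simp
  then show ?thesis unfolding agree_def using \<Psi> LIMSEQ_unique[OF 1] 2 by simp
qed

definition balls_ind :: "((real \<times> real \<Rightarrow> real) \<times> real) list \<Rightarrow> (real \<times> real \<Rightarrow> real) \<Rightarrow> real" where
  "balls_ind bs u = (\<Prod>b\<leftarrow>bs. indicator (L2_ball (fst b) (snd b)) u)"

lemma balls_ind_range: "0 \<le> balls_ind bs u" "balls_ind bs u \<le> 1"
proof -
  have "0 \<le> balls_ind bs u \<and> balls_ind bs u \<le> 1"
    unfolding balls_ind_def by (induction bs) (auto simp: indicator_def)
  then show "0 \<le> balls_ind bs u" "balls_ind bs u \<le> 1" by auto
qed

lemma agree_step:
  assumes f: "\<And>a v. a \<ge> 0 \<Longrightarrow> v \<in> L2 S T \<Longrightarrow> agree (\<lambda>u. exp (- (a * dist2 S T u v)) * f u)"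
    and f01: "\<And>u. 0 \<le> f u \<and> f u \<le> 1" and a: "a \<ge> 0" and v: "v \<in> L2 S T" and w: "w \<in> L2 S T"
  shows "agree (\<lambda>u. exp (- (a * dist2 S T u v)) * (indicator (L2_ball w s) u * f u))"
proof -
  define e where "e u = exp (- (a * dist2 S T u v)) * f u" for u
  have e01: "0 \<le> e u" "e u \<le> 1" for u
    unfolding e_def using f01[of u] a l2_inner_self_nonneg[of S T "\<lambda>p. u p - v p"] by (auto intro!: mult_le_one)
  define t where "t u = exp (- dist2 S T u w)" for u
  have t: "0 < t u" "t u \<le> 1" for u unfolding t_def using l2_inner_self_nonneg by auto
  \<comment> \<open>A power of \<open>t\<close> is a Gaussian around \<open>w\<close>; merged with
    the one around \<open>v\<close> it is a multiple of a single Gaussian. The case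
    \<open>n = 0\<close> is separate because \<open>a + n\<close> could vanish there.\<close>
  have mono: "agree (\<lambda>u. e u * t u ^ n)" for n
  proof (cases "n = 0")
    case True
    then show ?thesis using f[OF a v] unfolding e_def by simp
  next
    case False
    then have an: "a + real n > 0" using a by simp
    define v' where "v' = (\<lambda>p. a / (a + real n) * v p + real n / (a + real n) * w p)"
    have v': "v' \<in> L2 S T" unfolding v'_def by (intro L2_add L2_scale v w)
    define c where "c = exp (- (a * ip v v + real n * ip w w - (a + real n) * ip v' v'))"
    have "e u * t u ^ n = c * (exp (- ((a + real n) * dist2 S T u v')) * f u)" if u: "u \<in> L2 S T" for u
    proof -
      have "exp (- (a * dist2 S T u v)) * t u ^ n = exp (- (a * dist2 S T u v + real n * dist2 S T u w))"
        unfolding t_def exp_of_nat_mult[symmetric] by (simp add: exp_add[symmetric])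
      also have "a * dist2 S T u v + real n * dist2 S T u w =
          (a + real n) * dist2 S T u v' + (a * ip v v + real n * ip w w - (a + real n) * ip v' v')"
        unfolding v'_def by (rule gaussian_product[OF u v w an])
      also have "exp (- ((a + real n) * dist2 S T u v' + (a * ip v v + real n * ip w w - (a + real n) * ip v' v'))) =
          c * exp (- ((a + real n) * dist2 S T u v'))"
        unfolding c_def by (simp add: exp_add[symmetric])
      finally show ?thesis unfolding e_def by (simp add: mult_ac)
    qed
    moreover have "agree (\<lambda>u. c * (exp (- ((a + real n) * dist2 S T u v')) * f u))"
      by (rule agree_scale, rule f[OF less_imp_le[OF an] v'])
    ultimately show ?thesis by (intro agree_cong[of _ "\<lambda>u. e u * t u ^ n"]) simp_all
  qed
  have et: "\<bar>e u * y\<bar> \<le> \<bar>y\<bar>" for u y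
    unfolding abs_mult using e01[of u] by (intro mult_left_le_one_le) auto
  \<comment> \<open>\<open>t u\<close> stays in \<open>[0, 1]\<close>, so Weierstrass approximation
    in one real variable is enough.\<close>
  have cont: "agree (\<lambda>u. e u * g (t u))" if g: "continuous_on {0..1} g" for g :: "real \<Rightarrow> real"
  proof -
    have "\<exists>p. real_polynomial_function p \<and> (\<forall>x\<in>{0..1}. \<bar>g x - p x\<bar> < 1 / real (Suc k))" for k
      using Stone_Weierstrass_real_polynomial_function[OF compact_Icc g, of "1 / real (Suc k)"] by (metis divide_pos_pos of_nat_0_less_iff zero_less_Suc zero_less_one)
    then obtain p where p: "\<And>k. real_polynomial_function (p k)" "\<And>k x. x \<in> {0..1} \<Longrightarrow> \<bar>g x - p k x\<bar> < 1 / real (Suc k)"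
      by metis
    have "compact (g ` {0..1})" by (intro compact_continuous_image g) simp
    then have "bounded (g ` {0..1})" by (rule compact_imp_bounded)
    then obtain B where B: "\<And>x. x \<in> {0..1} \<Longrightarrow> \<bar>g x\<bar> \<le> B" unfolding bounded_iff by (auto simp del: atLeastAtMost_iff)
    show ?thesis
    proof (rule agree_lim[where \<Phi> = "\<lambda>k u. e u * p k (t u)" and C = "B + 1"])
      fix k
      from p(1)[of k] obtain c N where "p k = (\<lambda>x. \<Sum>i\<le>N. c i * x ^ i)"
        unfolding real_polynomial_function_iff_sum by blast
      then have "(\<lambda>u. e u * p k (t u)) = (\<lambda>u. \<Sum>i\<le>N. c i * (e u * t u ^ i))"
        by (simp add: sum_distrib_left mult_ac)
      moreover have "agree (\<lambda>u. \<Sum>i\<le>N. c i * (e u * t u ^ i))"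
      proof (rule agree_sum[where C = "\<lambda>i. \<bar>c i\<bar>"])
        fix i u
        have "\<bar>e u * t u ^ i\<bar> \<le> 1" using et[of u "t u ^ i"] t[of u] power_le_one[of "t u" i] by simp
        then show "\<bar>c i * (e u * t u ^ i)\<bar> \<le> \<bar>c i\<bar>" unfolding abs_mult[of "c i"] by (intro mult_left_le) auto
      qed (auto intro: agree_scale mono)
      ultimately show "agree (\<lambda>u. e u * p k (t u))" by simp
      fix u
      have tu: "t u \<in> {0..1}" using t[of u] by simp
      have "1 / real (Suc k) \<le> 1" by simp
      then have "\<bar>p k (t u)\<bar> \<le> B + 1" using p(2)[OF tu, of k] B[OF tu] by linarith
      then show "\<bar>e u * p k (t u)\<bar> \<le> B + 1" using et[of u "p k (t u)"] by linarith
    next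
      fix u
      have tu: "t u \<in> {0..1}" using t[of u] by simp
      have "(\<lambda>k. p k (t u) - g (t u)) \<longlonglongrightarrow> 0"
      proof (rule Lim_null_comparison[OF always_eventually LIMSEQ_inverse_real_of_nat])
        show "\<forall>k. norm (p k (t u) - g (t u)) \<le> inverse (real (Suc k))"
          using p(2)[OF tu] by (auto simp: abs_minus_commute inverse_eq_divide intro: less_imp_le)
      qed
      then have "(\<lambda>k. p k (t u)) \<longlonglongrightarrow> g (t u)" by (rule LIM_zero_cancel)
      then show "(\<lambda>k. e u * p k (t u)) \<longlonglongrightarrow> e u * g (t u)" by (intro tendsto_intros)
    qed
  qed
  have ball: "indicator (L2_ball w s) u = (if t u > exp (- s) then 1 else 0 :: real)" if "u \<in> L2 S T" for u
    unfolding L2_ball_def t_def indicator_def using that by simp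
  \<comment> \<open>In terms of \<open>t\<close> the ball is \<open>t u > exp (- s)\<close>. The
    ramps vanish up to this threshold and converge to the indicator of the open half-line beyond
    it.\<close>
  define g where "g k x = min 1 (real k * max 0 (x - exp (- s)))" for k :: nat and x :: real
  have "agree (\<lambda>u. e u * indicator (L2_ball w s) u)"
  proof (rule agree_lim[where \<Phi> = "\<lambda>k u. e u * g k (t u)" and C = 1])
    show "agree (\<lambda>u. e u * g k (t u))" for k
      by (rule cont) (auto simp: g_def intro!: continuous_intros)
    show "\<bar>e u * g k (t u)\<bar> \<le> 1" for k u
      using et[of u "g k (t u)"] by (rule order_trans) (auto simp: g_def)
    fix u assume u: "u \<in> L2 S T"
    have "(\<lambda>k. g k (t u)) \<longlonglongrightarrow> indicator (L2_ball w s) u"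
    proof (cases "t u > exp (- s)")
      case True
      define d where "d = t u - exp (- s)"
      have d: "d > 0" using True by (simp add: d_def)
      obtain N :: nat where N: "1 / d < real N" using reals_Archimedean2 by blast
      have "g k (t u) = 1" if "k \<ge> N" for k
      proof -
        have "1 / d < real k" using N that by (meson less_le_trans of_nat_le_iff)
        then have "1 < real k * d" using d by (simp add: divide_less_eq)
        then show ?thesis using d unfolding g_def d_def[symmetric] by (simp add: max_def min_def)
      qed
      then have "eventually (\<lambda>k. g k (t u) = 1) sequentially" unfolding eventually_sequentially by blast
      then show ?thesis using ball[OF u] True by (simp add: tendsto_eventually)
    next
      case False
      then have "g k (t u) = 0" for k unfolding g_def by (simp add: max_def)
      then show ?thesis using ball[OF u] False by simp
    qed
    then show "(\<lambda>k. e u * g k (t u)) \<longlonglongrightarrow> e u * indicator (L2_ball w s) u" by (intro tendsto_intros)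
  qed
  then show ?thesis unfolding e_def by (simp add: mult_ac)
qed

lemma agree_balls:
  assumes "\<And>b. b \<in> set bs \<Longrightarrow> fst b \<in> L2 S T" "a \<ge> 0" "v \<in> L2 S T"
  shows "agree (\<lambda>u. exp (- (a * dist2 S T u v)) * balls_ind bs u)"
  using assms
proof (induction bs arbitrary: a v)
  case Nil
  have "(\<lambda>u. exp (- (a * dist2 S T u v))) \<in> borel_measurable (L2_borel S T)"
    using dist2_measurable[OF Nil(3)] by measurable
  then show ?case using gauss[OF Nil(2,3)] unfolding agree_def balls_ind_def by simp
next
  case (Cons b bs)
  have "agree (\<lambda>u. exp (- (a * dist2 S T u v)) * (indicator (L2_ball (fst b) (snd b)) u * balls_ind bs u))"
    by (rule agree_step) (use Cons balls_ind_range in auto)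
  then show ?case unfolding balls_ind_def by simp
qed

text \<open>Finite intersections of balls, the empty list giving the whole space: a generator stable
  under intersection.\<close>

definition ball_sets :: "(real \<times> real \<Rightarrow> real) set set" where
  "ball_sets = {{u \<in> L2 S T. \<forall>b\<in>set bs. u \<in> L2_ball (fst b) (snd b)} | bs. \<forall>b\<in>set bs. fst b \<in> L2 S T}"

lemma sets_L2_borel_ball_sets: "A \<in> sets (L2_borel S T) \<Longrightarrow> A \<in> sigma_sets (L2 S T) ball_sets"
proof -
  have ball: "L2_ball d s \<in> ball_sets" if "d \<in> L2 S T" for d s
    unfolding ball_sets_def using that by (intro CollectI exI[of _ "[(d, s)]"]) (auto simp: L2_ball_def)
  have "U \<in> sigma_sets (L2 S T) ball_sets" if U: "L2_open S T U" for U
  proof -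
    interpret sigma_algebra "L2 S T" "sigma_sets (L2 S T) ball_sets"
      by (rule sigma_algebra_sigma_sets) (auto simp: ball_sets_def)
    define C where "C = {(d, k :: nat). d \<in> rat_centers \<and> L2_ball d (1 / real (Suc k)) \<subseteq> U}"
    have Csub: "C \<subseteq> rat_centers \<times> UNIV" unfolding C_def by auto
    then have C: "countable C" by (rule countable_subset) (intro countable_SIGMA countable_rat_centers, simp)
    have "U = (\<Union>x\<in>C. L2_ball (fst x) (1 / real (Suc (snd x))))"
      using L2_open_countable_balls[OF U] unfolding C_def split_beta .
    also have "\<dots> \<in> sigma_sets (L2 S T) ball_sets"
      by (rule countable_UN'[OF C]) (use Csub ball rat_centers_L2 in \<open>auto intro!: sigma_sets.Basic\<close>)
    finally show ?thesis .
  qed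
  then have "sigma_sets (L2 S T) {U. L2_open S T U} \<subseteq> sigma_sets (L2 S T) ball_sets"
    by (intro sigma_sets_mono) auto
  then show "A \<in> sets (L2_borel S T) \<Longrightarrow> A \<in> sigma_sets (L2 S T) ball_sets" unfolding sets_L2_borel by blast
qed

lemma Int_stable_ball_sets: "Int_stable ball_sets"
proof (rule Int_stableI)
  fix A B assume "A \<in> ball_sets" "B \<in> ball_sets"
  then obtain as bs where *: "A = {u \<in> L2 S T. \<forall>b\<in>set as. u \<in> L2_ball (fst b) (snd b)}" "\<forall>b\<in>set as. fst b \<in> L2 S T"
    "B = {u \<in> L2 S T. \<forall>b\<in>set bs. u \<in> L2_ball (fst b) (snd b)}" "\<forall>b\<in>set bs. fst b \<in> L2 S T"
    unfolding ball_sets_def by blast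
  then show "A \<inter> B \<in> ball_sets" unfolding ball_sets_def by (intro CollectI exI[of _ "as @ bs"]) auto
qed

lemma balls_ind_eq:
  "u \<in> L2 S T \<Longrightarrow> balls_ind bs u = indicator {u \<in> L2 S T. \<forall>b\<in>set bs. u \<in> L2_ball (fst b) (snd b)} u"
  unfolding balls_ind_def by (induction bs) (auto simp: indicator_def)

text \<open>Dynkin's argument: the sets whose indicators have equal integrals contain
  \<open>ball_sets\<close> and are closed under complements and countable disjoint unions.\<close>

lemma agree_sets:
  assumes "A \<in> sets (L2_borel S T)"
  shows "(LINT u|P. indicator A u * r u) = (LINT u|P'. indicator A u * r' u)"
proof -
  have sub: "ball_sets \<subseteq> Pow (L2 S T)" unfolding ball_sets_def by auto
  have ag: "A \<in> sets (L2_borel S T) \<and> agree (indicator A)" if "A \<in> sigma_sets (L2 S T) ball_sets" for A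
    using Int_stable_ball_sets sub that
  proof (induction rule: sigma_sets_induct_disjoint)
    case (basic A)
    then obtain bs where bs: "A = {u \<in> L2 S T. \<forall>b\<in>set bs. u \<in> L2_ball (fst b) (snd b)}" "\<forall>b\<in>set bs. fst b \<in> L2 S T"
      unfolding ball_sets_def by blast
    \<comment> \<open>Exponent 0 removes the Gaussian and leaves the indicator of the intersection
      alone.\<close>
    have "agree (\<lambda>u. exp (- (0 * dist2 S T u (\<lambda>p. 0))) * balls_ind bs u)"
      by (rule agree_balls) (use bs(2) L2_zero in auto)
    then have ag: "agree (balls_ind bs)" by simp
    have A: "A \<in> sets (L2_borel S T)"
    proof -
      have "A = {u \<in> space (L2_borel S T). \<forall>b\<in>set bs. u \<in> L2_ball (fst b) (snd b)}" unfolding bs space_L2_borel ..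
      also have "\<dots> \<in> sets (L2_borel S T)"
      proof (rule sets.sets_Collect_finite_All)
        fix b assume "b \<in> set bs"
        then have "space (L2_borel S T) \<inter> L2_ball (fst b) (snd b) \<in> sets (L2_borel S T)"
          using bs(2) L2_ball_sets by auto
        then show "{u \<in> space (L2_borel S T). u \<in> L2_ball (fst b) (snd b)} \<in> sets (L2_borel S T)" by (simp add: Int_def)
      qed simp
      finally show ?thesis .
    qed
    have "(LINT u|P. complex_of_real (indicator A u) * r u) = (LINT u|P. complex_of_real (balls_ind bs u) * r u)"
      "(LINT u|P'. complex_of_real (indicator A u) * r' u) = (LINT u|P'. complex_of_real (balls_ind bs u) * r' u)"
      unfolding bs(1) by (auto intro!: Bochner_Integration.integral_cong simp: space_P balls_ind_eq)
    then show ?case using ag A unfolding agree_def by simp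
  next
    case empty
    show ?case unfolding agree_def by simp
  next
    case (compl A)
    have "agree (\<lambda>u. 1)" using agree_balls[of "[]" 0 "\<lambda>p. 0"] L2_zero by (simp add: balls_ind_def)
    then have "agree (\<lambda>u. 1 + (-1) * indicator A u)"
      using compl by (intro agree_add[where C = 1 and D = 1] agree_scale) (auto simp: indicator_def)
    moreover have "1 + (-1) * indicator A u = (indicator (L2 S T - A) u :: real)" if "u \<in> L2 S T" for u
      using that by (auto simp: indicator_def)
    moreover have "L2 S T - A \<in> sets (L2_borel S T)" using compl sets.compl_sets[of A "L2_borel S T"] by (simp add: space_L2_borel)
    ultimately show ?case by (auto intro: agree_cong[rotated])
  next
    case (union A)
    have UA: "(\<Union>i. A i) \<in> sets (L2_borel S T)" using union by auto
    have "agree (indicator (\<Union>i. A i))"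
    proof (rule agree_lim[where \<Phi> = "\<lambda>k u. \<Sum>i<k. indicator (A i) u" and C = 1])
      show "agree (\<lambda>u. \<Sum>i<k. indicator (A i) u)" for k
        by (rule agree_sum[where C = "\<lambda>_. 1"]) (use union in \<open>auto simp: indicator_def\<close>)
      show "\<bar>\<Sum>i<k. indicator (A i) u\<bar> \<le> (1::real)" for k u
      proof -
        have "disjoint_family_on A {..<k}" using union(1) by (rule disjoint_family_on_mono[rotated]) simp
        then have "(\<Sum>i<k. indicator (A i) u) = (indicator (\<Union>i<k. A i) u :: real)"
          by (simp only: indicator_UN_disjoint[OF finite_lessThan])
        then show ?thesis by (simp only: indicator_def) simp
      qed
      show "(\<lambda>k. \<Sum>i<k. indicator (A i) u) \<longlonglongrightarrow> (indicator (\<Union>i. A i) u :: real)" for u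
        using indicator_sums[of A u] disjoint_family_onD[OF union(1)] unfolding sums_def by simp
    qed
    then show ?case using UA by simp
  qed
  from ag[OF sets_L2_borel_ball_sets[OF assms]] show ?thesis
    unfolding agree_def by (simp add: of_real_indicator)
qed

end

section \<open>A functional determines its measure\<close>

context yw
begin

lemma exp_pz_measurable: "x \<in> C0 S T \<Longrightarrow> (\<lambda>u. exp (\<i> * complex_of_real (c * pz u x))) \<in> borel_measurable (L2_borel S T)"
proof -
  assume x: "x \<in> C0 S T"
  have "(\<lambda>u. pz u x) \<in> borel_measurable (L2_borel S T)"
    using pz_measurable(1)[OF measurable_ident measurable_const, of x] x by (simp add: space_m0)
  then show ?thesis by measurable
qed

lemma corresponds_unique:
  assumes 1: "corresponds S T (completion m0) \<phi> f F" and 2: "corresponds S T (completion m0) \<phi> f' F"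
    and A: "A \<in> sets (L2_borel S T)"
  shows "f A = f' A"
proof -
  let ?L = "L2_borel S T"
  have f: "f \<in> complex_measures ?L" "f' \<in> complex_measures ?L"
    and F1: "\<And>\<rho>. \<rho> > 0 \<Longrightarrow> AE x in m0. F (rescale \<rho> x) = Some (cm_integral ?L f (\<lambda>u. exp (\<i> * complex_of_real (pz u (rescale \<rho> x)))))"
    and F2: "\<And>\<rho>. \<rho> > 0 \<Longrightarrow> AE x in m0. F (rescale \<rho> x) = Some (cm_integral ?L f' (\<lambda>u. exp (\<i> * complex_of_real (pz u (rescale \<rho> x)))))"
    using 1 2 unfolding corresponds_def s_ae_iff by auto
  obtain P r where P: "sets P = sets ?L" "cm_repr ?L P (\<lambda>u. u) r f" using complex_measures_repr[OF f(1)] by metis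
  obtain P' r' where P': "sets P' = sets ?L" "cm_repr ?L P' (\<lambda>u. u) r' f'" using complex_measures_repr[OF f(2)] by metis
  have fP: "finite_measure P" "finite_measure P'" and r: "integrable P r" "integrable P' r'"
    using P(2) P'(2) unfolding cm_repr_def by auto
  have pos: "(LINT u|P. complex_of_real (exp (- (a * dist2 S T u v))) * r u) = (LINT u|P'. complex_of_real (exp (- (a * dist2 S T u v))) * r' u)"
    if a: "a > 0" and v: "v \<in> L2 S T" for a v
  proof -
    \<comment> \<open>Agreement of the two formulas at scale \<open>c\<close> gives the Gaussians
      with exponent \<open>c\<^sup>2 / 2\<close>. Since the formulas hold at every scale, every
      exponent \<open>a > 0\<close> is reached.\<close>
    define c where "c = sqrt (2 * a)"
    have c: "c > 0" "c\<^sup>2 / 2 = a" using a by (auto simp: c_def)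
    have ev: "cm_integral ?L f (\<lambda>u. exp (\<i> * complex_of_real (pz u (rescale c x)))) = (LINT u|P. exp (\<i> * complex_of_real (c * pz u x)) * r u)"
      "cm_integral ?L f' (\<lambda>u. exp (\<i> * complex_of_real (pz u (rescale c x)))) = (LINT u|P'. exp (\<i> * complex_of_real (c * pz u x)) * r' u)"
      if x: "x \<in> C0 S T" for x
      using conv_rescale(2)[OF x, of c] c(1) exp_pz_measurable[OF x]
      by (auto intro!: cm_integral_repr[OF P(2), where C = 1] cm_integral_repr[OF P'(2), where C = 1] simp: norm_exp_i_real)
    have ae: "AE x in m0. (LINT u|P. exp (\<i> * complex_of_real (c * pz u x)) * r u) = (LINT u|P'. exp (\<i> * complex_of_real (c * pz u x)) * r' u)"
      using F1[OF c(1)] F2[OF c(1)] AE_space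
      by eventually_elim (simp add: ev space_m0)
    have meas: "(\<lambda>x. (LINT u|P. exp (\<i> * complex_of_real (c * pz u x)) * r u) * exp (- \<i> * complex_of_real (c * pz v x))) \<in> borel_measurable m0"
      if P: "finite_measure P" "sets P = sets ?L" "integrable P r" for P r
    proof -
      have E: "(\<lambda>(x, u). exp (\<i> * complex_of_real (c * pz u x))) \<in> borel_measurable (m0 \<Otimes>\<^sub>M P)"
        using pz_pair_measurable[OF measurable_ident_sets[OF P(2)]] by (simp add: split_beta)
      have "(\<lambda>x. LINT u|P. exp (\<i> * complex_of_real (c * pz u x)) * r u) \<in> borel_measurable m0"
        by (rule borel_measurable_integrable[OF fubini_pz(1)[OF P(1,3) E]]) (simp add: norm_exp_i_real)
      moreover have "pz v \<in> borel_measurable m0"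
        using pz_measurable(1)[OF measurable_L2_const[OF v] measurable_ident] by simp
      ultimately show ?thesis by measurable
    qed
    have "(LINT x|m0. (LINT u|P. exp (\<i> * complex_of_real (c * pz u x)) * r u) * exp (- \<i> * complex_of_real (c * pz v x))) =
       (LINT x|m0. (LINT u|P'. exp (\<i> * complex_of_real (c * pz u x)) * r' u) * exp (- \<i> * complex_of_real (c * pz v x)))"
      by (rule integral_cong_AE[OF meas[OF fP(1) P(1) r(1)] meas[OF fP(2) P'(1) r(2)]]) (use ae in eventually_elim, simp)
    then show ?thesis
      unfolding gaussian_of_functional[OF fP(1) P(1) r(1) v] gaussian_of_functional[OF fP(2) P'(1) r(2) v] c(2) .
  qed
  \<comment> \<open>Exponent 0 corresponds to no positive scale; it is the limit of the exponents
    \<open>1 / Suc k\<close>.\<close>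
  have zero: "(LINT u|P. r u) = (LINT u|P'. r' u)"
  proof -
    have lim: "(\<lambda>k. LINT u|P. complex_of_real (exp (- (1 / real (Suc k) * dist2 S T u (\<lambda>p. 0)))) * r u) \<longlonglongrightarrow> (LINT u|P. r u)"
      if P: "sets P = sets ?L" "integrable P r" for P r
    proof (rule integral_dominated_convergence[where w = "\<lambda>u. norm (r u)"])
      have "(\<lambda>u. dist2 S T u (\<lambda>p. 0)) \<in> borel_measurable P"
        using dist2_measurable[OF L2_zero] measurable_cong_sets[OF P(1) refl] by blast
      then show "(\<lambda>u. complex_of_real (exp (- (1 / real (Suc k) * dist2 S T u (\<lambda>p. 0)))) * r u) \<in> borel_measurable P" for k
        using borel_measurable_integrable[OF P(2)] by measurable
      show "AE u in P. norm (complex_of_real (exp (- (1 / real (Suc k) * dist2 S T u (\<lambda>p. 0)))) * r u) \<le> norm (r u)" for k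
        unfolding norm_mult using l2_inner_self_nonneg by (intro AE_I2 mult_left_le_one_le) (auto simp del: of_nat_Suc)
      have "(\<lambda>k. complex_of_real (exp (- (inverse (real (Suc k)) * x))) * y) \<longlonglongrightarrow> complex_of_real (exp (- (0 * x))) * y" for x y
        by (intro tendsto_intros LIMSEQ_inverse_real_of_nat)
      then show "AE u in P. (\<lambda>k. complex_of_real (exp (- (1 / real (Suc k) * dist2 S T u (\<lambda>p. 0)))) * r u) \<longlonglongrightarrow> r u"
        by (simp add: inverse_eq_divide)
    qed (use P(2) in auto)
    have "(LINT u|P. complex_of_real (exp (- (1 / real (Suc k) * dist2 S T u (\<lambda>p. 0)))) * r u) =
        (LINT u|P'. complex_of_real (exp (- (1 / real (Suc k) * dist2 S T u (\<lambda>p. 0)))) * r' u)" for k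
      by (rule pos[OF _ L2_zero]) simp
    then show ?thesis using LIMSEQ_unique[OF lim[OF P(1) r(1)]] lim[OF P'(1) r(2)] by simp
  qed
  interpret gaussian_agree S T \<phi> m0 P P' r r'
  proof
    fix a :: real and v assume a: "a \<ge> 0" and v: "v \<in> L2 S T"
    show "(LINT u|P. complex_of_real (exp (- (a * dist2 S T u v))) * r u) = (LINT u|P'. complex_of_real (exp (- (a * dist2 S T u v))) * r' u)"
      using pos[of a v] zero a v by (cases "a = 0") auto
  qed (use P P' r in auto)
  show ?thesis using agree_sets[OF A] P(2) P'(2) A unfolding cm_repr_def by simp
qed

end


section \<open>Transforms and convolution products\<close>


lemma pair_integral_product:
  fixes a :: "'a \<Rightarrow> complex" and b :: "'b \<Rightarrow> complex"
  assumes P: "finite_measure P1" "finite_measure P2" and a: "integrable P1 a" and b: "integrable P2 b"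
  shows "integrable (P1 \<Otimes>\<^sub>M P2) (\<lambda>z. a (fst z) * b (snd z))"
    "(LINT z|(P1 \<Otimes>\<^sub>M P2). a (fst z) * b (snd z)) = (LINT x|P1. a x) * (LINT y|P2. b y)"
proof -
  interpret P1: finite_measure P1 by fact
  interpret P2: finite_measure P2 by fact
  interpret pair_sigma_finite P1 P2 ..
  have [measurable]: "a \<in> borel_measurable P1" "b \<in> borel_measurable P2" using a b by auto
  show i: "integrable (P1 \<Otimes>\<^sub>M P2) (\<lambda>z. a (fst z) * b (snd z))"
  proof (rule Fubini_integrable)
    show "integrable P1 (\<lambda>x. LINT y|P2. norm (a (fst (x, y)) * b (snd (x, y))))"
      using a by (simp add: norm_mult)
    show "AE x in P1. integrable P2 (\<lambda>y. a (fst (x, y)) * b (snd (x, y)))" using b by simp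
  qed measurable
  show "(LINT z|(P1 \<Otimes>\<^sub>M P2). a (fst z) * b (snd z)) = (LINT x|P1. a x) * (LINT y|P2. b y)"
    using integral_fst'[OF i] by simp
qed

context yw
begin

abbreviation "L \<equiv> L2_borel S T"
abbreviation "mY \<equiv> completion m0"
abbreviation sqn :: "(real \<times> real \<Rightarrow> real) \<Rightarrow> real" where "sqn u \<equiv> ip u u"

text \<open>The image of the density under \<open>\<psi>\<close> is the measure sought. This is how
  functionals computed as integrals over some parameter space are recognised as members of the
  class.\<close>

lemma corresponds_of_repr:
  assumes P: "finite_measure P" and \<psi>: "\<psi> \<in> P \<rightarrow>\<^sub>M L" and \<rho>: "integrable P \<rho>"
    and F: "\<And>c. c > 0 \<Longrightarrow> AE x in m0. F (rescale c x) = Some (LINT \<omega>|P. exp (\<i> * complex_of_real (pz (\<psi> \<omega>) (rescale c x))) * \<rho> \<omega>)"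
  defines "f \<equiv> (\<lambda>A. LINT \<omega>|P. indicator A (\<psi> \<omega>) * \<rho> \<omega>)"
  shows "cm_repr L P \<psi> \<rho> f" "corresponds S T mY \<phi> f F"
proof -
  show r: "cm_repr L P \<psi> \<rho> f" unfolding cm_repr_def f_def using P \<psi> \<rho> by simp
  have ev: "cm_integral L f (\<lambda>u. exp (\<i> * complex_of_real (pz u x))) = (LINT \<omega>|P. exp (\<i> * complex_of_real (pz (\<psi> \<omega>) x)) * \<rho> \<omega>)"
    if x: "x \<in> C0 S T" for x
    by (rule cm_integral_repr[OF r, where C = 1]) (use exp_pz_measurable[OF x, of 1] in \<open>auto simp: norm_exp_i_real\<close>)
  show "corresponds S T mY \<phi> f F"
    unfolding corresponds_def s_ae_iff
  proof (intro conjI allI impI)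
    show "f \<in> complex_measures L" by (rule cm_repr_imp_complex_measures[OF r])
    fix c :: real assume "c > 0"
    from F[OF this] AE_space
    show "AE x in m0. F (rescale c x) = Some (cm_integral L f (\<lambda>u. exp (\<i> * complex_of_real (pz u (rescale c x)))))"
      by eventually_elim (simp add: ev rescale_C0 space_m0)
  qed
qed

text \<open>The measure chosen by \<open>measure_of_functional\<close> agrees with \<open>f\<close>
  on all Borel sets by uniqueness, so any representation of \<open>f\<close> computes the value. The
  phase in \<open>y\<close> is grouped with the density, the phase in \<open>x\<close> stands apart
  for averaging.\<close>

lemma eval_along_repr:
  assumes c: "corresponds S T mY \<phi> f F" and r: "cm_repr L P \<psi> \<rho> f" and h: "osc_bounded S T h"
    and y: "y \<in> C0 S T" and x: "x \<in> C0 S T"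
  shows "eval_along S T mY \<phi> F b y c' h x =
    (LINT \<omega>|P. exp (\<i> * complex_of_real (c' * pz (\<lambda>p. \<psi> \<omega> p * h p) x)) * (exp (\<i> * complex_of_real (b * pz (\<psi> \<omega>) y)) * \<rho> \<omega>))"
proof -
  define f' where "f' = measure_of_functional S T mY \<phi> F"
  have c': "corresponds S T mY \<phi> f' F"
    unfolding f'_def measure_of_functional_def by (rule someI[of _ f]) (rule c)
  have r': "cm_repr L P \<psi> \<rho> f'"
    using r corresponds_unique[OF c' c] unfolding cm_repr_def by simp
  define \<Phi> where "\<Phi> u = exp (\<i> * complex_of_real (b * pz u y + c' * pz (\<lambda>p. u p * h p) x))" for u
  have 1: "(\<lambda>u. pz u y) \<in> borel_measurable L"
    using pz_measurable(1)[OF measurable_ident measurable_const, of y] y by (simp add: space_m0)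
  have 2: "(\<lambda>u. pz (\<lambda>p. u p * h p) x) \<in> borel_measurable L"
    using pz_measurable(1)[OF measurable_L2_mult[OF measurable_ident h] measurable_const, of x] x by (simp add: space_m0)
  have \<Phi>: "\<Phi> \<in> borel_measurable L" unfolding \<Phi>_def using 1 2 by measurable
  have "eval_along S T mY \<phi> F b y c' h x = cm_integral L f' \<Phi>"
    unfolding eval_along_def f'_def \<Phi>_def by (simp add: distrib_left mult.assoc)
  also have "\<dots> = (LINT \<omega>|P. \<Phi> (\<psi> \<omega>) * \<rho> \<omega>)"
    by (rule cm_integral_repr[OF r' \<Phi>, where C = 1]) (simp add: \<Phi>_def norm_exp_eq_Re)
  also have "\<dots> = (LINT \<omega>|P. exp (\<i> * complex_of_real (c' * pz (\<lambda>p. \<psi> \<omega> p * h p) x)) * (exp (\<i> * complex_of_real (b * pz (\<psi> \<omega>) y)) * \<rho> \<omega>))"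
    unfolding \<Phi>_def by (simp add: distrib_left exp_add mult_ac)
  finally show ?thesis .
qed

lemma eval_along_measurable:
  assumes c: "corresponds S T mY \<phi> f F" and r: "cm_repr L P \<psi> \<rho> f" and h: "osc_bounded S T h" and y: "y \<in> C0 S T"
  shows "eval_along S T mY \<phi> F b y c' h \<in> borel_measurable m0"
proof -
  have P: "finite_measure P" and \<psi>: "\<psi> \<in> P \<rightarrow>\<^sub>M L" and \<rho>: "integrable P \<rho>" using r unfolding cm_repr_def by auto
  have yi: "(\<lambda>\<omega>. pz (\<psi> \<omega>) y) \<in> borel_measurable P"
    using pz_measurable(1)[OF \<psi> measurable_const, of y] y by (simp add: space_m0)
  have \<rho>': "integrable P (\<lambda>\<omega>. exp (\<i> * complex_of_real (b * pz (\<psi> \<omega>) y)) * \<rho> \<omega>)"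
    by (rule integrable_bounded_mult[OF \<rho>, where C = 1]) (use yi in \<open>auto simp: norm_exp_eq_Re\<close>)
  have E: "(\<lambda>(x, \<omega>). exp (\<i> * complex_of_real (c' * pz (\<lambda>p. \<psi> \<omega> p * h p) x))) \<in> borel_measurable (m0 \<Otimes>\<^sub>M P)"
    using pz_pair_measurable[OF measurable_L2_mult[OF \<psi> h]] by (simp add: split_beta)
  have "(\<lambda>x. LINT \<omega>|P. exp (\<i> * complex_of_real (c' * pz (\<lambda>p. \<psi> \<omega> p * h p) x)) * (exp (\<i> * complex_of_real (b * pz (\<psi> \<omega>) y)) * \<rho> \<omega>)) \<in> borel_measurable m0"
    by (rule borel_measurable_integrable[OF fubini_pz(1)[OF P \<rho>' E]]) (simp add: norm_exp_i_real)
  then show ?thesis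
    by (rule measurable_cong[THEN iffD2, rotated]) (simp add: eval_along_repr[OF c r h y] space_m0)
qed

lemma pz_const_measurable:
  assumes "\<psi> \<in> P \<rightarrow>\<^sub>M L" "y \<in> C0 S T"
  shows "(\<lambda>\<omega>. pz (\<psi> \<omega>) y) \<in> borel_measurable P"
  using pz_measurable(1)[OF assms(1) measurable_const, of y] assms(2) by (simp add: space_m0)

text \<open>Valid at every \<open>y\<close> in \<open>C0\<close>: the phase in \<open>y\<close> is
  carried along as part of the density, and the vector is not decomposed.\<close>

lemma transform_repr:
  assumes c: "corresponds S T mY \<phi> f F" and r: "cm_repr L P \<psi> \<rho> f" and h: "osc_bounded S T h"
    and q: "q \<noteq> 0" and y: "y \<in> C0 S T"
  shows "transform S T mY \<phi> q h F y = Some (LINT \<omega>|P. exp (- \<i> * complex_of_real (sqn (\<lambda>p. \<psi> \<omega> p * h p) / (2 * q))) *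
     (exp (\<i> * complex_of_real (pz (\<psi> \<omega>) y)) * \<rho> \<omega>))"
proof -
  have P: "finite_measure P" and \<psi>: "\<psi> \<in> P \<rightarrow>\<^sub>M L" and \<rho>: "integrable P \<rho>" using r unfolding cm_repr_def by auto
  have \<rho>': "integrable P (\<lambda>\<omega>. exp (\<i> * complex_of_real (pz (\<psi> \<omega>) y)) * \<rho> \<omega>)"
    by (rule integrable_bounded_mult[OF \<rho>, where C = 1]) (use pz_const_measurable[OF \<psi> y] in \<open>auto simp: norm_exp_eq_Re\<close>)
  have "F \<in> S_class S T mY \<phi>" unfolding S_class_def using c by blast
  then have "transform S T mY \<phi> q h F y = analytic_limit mY q (\<lambda>\<kappa> x. eval_along S T mY \<phi> F 1 y (\<kappa> powr (-1/2)) h x)"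
    unfolding transform_def by simp
  also have "\<dots> = Some (LINT \<omega>|P. exp (- \<i> * complex_of_real (sqn (\<lambda>p. \<psi> \<omega> p * h p) / (2 * q))) *
     (exp (\<i> * complex_of_real (pz (\<psi> \<omega>) y)) * \<rho> \<omega>))"
  proof (rule analytic_limit_gaussian[OF P measurable_L2_mult[OF \<psi> h] \<rho>' q])
    show "(\<lambda>x. eval_along S T mY \<phi> F 1 y (\<kappa> powr (-1/2)) h x) \<in> borel_measurable m0" for \<kappa>
      by (rule eval_along_measurable[OF c r h y])
    show "AE x in m0. eval_along S T mY \<phi> F 1 y (\<kappa> powr (-1/2)) h x =
       (LINT \<omega>|P. exp (\<i> * complex_of_real (\<kappa> powr (-1/2) * pz (\<lambda>p. \<psi> \<omega> p * h p) x)) * (exp (\<i> * complex_of_real (pz (\<psi> \<omega>) y)) * \<rho> \<omega>))" for \<kappa>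
      by (rule AE_I2) (simp add: eval_along_repr[OF c r h y] space_m0)
  qed
  finally show ?thesis .
qed

lemma sqn_measurable: "\<psi> \<in> P \<rightarrow>\<^sub>M L \<Longrightarrow> (\<lambda>\<omega>. sqn (\<psi> \<omega>)) \<in> borel_measurable P"
  by (rule measurable_ip)

lemma integrable_phase:
  fixes a :: "'b \<Rightarrow> real"
  assumes "integrable P \<rho>" "a \<in> borel_measurable P"
  shows "integrable P (\<lambda>\<omega>. exp (- \<i> * complex_of_real (a \<omega>)) * \<rho> \<omega>)"
  by (rule integrable_bounded_mult[OF assms(1), where C = 1]) (use assms(2) in \<open>auto simp: norm_exp_eq_Re\<close>)

text \<open>The map \<open>\<psi>\<close> is kept and the density acquires a factor of modulus 1, so
  transforms can be iterated on the same parameter space.\<close>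

lemma transform_corresponds:
  assumes c: "corresponds S T mY \<phi> f F" and r: "cm_repr L P \<psi> \<rho> f" and h: "osc_bounded S T h" and q: "q \<noteq> 0"
  shows "\<exists>f'. cm_repr L P \<psi> (\<lambda>\<omega>. exp (- \<i> * complex_of_real (sqn (\<lambda>p. \<psi> \<omega> p * h p) / (2 * q))) * \<rho> \<omega>) f' \<and>
    corresponds S T mY \<phi> f' (transform S T mY \<phi> q h F)"
proof -
  have P: "finite_measure P" and \<psi>: "\<psi> \<in> P \<rightarrow>\<^sub>M L" and \<rho>: "integrable P \<rho>" using r unfolding cm_repr_def by auto
  have \<rho>': "integrable P (\<lambda>\<omega>. exp (- \<i> * complex_of_real (sqn (\<lambda>p. \<psi> \<omega> p * h p) / (2 * q))) * \<rho> \<omega>)"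
    by (rule integrable_phase[OF \<rho>]) (use sqn_measurable[OF measurable_L2_mult[OF \<psi> h]] in measurable)
  have "AE x in m0. transform S T mY \<phi> q h F (rescale c x) = Some (LINT \<omega>|P. exp (\<i> * complex_of_real (pz (\<psi> \<omega>) (rescale c x))) *
      (exp (- \<i> * complex_of_real (sqn (\<lambda>p. \<psi> \<omega> p * h p) / (2 * q))) * \<rho> \<omega>))" for c
    by (rule AE_I2) (simp add: transform_repr[OF c r h q] rescale_C0 space_m0 mult.left_commute)
  from corresponds_of_repr[OF P \<psi> \<rho>' this] show ?thesis by blast
qed

lemma iterated_transform_corresponds:
  assumes c: "corresponds S T mY \<phi> f F" and r: "cm_repr L P \<psi> \<rho> f" and q: "q \<noteq> 0"
    and h: "\<And>j. j \<in> {1..n} \<Longrightarrow> osc_bounded S T (h j)"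
  shows "\<exists>f'. cm_repr L P \<psi> (\<lambda>\<omega>. exp (- \<i> * complex_of_real ((\<Sum>j=1..n. sqn (\<lambda>p. \<psi> \<omega> p * h j p)) / (2 * q))) * \<rho> \<omega>) f' \<and>
    corresponds S T mY \<phi> f' (iterated_transform S T mY \<phi> q h n F)"
  using h
proof (induction n)
  case 0
  then show ?case using c r by auto
next
  case (Suc n)
  then obtain f' where f': "cm_repr L P \<psi> (\<lambda>\<omega>. exp (- \<i> * complex_of_real ((\<Sum>j=1..n. sqn (\<lambda>p. \<psi> \<omega> p * h j p)) / (2 * q))) * \<rho> \<omega>) f'"
    "corresponds S T mY \<phi> f' (iterated_transform S T mY \<phi> q h n F)" by auto
  have "osc_bounded S T (h (Suc n))" using Suc.prems by simp
  from transform_corresponds[OF f'(2,1) this q]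
  have "\<exists>f'. cm_repr L P \<psi> (\<lambda>\<omega>. exp (- \<i> * complex_of_real (sqn (\<lambda>p. \<psi> \<omega> p * h (Suc n) p) / (2 * q))) *
      (exp (- \<i> * complex_of_real ((\<Sum>j=1..n. sqn (\<lambda>p. \<psi> \<omega> p * h j p)) / (2 * q))) * \<rho> \<omega>)) f' \<and>
    corresponds S T mY \<phi> f' (iterated_transform S T mY \<phi> q h (Suc n) F)" by simp
  moreover have "exp (- \<i> * complex_of_real (sqn (\<lambda>p. \<psi> \<omega> p * h (Suc n) p) / (2 * q))) *
      (exp (- \<i> * complex_of_real ((\<Sum>j=1..n. sqn (\<lambda>p. \<psi> \<omega> p * h j p)) / (2 * q))) * \<rho> \<omega>) =
      exp (- \<i> * complex_of_real ((\<Sum>j=1..Suc n. sqn (\<lambda>p. \<psi> \<omega> p * h j p)) / (2 * q))) * \<rho> \<omega>" for \<omega>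
    unfolding mult.assoc[symmetric] exp_add[symmetric] by (simp add: add_divide_distrib distrib_left add.commute)
  ultimately show ?case by (simp only:)
qed

section \<open>The convolution product as an integral over pairs of vectors\<close>

definition conv_V :: "(real \<times> real \<Rightarrow> real) \<Rightarrow> (real \<times> real \<Rightarrow> real) \<Rightarrow>
    (real \<times> real \<Rightarrow> real) \<times> (real \<times> real \<Rightarrow> real) \<Rightarrow> real \<times> real \<Rightarrow> real" where
  "conv_V k1 k2 z = (\<lambda>p. 1 / sqrt 2 * (fst z p * k1 p) + (- 1 / sqrt 2) * (snd z p * k2 p))"

text \<open>The vector that is paired with the argument \<open>y\<close> of the product, whereas
  \<open>conv_V\<close> is paired with the path that is averaged out.\<close>

definition conv_W :: "(real \<times> real \<Rightarrow> real) \<times> (real \<times> real \<Rightarrow> real) \<Rightarrow> real \<times> real \<Rightarrow> real" where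
  "conv_W z = (\<lambda>p. 1 / sqrt 2 * fst z p + 1 / sqrt 2 * snd z p)"

text \<open>The product of two evaluations is an integral over pairs of vectors. The two phases in
  \<open>y\<close> remain separate, so the formula holds at every \<open>y\<close>; merging them
  into \<open>conv_W\<close> would presuppose convergence at \<open>y\<close>.\<close>

lemma convolution_value:
  assumes c1: "corresponds S T mY \<phi> f F" and c2: "corresponds S T mY \<phi> g G"
    and s1: "sets P1 = sets L" and s2: "sets P2 = sets L"
    and r1: "cm_repr L P1 (\<lambda>u. u) \<rho>1 f" and r2: "cm_repr L P2 (\<lambda>u. u) \<rho>2 g"
    and k: "osc_bounded S T k1" "osc_bounded S T k2" and q: "q \<noteq> 0" and y: "y \<in> C0 S T"
  shows "convolution_product S T mY \<phi> q k1 k2 F G y =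
    Some (LINT z|(P1 \<Otimes>\<^sub>M P2). exp (- \<i> * complex_of_real (sqn (conv_V k1 k2 z) / (2 * q))) *
      ((exp (\<i> * complex_of_real (1 / sqrt 2 * pz (fst z) y)) * \<rho>1 (fst z)) * (exp (\<i> * complex_of_real (1 / sqrt 2 * pz (snd z) y)) * \<rho>2 (snd z))))"
proof -
  let ?\<Omega> = "P1 \<Otimes>\<^sub>M P2"
  have P: "finite_measure P1" "finite_measure P2" and \<rho>: "integrable P1 \<rho>1" "integrable P2 \<rho>2"
    using r1 r2 unfolding cm_repr_def by auto
  interpret P1: finite_measure P1 by (rule P)
  interpret P2: finite_measure P2 by (rule P)
  interpret pair_sigma_finite P1 P2 ..
  have fin: "finite_measure ?\<Omega>" by (rule finite_measure_pair_measure[OF P(2,1)])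
  have id: "(\<lambda>u. u) \<in> P1 \<rightarrow>\<^sub>M L" "(\<lambda>u. u) \<in> P2 \<rightarrow>\<^sub>M L" by (rule measurable_ident_sets, fact)+
  have fs: "fst \<in> ?\<Omega> \<rightarrow>\<^sub>M L" "snd \<in> ?\<Omega> \<rightarrow>\<^sub>M L"
    by (rule measurable_compose[OF measurable_fst id(1)], rule measurable_compose[OF measurable_snd id(2)])
  have k1: "(\<lambda>z p. fst z p * k1 p) \<in> ?\<Omega> \<rightarrow>\<^sub>M L" and k2: "(\<lambda>z p. snd z p * k2 p) \<in> ?\<Omega> \<rightarrow>\<^sub>M L"
    by (rule measurable_L2_mult[OF fs(1) k(1)], rule measurable_L2_mult[OF fs(2) k(2)])
  have V: "conv_V k1 k2 \<in> ?\<Omega> \<rightarrow>\<^sub>M L"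
    unfolding conv_V_def by (rule measurable_L2_lin[OF k1 k2])
  define a where "a b x u = exp (\<i> * complex_of_real (b * pz (\<lambda>p. u p * k1 p) x)) * (exp (\<i> * complex_of_real (1 / sqrt 2 * pz u y)) * \<rho>1 u)" for b x u
  define d where "d b x v = exp (\<i> * complex_of_real (b * pz (\<lambda>p. v p * k2 p) x)) * (exp (\<i> * complex_of_real (1 / sqrt 2 * pz v y)) * \<rho>2 v)" for b x v
  have a0: "integrable P1 (\<lambda>u. exp (\<i> * complex_of_real (1 / sqrt 2 * pz u y)) * \<rho>1 u)"
    by (rule integrable_bounded_mult[OF \<rho>(1), where C = 1]) (use pz_const_measurable[OF id(1) y] in \<open>auto simp: norm_exp_eq_Re\<close>)
  have d0: "integrable P2 (\<lambda>u. exp (\<i> * complex_of_real (1 / sqrt 2 * pz u y)) * \<rho>2 u)"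
    by (rule integrable_bounded_mult[OF \<rho>(2), where C = 1]) (use pz_const_measurable[OF id(2) y] in \<open>auto simp: norm_exp_eq_Re\<close>)
  have a: "integrable P1 (a b x)" if x: "x \<in> C0 S T" for b x
    unfolding a_def by (rule integrable_bounded_mult[OF a0, where C = 1])
      (use pz_const_measurable[OF measurable_L2_mult[OF id(1) k(1)] x] in \<open>auto simp: norm_exp_eq_Re\<close>)
  have d: "integrable P2 (d b x)" if x: "x \<in> C0 S T" for b x
    unfolding d_def by (rule integrable_bounded_mult[OF d0, where C = 1])
      (use pz_const_measurable[OF measurable_L2_mult[OF id(2) k(2)] x] in \<open>auto simp: norm_exp_eq_Re\<close>)
  have "F \<in> S_class S T mY \<phi>" "G \<in> S_class S T mY \<phi>" unfolding S_class_def using c1 c2 by blast+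
  then have "convolution_product S T mY \<phi> q k1 k2 F G y = analytic_limit mY q (\<lambda>\<kappa> x.
            eval_along S T mY \<phi> F (1 / sqrt 2) y (\<kappa> powr (-1/2) / sqrt 2) k1 x *
            eval_along S T mY \<phi> G (1 / sqrt 2) y (- (\<kappa> powr (-1/2) / sqrt 2)) k2 x)"
    unfolding convolution_product_def by simp
  also have "\<dots> = Some (LINT z|?\<Omega>. exp (- \<i> * complex_of_real (sqn (conv_V k1 k2 z) / (2 * q))) *
      ((exp (\<i> * complex_of_real (1 / sqrt 2 * pz (fst z) y)) * \<rho>1 (fst z)) * (exp (\<i> * complex_of_real (1 / sqrt 2 * pz (snd z) y)) * \<rho>2 (snd z))))"
  proof (rule analytic_limit_gaussian[OF fin V pair_integral_product(1)[OF P a0 d0] q])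
    fix \<kappa> :: real
    show "(\<lambda>x. eval_along S T mY \<phi> F (1 / sqrt 2) y (\<kappa> powr (-1/2) / sqrt 2) k1 x *
            eval_along S T mY \<phi> G (1 / sqrt 2) y (- (\<kappa> powr (-1/2) / sqrt 2)) k2 x) \<in> borel_measurable m0"
      by (intro borel_measurable_times eval_along_measurable[OF c1 r1 k(1) y] eval_along_measurable[OF c2 r2 k(2) y])
    show "AE x in m0. eval_along S T mY \<phi> F (1 / sqrt 2) y (\<kappa> powr (-1/2) / sqrt 2) k1 x *
            eval_along S T mY \<phi> G (1 / sqrt 2) y (- (\<kappa> powr (-1/2) / sqrt 2)) k2 x =
       (LINT z|?\<Omega>. exp (\<i> * complex_of_real (\<kappa> powr (-1/2) * pz (conv_V k1 k2 z) x)) *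
      ((exp (\<i> * complex_of_real (1 / sqrt 2 * pz (fst z) y)) * \<rho>1 (fst z)) * (exp (\<i> * complex_of_real (1 / sqrt 2 * pz (snd z) y)) * \<rho>2 (snd z))))"
      \<comment> \<open>For almost every \<open>x\<close> both integrals are genuine limits for
        almost every pair of vectors, and there the integral of \<open>conv_V\<close>
        splits.\<close>
      using AE_AE_conv[OF fin k1] AE_AE_conv[OF fin k2] AE_space
    proof eventually_elim
      case (elim x)
      have x: "x \<in> C0 S T" using elim(3) by (simp add: space_m0)
      define b where "b = \<kappa> powr (-1/2) / sqrt 2"
      have "eval_along S T mY \<phi> F (1 / sqrt 2) y (\<kappa> powr (-1/2) / sqrt 2) k1 x *
            eval_along S T mY \<phi> G (1 / sqrt 2) y (- (\<kappa> powr (-1/2) / sqrt 2)) k2 x = (LINT u|P1. a b x u) * (LINT v|P2. d (- b) x v)"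
        unfolding eval_along_repr[OF c1 r1 k(1) y x] eval_along_repr[OF c2 r2 k(2) y x] a_def d_def b_def ..
      also have "\<dots> = (LINT z|?\<Omega>. a b x (fst z) * d (- b) x (snd z))"
        by (rule pair_integral_product(2)[OF P a[OF x] d[OF x], symmetric])
      also have "\<dots> = (LINT z|?\<Omega>. exp (\<i> * complex_of_real (\<kappa> powr (-1/2) * pz (conv_V k1 k2 z) x)) *
      ((exp (\<i> * complex_of_real (1 / sqrt 2 * pz (fst z) y)) * \<rho>1 (fst z)) * (exp (\<i> * complex_of_real (1 / sqrt 2 * pz (snd z) y)) * \<rho>2 (snd z))))"
      proof (rule integral_cong_AE)
        show "(\<lambda>z. a b x (fst z) * d (- b) x (snd z)) \<in> borel_measurable ?\<Omega>"
          by (rule borel_measurable_integrable[OF pair_integral_product(1)[OF P a[OF x] d[OF x]]])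
        have "(\<lambda>z. exp (\<i> * complex_of_real (\<kappa> powr (-1/2) * pz (conv_V k1 k2 z) x))) \<in> borel_measurable ?\<Omega>"
          using pz_const_measurable[OF V x] by measurable
        then show "(\<lambda>z. exp (\<i> * complex_of_real (\<kappa> powr (-1/2) * pz (conv_V k1 k2 z) x)) *
      ((exp (\<i> * complex_of_real (1 / sqrt 2 * pz (fst z) y)) * \<rho>1 (fst z)) * (exp (\<i> * complex_of_real (1 / sqrt 2 * pz (snd z) y)) * \<rho>2 (snd z)))) \<in> borel_measurable ?\<Omega>"
          by (rule borel_measurable_times) (rule borel_measurable_integrable[OF pair_integral_product(1)[OF P a0 d0]])
        show "AE z in ?\<Omega>. a b x (fst z) * d (- b) x (snd z) =
          exp (\<i> * complex_of_real (\<kappa> powr (-1/2) * pz (conv_V k1 k2 z) x)) *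
      ((exp (\<i> * complex_of_real (1 / sqrt 2 * pz (fst z) y)) * \<rho>1 (fst z)) * (exp (\<i> * complex_of_real (1 / sqrt 2 * pz (snd z) y)) * \<rho>2 (snd z)))"
          using elim(1,2) AE_space
        proof eventually_elim
          case (elim z)
          have L: "(\<lambda>p. fst z p * k1 p) \<in> L2 S T" "(\<lambda>p. snd z p * k2 p) \<in> L2 S T"
            using L2_measurable_space[OF k1 elim(3)] L2_measurable_space[OF k2 elim(3)] by simp_all
          have "\<kappa> powr (-1/2) * pz (conv_V k1 k2 z) x = b * pz (\<lambda>p. fst z p * k1 p) x + (- b) * pz (\<lambda>p. snd z p * k2 p) x"
            unfolding conv_V_def conv_lin(2)[OF L x elim(1,2)] b_def by (simp add: algebra_simps)
          then have "exp (\<i> * complex_of_real (\<kappa> powr (-1/2) * pz (conv_V k1 k2 z) x)) =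
             exp (\<i> * complex_of_real (b * pz (\<lambda>p. fst z p * k1 p) x)) * exp (\<i> * complex_of_real ((- b) * pz (\<lambda>p. snd z p * k2 p) x))"
            unfolding exp_add[symmetric] by (simp only: of_real_add distrib_left)
          then show ?case unfolding a_def d_def by (simp only: mult_ac)
        qed
      qed
      finally show ?case .
    qed
  qed
  finally show ?thesis .
qed

lemma sqn_sum:
  assumes w: "w \<in> L2 S T" and h: "\<And>j. j \<in> I \<Longrightarrow> osc_bounded S T (h j)" and s: "osc_bounded S T s"
    and eq: "AE p in Leb S T. (s p)\<^sup>2 = (\<Sum>j\<in>I. (h j p)\<^sup>2)"
  shows "(\<Sum>j\<in>I. sqn (\<lambda>p. w p * h j p)) = sqn (\<lambda>p. w p * s p)"
proof -
  have i: "integrable (Leb S T) (\<lambda>p. (w p * h j p) * (w p * h j p))" if "j \<in> I" for j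
    by (intro L2_mult_integrable L2_mult_osc w h that)
  have ws: "integrable (Leb S T) (\<lambda>p. (w p * s p) * (w p * s p))"
    by (intro L2_mult_integrable L2_mult_osc w s)
  have "(\<Sum>j\<in>I. sqn (\<lambda>p. w p * h j p)) = (LINT p|Leb S T. (\<Sum>j\<in>I. (w p * h j p) * (w p * h j p)))"
    unfolding l2_inner_def by (rule Bochner_Integration.integral_sum[symmetric]) (rule i)
  also have "\<dots> = sqn (\<lambda>p. w p * s p)"
    unfolding l2_inner_def
  proof (rule integral_cong_AE)
    show "AE p in Leb S T. (\<Sum>j\<in>I. (w p * h j p) * (w p * h j p)) = (w p * s p) * (w p * s p)"
      using eq
    proof eventually_elim
      case (elim p)
      have "(\<Sum>j\<in>I. (w p * h j p) * (w p * h j p)) = (w p)\<^sup>2 * (\<Sum>j\<in>I. (h j p)\<^sup>2)"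
        by (simp add: sum_distrib_left power2_eq_square mult_ac)
      also have "\<dots> = (w p * s p) * (w p * s p)" unfolding elim[symmetric] by (simp add: power2_eq_square mult_ac)
      finally show ?case .
    qed
  qed (intro borel_measurable_integrable Bochner_Integration.integrable_sum i ws, assumption?)+
  finally show ?thesis .
qed

text \<open>The squared norms are compared under the integral sign, where the hypotheses on
  \<open>sH\<close>, \<open>sK1\<close> and \<open>sK2\<close> hold at almost every point.\<close>

lemma sqn_rotation:
  assumes z: "fst z \<in> L2 S T" "snd z \<in> L2 S T"
    and o: "osc_bounded S T k1" "osc_bounded S T k2" "osc_bounded S T sH" "osc_bounded S T sK1" "osc_bounded S T sK2"
    and eq: "AE p in Leb S T. (sH p)\<^sup>2 = k1 p * k2 p"
      "AE p in Leb S T. (sK1 p)\<^sup>2 = (sH p)\<^sup>2 + (k1 p)\<^sup>2" "AE p in Leb S T. (sK2 p)\<^sup>2 = (sH p)\<^sup>2 + (k2 p)\<^sup>2"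
  shows "sqn (\<lambda>p. conv_W z p * sH p) + sqn (conv_V k1 k2 z) =
    sqn (\<lambda>p. fst z p * (sK1 p / sqrt 2)) + sqn (\<lambda>p. snd z p * (sK2 p / sqrt 2))"
proof -
  have sc: "osc_bounded S T (\<lambda>p. s p / sqrt 2)" if "osc_bounded S T s" for s
    using osc_bounded_mult[OF S T that osc_bounded_const[of _ _ "1 / sqrt 2"]] by simp
  have L: "(\<lambda>p. conv_W z p * sH p) \<in> L2 S T" "conv_V k1 k2 z \<in> L2 S T"
    "(\<lambda>p. fst z p * (sK1 p / sqrt 2)) \<in> L2 S T" "(\<lambda>p. snd z p * (sK2 p / sqrt 2)) \<in> L2 S T"
    unfolding conv_W_def conv_V_def by (intro L2_mult_osc L2_add L2_scale z o sc)+
  note i = L2_mult_integrable[OF L(1) L(1)] L2_mult_integrable[OF L(2) L(2)]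
    L2_mult_integrable[OF L(3) L(3)] L2_mult_integrable[OF L(4) L(4)]
  show ?thesis
    unfolding l2_inner_def Bochner_Integration.integral_add[OF i(1,2), symmetric] Bochner_Integration.integral_add[OF i(3,4), symmetric]
  proof (rule integral_cong_AE)
    show "AE p in Leb S T. conv_W z p * sH p * (conv_W z p * sH p) + conv_V k1 k2 z p * conv_V k1 k2 z p =
        fst z p * (sK1 p / sqrt 2) * (fst z p * (sK1 p / sqrt 2)) + snd z p * (sK2 p / sqrt 2) * (snd z p * (sK2 p / sqrt 2))"
      using eq
    proof eventually_elim
      case (elim p)
      define u v where "u = fst z p" and "v = snd z p"
      \<comment> \<open>With the root named, the algebra sees only polynomials; the same factor
        \<open>c * c\<close> stands on both sides.\<close>
      define c where "c = 1 / sqrt (2::real)"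
      have c: "c * c = 1 / 2" by (simp add: c_def)
      have "conv_W z p * sH p * (conv_W z p * sH p) + conv_V k1 k2 z p * conv_V k1 k2 z p =
          (c * c) * ((u + v)\<^sup>2 * (sH p)\<^sup>2 + (u * k1 p - v * k2 p)\<^sup>2)"
        unfolding conv_W_def conv_V_def u_def[symmetric] v_def[symmetric] minus_divide_left[symmetric] c_def[symmetric]
        by (simp add: power2_eq_square algebra_simps)
      also have "\<dots> = (c * c) * (u\<^sup>2 * (sK1 p)\<^sup>2 + v\<^sup>2 * (sK2 p)\<^sup>2)"
        unfolding elim(2,3) elim(1) by (simp add: power2_eq_square algebra_simps)
      also have "\<dots> = u * (sK1 p * c) * (u * (sK1 p * c)) + v * (sK2 p * c) * (v * (sK2 p * c))"
        by (simp add: power2_eq_square algebra_simps)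
      finally show ?case unfolding u_def v_def c_def by simp
    qed
  qed (intro borel_measurable_integrable Bochner_Integration.integrable_add i)+
qed

end

lemma yeh_wiener_measure_yw:
  assumes "S > 0" "T > 0" "yeh_wiener_measure S T m" "complete_orthonormal_BV S T \<phi>"
  obtains m0 where "m = completion m0" "yw S T \<phi> m0"
proof -
  from assms(3) obtain m0 where m: "m = completion m0" "prob_space m0" "space m0 = C0 S T"
      "sets m0 = sets (sigma (C0 S T)
        {(\<lambda>x. x p) -` B \<inter> C0 S T | p B. p \<in> Q S T \<and> B \<in> sets (borel :: real measure)})"
      "\<forall>P a. finite P \<and> P \<subseteq> Q S T \<longrightarrow>
         centered_normal (distr m0 borel (\<lambda>x. \<Sum>p\<in>P. a p * x p))"
      "\<forall>s\<in>{0..S}. \<forall>t\<in>{0..T}. \<forall>s'\<in>{0..S}. \<forall>t'\<in>{0..T}.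
         (LINT x|m0. x (s, t) * x (s', t')) = min s s' * min t t'"
    unfolding yeh_wiener_measure_def by (elim exE conjE)
  have "yw S T \<phi> m0"
  proof (intro yw.intro onb.intro yw_axioms.intro)
    show "centered_normal (distr m0 borel (\<lambda>x. \<Sum>p\<in>P. a p * x p))" if "finite P" "P \<subseteq> Q S T" for P a
      using m(5)[rule_format, OF conjI[OF that]] .
    show "(LINT x|m0. x (s, t) * x (s', t')) = min s s' * min t t'"
      if "s \<in> {0..S}" "t \<in> {0..T}" "s' \<in> {0..S}" "t' \<in> {0..T}" for s t s' t'
      by (rule m(6)[rule_format, OF that])
  qed (rule assms(1) assms(2) assms(4) m(2) m(3) m(4))+
  with m(1) show thesis by (rule that)
qed

text \<open>Functionals are partial, so the witnesses \<open>a\<close> and \<open>b\<close> assert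
  that all four values exist in addition to being equal as claimed. In
  \<open>iterated_transform\<close> the transform with \<open>h 1\<close> is applied first.\<close>

theorem corollary6p9:
  fixes S T q :: real
    and m :: "(real \<times> real \<Rightarrow> real) measure"
    and \<phi> :: "nat \<Rightarrow> real \<times> real \<Rightarrow> real"
    and k1 k2 sH sK1 sK2 :: "real \<times> real \<Rightarrow> real"
    and n :: nat
    and h :: "nat \<Rightarrow> real \<times> real \<Rightarrow> real"
    and F G :: functional
    and f g :: "(real \<times> real \<Rightarrow> real) set \<Rightarrow> complex"
  assumes "S > 0" and "T > 0"
    and "yeh_wiener_measure S T m"
    and "complete_orthonormal_BV S T \<phi>"
    and "k1 \<in> Supp_BV S T" and "k2 \<in> Supp_BV S T"
    and "corresponds S T m \<phi> f F" and "corresponds S T m \<phi> g G"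
    and "n \<ge> 1" and "\<And>j. j \<in> {1..n} \<Longrightarrow> h j \<in> Supp_BV S T"
    and "sH \<in> Supp_BV S T"
    and "AE p in lebesgue_on (Q S T). (sH p)\<^sup>2 = (\<Sum>j=1..n. (h j p)\<^sup>2)"
    and "AE p in lebesgue_on (Q S T). (sH p)\<^sup>2 = k1 p * k2 p"
    and "sK1 \<in> Supp_BV S T"
    and "AE p in lebesgue_on (Q S T). (sK1 p)\<^sup>2 = (\<Sum>j=1..n. (h j p)\<^sup>2) + (k1 p)\<^sup>2"
    and "sK2 \<in> Supp_BV S T"
    and "AE p in lebesgue_on (Q S T). (sK2 p)\<^sup>2 = (\<Sum>j=1..n. (h j p)\<^sup>2) + (k2 p)\<^sup>2"
    and "q \<noteq> 0"
  shows "s_ae m (\<lambda>y. \<exists>a b.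
           transform S T m \<phi> q (\<lambda>p. sK1 p / sqrt 2) F (rescale (1 / sqrt 2) y) = Some a \<and>
           transform S T m \<phi> q (\<lambda>p. sK2 p / sqrt 2) G (rescale (1 / sqrt 2) y) = Some b \<and>
           transform S T m \<phi> q sH (convolution_product S T m \<phi> q k1 k2 F G) y = Some (a * b) \<and>
           iterated_transform S T m \<phi> q h n (convolution_product S T m \<phi> q k1 k2 F G) y = Some (a * b))"
proof -
  obtain m0 where m: "m = completion m0" and yw: "yw S T \<phi> m0"
    by (rule yeh_wiener_measure_yw[OF assms(1-4)])
  interpret yw S T \<phi> m0 by (rule yw)
  note c1 = assms(7)[unfolded m] and c2 = assms(8)[unfolded m]
  have k: "osc_bounded S T k1" "osc_bounded S T k2" and osH: "osc_bounded S T sH"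
    and osK: "osc_bounded S T sK1" "osc_bounded S T sK2"
    and oh: "\<And>j. j \<in> {1..n} \<Longrightarrow> osc_bounded S T (h j)"
    using assms(5,6,10,11,14,16) by (auto intro: Supp_BV_osc)
  have osK': "osc_bounded S T (\<lambda>p. sK1 p / sqrt 2)" "osc_bounded S T (\<lambda>p. sK2 p / sqrt 2)"
    using osc_bounded_mult[OF S T osK(1) osc_bounded_const[of _ _ "1 / sqrt 2"]]
      osc_bounded_mult[OF S T osK(2) osc_bounded_const[of _ _ "1 / sqrt 2"]] by simp_all
  have q: "q \<noteq> 0" by (rule assms(18))
  have AEK1: "AE p in Leb S T. (sK1 p)\<^sup>2 = (sH p)\<^sup>2 + (k1 p)\<^sup>2"
    using assms(12,15) by eventually_elim simp
  have AEK2: "AE p in Leb S T. (sK2 p)\<^sup>2 = (sH p)\<^sup>2 + (k2 p)\<^sup>2"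
    using assms(12,17) by eventually_elim simp
  obtain P1 r1 where P1: "sets P1 = sets L" "cm_repr L P1 (\<lambda>u. u) r1 f"
    using complex_measures_repr[of f L] c1 unfolding corresponds_def by metis
  obtain P2 r2 where P2: "sets P2 = sets L" "cm_repr L P2 (\<lambda>u. u) r2 g"
    using complex_measures_repr[of g L] c2 unfolding corresponds_def by metis
  have fin: "finite_measure P1" "finite_measure P2" and int: "integrable P1 r1" "integrable P2 r2"
    using P1(2) P2(2) unfolding cm_repr_def by auto
  \<comment> \<open>The convolution product and all its transforms are represented over this one
    space of pairs, always with the map \<open>conv_W\<close>.\<close>
  define \<Omega> where "\<Omega> = P1 \<Otimes>\<^sub>M P2"
  have f\<Omega>: "finite_measure \<Omega>" unfolding \<Omega>_def by (rule finite_measure_pair_measure[OF fin(2,1)])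
  have id: "(\<lambda>u. u) \<in> P1 \<rightarrow>\<^sub>M L" "(\<lambda>u. u) \<in> P2 \<rightarrow>\<^sub>M L" by (rule measurable_ident_sets, fact)+
  have fs: "fst \<in> \<Omega> \<rightarrow>\<^sub>M L" "snd \<in> \<Omega> \<rightarrow>\<^sub>M L"
    unfolding \<Omega>_def by (rule measurable_compose[OF measurable_fst id(1)], rule measurable_compose[OF measurable_snd id(2)])
  have W: "conv_W \<in> \<Omega> \<rightarrow>\<^sub>M L" unfolding conv_W_def by (rule measurable_L2_lin[OF fs])
  have V: "conv_V k1 k2 \<in> \<Omega> \<rightarrow>\<^sub>M L"
    unfolding conv_V_def by (intro measurable_L2_lin measurable_L2_mult fs k)
  \<comment> \<open>The density of the convolution product: the product density times the phase left
    by averaging over the path.\<close>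
  define \<rho> where "\<rho> z = exp (- \<i> * complex_of_real (sqn (conv_V k1 k2 z) / (2 * q))) * (r1 (fst z) * r2 (snd z))" for z
  have \<rho>: "integrable \<Omega> \<rho>"
    unfolding \<rho>_def \<Omega>_def
    by (rule integrable_phase[OF pair_integral_product(1)[OF fin int]]) (use sqn_measurable[OF V[unfolded \<Omega>_def]] in measurable)
  define C where "C = convolution_product S T m \<phi> q k1 k2 F G"
  have AEconv: "AE x in m0. AE z in \<Omega>. conv (fst z) (rescale c x) \<and> conv (snd z) (rescale c x)" if c: "c > 0" for c
    using AE_AE_conv[OF f\<Omega> fs(1)] AE_AE_conv[OF f\<Omega> fs(2)] AE_space
  proof eventually_elim
    case (elim x)
    then have x: "x \<in> C0 S T" by (simp add: space_m0)
    show ?case using elim(1,2) by eventually_elim (use conv_rescale(1)[OF x, of c] c in simp)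
  qed
  \<comment> \<open>The place where linearity in the vector is used at \<open>y\<close>, hence the
    restriction to pairs whose components both converge there.\<close>
  have pzW: "exp (\<i> * complex_of_real (pz (conv_W z) y)) =
      exp (\<i> * complex_of_real (1 / sqrt 2 * pz (fst z) y)) * exp (\<i> * complex_of_real (1 / sqrt 2 * pz (snd z) y))"
    if "z \<in> space \<Omega>" "y \<in> C0 S T" "conv (fst z) y" "conv (snd z) y" for z y
    unfolding conv_W_def
      conv_lin(2)[OF L2_measurable_space[OF fs(1) that(1)] L2_measurable_space[OF fs(2) that(1)] that(2-4)]
    by (simp only: of_real_add distrib_left exp_add)
  have Cval: "AE x in m0. C (rescale c x) = Some (LINT z|\<Omega>. exp (\<i> * complex_of_real (pz (conv_W z) (rescale c x))) * \<rho> z)"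
    if "c > 0" for c
    using AEconv[OF that] AE_space
  proof eventually_elim
    case (elim x)
    define y where "y = rescale c x"
    have y: "y \<in> C0 S T" unfolding y_def using elim(2) by (intro rescale_C0) (simp add: space_m0)
    have a0: "integrable P1 (\<lambda>u. exp (\<i> * complex_of_real (1 / sqrt 2 * pz u y)) * r1 u)"
      by (rule integrable_bounded_mult[OF int(1), where C = 1]) (use pz_const_measurable[OF id(1) y] in \<open>auto simp: norm_exp_eq_Re\<close>)
    have d0: "integrable P2 (\<lambda>u. exp (\<i> * complex_of_real (1 / sqrt 2 * pz u y)) * r2 u)"
      by (rule integrable_bounded_mult[OF int(2), where C = 1]) (use pz_const_measurable[OF id(2) y] in \<open>auto simp: norm_exp_eq_Re\<close>)
    have "C y = Some (LINT z|\<Omega>. exp (- \<i> * complex_of_real (sqn (conv_V k1 k2 z) / (2 * q))) *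
      ((exp (\<i> * complex_of_real (1 / sqrt 2 * pz (fst z) y)) * r1 (fst z)) * (exp (\<i> * complex_of_real (1 / sqrt 2 * pz (snd z) y)) * r2 (snd z))))"
      unfolding C_def m \<Omega>_def by (rule convolution_value[OF c1 c2 P1(1) P2(1) P1(2) P2(2) k q y])
    also have "\<dots> = Some (LINT z|\<Omega>. exp (\<i> * complex_of_real (pz (conv_W z) y)) * \<rho> z)"
    proof (intro arg_cong[where f = Some] integral_cong_AE)
      show "(\<lambda>z. exp (- \<i> * complex_of_real (sqn (conv_V k1 k2 z) / (2 * q))) *
      ((exp (\<i> * complex_of_real (1 / sqrt 2 * pz (fst z) y)) * r1 (fst z)) * (exp (\<i> * complex_of_real (1 / sqrt 2 * pz (snd z) y)) * r2 (snd z)))) \<in> borel_measurable \<Omega>"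
        by (rule borel_measurable_integrable, rule integrable_phase, unfold \<Omega>_def, rule pair_integral_product(1)[OF fin a0 d0])
          (use sqn_measurable[OF V[unfolded \<Omega>_def]] in measurable)
      show "(\<lambda>z. exp (\<i> * complex_of_real (pz (conv_W z) y)) * \<rho> z) \<in> borel_measurable \<Omega>"
        using pz_const_measurable[OF W y] borel_measurable_integrable[OF \<rho>] by measurable
      show "AE z in \<Omega>. exp (- \<i> * complex_of_real (sqn (conv_V k1 k2 z) / (2 * q))) *
      ((exp (\<i> * complex_of_real (1 / sqrt 2 * pz (fst z) y)) * r1 (fst z)) * (exp (\<i> * complex_of_real (1 / sqrt 2 * pz (snd z) y)) * r2 (snd z))) =
        exp (\<i> * complex_of_real (pz (conv_W z) y)) * \<rho> z"
        using elim(1)[folded y_def] AE_space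
      proof eventually_elim
        case (elim z)
        show ?case unfolding pzW[OF elim(2) y conjunct1[OF elim(1)] conjunct2[OF elim(1)]] \<rho>_def by (simp only: mult_ac)
      qed
    qed
    finally show ?case unfolding y_def .
  qed
  obtain c where c: "cm_repr L \<Omega> conv_W \<rho> c" "corresponds S T (completion m0) \<phi> c C"
    using corresponds_of_repr[OF f\<Omega> W \<rho> Cval] by blast
  \<comment> \<open>The first \<open>n'\<close> transforms are absorbed into a representing measure.
    The last one is evaluated by \<open>transform_repr\<close> at the same \<open>y\<close> as the
    other three values.\<close>
  obtain n' where n': "n = Suc n'" using assms(9) by (cases n) auto
  obtain c' where c': "cm_repr L \<Omega> conv_W (\<lambda>z. exp (- \<i> * complex_of_real ((\<Sum>j=1..n'. sqn (\<lambda>p. conv_W z p * h j p)) / (2 * q))) * \<rho> z) c'"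
    "corresponds S T (completion m0) \<phi> c' (iterated_transform S T (completion m0) \<phi> q h n' C)"
    using iterated_transform_corresponds[OF c(2,1) q, of n' h] oh n' by auto
  \<comment> \<open>A statement for individual paths: convergence at \<open>y\<close> for almost
    every pair is all that the exceptional set has to guarantee.\<close>
  have final: "\<exists>a b.
           transform S T m \<phi> q (\<lambda>p. sK1 p / sqrt 2) F (rescale (1 / sqrt 2) y) = Some a \<and>
           transform S T m \<phi> q (\<lambda>p. sK2 p / sqrt 2) G (rescale (1 / sqrt 2) y) = Some b \<and>
           transform S T m \<phi> q sH C y = Some (a * b) \<and>
           iterated_transform S T m \<phi> q h n C y = Some (a * b)"
    if y: "y \<in> C0 S T" and cv: "AE z in \<Omega>. conv (fst z) y \<and> conv (snd z) y" for y
  proof -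
    have y': "rescale (1 / sqrt 2) y \<in> C0 S T" by (rule rescale_C0[OF y])
    \<comment> \<open>The integrand of the first factor at \<open>y / sqrt 2\<close>; by
      \<open>conv_rescale\<close> the scaling of the path appears as \<open>1 / sqrt 2\<close> in
      the phase.\<close>
    define \<alpha> where "\<alpha> u = exp (- \<i> * complex_of_real (sqn (\<lambda>p. u p * (sK1 p / sqrt 2)) / (2 * q))) * (exp (\<i> * complex_of_real (1 / sqrt 2 * pz u y)) * r1 u)" for u
    define \<beta> where "\<beta> v = exp (- \<i> * complex_of_real (sqn (\<lambda>p. v p * (sK2 p / sqrt 2)) / (2 * q))) * (exp (\<i> * complex_of_real (1 / sqrt 2 * pz v y)) * r2 v)" for v
    have i\<alpha>: "integrable P1 \<alpha>" unfolding \<alpha>_def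
    proof (rule integrable_phase)
      show "integrable P1 (\<lambda>u. exp (\<i> * complex_of_real (1 / sqrt 2 * pz u y)) * r1 u)"
        by (rule integrable_bounded_mult[OF int(1), where C = 1]) (use pz_const_measurable[OF id(1) y] in \<open>auto simp: norm_exp_eq_Re\<close>)
    qed (use sqn_measurable[OF measurable_L2_mult[OF id(1) osK'(1)]] in measurable)
    have i\<beta>: "integrable P2 \<beta>" unfolding \<beta>_def
    proof (rule integrable_phase)
      show "integrable P2 (\<lambda>u. exp (\<i> * complex_of_real (1 / sqrt 2 * pz u y)) * r2 u)"
        by (rule integrable_bounded_mult[OF int(2), where C = 1]) (use pz_const_measurable[OF id(2) y] in \<open>auto simp: norm_exp_eq_Re\<close>)
    qed (use sqn_measurable[OF measurable_L2_mult[OF id(2) osK'(2)]] in measurable)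
    have sq2: "1 / sqrt (2::real) \<noteq> 0" by simp
    have TF: "transform S T m \<phi> q (\<lambda>p. sK1 p / sqrt 2) F (rescale (1 / sqrt 2) y) = Some (LINT u|P1. \<alpha> u)"
      unfolding m transform_repr[OF c1 P1(2) osK'(1) q y'] conv_rescale(2)[OF y sq2] \<alpha>_def ..
    have TG: "transform S T m \<phi> q (\<lambda>p. sK2 p / sqrt 2) G (rescale (1 / sqrt 2) y) = Some (LINT v|P2. \<beta> v)"
      unfolding m transform_repr[OF c2 P2(2) osK'(2) q y'] conv_rescale(2)[OF y sq2] \<beta>_def ..
    \<comment> \<open>The common integrand of the transform along \<open>sH\<close> and of the
      iterated transform. For almost every pair it equals the product of \<open>\<alpha>\<close> and
      \<open>\<beta>\<close>, so its integral factorises.\<close>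
    define \<tau> where "\<tau> z = exp (- \<i> * complex_of_real (sqn (\<lambda>p. conv_W z p * sH p) / (2 * q))) * (exp (\<i> * complex_of_real (pz (conv_W z) y)) * \<rho> z)" for z
    have prod: "(LINT z|\<Omega>. \<tau> z) = (LINT u|P1. \<alpha> u) * (LINT v|P2. \<beta> v)"
    proof -
      have "(LINT z|\<Omega>. \<tau> z) = (LINT z|\<Omega>. \<alpha> (fst z) * \<beta> (snd z))"
      proof (rule integral_cong_AE)
        have "integrable \<Omega> \<tau>" unfolding \<tau>_def
        proof (rule integrable_phase)
          show "integrable \<Omega> (\<lambda>z. exp (\<i> * complex_of_real (pz (conv_W z) y)) * \<rho> z)"
            by (rule integrable_bounded_mult[OF \<rho>, where C = 1]) (use pz_const_measurable[OF W y] in \<open>auto simp: norm_exp_eq_Re\<close>)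
        qed (use sqn_measurable[OF measurable_L2_mult[OF W osH]] in measurable)
        then show "\<tau> \<in> borel_measurable \<Omega>" by (rule borel_measurable_integrable)
        show "(\<lambda>z. \<alpha> (fst z) * \<beta> (snd z)) \<in> borel_measurable \<Omega>"
          unfolding \<Omega>_def by (rule borel_measurable_integrable[OF pair_integral_product(1)[OF fin i\<alpha> i\<beta>]])
        show "AE z in \<Omega>. \<tau> z = \<alpha> (fst z) * \<beta> (snd z)"
          using cv AE_space
        proof eventually_elim
          case (elim z)
          let ?e = "\<lambda>x. exp (- \<i> * complex_of_real (x / (2 * q)))"
          have e: "?e a * ?e b = ?e (a + b)" for a b
            unfolding exp_add[symmetric] by (simp only: add_divide_distrib of_real_add distrib_left)
          have "sqn (\<lambda>p. conv_W z p * sH p) + sqn (conv_V k1 k2 z) =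
             sqn (\<lambda>p. fst z p * (sK1 p / sqrt 2)) + sqn (\<lambda>p. snd z p * (sK2 p / sqrt 2))"
            by (rule sqn_rotation[OF L2_measurable_space[OF fs(1) elim(2)] L2_measurable_space[OF fs(2) elim(2)] k osH osK assms(13) AEK1 AEK2])
          then have "?e (sqn (\<lambda>p. conv_W z p * sH p)) * ?e (sqn (conv_V k1 k2 z)) =
             ?e (sqn (\<lambda>p. fst z p * (sK1 p / sqrt 2))) * ?e (sqn (\<lambda>p. snd z p * (sK2 p / sqrt 2)))"
            unfolding e by simp
          then have "(?e (sqn (\<lambda>p. conv_W z p * sH p)) * ?e (sqn (conv_V k1 k2 z))) * x =
             (?e (sqn (\<lambda>p. fst z p * (sK1 p / sqrt 2))) * ?e (sqn (\<lambda>p. snd z p * (sK2 p / sqrt 2)))) * x" for x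
            by (rule arg_cong)
          then show ?case
            unfolding \<tau>_def \<rho>_def \<alpha>_def \<beta>_def pzW[OF elim(2) y conjunct1[OF elim(1)] conjunct2[OF elim(1)]]
            by (simp only: mult_ac)
        qed
      qed
      also have "\<dots> = (LINT u|P1. \<alpha> u) * (LINT v|P2. \<beta> v)"
        unfolding \<Omega>_def by (rule pair_integral_product(2)[OF fin i\<alpha> i\<beta>])
      finally show ?thesis .
    qed
    have TC: "transform S T m \<phi> q sH C y = Some (LINT z|\<Omega>. \<tau> z)"
      unfolding m transform_repr[OF c(2,1) osH q y] \<tau>_def ..
    have TI: "iterated_transform S T m \<phi> q h n C y = Some (LINT z|\<Omega>. \<tau> z)"
    proof -
      have hn: "osc_bounded S T (h (Suc n'))" using oh[of "Suc n'"] n' by simp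
      have "iterated_transform S T m \<phi> q h n C y = Some (LINT z|\<Omega>. exp (- \<i> * complex_of_real (sqn (\<lambda>p. conv_W z p * h (Suc n') p) / (2 * q))) *
        (exp (\<i> * complex_of_real (pz (conv_W z) y)) * (exp (- \<i> * complex_of_real ((\<Sum>j=1..n'. sqn (\<lambda>p. conv_W z p * h j p)) / (2 * q))) * \<rho> z)))"
        unfolding n' iterated_transform.simps m by (rule transform_repr[OF c'(2,1) hn q y])
      also have "\<dots> = Some (LINT z|\<Omega>. \<tau> z)"
      proof (intro arg_cong[where f = Some] Bochner_Integration.integral_cong refl)
        fix z assume z: "z \<in> space \<Omega>"
        have s: "(\<Sum>j=1..n'. sqn (\<lambda>p. conv_W z p * h j p)) + sqn (\<lambda>p. conv_W z p * h (Suc n') p) = sqn (\<lambda>p. conv_W z p * sH p)"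
          using sqn_sum[OF L2_measurable_space[OF W z] oh osH assms(12)] unfolding n' by simp
        have "exp (- \<i> * complex_of_real (sqn (\<lambda>p. conv_W z p * h (Suc n') p) / (2 * q))) * exp (- \<i> * complex_of_real ((\<Sum>j=1..n'. sqn (\<lambda>p. conv_W z p * h j p)) / (2 * q))) =
           exp (- \<i> * complex_of_real (sqn (\<lambda>p. conv_W z p * sH p) / (2 * q)))"
          unfolding s[symmetric] exp_add[symmetric] by (simp add: add_divide_distrib distrib_left add.commute)
        then have "(exp (- \<i> * complex_of_real (sqn (\<lambda>p. conv_W z p * h (Suc n') p) / (2 * q))) * exp (- \<i> * complex_of_real ((\<Sum>j=1..n'. sqn (\<lambda>p. conv_W z p * h j p)) / (2 * q)))) * x =
           exp (- \<i> * complex_of_real (sqn (\<lambda>p. conv_W z p * sH p) / (2 * q))) * x" for x by (rule arg_cong)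
        then show "exp (- \<i> * complex_of_real (sqn (\<lambda>p. conv_W z p * h (Suc n') p) / (2 * q))) *
        (exp (\<i> * complex_of_real (pz (conv_W z) y)) * (exp (- \<i> * complex_of_real ((\<Sum>j=1..n'. sqn (\<lambda>p. conv_W z p * h j p)) / (2 * q))) * \<rho> z)) = \<tau> z"
          unfolding \<tau>_def by (simp only: mult_ac)
      qed
      finally show ?thesis .
    qed
    show ?thesis using TF TG TC TI unfolding prod by blast
  qed
  show ?thesis
    unfolding C_def[symmetric] unfolding m s_ae_iff
  proof (intro allI impI)
    fix c :: real assume "c > 0"
    \<comment> \<open>The condition on \<open>y\<close> holds at every scale, for almost every path,
      so the exceptional set is scale-invariant null.\<close>
    from AEconv[OF this] AE_space
    show "AE y in m0. \<exists>a b.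
           transform S T (completion m0) \<phi> q (\<lambda>p. sK1 p / sqrt 2) F (rescale (1 / sqrt 2) (rescale c y)) = Some a \<and>
           transform S T (completion m0) \<phi> q (\<lambda>p. sK2 p / sqrt 2) G (rescale (1 / sqrt 2) (rescale c y)) = Some b \<and>
           transform S T (completion m0) \<phi> q sH C (rescale c y) = Some (a * b) \<and>
           iterated_transform S T (completion m0) \<phi> q h n C (rescale c y) = Some (a * b)"
      by eventually_elim (rule final[unfolded m], auto intro: rescale_C0 simp: space_m0)
  qed
qed


end
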